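(* Let $(f_k:I\to I)_k$ be a sequence of $\mathcal{C}^\infty$ maps that converges to $f$ in the $\mathcal{C}^\infty$ topology and suppose that each $f_k$ admits an ergodic SRB measure $\mu_k$. Suppose that $h_{\rm top}(f)>0$. If $\mu_k\to\mu$ in the weak-$*$ topology and $h_{f_k}(\mu_k)\to h_{\rm top}(f)$, then $\mu$ is an SRB measure of $f$.
   Context: $I$ denotes the interval $[0,1]$ or the circle $\mathbb{S}^1$. For a smooth map $g:I\to I$, $\lambda_g(x):=\limsup_{n\to\infty}\frac1n\sum_{i=0}^{n-1}\log|g'(g^ix)|$; a $g$-invariant Borel probability measure $\nu$ is hyperbolic if $\lambda_g(x)>0$ for $\nu$-a.e. $x$. An SRB measure of $g$ is a hyperbolic $g$-invariant Borel probability measure which is absolutely continuous with respect to Lebesgue measure on $I$. $h_g(\nu)$ denotes metric entropy and $h_{\rm top}(g)$ topological entropy. *)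

theory Defs
  imports "HOL-Probability.Probability"
begin

text \<open>
  The two phase spaces are treated uniformly: \<open>points\<close> is the compact metric space itself,
  realised in a normed space, \<open>arc\<close> is a unit-speed parametrisation of it defined on
  \<open>times\<close>, and \<open>leb\<close> is Lebesgue measure (arc length) on its Borel sets. Maps of the phase
  space are functions on the ambient type; only their values on \<open>points\<close> matter.
\<close>

record 'a phase_space =
  points :: "'a set"
  arc :: "real \<Rightarrow> 'a"
  times :: "real set"
  leb :: "'a measure"

definition unit_interval :: "real phase_space" where
  "unit_interval =
    \<lparr>points = {0..1}, arc = (\<lambda>t. t), times = {0..1}, leb = restrict_space lborel {0..1}\<rparr>"

definition unit_circle :: "complex phase_space" where
  "unit_circle =
    \<lparr>points = sphere 0 1, arc = cis, times = UNIV,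
     leb = distr (restrict_space lborel {0..<2 * pi}) (restrict_space borel (sphere 0 1)) cis\<rparr>"


subsection \<open>Smooth maps\<close>

text \<open>Derivatives relative to \<open>T\<close>, hence one-sided at the endpoints of an interval.\<close>

definition nth_vector_derivative ::
    "real set \<Rightarrow> nat \<Rightarrow> (real \<Rightarrow> 'a::real_normed_vector) \<Rightarrow> real \<Rightarrow> 'a" where
  "nth_vector_derivative T n = (\<lambda>h t. vector_derivative h (at t within T)) ^^ n"

definition smooth_curve_on :: "real set \<Rightarrow> (real \<Rightarrow> 'a::real_normed_vector) \<Rightarrow> bool" where
  "smooth_curve_on T h \<longleftrightarrow>
    (\<forall>n. \<forall>t\<in>T. nth_vector_derivative T n h differentiable (at t within T))"

text \<open>
  For the circle, smoothness of a self-map and the \<open>C\<^sup>\<infinity>\<close> topology are those of maps into the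
  plane, in which the circle is an embedded submanifold.
\<close>

definition smooth_map :: "'a::real_normed_vector phase_space \<Rightarrow> ('a \<Rightarrow> 'a) \<Rightarrow> bool" where
  "smooth_map I g \<longleftrightarrow> g \<in> points I \<rightarrow> points I \<and> smooth_curve_on (times I) (g \<circ> arc I)"

definition smooth_converges ::
    "'a::real_normed_vector phase_space \<Rightarrow> (nat \<Rightarrow> 'a \<Rightarrow> 'a) \<Rightarrow> ('a \<Rightarrow> 'a) \<Rightarrow> bool" where
  "smooth_converges I f g \<longleftrightarrow>
    (\<forall>n. uniform_limit (times I) (\<lambda>k. nth_vector_derivative (times I) n (f k \<circ> arc I))
           (nth_vector_derivative (times I) n (g \<circ> arc I)) sequentially)"

text \<open>
  \<open>\<bar>g'(x)\<bar>\<close>. Since \<open>arc\<close> has unit speed, the speed of \<open>g \<circ> arc\<close> is the absolute value of the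
  derivative; it does not depend on the chosen parameter of \<open>x\<close>.
\<close>

definition abs_deriv :: "'a::real_normed_vector phase_space \<Rightarrow> ('a \<Rightarrow> 'a) \<Rightarrow> 'a \<Rightarrow> real" where
  "abs_deriv I g x =
    norm (vector_derivative (g \<circ> arc I) (at (inv_into (times I) (arc I) x) within times I))"


subsection \<open>Invariant measures\<close>

definition borel_prob :: "'a::real_normed_vector phase_space \<Rightarrow> 'a measure \<Rightarrow> bool" where
  "borel_prob I \<nu> \<longleftrightarrow> prob_space \<nu> \<and> sets \<nu> = sets (restrict_space borel (points I))"

definition invariant_measure :: "('a \<Rightarrow> 'a) \<Rightarrow> 'a measure \<Rightarrow> bool" where
  "invariant_measure g \<nu> \<longleftrightarrow> g \<in> measurable \<nu> \<nu> \<and> distr \<nu> \<nu> g = \<nu>"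

definition ergodic_measure :: "('a \<Rightarrow> 'a) \<Rightarrow> 'a measure \<Rightarrow> bool" where
  "ergodic_measure g \<nu> \<longleftrightarrow> invariant_measure g \<nu> \<and>
    (\<forall>A\<in>sets \<nu>. g -` A \<inter> space \<nu> = A \<longrightarrow> measure \<nu> A = 0 \<or> measure \<nu> A = 1)"

definition weak_star_converges ::
    "'a::real_normed_vector phase_space \<Rightarrow> (nat \<Rightarrow> 'a measure) \<Rightarrow> 'a measure \<Rightarrow> bool" where
  "weak_star_converges I \<mu> \<nu> \<longleftrightarrow>
    (\<forall>\<phi> :: 'a \<Rightarrow> real. continuous_on (points I) \<phi> \<longrightarrow>
      (\<lambda>k. \<integral>x. \<phi> x \<partial>\<mu> k) \<longlonglongrightarrow> (\<integral>x. \<phi> x \<partial>\<nu>))"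

text \<open>Logarithm with \<open>log 0 = -\<infinity>\<close>, needed at critical points; note that \<open>ln 0 = 0\<close> on the reals.\<close>

definition ext_ln :: "real \<Rightarrow> ereal" where
  "ext_ln r = (if r = 0 then -\<infinity> else ereal (ln r))"

definition lyapunov :: "'a::real_normed_vector phase_space \<Rightarrow> ('a \<Rightarrow> 'a) \<Rightarrow> 'a \<Rightarrow> ereal" where
  "lyapunov I g x =
    limsup (\<lambda>n. ereal (1 / real n) * (\<Sum>i<n. ext_ln (abs_deriv I g ((g ^^ i) x))))"

definition hyperbolic_measure ::
    "'a::real_normed_vector phase_space \<Rightarrow> ('a \<Rightarrow> 'a) \<Rightarrow> 'a measure \<Rightarrow> bool" where
  "hyperbolic_measure I g \<nu> \<longleftrightarrow> borel_prob I \<nu> \<and> invariant_measure g \<nu> \<and>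
    (AE x in \<nu>. 0 < lyapunov I g x)"

definition SRB_measure ::
    "'a::real_normed_vector phase_space \<Rightarrow> ('a \<Rightarrow> 'a) \<Rightarrow> 'a measure \<Rightarrow> bool" where
  "SRB_measure I g \<nu> \<longleftrightarrow> hyperbolic_measure I g \<nu> \<and> absolutely_continuous (leb I) \<nu>"


subsection \<open>Metric entropy\<close>

definition partition_entropy :: "'a measure \<Rightarrow> 'a set set \<Rightarrow> real" where
  "partition_entropy \<nu> P = (\<Sum>A\<in>P. - measure \<nu> A * ln (measure \<nu> A))"

definition iterated_partition ::
    "'a measure \<Rightarrow> ('a \<Rightarrow> 'a) \<Rightarrow> 'a set set \<Rightarrow> nat \<Rightarrow> 'a set set" where
  "iterated_partition \<nu> g P n =
    common_refinement ((\<lambda>i. (\<lambda>A. (g ^^ i) -` A \<inter> space \<nu>) ` P - {{}}) ` {..<n})"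

definition metric_entropy :: "('a \<Rightarrow> 'a) \<Rightarrow> 'a measure \<Rightarrow> ereal" where
  "metric_entropy g \<nu> =
    (SUP P \<in> {P. finite P \<and> P \<subseteq> sets \<nu> \<and> partition_on (space \<nu>) P}.
      lim (\<lambda>n. ereal (partition_entropy \<nu> (iterated_partition \<nu> g P n) / real n)))"


subsection \<open>Topological entropy (Bowen's definition)\<close>

definition separated :: "('a::metric_space \<Rightarrow> 'a) \<Rightarrow> nat \<Rightarrow> real \<Rightarrow> 'a set \<Rightarrow> bool" where
  "separated g n \<epsilon> E \<longleftrightarrow>
    (\<forall>x\<in>E. \<forall>y\<in>E. x \<noteq> y \<longrightarrow> (\<exists>i<n. \<epsilon> < dist ((g ^^ i) x) ((g ^^ i) y)))"

definition max_separated :: "'a::metric_space set \<Rightarrow> ('a \<Rightarrow> 'a) \<Rightarrow> nat \<Rightarrow> real \<Rightarrow> nat" where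
  "max_separated X g n \<epsilon> = Sup (card ` {E. E \<subseteq> X \<and> finite E \<and> separated g n \<epsilon> E})"

definition top_entropy :: "'a::metric_space set \<Rightarrow> ('a \<Rightarrow> 'a) \<Rightarrow> ereal" where
  "top_entropy X g =
    (SUP \<epsilon> \<in> {0<..}. limsup (\<lambda>n. ereal (ln (real (max_separated X g n \<epsilon>)) / real n)))"

end

theory Submission
  imports Defs
begin

text \<open>
  All derivatives of \<open>F = f\<^sub>k ^^ p\<close> are bounded uniformly in \<open>k\<close>. Differentiating \<open>d\<close> times, an
  interval of fixed small length \<open>e\<close> can be cut so that \<open>F'\<close> is nearly constant on the pieces, and
  only \<open>O(\<tau> powr (-1/(d+1)))\<close> pieces have \<open>\<bar>F'\<bar>\<close> of size \<open>\<tau>\<close>. Hence the weights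
  \<open>\<bar>F'\<bar> powr \<beta> / C\<close> with \<open>\<beta> = 2/(d+1)\<close> have sum at most \<open>1\<close> over the branches, where \<open>C\<close> depends on
  \<open>d\<close> but not on \<open>p\<close>. Call a time good if the piece of the iterated partition around the orbit is
  mapped onto an interval longer than some fixed \<open>r\<close>. Over a block of \<open>m\<close> steps of \<open>F\<close> that starts at
  a bad time the weights sum to at most \<open>1\<close>, because the images stay shorter than \<open>e\<close>; after a good
  time they sum to at most the number \<open>R\<close> of Bowen balls covering the space. Gibbs' inequality then
  bounds the metric entropy by
  \<open>ln C / p + \<beta> * ln M + ln R / (m p) * (frequency of good times)\<close>, and \<open>ln R / (m p)\<close> is
  close to the topological entropy of the limit map. Convergence of the entropies forces the frequency
  to be almost \<open>1\<close>, uniformly in \<open>k\<close>.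

  At a good time the piece is mapped with bounded distortion to an interval of length at least \<open>r\<close>,
  and it contracts exponentially in backward time. For every \<open>\<gamma> < 1\<close> this yields constants with
  \<open>\<mu>\<^sub>k(B) \<le> 1 - \<gamma> + const * leb(B)\<close> and
  \<open>\<mu>\<^sub>k(\<bar>(f\<^sub>k ^^ (p * j))'\<bar> \<ge> const * 2 ^ j) \<ge> \<gamma>\<close> for all \<open>j\<close> and all large \<open>k\<close>. Both estimates pass to
  the weak limit.
\<close>

section \<open>Cutting intervals where a function is nearly constant\<close>

text \<open>Critical points are the obstacle: near them distortion is unbounded, and so is
  \<open>ln \<bar>f'\<bar>\<close>. Smoothness of high order leaves only a small power \<beta> of
  the derivative in the weights. That power is affordable because a positive exponent bounds the
  integral of the negative part of \<open>ln \<bar>f\<^sub>k'\<bar>\<close> by \<open>ln M0\<close>,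
  with one \<open>M0\<close> for all k. \<open>C\<close> does not see p since the cutting statement
  is scale-free: large derivatives of the iterate only shrink e. The constants are therefore chosen
  in the order d, p, e, m, r: d makes \<open>\<beta> * ln M0\<close> small, p makes
  \<open>ln C / p\<close> small, e is dictated by the derivatives of the p-th iterate, m by the
  growth of separated sets at scale \<open>e / 16\<close>, and r by m. None of them depends on k.
  Pieces are moreover halved at every step, at the cost of a factor 2 in the constant; this keeps
  the distortion bounded at all depths and makes the pieces contract.\<close>

lemma grid_exists:
  fixes s t l h :: real
  assumes "t - s \<le> l" "0 < h" "s \<le> t"
  obtains E where "finite E" "real (card E) \<le> l / h + 2"
    "\<And>u v. s \<le> u \<Longrightarrow> u \<le> v \<Longrightarrow> v \<le> t \<Longrightarrow> {u..v} \<inter> E = {} \<Longrightarrow> v - u \<le> h"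
proof -
  define n where "n = nat \<lceil>l / h\<rceil>"
  define E where "E = (\<lambda>j. s + real j * h) ` {..n}"
  have lh: "0 \<le> l / h" using assms by simp
  have "card E \<le> Suc n" unfolding E_def by (metis card_atMost card_image_le finite_atMost)
  moreover have "real n \<le> l / h + 1"
    using lh unfolding n_def by linarith
  ultimately have "real (card E) \<le> l / h + 2" by linarith
  moreover have "v - u \<le> h" if "s \<le> u" "u \<le> v" "v \<le> t" "{u..v} \<inter> E = {}" for u v
  proof (rule ccontr)
    assume c: "\<not> v - u \<le> h"
    define j where "j = nat \<lceil>(u - s) / h\<rceil>"
    have j0: "0 \<le> (u - s) / h" using that assms by simp
    have "(u - s) / h \<le> l / h" using that assms by (intro divide_right_mono) auto
    then have "j \<le> n" unfolding j_def n_def by (intro nat_mono ceiling_mono)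
    moreover have "(u - s) / h \<le> real j" "real j < (u - s) / h + 1"
      using j0 unfolding j_def by linarith+
    then have "u \<le> s + real j * h" "s + real j * h < u + h"
      using assms(2) by (auto simp: field_simps)
    ultimately have "s + real j * h \<in> {u..v} \<inter> E" using c unfolding E_def by auto
    then show False using that by auto
  qed
  moreover have "finite E" unfolding E_def by simp
  ultimately show thesis using that by blast
qed

text \<open>The number of points of \<open>E\<close> to the left of \<open>x\<close> is strictly
  increasing on \<open>A\<close>, hence an injection into \<open>{..card E}\<close>. Disjointness of
  \<open>A\<close> and \<open>E\<close> keeps a separating point from coinciding with the right
  end.\<close>

lemma card_separated_le:
  fixes A E :: "real set"
  assumes "finite E" "A \<inter> E = {}"
    and sep: "\<And>x y. x \<in> A \<Longrightarrow> y \<in> A \<Longrightarrow> x < y \<Longrightarrow> {x..y} \<inter> E \<noteq> {}"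
  shows "finite A \<and> card A \<le> card E + 1"
proof -
  define c where "c x = card {e\<in>E. e < x}" for x
  have lt: "c x < c y" if xy: "x \<in> A" "y \<in> A" "x < y" for x y
  proof -
    obtain e where e: "e \<in> E" "x \<le> e" "e \<le> y" using sep[OF xy] by auto
    then have "e \<noteq> y" using xy assms(2) by auto
    then have "e \<in> {e\<in>E. e < y}" "e \<notin> {e\<in>E. e < x}" using e by simp_all
    moreover have "{e\<in>E. e < x} \<subseteq> {e\<in>E. e < y}" using xy(3) by (intro Collect_mono) simp
    ultimately have "{e\<in>E. e < x} \<subset> {e\<in>E. e < y}" by blast
    then show ?thesis unfolding c_def using assms(1) by (intro psubset_card_mono) auto
  qed
  have "inj_on c A" unfolding inj_on_def using lt by (metis less_irrefl linorder_neqE)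
  moreover have "c ` A \<subseteq> {..card E}"
    unfolding c_def using card_mono[OF assms(1)] by auto
  ultimately have "finite A" "card A \<le> card {..card E}"
    using inj_on_finite[of c A "{..card E}"] card_inj_on_le[of c A "{..card E}"] by auto
  then show ?thesis by simp
qed

text \<open>Up to the normalisation \<open>e\<close> of the derivative, \<open>nearly_const\<close> bounds the total
  variation of \<open>ln \<bar>g\<bar>\<close> on \<open>{u..v}\<close>.\<close>

definition nearly_const :: "real \<Rightarrow> (real \<Rightarrow> real) \<Rightarrow> (real \<Rightarrow> real) \<Rightarrow> real \<Rightarrow> real \<Rightarrow> bool" where
  "nearly_const e g g' u v \<longleftrightarrow>
    (\<forall>x\<in>{u..v}. \<forall>y\<in>{u..v}. (v - u) * \<bar>g' x\<bar> \<le> e / 4 * \<bar>g y\<bar>)"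

lemma mvt_within:
  fixes g g' :: "real \<Rightarrow> real"
  assumes "\<And>x. x \<in> {u..v} \<Longrightarrow> (g has_real_derivative g' x) (at x within {u..v})"
    and "x \<in> {u..v}" "y \<in> {u..v}"
  obtains z where "z \<in> closed_segment x y" "z \<in> {u..v}" "g y - g x = g' z * (y - x)"
proof -
  have *: "\<exists>z\<in>{x<..<y}. g y - g x = (y - x) * g' z" if "x < y" "x \<in> {u..v}" "y \<in> {u..v}" for x y
  proof -
    have "\<exists>z\<in>{x<..<y}. g y - g x = (\<lambda>h. g' z * h) (y - x)"
    proof (rule mvt_simple[OF that(1)])
      fix z assume z: "x \<le> z" "z \<le> y"
      have "(g has_real_derivative g' z) (at z within {x..y})"
        by (rule has_field_derivative_subset[OF assms(1)]) (use that z in auto)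
      then show "(g has_derivative (\<lambda>h. g' z * h)) (at z within {x..y})"
        by (simp add: has_field_derivative_def)
    qed
    then show ?thesis by (auto simp: mult.commute)
  qed
  consider "x < y" | "x = y" | "y < x" by linarith
  then show thesis
  proof cases
    case 1
    with *[OF 1 assms(2,3)] obtain z where "z\<in>{x<..<y}" "g y - g x = (y - x) * g' z" by auto
    then show thesis using assms 1 by (intro that[of z]) (auto simp: closed_segment_eq_real_ivl mult.commute)
  next
    case 2 then show thesis using assms by (intro that[of x]) auto
  next
    case 3
    with *[OF 3 assms(3,2)] obtain z where "z\<in>{y<..<x}" "g x - g y = (x - y) * g' z" by auto
    then show thesis using assms 3 by (intro that[of z]) (auto simp: closed_segment_eq_real_ivl algebra_simps)
  qed
qed

text \<open>The mean value theorem turns the bound on the derivative into one on the oscillation.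
  The point \<open>w\<close> is free, so that the oscillation can be measured against the value at
  whichever point is known.\<close>

lemma nearly_const_diff:
  assumes "nearly_const e g g' u v" "0 < e"
    and "\<And>x. x \<in> {u..v} \<Longrightarrow> (g has_real_derivative g' x / e) (at x within {u..v})"
    and x: "x \<in> {u..v}" and y: "y \<in> {u..v}" and w: "w \<in> {u..v}"
  shows "\<bar>g x - g y\<bar> \<le> \<bar>g w\<bar> / 4"
proof -
  obtain z where z: "z \<in> {u..v}" "g x - g y = g' z / e * (x - y)"
    using mvt_within[OF assms(3) y x] by metis
  have "\<bar>g x - g y\<bar> = \<bar>g' z\<bar> / e * \<bar>x - y\<bar>" using z assms(2) by (simp add: abs_mult)
  also have "\<dots> \<le> \<bar>g' z\<bar> / e * (v - u)" using x y assms(2) by (intro mult_left_mono) auto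
  also have "\<dots> = ((v - u) * \<bar>g' z\<bar>) / e" by simp
  also have "\<dots> \<le> (e / 4 * \<bar>g w\<bar>) / e"
    using assms(1,2) z w unfolding nearly_const_def by (intro divide_right_mono) auto
  also have "\<dots> = \<bar>g w\<bar> / 4" using assms(2) by simp
  finally show ?thesis .
qed

text \<open>The segment is so short that \<open>g\<close> moves by at most \<open>r / 8\<close>;
  hence \<open>\<bar>g\<bar>\<close> stays above \<open>r / 2\<close>, which pays for
  \<open>(v - u) * S \<le> e / 4 * (r / 2)\<close>.\<close>

lemma nearly_const_small_deriv:
  assumes "0 < e" "0 < r" "\<And>x. x \<in> {u..v} \<Longrightarrow> (g has_real_derivative g' x / e) (at x within {u..v})"
    and S: "\<And>x. x \<in> {u..v} \<Longrightarrow> \<bar>g' x\<bar> \<le> S" and len: "(v - u) * S \<le> e * r / 8"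
    and "x0 \<in> {u..v}" "r \<le> \<bar>g x0\<bar>"
  shows "nearly_const e g g' u v"
  unfolding nearly_const_def
proof (intro ballI)
  fix x y assume x: "x \<in> {u..v}" and y: "y \<in> {u..v}"
  have uv: "0 \<le> v - u" using x by auto
  obtain z where z: "z \<in> {u..v}" "g y - g x0 = g' z / e * (y - x0)"
    using mvt_within[OF assms(3) assms(6) y] by metis
  have "\<bar>g y - g x0\<bar> = \<bar>g' z\<bar> / e * \<bar>y - x0\<bar>" using z assms(1) by (simp add: abs_mult)
  also have "\<dots> \<le> S / e * (v - u)" using S[OF z(1)] y assms(1,6)
    by (intro mult_mono divide_right_mono) auto
  also have "\<dots> = ((v - u) * S) / e" by simp
  also have "\<dots> \<le> (e * r / 8) / e" using len assms(1) by (intro divide_right_mono) auto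
  also have "\<dots> = r / 8" using assms(1) by simp
  finally have *: "r / 2 \<le> \<bar>g y\<bar>" using assms(2,7) by linarith
  have "(v - u) * \<bar>g' x\<bar> \<le> (v - u) * S" using S[OF x] uv by (intro mult_left_mono) auto
  also have "\<dots> \<le> e / 4 * (r / 2)" using len by simp
  also have "\<dots> \<le> e / 4 * \<bar>g y\<bar>" using * assms(1) by (intro mult_left_mono) auto
  finally show "(v - u) * \<bar>g' x\<bar> \<le> e / 4 * \<bar>g y\<bar>" .
qed

text \<open>The exponent \<open>1/(d+1)\<close> comes from the induction on \<open>d\<close>: cuts for \<open>g 1\<close> at levels from
  \<open>r powr (d/(d+1))\<close> upwards control the monotone pieces of \<open>g 0\<close>, and an equidistant grid takes care of the
  region where \<open>g 1\<close> is smaller than that.\<close>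

definition cut_bound :: "nat \<Rightarrow> real \<Rightarrow> bool" where
  "cut_bound d C \<longleftrightarrow> (\<forall>e (g :: nat \<Rightarrow> real \<Rightarrow> real) s t r. 0 < e \<longrightarrow> s \<le> t \<longrightarrow> t - s \<le> e \<longrightarrow>
    (\<forall>i\<le>d. \<forall>x\<in>{s..t}. (g i has_real_derivative g (Suc i) x / e) (at x within {s..t})) \<longrightarrow>
    (\<forall>i\<le>d. \<forall>x\<in>{s..t}. \<bar>g (Suc i) x\<bar> \<le> 1) \<longrightarrow> 0 < r \<longrightarrow> r \<le> 1 \<longrightarrow>
    (\<exists>E. finite E \<and> real (card E) \<le> C * r powr (- 1 / (real d + 1)) \<and>
      (\<forall>u v. s \<le> u \<longrightarrow> u \<le> v \<longrightarrow> v \<le> t \<longrightarrow> {u..v} \<inter> E = {} \<longrightarrow>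
        (\<exists>x\<in>{u..v}. r \<le> \<bar>g 0 x\<bar> \<and> \<bar>g 0 x\<bar> \<le> 2 * r) \<longrightarrow> nearly_const e (g 0) (g 1) u v)))"

text \<open>With one bounded derivative an equidistant grid of mesh \<open>e * r / 8\<close> does:
  it has at most \<open>8 / r + 2\<close> points, which is at most \<open>10 / r\<close> because
  \<open>r \<le> 1\<close>.\<close>

lemma cut_bound_0: "cut_bound 0 10"
  unfolding cut_bound_def
proof (intro allI impI)
  fix e and g :: "nat \<Rightarrow> real \<Rightarrow> real" and s t r :: real
  assume e: "0 < e" and st: "s \<le> t" "t - s \<le> e"
    and d: "\<forall>i\<le>0. \<forall>x\<in>{s..t}. (g i has_real_derivative g (Suc i) x / e) (at x within {s..t})"
    and b: "\<forall>i\<le>0. \<forall>x\<in>{s..t}. \<bar>g (Suc i) x\<bar> \<le> 1" and r: "0 < r" "r \<le> 1"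
  obtain E where E: "finite E" "real (card E) \<le> e / (e * r / 8) + 2"
    "\<And>u v. s \<le> u \<Longrightarrow> u \<le> v \<Longrightarrow> v \<le> t \<Longrightarrow> {u..v} \<inter> E = {} \<Longrightarrow> v - u \<le> e * r / 8"
    using grid_exists[OF st(2), of "e * r / 8"] e r st by auto
  have "e / (e * r / 8) + 2 = 8 / r + 2" using e r by simp
  also have "\<dots> \<le> 10 * r powr (- 1 / (real 0 + 1))"
    using r by (simp add: powr_minus field_simps)
  finally have "real (card E) \<le> 10 * r powr (- 1 / (real 0 + 1))" using E by linarith
  moreover have "nearly_const e (g 0) (g 1) u v"
    if uv: "s \<le> u" "u \<le> v" "v \<le> t" "{u..v} \<inter> E = {}"
      and x: "\<exists>x\<in>{u..v}. r \<le> \<bar>g 0 x\<bar> \<and> \<bar>g 0 x\<bar> \<le> 2 * r" for u v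
  proof -
    obtain x0 where "x0 \<in> {u..v}" "r \<le> \<bar>g 0 x0\<bar>" using x by auto
    moreover have "(g 0 has_real_derivative g 1 x / e) (at x within {u..v})" if "x \<in> {u..v}" for x
      by (rule has_field_derivative_subset[of _ _ _ "{s..t}"]) (use d that uv in auto)
    ultimately show ?thesis
      by (intro nearly_const_small_deriv[of e r u v _ _ 1])
         (use e r b uv E(3)[OF uv] in auto)
  qed
  ultimately show "\<exists>E. finite E \<and> real (card E) \<le> 10 * r powr (- 1 / (real 0 + 1)) \<and>
      (\<forall>u v. s \<le> u \<longrightarrow> u \<le> v \<longrightarrow> v \<le> t \<longrightarrow> {u..v} \<inter> E = {} \<longrightarrow>
        (\<exists>x\<in>{u..v}. r \<le> \<bar>g 0 x\<bar> \<and> \<bar>g 0 x\<bar> \<le> 2 * r) \<longrightarrow> nearly_const e (g 0) (g 1) u v)"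
    using E(1) by blast
qed

lemma dyadic_level:
  fixes a b :: real
  assumes "0 < a" "a \<le> b"
  obtains k :: nat where "a * 2 ^ k \<le> b" "b \<le> 2 * (a * 2 ^ k)"
proof -
  define k where "k = nat \<lfloor>log 2 (b / a)\<rfloor>"
  have ba: "1 \<le> b / a" using assms by simp
  then have l0: "0 \<le> log 2 (b / a)" by simp
  have "real k \<le> log 2 (b / a)" "log 2 (b / a) \<le> real k + 1"
    using l0 unfolding k_def by linarith+
  then have "2 powr real k \<le> b / a" "b / a \<le> 2 powr (real k + 1)"
    using ba by (simp_all add: le_log_iff log_le_iff)
  then show thesis using assms
    by (intro that[of k]) (auto simp: powr_realpow powr_add field_simps)
qed

lemma cut_bound_Suc:
  assumes cb: "cut_bound d C" and C: "0 \<le> C"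
  shows "\<exists>C'\<ge>0. cut_bound (Suc d) C'"
proof -
  define a where "a = 1 / (real d + 1)"
  define q where "q = (2::real) powr (- a)"
  define B where "B = C / (1 - q)"
  have a: "0 < a" unfolding a_def by simp
  have q: "0 < q" "q < 1" unfolding q_def using a by (auto simp: powr_less_one)
  have B: "0 \<le> B" unfolding B_def using C q by simp
  have "cut_bound (Suc d) (22 * B + 39)"
    unfolding cut_bound_def
  proof (intro allI impI)
    fix e and g :: "nat \<Rightarrow> real \<Rightarrow> real" and s t r :: real
    assume e: "0 < e" and st: "s \<le> t" "t - s \<le> e"
      and d: "\<forall>i\<le>Suc d. \<forall>x\<in>{s..t}. (g i has_real_derivative g (Suc i) x / e) (at x within {s..t})"
      and b: "\<forall>i\<le>Suc d. \<forall>x\<in>{s..t}. \<bar>g (Suc i) x\<bar> \<le> 1" and r: "0 < r" "r \<le> 1"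
    \<comment> \<open>\<open>S\<close> balances two costs: the cuts for \<open>g 1\<close> at levels
      from \<open>S\<close> upwards number about \<open>S powr (- a)\<close>, and the grid for the
      region where \<open>\<bar>g 1\<bar>\<close> is below \<open>2 * S\<close> has about
      \<open>S / r\<close> points. Both become \<open>R\<close>, the rate wanted for
      \<open>Suc d\<close>.\<close>
    define S where "S = r powr (1 / (1 + a))"
    have S: "0 < S" "S \<le> 1" unfolding S_def using r a by (auto intro: powr_le1)
    have ea: "1 / (1 + a) * - a = - 1 / (real (Suc d) + 1)" "1 / (1 + a) - 1 = - 1 / (real (Suc d) + 1)"
      unfolding a_def by (simp_all add: field_simps)
    define R where "R = r powr (- 1 / (real (Suc d) + 1))"
    have Sa: "S powr (- a) = R" unfolding S_def R_def by (simp only: powr_powr ea)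
    have Sr: "S / r = R"
      unfolding S_def R_def ea(2)[symmetric] using r by (simp add: powr_diff)
    have R1: "1 \<le> R"
    proof -
      have "R * r powr (1 / (real (Suc d) + 1)) = 1"
        unfolding R_def using r by (simp add: powr_add[symmetric] add_divide_distrib[symmetric])
      moreover have "0 < r powr (1 / (real (Suc d) + 1))" "r powr (1 / (real (Suc d) + 1)) \<le> 1"
        using r by (auto intro: powr_le1)
      moreover have "0 < R" unfolding R_def using r by simp
      ultimately show ?thesis
        by (metis less_eq_real_def linorder_not_le mult.right_neutral mult_less_cancel_left_pos mult_less_cancel_right_pos order_le_less_trans)
    qed
    have D: "(g i has_real_derivative g (Suc i) x / e) (at x within {u..v})"
      if "i \<le> Suc d" "s \<le> u" "v \<le> t" "x \<in> {u..v}" for i u v x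
      by (rule has_field_derivative_subset[of _ _ _ "{s..t}"]) (use d that in auto)
    \<comment> \<open>Only finitely many dyadic levels lie between \<open>S\<close> and the bound 1
      on \<open>\<bar>g 1\<bar>\<close>.\<close>
    define K where "K = {k::nat. S * 2 ^ k \<le> 1}"
    have "finite K"
    proof -
      obtain n :: nat where "1 / S < 2 ^ n" using real_arch_pow[of 2 "1 / S"] by auto
      then have "K \<subseteq> {..n}"
      proof (intro subsetI, unfold K_def, elim CollectE)
        fix k assume n: "1 / S < 2 ^ n" and k: "S * 2 ^ k \<le> 1"
        have "(2::real) ^ k < 2 ^ n"
        proof -
          have "2 ^ k \<le> 1 / S" using k S(1) by (simp add: pos_le_divide_eq mult.commute)
          then show ?thesis using n by linarith
        qed
        then show "k \<in> {..n}" by (simp add: power_strict_increasing_iff less_imp_le)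
      qed
      then show ?thesis using finite_subset by blast
    qed
    have "\<exists>E. finite E \<and> real (card E) \<le> C * (S * 2 ^ k) powr (- 1 / (real d + 1)) \<and>
      (\<forall>u v. s \<le> u \<longrightarrow> u \<le> v \<longrightarrow> v \<le> t \<longrightarrow> {u..v} \<inter> E = {} \<longrightarrow>
        (\<exists>x\<in>{u..v}. S * 2 ^ k \<le> \<bar>g 1 x\<bar> \<and> \<bar>g 1 x\<bar> \<le> 2 * (S * 2 ^ k)) \<longrightarrow> nearly_const e (g 1) (g 2) u v)"
      if "k \<in> K" for k
      using cb[unfolded cut_bound_def, rule_format, of e s t "\<lambda>i. g (Suc i)" "S * 2 ^ k"]
        e st d b S that unfolding K_def by (simp add: numeral_2_eq_2)
    then obtain Ek where Ek: "\<And>k. k \<in> K \<Longrightarrow> finite (Ek k)"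
      "\<And>k. k \<in> K \<Longrightarrow> real (card (Ek k)) \<le> C * (S * 2 ^ k) powr (- 1 / (real d + 1))"
      "\<And>k u v. k \<in> K \<Longrightarrow> s \<le> u \<Longrightarrow> u \<le> v \<Longrightarrow> v \<le> t \<Longrightarrow> {u..v} \<inter> Ek k = {} \<Longrightarrow>
        \<exists>x\<in>{u..v}. S * 2 ^ k \<le> \<bar>g 1 x\<bar> \<and> \<bar>g 1 x\<bar> \<le> 2 * (S * 2 ^ k) \<Longrightarrow> nearly_const e (g 1) (g 2) u v"
      by metis
    define E1 where "E1 = (\<Union>k\<in>K. Ek k)"
    have fE1: "finite E1" unfolding E1_def using \<open>finite K\<close> Ek(1) by blast
    have cE1: "real (card E1) \<le> B * R"
    proof -
      have "real (card E1) \<le> (\<Sum>k\<in>K. real (card (Ek k)))"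
        unfolding E1_def using card_UN_le[OF \<open>finite K\<close>, of Ek] by (metis of_nat_mono of_nat_sum)
      also have "\<dots> \<le> (\<Sum>k\<in>K. C * R * q ^ k)"
      proof (rule sum_mono)
        fix k assume "k \<in> K"
        have "(S * 2 ^ k) powr (- 1 / (real d + 1)) = R * q ^ k"
          using S Sa a_def by (simp add: powr_mult q_def powr_realpow[symmetric] powr_powr mult.commute)
        then show "real (card (Ek k)) \<le> C * R * q ^ k" using Ek(2)[OF \<open>k \<in> K\<close>] by simp
      qed
      also have "\<dots> = C * R * (\<Sum>k\<in>K. q ^ k)" by (simp add: sum_distrib_left)
      \<comment> \<open>The number of cuts decreases geometrically in the level, so all levels
        together cost no more than a multiple of the lowest one.\<close>
      also have "\<dots> \<le> C * R * (1 / (1 - q))"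
      proof (intro mult_left_mono)
        have "(\<Sum>k\<in>K. q ^ k) \<le> (\<Sum>k. q ^ k)"
          using q \<open>finite K\<close> by (intro sum_le_suminf summable_geometric) auto
        then show "(\<Sum>k\<in>K. q ^ k) \<le> 1 / (1 - q)" using q by (simp add: suminf_geometric)
      qed (use C R1 in auto)
      finally show ?thesis unfolding B_def by simp
    qed
    \<comment> \<open>Where \<open>g 1\<close> is nearly constant and not small it has no zero and
      varies by a factor of at most 5/4, so that \<open>g 0\<close> is strictly monotone
      there.\<close>
    have P: "(\<forall>y\<in>{u..v}. g 1 y \<noteq> 0) \<and> (\<forall>x\<in>{u..v}. \<forall>y\<in>{u..v}. \<bar>g 1 x\<bar> \<le> 5 / 4 * \<bar>g 1 y\<bar>)"
      if uv: "s \<le> u" "u \<le> v" "v \<le> t" "{u..v} \<inter> E1 = {}" and x: "x \<in> {u..v}" "S \<le> \<bar>g 1 x\<bar>" for u v x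
    proof -
      obtain k where k: "S * 2 ^ k \<le> \<bar>g 1 x\<bar>" "\<bar>g 1 x\<bar> \<le> 2 * (S * 2 ^ k)"
        using dyadic_level[OF S(1) x(2)] by metis
      have "\<bar>g 1 x\<bar> \<le> 1" using b x(1) uv by (auto dest!: spec[of _ 0])
      then have "k \<in> K" using k unfolding K_def by simp
      moreover have "{u..v} \<inter> Ek k = {}" using uv \<open>k \<in> K\<close> unfolding E1_def by blast
      ultimately have nc: "nearly_const e (g 1) (g 2) u v"
        using Ek(3)[of k u v] uv x(1) k by blast
      have df: "\<bar>g 1 x - g 1 y\<bar> \<le> \<bar>g 1 y\<bar> / 4" if "x \<in> {u..v}" "y \<in> {u..v}" for x y
        by (rule nearly_const_diff[OF nc e _ that(1,2,2)])
           (use D[of 1 u v] uv in \<open>auto simp: numeral_2_eq_2\<close>)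
      have "g 1 y \<noteq> 0" if "y \<in> {u..v}" for y using df[OF x(1) that] x(2) S by auto
      moreover have "\<bar>g 1 x\<bar> \<le> 5 / 4 * \<bar>g 1 y\<bar>" if "x \<in> {u..v}" "y \<in> {u..v}" for x y
        using df[OF that] by linarith
      ultimately show ?thesis by blast
    qed
    \<comment> \<open>By \<open>P\<close>, two points with \<open>\<bar>g 1\<bar>\<close> at least
      \<open>S\<close> and the same value of \<open>g 0\<close> are separated by \<open>E1\<close>.
      The 21 multiples of \<open>r / 5\<close> with \<open>j\<close> from -10 to 10 cover all values
      of modulus up to \<open>2 * r\<close>.\<close>
    define Ej where "Ej j = {z\<in>{s..t}. z \<notin> E1 \<and> S \<le> \<bar>g 1 z\<bar> \<and> g 0 z = r * real_of_int j / 5}" for j :: int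
    have Ej: "finite (Ej j) \<and> card (Ej j) \<le> card E1 + 1" for j
    proof (rule card_separated_le[OF fE1])
      show "Ej j \<inter> E1 = {}" unfolding Ej_def by auto
      fix x y assume xy: "x \<in> Ej j" "y \<in> Ej j" "x < y"
      show "{x..y} \<inter> E1 \<noteq> {}"
      proof
        assume em: "{x..y} \<inter> E1 = {}"
        have xy': "s \<le> x" "x \<le> y" "y \<le> t" "S \<le> \<bar>g 1 x\<bar>" "g 0 x = g 0 y"
          using xy unfolding Ej_def by auto
        have nz: "\<forall>z\<in>{x..y}. g 1 z \<noteq> 0" using P[OF xy'(1-3) em, of x] xy' by auto
        obtain z where "z \<in> {x..y}" "g 0 y - g 0 x = g 1 z / e * (y - x)"
          using mvt_within[of x y "g 0" "\<lambda>z. g 1 z / e" x y] D[of 0 x y] xy' by auto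
        then show False using nz xy' xy(3) e by auto
      qed
    qed
    define E2 where "E2 = (\<Union>j\<in>{-10..10::int}. Ej j)"
    have fE2: "finite E2" unfolding E2_def using Ej by blast
    have "card E2 \<le> (\<Sum>j\<in>{-10..10::int}. card (Ej j))" unfolding E2_def by (rule card_UN_le) simp
    also have "\<dots> \<le> (\<Sum>j\<in>{-10..10::int}. card E1 + 1)" using Ej by (intro sum_mono) auto
    finally have "card E2 \<le> 21 * (card E1 + 1)" by simp
    then have "real (card E2) \<le> real (21 * (card E1 + 1))" by (rule of_nat_mono)
    then have cE2: "real (card E2) \<le> 21 * real (card E1) + 21" by simp
    obtain E3 where E3: "finite E3" "real (card E3) \<le> e / (e * r / (16 * S)) + 2"
      "\<And>u v. s \<le> u \<Longrightarrow> u \<le> v \<Longrightarrow> v \<le> t \<Longrightarrow> {u..v} \<inter> E3 = {} \<Longrightarrow> v - u \<le> e * r / (16 * S)"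
      using grid_exists[OF st(2), of "e * r / (16 * S)"] e r st S by auto
    have cE3: "real (card E3) \<le> 16 * R + 2"
    proof -
      have "e / (e * r / (16 * S)) = 16 * (S / r)" using e by simp
      then show ?thesis using E3(2) Sr by simp
    qed
    define E where "E = E1 \<union> E2 \<union> E3"
    have "card E \<le> card E1 + card E2 + card E3" unfolding E_def
      by (meson add_le_mono card_Un_le le_refl order_trans)
    then have "real (card E) \<le> real (card E1) + real (card E2) + real (card E3)" by linarith
    also have "\<dots> \<le> 22 * (B * R) + 16 * R + 23" using cE1 cE2 cE3 by linarith
    also have "\<dots> \<le> (22 * B + 39) * R" using R1 by (simp add: algebra_simps)
    finally have cE: "real (card E) \<le> (22 * B + 39) * R" .
    have "nearly_const e (g 0) (g 1) u v"
      if uv: "s \<le> u" "u \<le> v" "v \<le> t" "{u..v} \<inter> E = {}"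
        and x0: "x0 \<in> {u..v}" "r \<le> \<bar>g 0 x0\<bar>" "\<bar>g 0 x0\<bar> \<le> 2 * r" for u v x0
    proof -
      have em: "{u..v} \<inter> E1 = {}" "{u..v} \<inter> E2 = {}" "{u..v} \<inter> E3 = {}" using uv(4) unfolding E_def by auto
      have D0: "(g 0 has_real_derivative g 1 x / e) (at x within {u..v})" if "x \<in> {u..v}" for x
        using D[of 0 u v x] uv that by auto
      show ?thesis
      proof (cases "\<exists>x\<in>{u..v}. 2 * S \<le> \<bar>g 1 x\<bar>")
        case False
        then have "\<And>x. x \<in> {u..v} \<Longrightarrow> \<bar>g 1 x\<bar> \<le> 2 * S" by (meson linear)
        moreover have "(v - u) * (2 * S) \<le> e * r / 8"
          using E3(3)[OF uv(1-3) em(3)] S by (simp add: field_simps)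
        ultimately show ?thesis using nearly_const_small_deriv[OF e r(1) D0 _ _ x0(1,2)] by blast
      next
        case True
        then obtain x where x: "x \<in> {u..v}" "2 * S \<le> \<bar>g 1 x\<bar>" by auto
        note PP = P[OF uv(1-3) em(1) x(1)]
        have ratio: "\<bar>g 1 x\<bar> \<le> 5 / 4 * \<bar>g 1 y\<bar>" if "x \<in> {u..v}" "y \<in> {u..v}" for x y
          using PP x S that by auto
        \<comment> \<open>From \<open>2 * S\<close> at one point a factor 5/4 leaves at least
          \<open>S\<close> everywhere. Every crossing of a multiple of \<open>r / 5\<close> in this
          segment is therefore recorded in \<open>E2\<close>, and \<open>g 0\<close> stays inside
          one strip between neighbouring multiples.\<close>
        have big: "S \<le> \<bar>g 1 y\<bar>" if "y \<in> {u..v}" for y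
          using ratio[OF x(1) that] x(2) S by linarith
        have no: "g 0 z \<noteq> r * real_of_int j / 5" if "z \<in> {u..v}" "j \<in> {-10..10}" for z j
        proof
          assume "g 0 z = r * real_of_int j / 5"
          then have "z \<in> E2" unfolding E2_def Ej_def using big[OF that(1)] that uv em by auto
          then show False using em that by auto
        qed
        define j where "j = \<lfloor>5 * g 0 x0 / r\<rfloor>"
        have jj: "real_of_int j \<le> 5 * g 0 x0 / r" "5 * g 0 x0 / r < real_of_int j + 1"
          unfolding j_def by linarith+
        have bb: "- 10 \<le> 5 * g 0 x0 / r" "5 * g 0 x0 / r \<le> 10"
          using x0(3) r by (auto simp: field_simps)
        have "5 * g 0 x0 / r \<noteq> 10" using no[OF x0(1), of 10] r by (auto simp: field_simps)
        then have jr: "j \<in> {-10..9}" using jj bb by auto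
        have c: "continuous_on {u..v} (g 0)"
          using D0 by (meson DERIV_continuous continuous_on_eq_continuous_within)
        have conn: "connected (g 0 ` {u..v})" by (rule connected_continuous_image[OF c]) simp
        have icc: "{g 0 y..g 0 z} \<subseteq> g 0 ` {u..v}" if "y \<in> {u..v}" "z \<in> {u..v}" for y z
          using connected_contains_Icc[OF conn] that by blast
        have gx0: "r * real_of_int j / 5 \<le> g 0 x0" "g 0 x0 \<le> r * real_of_int (j + 1) / 5"
          using jj r by (auto simp: field_simps)
        have lo: "r * real_of_int j / 5 < g 0 y" if y: "y \<in> {u..v}" for y
        proof (rule ccontr)
          assume "\<not> ?thesis"
          then have "r * real_of_int j / 5 \<in> {g 0 y..g 0 x0}" using gx0 by auto
          then obtain z where "z \<in> {u..v}" "g 0 z = r * real_of_int j / 5"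
            using icc[OF y x0(1)] by (metis imageE subsetD)
          then show False using no jr by auto
        qed
        have hi: "g 0 y < r * real_of_int (j + 1) / 5" if y: "y \<in> {u..v}" for y
        proof (rule ccontr)
          assume "\<not> ?thesis"
          then have "r * real_of_int (j + 1) / 5 \<in> {g 0 x0..g 0 y}" using gx0 by auto
          then obtain z where "z \<in> {u..v}" "g 0 z = r * real_of_int (j + 1) / 5"
            using icc[OF x0(1) y] by (metis imageE subsetD)
          then show False using no[of z "j + 1"] jr by auto
        qed
        have ge: "r \<le> \<bar>g 0 y\<bar>" if y: "y \<in> {u..v}" for y
        proof (cases "0 \<le> g 0 x0")
          case True
          then have "5 \<le> 5 * g 0 x0 / r" using x0(2) r by (simp add: field_simps)
          then have "5 \<le> j" using jj by linarith
          then have "r * 5 \<le> r * real_of_int j" using r by (intro mult_left_mono) auto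
          then show ?thesis using lo[OF y] by linarith
        next
          case False
          then have "5 * g 0 x0 / r \<le> - 5" using x0(2) r by (simp add: field_simps)
          \<comment> \<open>For negative values the floor would assign \<open>- r\<close> to the
            strip that reaches into \<open>\<bar>g 0\<bar> < r\<close>. This value is a recorded
            crossing, so it does not occur.\<close>
          moreover have "5 * g 0 x0 / r \<noteq> - 5" using no[OF x0(1), of "-5"] r by (auto simp: field_simps)
          ultimately have "j + 1 \<le> - 5" using jj by linarith
          then have "r * real_of_int (j + 1) \<le> r * (- 5)" using r by (intro mult_left_mono) auto
          then show ?thesis using hi[OF y] by linarith
        qed
        obtain z where z: "z \<in> {u..v}" "g 0 v - g 0 u = g 1 z / e * (v - u)"
        proof -
          have "u \<in> {u..v}" "v \<in> {u..v}" using uv by auto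
          from mvt_within[OF D0 this] show thesis using that by metis
        qed
        have "\<bar>g 0 v - g 0 u\<bar> \<le> r / 5"
        proof -
          have "r * real_of_int (j + 1) / 5 = r * real_of_int j / 5 + r / 5" by (simp add: field_simps)
          moreover have "u \<in> {u..v}" "v \<in> {u..v}" using uv by auto
          note lo[OF this(1)] lo[OF this(2)] hi[OF this(1)] hi[OF this(2)]
          ultimately show ?thesis by linarith
        qed
        \<comment> \<open>A strip has width \<open>r / 5\<close>; the factor 5/4 for the variation
          of \<open>g 1\<close> turns this into the quarter required by
          \<open>nearly_const\<close>.\<close>
        then have *: "\<bar>g 1 z\<bar> * (v - u) \<le> e * r / 5"
        proof -
          have "\<bar>g 0 v - g 0 u\<bar> = \<bar>g 1 z\<bar> * (v - u) / e" using z(2) uv e by (simp add: abs_mult)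
          then show ?thesis using \<open>\<bar>g 0 v - g 0 u\<bar> \<le> r / 5\<close> e by (simp add: pos_divide_le_eq mult.commute)
        qed
        show ?thesis unfolding nearly_const_def
        proof (intro ballI)
          fix x y assume xy: "x \<in> {u..v}" "y \<in> {u..v}"
          have "(v - u) * \<bar>g 1 x\<bar> \<le> (v - u) * (5 / 4 * \<bar>g 1 z\<bar>)"
            using ratio[OF xy(1) z(1)] uv by (intro mult_left_mono) auto
          also have "\<dots> \<le> e / 4 * r" using * by (simp add: field_simps)
          also have "\<dots> \<le> e / 4 * \<bar>g 0 y\<bar>" using ge[OF xy(2)] e by (intro mult_left_mono) auto
          finally show "(v - u) * \<bar>g 1 x\<bar> \<le> e / 4 * \<bar>g 0 y\<bar>" .
        qed
      qed
    qed
    moreover have "finite E" unfolding E_def using fE1 fE2 E3 by simp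
    ultimately show "\<exists>E. finite E \<and> real (card E) \<le> (22 * B + 39) * r powr (- 1 / (real (Suc d) + 1)) \<and>
      (\<forall>u v. s \<le> u \<longrightarrow> u \<le> v \<longrightarrow> v \<le> t \<longrightarrow> {u..v} \<inter> E = {} \<longrightarrow>
        (\<exists>x\<in>{u..v}. r \<le> \<bar>g 0 x\<bar> \<and> \<bar>g 0 x\<bar> \<le> 2 * r) \<longrightarrow> nearly_const e (g 0) (g 1) u v)"
      using cE unfolding R_def by blast
  qed
  then show ?thesis using B by (intro exI[of _ "22 * B + 39"]) auto
qed

lemma cut_bound_exists: "\<exists>C\<ge>0. cut_bound d C"
proof (induction d)
  case 0 then show ?case using cut_bound_0 by (intro exI[of _ 10]) auto
next
  case (Suc d) then show ?case using cut_bound_Suc by blast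
qed

lemma first_exit_right:
  fixes h :: "real \<Rightarrow> real"
  assumes c: "continuous_on {x..y} h" and "x \<le> y" "h x < r" "r \<le> h y"
  obtains z where "z \<in> {x..y}" "h z = r" "\<And>w. w \<in> {x..z} \<Longrightarrow> h w \<le> r"
proof -
  define S where "S = {w\<in>{x..y}. r \<le> h w}"
  have "S = {x..y} \<inter> h -` {r..}" unfolding S_def by auto
  then have "closed S" using continuous_closed_preimage[OF c closed_atLeastAtMost closed_atLeast] by simp
  moreover have "bounded S"
    by (rule bounded_subset[OF bounded_closed_interval[of x y]]) (auto simp: S_def)
  ultimately have "compact S" by (simp add: compact_eq_bounded_closed)
  moreover have "S \<noteq> {}" using assms unfolding S_def by auto
  ultimately obtain z where z: "z \<in> S" "\<And>w. w \<in> S \<Longrightarrow> z \<le> w"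
    using compact_attains_inf by metis
  have zx: "x \<le> z" "z \<le> y" "r \<le> h z" using z unfolding S_def by auto
  have "continuous_on {x..z} h" using c zx by (meson atLeastatMost_subset_iff continuous_on_subset order_refl)
  then obtain z' where z': "x \<le> z'" "z' \<le> z" "h z' = r" using IVT'[of h x r z] assms zx by auto
  then have "z' \<in> S" unfolding S_def using zx by auto
  then have "z' = z" using z z' by force
  moreover have "h w \<le> r" if "w \<in> {x..z}" for w
  proof (rule ccontr)
    assume "\<not> h w \<le> r"
    then have "w \<in> S" unfolding S_def using that zx by auto
    then have "w = z" using z(2) that by force
    then show False using z' \<open>z' = z\<close> \<open>\<not> h w \<le> r\<close> by auto
  qed
  ultimately show thesis using z' zx that by auto
qed

text \<open>The exit segment runs from \<open>x\<close> to the first place where the level is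
  reached, in the direction of \<open>y\<close>; a reflection reduces exits to the left to those on
  the right.\<close>

lemma first_exit:
  fixes h :: "real \<Rightarrow> real"
  assumes c: "continuous_on {u..v} h" and xy: "x \<in> {u..v}" "y \<in> {u..v}" "h x < r" "r \<le> h y"
  obtains z a b where "h z = r" "a \<le> b" "{a..b} \<subseteq> {u..v}" "x \<in> {a..b}" "z \<in> {a..b}"
    "\<And>w. w \<in> {a..b} \<Longrightarrow> h w \<le> r"
proof (cases "x \<le> y")
  case True
  have "continuous_on {x..y} h" using c xy by (meson atLeastatMost_subset_iff atLeastAtMost_iff continuous_on_subset)
  then obtain z where "z \<in> {x..y}" "h z = r" "\<And>w. w \<in> {x..z} \<Longrightarrow> h w \<le> r"
    using first_exit_right[OF _ True xy(3,4)] by metis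
  then show thesis using xy by (intro that[of z x z]) auto
next
  case False
  have "continuous_on {-x..-y} (\<lambda>w. h (- w))"
    by (rule continuous_on_compose2[OF c]) (use xy in \<open>auto intro!: continuous_intros\<close>)
  then obtain z where z: "z \<in> {-x..-y}" "h (- z) = r" "\<And>w. w \<in> {-x..z} \<Longrightarrow> h (- w) \<le> r"
    using first_exit_right[of "-x" "-y" "\<lambda>w. h (- w)" r] xy False by auto
  have "h w \<le> r" if "w \<in> {-z..x}" for w using z(3)[of "-w"] that by auto
  then show thesis using xy z by (intro that[of "- z" "-z" x]) auto
qed

section \<open>Weighted sums over separated points\<close>

lemma half_power: "(1/2::real) ^ k = 2 powr (- real k)"
  by (simp add: powr_minus powr_realpow power_one_over inverse_eq_divide)

text \<open>The constant has to be a function of \<open>d\<close> alone, so \<open>C\<close> is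
  picked by \<open>SOME\<close> and not obtained inside a proof. The summand 10 covers the grid at
  level 0, \<open>Q ^ 4 / (Q - 1)\<close> bounds the cut points of levels up to \<open>k + 3\<close>
  relative to \<open>Q ^ k\<close>, and the remaining factors sum the weights over all
  levels.\<close>

definition sep_bound :: "nat \<Rightarrow> real" where
  "sep_bound d = (let C = (SOME C. 0 \<le> C \<and> cut_bound d C) + 10; Q = 2 powr (1 / (real d + 1))
     in (C * Q ^ 4 / (Q - 1) + 1) * (Q ^ 2) / (1 - 1 / Q))"

text \<open>The cut points of level \<open>k\<close>, where \<open>2\<^sup>-\<^sup>k \<le> \<bar>g\<bar> \<le> 2 \<cdot> 2\<^sup>-\<^sup>k\<close>, are only kept where
  \<open>\<bar>g\<bar> \<le> 4 \<cdot> 2\<^sup>-\<^sup>k\<close>. A segment through level \<open>k\<close> that avoids these stays in that region, and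
  the cut points near it belong to levels at most \<open>k + 3\<close>.\<close>

lemma cell_cuts:
  fixes g :: "nat \<Rightarrow> real \<Rightarrow> real"
  assumes e: "0 < e" and st: "s \<le> t" "t - s \<le> e"
    and d: "\<And>i x. i \<le> d \<Longrightarrow> x \<in> {s..t} \<Longrightarrow> (g i has_real_derivative g (Suc i) x / e) (at x within {s..t})"
    and b: "\<And>i x. i \<le> d \<Longrightarrow> x \<in> {s..t} \<Longrightarrow> \<bar>g (Suc i) x\<bar> \<le> 1"
  obtains Z where "Z \<subseteq> {s..t}" "countable (Z \<inter> {x. g 0 x \<noteq> 0})"
    "\<And>x. x \<in> {s..t} \<Longrightarrow> g 0 x = 0 \<Longrightarrow> x \<in> Z"
    "\<And>u v. s \<le> u \<Longrightarrow> u \<le> v \<Longrightarrow> v \<le> t \<Longrightarrow> {u..v} \<inter> Z = {} \<Longrightarrow> nearly_const e (g 0) (g 1) u v"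
    "\<And>A. finite A \<Longrightarrow> A \<subseteq> {s..t} \<Longrightarrow> A \<inter> Z = {} \<Longrightarrow>
      (\<And>x y. x \<in> A \<Longrightarrow> y \<in> A \<Longrightarrow> x < y \<Longrightarrow> {x..y} \<inter> Z \<noteq> {}) \<Longrightarrow>
      (\<Sum>x\<in>A. min 1 (\<bar>g 0 x\<bar> powr (2 / (real d + 1)))) \<le> sep_bound d"
proof -
  define C where "C = (SOME C. 0 \<le> C \<and> cut_bound d C)"
  define a where "a = 1 / (real d + 1)"
  define Q where "Q = (2::real) powr a"
  have "0 \<le> C \<and> cut_bound d C" unfolding C_def by (rule someI_ex) (use cut_bound_exists in auto)
  then have C: "0 \<le> C" "cut_bound d C" by auto
  have a: "0 < a" "a \<le> 1" unfolding a_def by auto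
  have Q: "1 < Q" unfolding Q_def using a by simp
  have sb: "sep_bound d = ((C + 10) * Q ^ 4 / (Q - 1) + 1) * Q ^ 2 / (1 - 1 / Q)"
    unfolding sep_bound_def C_def Q_def a_def Let_def by simp
  have D: "(g i has_real_derivative g (Suc i) x / e) (at x within {u..v})"
    if "i \<le> d" "s \<le> u" "v \<le> t" "x \<in> {u..v}" for i u v x
    by (rule has_field_derivative_subset[of _ _ _ "{s..t}"]) (use d that in auto)
  \<comment> \<open>Level 0 collects all values of modulus at least 1, so only positive levels come
    with an upper bound; the cap at 1 in the weights matches this.\<close>
  define lev where "lev x = (LEAST k. (1/2) ^ k \<le> \<bar>g 0 x\<bar>)" for x
  have lev: "(1/2) ^ lev x \<le> \<bar>g 0 x\<bar>" "0 < lev x \<Longrightarrow> \<bar>g 0 x\<bar> \<le> 2 * (1/2) ^ lev x" if nz: "g 0 x \<noteq> 0" for x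
  proof -
    obtain n where "(1/2) ^ n < \<bar>g 0 x\<bar>" using real_arch_pow_inv[of "\<bar>g 0 x\<bar>" "1/2"] nz by auto
    then show "(1/2) ^ lev x \<le> \<bar>g 0 x\<bar>" unfolding lev_def by (intro LeastI) (rule less_imp_le)
    assume "0 < lev x"
    then obtain k where k: "lev x = Suc k" by (cases "lev x") auto
    then have "\<not> (1/2) ^ k \<le> \<bar>g 0 x\<bar>" unfolding lev_def by (metis lessI not_less_Least)
    then show "\<bar>g 0 x\<bar> \<le> 2 * (1/2) ^ lev x" using k by simp
  qed
  have "\<exists>E. finite E \<and> real (card E) \<le> (C + 10) * Q ^ k \<and>
    (\<forall>u v. s \<le> u \<longrightarrow> u \<le> v \<longrightarrow> v \<le> t \<longrightarrow> {u..v} \<inter> E = {} \<longrightarrow>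
      (\<exists>x\<in>{u..v}. g 0 x \<noteq> 0 \<and> lev x = k) \<longrightarrow> nearly_const e (g 0) (g 1) u v)" for k
  proof (cases "k = 0")
    case True
    obtain E where E: "finite E" "real (card E) \<le> e / (e / 8) + 2"
      "\<And>u v. s \<le> u \<Longrightarrow> u \<le> v \<Longrightarrow> v \<le> t \<Longrightarrow> {u..v} \<inter> E = {} \<Longrightarrow> v - u \<le> e / 8"
      using grid_exists[OF st(2), of "e / 8"] e st by auto
    have "real (card E) \<le> (C + 10) * Q ^ k" using E(2) e C True by simp
    moreover have "nearly_const e (g 0) (g 1) u v"
      if uv: "s \<le> u" "u \<le> v" "v \<le> t" "{u..v} \<inter> E = {}" and x: "x \<in> {u..v}" "g 0 x \<noteq> 0" "lev x = k" for u v x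
    proof (rule nearly_const_small_deriv[of e 1 u v "g 0" "g 1" 1 x])
      show "1 \<le> \<bar>g 0 x\<bar>" using lev(1)[OF x(2)] x(3) True by simp
      show "(g 0 has_real_derivative g 1 x / e) (at x within {u..v})" if "x \<in> {u..v}" for x
        using D[of 0 u v x] uv that by auto
      show "\<bar>g 1 x\<bar> \<le> 1" if "x \<in> {u..v}" for x using b[of 0 x] uv that by auto
    qed (use e x E(3)[OF uv] in auto)
    ultimately show ?thesis using E(1) by blast
  next
    case False
    have "\<exists>E. finite E \<and> real (card E) \<le> C * ((1/2) ^ k) powr (- 1 / (real d + 1)) \<and>
      (\<forall>u v. s \<le> u \<longrightarrow> u \<le> v \<longrightarrow> v \<le> t \<longrightarrow> {u..v} \<inter> E = {} \<longrightarrow>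
        (\<exists>x\<in>{u..v}. (1/2) ^ k \<le> \<bar>g 0 x\<bar> \<and> \<bar>g 0 x\<bar> \<le> 2 * (1/2) ^ k) \<longrightarrow> nearly_const e (g 0) (g 1) u v)"
      using C(2)[unfolded cut_bound_def, rule_format, of e s t g "(1/2) ^ k"] e st d b
      by (auto simp: power_le_one)
    then obtain E where E: "finite E" "real (card E) \<le> C * ((1/2) ^ k) powr (- 1 / (real d + 1))"
      "\<And>u v. s \<le> u \<Longrightarrow> u \<le> v \<Longrightarrow> v \<le> t \<Longrightarrow> {u..v} \<inter> E = {} \<Longrightarrow>
        \<exists>x\<in>{u..v}. (1/2) ^ k \<le> \<bar>g 0 x\<bar> \<and> \<bar>g 0 x\<bar> \<le> 2 * (1/2) ^ k \<Longrightarrow> nearly_const e (g 0) (g 1) u v"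
      by blast
    have "((1/2::real) ^ k) powr (- 1 / (real d + 1)) = 2 powr (a * real k)"
      unfolding a_def half_power by (simp add: powr_powr)
    also have "\<dots> = Q ^ k" using Q unfolding Q_def by (simp add: powr_powr[symmetric] powr_realpow)
    finally have "real (card E) \<le> C * Q ^ k" using E(2) by simp
    also have "\<dots> \<le> (C + 10) * Q ^ k" using Q by (intro mult_right_mono) auto
    finally have "real (card E) \<le> (C + 10) * Q ^ k" .
    moreover have "nearly_const e (g 0) (g 1) u v"
      if uv: "s \<le> u" "u \<le> v" "v \<le> t" "{u..v} \<inter> E = {}" and x: "x \<in> {u..v}" "g 0 x \<noteq> 0" "lev x = k" for u v x
    proof (rule E(3)[OF uv], rule bexI[OF _ x(1)])
      show "(1/2) ^ k \<le> \<bar>g 0 x\<bar> \<and> \<bar>g 0 x\<bar> \<le> 2 * (1/2) ^ k" using lev[OF x(2)] x(3) False by auto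
    qed
    ultimately show ?thesis using E(1) by blast
  qed
  then obtain E where E: "\<And>k. finite (E k)" "\<And>k. real (card (E k)) \<le> (C + 10) * Q ^ k"
    "\<And>k u v x. s \<le> u \<Longrightarrow> u \<le> v \<Longrightarrow> v \<le> t \<Longrightarrow> {u..v} \<inter> E k = {} \<Longrightarrow> x \<in> {u..v} \<Longrightarrow> g 0 x \<noteq> 0 \<Longrightarrow>
       lev x = k \<Longrightarrow> nearly_const e (g 0) (g 1) u v"
    by metis
  define F where "F k = {x\<in>E k. x \<in> {s..t} \<and> (k = 0 \<or> \<bar>g 0 x\<bar> \<le> 4 * (1/2) ^ k)}" for k
  \<comment> \<open>The zeros of \<open>g 0\<close> may form an uncountable set; countability is
    claimed only for the remaining cut points, which lie in the countable union of the finite sets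
    \<open>F k\<close>.\<close>
  define Z where "Z = (\<Union>k. F k) \<union> {x\<in>{s..t}. g 0 x = 0}"
  have fF: "finite (F k)" for k unfolding F_def using E(1) by simp
  have cF: "real (card (F k)) \<le> (C + 10) * Q ^ k" for k
  proof -
    have "card (F k) \<le> card (E k)" unfolding F_def by (intro card_mono E(1)) auto
    then show ?thesis using E(2)[of k] by linarith
  qed
  have nc_diff: "\<bar>g 0 x - g 0 y\<bar> \<le> \<bar>g 0 x\<bar> / 4"
    if "nearly_const e (g 0) (g 1) u v" "s \<le> u" "v \<le> t" "x \<in> {u..v}" "y \<in> {u..v}" for u v x y
    by (rule nearly_const_diff[OF that(1) e _ that(4,5,4)]) (use D[of 0 u v] that in auto)
  have stay: "nearly_const e (g 0) (g 1) u v"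
    if uv: "s \<le> u" "u \<le> v" "v \<le> t" and x: "x \<in> {u..v}" "g 0 x \<noteq> 0" "lev x = k"
      and em: "{u..v} \<inter> F k = {}" for u v x k
  proof -
    have "{u..v} \<inter> E k = {}"
    proof (cases "k = 0")
      case True then show ?thesis using em uv unfolding F_def by auto
    next
      case False
      define r where "r = 4 * (1/2::real) ^ k"
      have xr: "\<bar>g 0 x\<bar> \<le> r / 2" using lev(2)[OF x(2)] x(3) False unfolding r_def by auto
      have rpos: "0 < r" unfolding r_def by simp
      \<comment> \<open>Up to its first exit from the region below \<open>r\<close> the segment
        could meet \<open>E k\<close> only in cuts that were kept, so \<open>g 0\<close> is nearly
        constant there; starting at \<open>r / 2\<close> or less it cannot reach
        \<open>r\<close>.\<close>
      have "\<bar>g 0 y\<bar> < r" if y: "y \<in> {u..v}" for y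
      proof (rule ccontr)
        assume "\<not> ?thesis"
        then have y2: "r \<le> \<bar>g 0 y\<bar>" by simp
        have "continuous_on {u..v} (g 0)"
          using D[of 0 u v] uv by (metis DERIV_continuous continuous_on_eq_continuous_within le0)
        then have c: "continuous_on {u..v} (\<lambda>x. \<bar>g 0 x\<bar>)" by (intro continuous_intros)
        have "\<bar>g 0 x\<bar> < r" using xr rpos by linarith
        from first_exit[OF c x(1) y this y2] obtain z a b where z: "\<bar>g 0 z\<bar> = r" "a \<le> b"
          "{a..b} \<subseteq> {u..v}" "x \<in> {a..b}" "z \<in> {a..b}" "\<And>w. w \<in> {a..b} \<Longrightarrow> \<bar>g 0 w\<bar> \<le> r" by blast
        have ab: "s \<le> a" "b \<le> t" using z uv by auto
        have "{a..b} \<inter> E k = {}" using z(3,6) em ab unfolding F_def r_def by fastforce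
        then have "nearly_const e (g 0) (g 1) a b" using E(3)[OF ab(1) z(2) ab(2)] z(4) x by blast
        from nc_diff[OF this ab z(4,5)] show False using xr z(1) rpos by linarith
      qed
      then show ?thesis using em uv unfolding F_def r_def by fastforce
    qed
    then show ?thesis using E(3)[OF uv] x by blast
  qed
  have "countable (\<Union>k. F k)" by (rule countable_UN) (auto intro: countable_finite fF)
  then have cZ: "countable (Z \<inter> {x. g 0 x \<noteq> 0})"
    by (rule countable_subset[rotated]) (auto simp: Z_def)
  have sum: "(\<Sum>x\<in>A. min 1 (\<bar>g 0 x\<bar> powr (2 / (real d + 1)))) \<le> sep_bound d"
    if A: "finite A" "A \<subseteq> {s..t}" "A \<inter> Z = {}"
      and sep: "\<And>x y. x \<in> A \<Longrightarrow> y \<in> A \<Longrightarrow> x < y \<Longrightarrow> {x..y} \<inter> Z \<noteq> {}" for A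
  proof -
    have A0: "g 0 x \<noteq> 0" if "x \<in> A" for x using that A unfolding Z_def by blast
    define Ak where "Ak k = {x\<in>A. lev x = k}" for k
    define C2 where "C2 = (C + 10) * Q ^ 4 / (Q - 1) + 1"
    have C2: "0 \<le> C2" unfolding C2_def using C Q by simp
    have cAk: "real (card (Ak k)) \<le> C2 * Q ^ k" for k
    proof -
      define G where "G = (\<Union>j\<le>k+3. F j)"
      have fG: "finite G" unfolding G_def using fF by blast
      have "card G \<le> (\<Sum>j\<le>k+3. card (F j))" unfolding G_def by (intro card_UN_le) simp
      then have "real (card G) \<le> (\<Sum>j\<le>k+3. real (card (F j)))" by (metis of_nat_mono of_nat_sum)
      also have "\<dots> \<le> (\<Sum>j\<le>k+3. (C + 10) * Q ^ j)" using cF by (intro sum_mono) auto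
      also have "\<dots> = (C + 10) * (\<Sum>j<Suc (k+3). Q ^ j)" by (simp only: sum_distrib_left lessThan_Suc_atMost)
      also have "\<dots> = (C + 10) * ((Q ^ Suc (k+3) - 1) / (Q - 1))" using Q by (subst geometric_sum) auto
      also have "\<dots> \<le> (C + 10) * (Q ^ Suc (k+3) / (Q - 1))"
        using Q C by (intro mult_left_mono divide_right_mono) auto
      finally have cG: "real (card G) \<le> (C + 10) * Q ^ 4 / (Q - 1) * Q ^ k"
        by (simp add: power_add numeral_eq_Suc algebra_simps)
      have "finite (Ak k) \<and> card (Ak k) \<le> card G + 1"
      proof (rule card_separated_le[OF fG])
        show "Ak k \<inter> G = {}" using A(3) unfolding Ak_def G_def Z_def by blast
        fix x y assume xy: "x \<in> Ak k" "y \<in> Ak k" "x < y"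
        have x: "x \<in> A" "y \<in> A" "lev x = k" "s \<le> x" "y \<le> t" using xy A unfolding Ak_def by auto
        show "{x..y} \<inter> G \<noteq> {}"
        proof
          assume em: "{x..y} \<inter> G = {}"
          then have em': "{x..y} \<inter> F k = {}" unfolding G_def by fastforce
          have nc: "nearly_const e (g 0) (g 1) x y"
            by (rule stay[OF x(4) _ x(5) _ A0[OF x(1)] x(3) em']) (use xy in auto)
          obtain z where z: "z \<in> {x..y}" "z \<in> Z" using sep[OF x(1,2) xy(3)] by blast
          have "\<bar>g 0 x - g 0 z\<bar> \<le> \<bar>g 0 x\<bar> / 4"
            by (rule nc_diff[OF nc x(4,5)]) (use z xy in auto)
          moreover have "(1/2) ^ k \<le> \<bar>g 0 x\<bar>" using lev(1)[OF A0[OF x(1)]] x(3) by simp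
          ultimately have gz: "3 / 4 * (1/2) ^ k \<le> \<bar>g 0 z\<bar>" by linarith
          moreover have "0 < (1/2::real) ^ k" by simp
          ultimately have "g 0 z \<noteq> 0" by linarith
          then obtain j where j: "z \<in> F j" using z unfolding Z_def by auto
          have "j \<le> k + 3"
          proof (rule ccontr)
            assume c: "\<not> j \<le> k + 3"
            then have "\<bar>g 0 z\<bar> \<le> 4 * (1/2) ^ j" using j unfolding F_def by auto
            also have "\<dots> \<le> 4 * (1/2) ^ (k + 3)" using c by (intro mult_left_mono power_decreasing) auto
            also have "\<dots> = 1 / 2 * (1/2) ^ k" by (simp add: power_add power3_eq_cube)
            also have "\<dots> < 3 / 4 * (1/2) ^ k" by simp
            finally show False using gz by simp
          qed
          then show False using em j z unfolding G_def by blast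
        qed
      qed
      then have "real (card (Ak k)) \<le> real (card G) + 1" by linarith
      also have "\<dots> \<le> (C + 10) * Q ^ 4 / (Q - 1) * Q ^ k + Q ^ k" using cG Q by (simp add: add_mono one_le_power)
      also have "\<dots> = C2 * Q ^ k" unfolding C2_def by (simp add: algebra_simps)
      finally show ?thesis .
    qed
    obtain N where N: "\<And>x. x \<in> A \<Longrightarrow> lev x < N"
      using finite_nat_set_iff_bounded[of "lev ` A"] A(1) by auto
    have qb: "2 / (real d + 1) = 2 * a" unfolding a_def by simp
    \<comment> \<open>The exponent is twice the one in the count: about \<open>Q ^ k\<close> points
      of weight about \<open>Q powr (- 2 * k)\<close> sum to a convergent geometric series over the
      levels.\<close>
    have val: "min 1 (\<bar>g 0 x\<bar> powr (2 / (real d + 1))) \<le> Q ^ 2 * (1 / Q ^ 2) ^ k" if "x \<in> Ak k" for x k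
    proof (cases "k = 0")
      case True then show ?thesis using Q by (simp add: min.coboundedI1 one_le_power)
    next
      case False
      have "\<bar>g 0 x\<bar> \<le> 2 * (1/2) ^ k" using lev(2)[OF A0[of x]] that False unfolding Ak_def by auto
      then have "\<bar>g 0 x\<bar> powr (2 / (real d + 1)) \<le> (2 * (1/2) ^ k) powr (2 * a)"
        unfolding qb using a by (intro powr_mono2) auto
      also have "\<dots> = 2 powr (2 * a) * (2 powr (- real k)) powr (2 * a)"
        by (simp add: powr_mult half_power)
      also have "\<dots> = Q powr 2 * Q powr (- real (2 * k))"
        unfolding Q_def by (simp add: powr_powr mult.commute mult.left_commute)
      also have "Q powr (- real (2 * k)) = 1 / Q ^ (2 * k)"
        using Q by (simp only: powr_minus powr_realpow inverse_eq_divide)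
      also have "\<dots> = (1 / Q ^ 2) ^ k" by (simp add: power_mult power_one_over)
      also have "Q powr 2 = Q ^ 2" using Q by simp
      finally show ?thesis by linarith
    qed
    have "(\<Sum>x\<in>A. min 1 (\<bar>g 0 x\<bar> powr (2 / (real d + 1))))
        = (\<Sum>k<N. \<Sum>x\<in>Ak k. min 1 (\<bar>g 0 x\<bar> powr (2 / (real d + 1))))"
      unfolding Ak_def using A(1) N by (intro sum.group[symmetric]) auto
    also have "\<dots> \<le> (\<Sum>k<N. C2 * Q ^ k * (Q ^ 2 * (1 / Q ^ 2) ^ k))"
    proof (rule sum_mono)
      fix k
      have "(\<Sum>x\<in>Ak k. min 1 (\<bar>g 0 x\<bar> powr (2 / (real d + 1)))) \<le> (\<Sum>x\<in>Ak k. Q ^ 2 * (1 / Q ^ 2) ^ k)"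
        by (intro sum_mono val)
      also have "\<dots> = real (card (Ak k)) * (Q ^ 2 * (1 / Q ^ 2) ^ k)" by simp
      also have "\<dots> \<le> C2 * Q ^ k * (Q ^ 2 * (1 / Q ^ 2) ^ k)"
        using cAk Q by (intro mult_right_mono) auto
      finally show "(\<Sum>x\<in>Ak k. min 1 (\<bar>g 0 x\<bar> powr (2 / (real d + 1)))) \<le> C2 * Q ^ k * (Q ^ 2 * (1 / Q ^ 2) ^ k)" .
    qed
    also have "\<dots> = (\<Sum>k<N. C2 * Q ^ 2 * (1 / Q) ^ k)"
    proof (rule sum.cong[OF refl])
      fix k
      have "Q ^ k * (1 / Q ^ 2) ^ k = (1 / Q) ^ k"
        unfolding power_mult_distrib[symmetric] using Q by (simp add: power2_eq_square)
      then show "C2 * Q ^ k * (Q ^ 2 * (1 / Q ^ 2) ^ k) = C2 * Q ^ 2 * (1 / Q) ^ k"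
        by (metis mult.assoc mult.left_commute)
    qed
    also have "\<dots> = C2 * Q ^ 2 * (\<Sum>k<N. (1 / Q) ^ k)" by (simp add: sum_distrib_left)
    also have "\<dots> \<le> C2 * Q ^ 2 * (1 / (1 - 1 / Q))"
    proof (intro mult_left_mono)
      have "(\<Sum>k<N. (1 / Q) ^ k) \<le> (\<Sum>k. (1 / Q) ^ k)"
        using Q by (intro sum_le_suminf summable_geometric) auto
      then show "(\<Sum>k<N. (1 / Q) ^ k) \<le> 1 / (1 - 1 / Q)" using Q by (simp add: suminf_geometric)
    qed (use C2 in auto)
    finally show ?thesis unfolding sb C2_def by simp
  qed
  show thesis
  proof (rule that[OF _ cZ _ _ sum])
    show "Z \<subseteq> {s..t}" unfolding Z_def F_def by auto
    show "x \<in> Z" if "x \<in> {s..t}" "g 0 x = 0" for x using that unfolding Z_def by auto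
    show "nearly_const e (g 0) (g 1) u v" if uv: "s \<le> u" "u \<le> v" "v \<le> t" "{u..v} \<inter> Z = {}" for u v
      by (rule stay[OF uv(1-3), of u "lev u"]) (use uv in \<open>auto simp: Z_def\<close>)
  qed
qed

lemma sep_bound_ge1: "1 \<le> sep_bound d"
proof -
  define C where "C = (SOME C. 0 \<le> C \<and> cut_bound d C)"
  define Q where "Q = (2::real) powr (1 / (real d + 1))"
  have "0 \<le> C \<and> cut_bound d C" unfolding C_def by (rule someI_ex) (use cut_bound_exists in auto)
  then have C: "0 \<le> C" by auto
  have Q: "1 < Q" unfolding Q_def by simp
  have sb: "sep_bound d = ((C + 10) * Q ^ 4 / (Q - 1) + 1) * Q ^ 2 / (1 - 1 / Q)"
    unfolding sep_bound_def C_def Q_def Let_def by simp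
  have 1: "1 \<le> (C + 10) * Q ^ 4 / (Q - 1) + 1" using C Q by simp
  have 2: "1 \<le> Q ^ 2" using Q by (simp add: one_le_power)
  have 3: "1 \<le> 1 / (1 - 1 / Q)" using Q by (simp add: field_simps)
  have "1 * 1 \<le> ((C + 10) * Q ^ 4 / (Q - 1) + 1) * Q ^ 2" using 1 2 by (intro mult_mono) auto
  then have "1 * 1 \<le> ((C + 10) * Q ^ 4 / (Q - 1) + 1) * Q ^ 2 * (1 / (1 - 1 / Q))"
    using 3 by (intro mult_mono) auto
  then show ?thesis unfolding sb by simp
qed

lemma floor_le_one_apart:
  fixes x y :: real
  assumes "\<bar>x - y\<bar> \<le> e" "0 < e"
  shows "\<lfloor>x / e\<rfloor> \<le> \<lfloor>y / e\<rfloor> + 1"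
proof -
  have "x / e \<le> y / e + 1" using assms by (simp add: field_simps)
  then show ?thesis by (metis floor_add_int floor_mono of_int_1)
qed

text \<open>\<open>cell_cuts\<close> needs an interval of length at most \<open>e\<close>, so
  \<open>T\<close>, possibly a whole line, is first divided at the multiples of \<open>e\<close>. A
  set of diameter at most \<open>e\<close> that avoids the cuts meets at most two of the cells,
  whence the factor 2.\<close>

lemma static_cuts:
  fixes g :: "nat \<Rightarrow> real \<Rightarrow> real" and T :: "real set"
  assumes T: "closed T" "convex T" and e: "0 < e"
    and d: "\<And>i x. i \<le> d \<Longrightarrow> x \<in> T \<Longrightarrow> (g i has_real_derivative g (Suc i) x / e) (at x within T)"
    and b: "\<And>i x. i \<le> d \<Longrightarrow> x \<in> T \<Longrightarrow> \<bar>g (Suc i) x\<bar> \<le> 1"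
  obtains Z where "countable (Z \<inter> {x. g 0 x \<noteq> 0})" "\<And>x. x \<in> T \<Longrightarrow> g 0 x = 0 \<Longrightarrow> x \<in> Z"
    "\<And>u v. u \<le> v \<Longrightarrow> {u..v} \<subseteq> T \<Longrightarrow> {u..v} \<inter> Z = {} \<Longrightarrow> nearly_const e (g 0) (g 1) u v \<and> v - u \<le> e"
    "\<And>A. finite A \<Longrightarrow> A \<subseteq> T \<Longrightarrow> A \<inter> Z = {} \<Longrightarrow>
      (\<And>x y. x \<in> A \<Longrightarrow> y \<in> A \<Longrightarrow> \<bar>x - y\<bar> \<le> e) \<Longrightarrow>
      (\<And>x y. x \<in> A \<Longrightarrow> y \<in> A \<Longrightarrow> x < y \<Longrightarrow> {x..y} \<inter> Z \<noteq> {}) \<Longrightarrow>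
      (\<Sum>x\<in>A. min 1 (\<bar>g 0 x\<bar> powr (2 / (real d + 1)))) \<le> 2 * sep_bound d"
proof -
  define J where "J k = {real_of_int k * e..real_of_int (k + 1) * e} \<inter> T" for k
  define P where "P k Z \<longleftrightarrow> Z \<subseteq> J k \<and> countable (Z \<inter> {x. g 0 x \<noteq> 0}) \<and> (\<forall>x\<in>J k. g 0 x = 0 \<longrightarrow> x \<in> Z) \<and>
    (\<forall>u v. u \<le> v \<longrightarrow> {u..v} \<subseteq> J k \<longrightarrow> {u..v} \<inter> Z = {} \<longrightarrow> nearly_const e (g 0) (g 1) u v) \<and>
    (\<forall>A. finite A \<longrightarrow> A \<subseteq> J k \<longrightarrow> A \<inter> Z = {} \<longrightarrow>
      (\<forall>x\<in>A. \<forall>y\<in>A. x < y \<longrightarrow> {x..y} \<inter> Z \<noteq> {}) \<longrightarrow>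
      (\<Sum>x\<in>A. min 1 (\<bar>g 0 x\<bar> powr (2 / (real d + 1)))) \<le> sep_bound d)" for k Z
  have "\<exists>Z. P k Z" for k
  proof (cases "J k = {}")
    case True
    then show ?thesis using sep_bound_ge1[of d] unfolding P_def by (intro exI[of _ "{}"]) auto
  next
    case False
    have "compact (J k)" unfolding J_def using T(1) by (intro compact_Int_closed) auto
    moreover have "convex (J k)" unfolding J_def using T(2) by (intro convex_Int) auto
    ultimately obtain s t where st: "J k = {s..t}"
      using connected_compact_interval_1 convex_connected by blast
    have sT: "{s..t} \<subseteq> T" using st unfolding J_def by auto
    have le: "s \<le> t" using False st by auto
    then have "s \<in> J k" "t \<in> J k" using st by auto
    then have "t - s \<le> real_of_int (k + 1) * e - real_of_int k * e" unfolding J_def by auto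
    then have len: "t - s \<le> e" by (simp add: algebra_simps)
    show ?thesis
    proof (rule cell_cuts[OF e le len, of d g], goal_cases)
      case (1 i x)
      then show ?case using d[of i x] sT has_field_derivative_subset by blast
    next
      case (2 i x) then show ?case using b sT by blast
    next
      case (3 Z)
      have "nearly_const e (g 0) (g 1) u v" if "u \<le> v" "{u..v} \<subseteq> {s..t}" "{u..v} \<inter> Z = {}" for u v
        using 3(4)[of u v] that by auto
      moreover have "(\<Sum>x\<in>A. min 1 (\<bar>g 0 x\<bar> powr (2 / (real d + 1)))) \<le> sep_bound d"
        if "finite A" "A \<subseteq> {s..t}" "A \<inter> Z = {}"
          "\<forall>x\<in>A. \<forall>y\<in>A. x < y \<longrightarrow> {x..y} \<inter> Z \<noteq> {}" for A
        by (rule 3(5)) (use that in auto)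
      ultimately show ?case unfolding P_def st using 3(1,2,3)
        by (intro exI[of _ Z] conjI ballI allI impI) auto
    qed
  qed
  then obtain Zk where ZkP: "\<And>k. P k (Zk k)" by metis
  have Zk: "\<And>k. Zk k \<subseteq> J k" "\<And>k. countable (Zk k \<inter> {x. g 0 x \<noteq> 0})"
    "\<And>k x. x \<in> J k \<Longrightarrow> g 0 x = 0 \<Longrightarrow> x \<in> Zk k"
    "\<And>k u v. u \<le> v \<Longrightarrow> {u..v} \<subseteq> J k \<Longrightarrow> {u..v} \<inter> Zk k = {} \<Longrightarrow> nearly_const e (g 0) (g 1) u v"
    "\<And>k A. finite A \<Longrightarrow> A \<subseteq> J k \<Longrightarrow> A \<inter> Zk k = {} \<Longrightarrow>
      \<forall>x\<in>A. \<forall>y\<in>A. x < y \<longrightarrow> {x..y} \<inter> Zk k \<noteq> {} \<Longrightarrow>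
      (\<Sum>x\<in>A. min 1 (\<bar>g 0 x\<bar> powr (2 / (real d + 1)))) \<le> sep_bound d"
    using ZkP unfolding P_def by blast+
  define D where "D = range (\<lambda>k::int. real_of_int k * e)"
  define Z where "Z = (\<Union>k. Zk k) \<union> D"
  define fl where "fl x = \<lfloor>x / e\<rfloor>" for x
  have fl: "real_of_int (fl x) * e \<le> x" "x \<le> real_of_int (fl x + 1) * e" for x
  proof -
    have "real_of_int (fl x) \<le> x / e" "x / e \<le> real_of_int (fl x + 1)" unfolding fl_def by linarith+
    then show "real_of_int (fl x) * e \<le> x" "x \<le> real_of_int (fl x + 1) * e"
      using e by (simp_all add: pos_le_divide_eq pos_divide_le_eq)
  qed
  have inJ: "x \<in> J (fl x)" if "x \<in> T" for x unfolding J_def using fl[of x] that by auto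
  have strict: "real_of_int (fl x) * e < x" "x < real_of_int (fl x + 1) * e" if "x \<notin> D" for x
    using fl[of x] that unfolding D_def by (metis less_eq_real_def rangeI)+
  have uniq: "k = fl x" if "x \<in> J k" "x \<notin> D" for x k
  proof -
    have "real_of_int k * e < x" "x < real_of_int (k + 1) * e"
      using that unfolding J_def D_def by (metis IntD1 atLeastAtMost_iff less_eq_real_def rangeI)+
    then have "real_of_int k \<le> x / e" "x / e < real_of_int k + 1" using e by (auto simp: field_simps)
    then show ?thesis unfolding fl_def by linarith
  qed
  have cell: "{u..v} \<subseteq> J (fl u)" if "u \<le> v" "{u..v} \<subseteq> T" "{u..v} \<inter> Z = {}" for u v
  proof
    fix x assume x: "x \<in> {u..v}"
    have "x \<le> real_of_int (fl u + 1) * e"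
    proof (rule ccontr)
      assume "\<not> ?thesis"
      then have "real_of_int (fl u + 1) * e \<in> {u..v}" using x fl(2)[of u] by auto
      then show False using that(3) unfolding Z_def D_def by blast
    qed
    then show "x \<in> J (fl u)" using x fl(1)[of u] that(2) unfolding J_def by auto
  qed
  have 1: "countable (Z \<inter> {x. g 0 x \<noteq> 0})"
  proof -
    have "Z \<inter> {x. g 0 x \<noteq> 0} \<subseteq> (\<Union>k. Zk k \<inter> {x. g 0 x \<noteq> 0}) \<union> D" unfolding Z_def by auto
    moreover have "countable ((\<Union>k. Zk k \<inter> {x. g 0 x \<noteq> 0}) \<union> D)"
      unfolding D_def by (intro countable_Un countable_UN countable_image) (use Zk(2) in auto)
    ultimately show ?thesis by (rule countable_subset)
  qed
  have 2: "x \<in> Z" if "x \<in> T" "g 0 x = 0" for x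
    using Zk(3)[OF inJ[OF that(1)] that(2)] unfolding Z_def by auto
  have 3: "nearly_const e (g 0) (g 1) u v \<and> v - u \<le> e"
    if uv: "u \<le> v" "{u..v} \<subseteq> T" "{u..v} \<inter> Z = {}" for u v
  proof -
    note c = cell[OF uv]
    have "{u..v} \<inter> Zk (fl u) = {}" using uv(3) unfolding Z_def by auto
    then have "nearly_const e (g 0) (g 1) u v" using Zk(4)[OF uv(1) c] by blast
    moreover have "v \<le> real_of_int (fl u + 1) * e" using c uv(1) unfolding J_def by auto
    then have "v - u \<le> e" using fl(1)[of u] by (simp add: algebra_simps)
    ultimately show ?thesis by blast
  qed
  have 4: "(\<Sum>x\<in>A. min 1 (\<bar>g 0 x\<bar> powr (2 / (real d + 1)))) \<le> 2 * sep_bound d" (is "sum ?q A \<le> _")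
    if A: "finite A" "A \<subseteq> T" "A \<inter> Z = {}" and close: "\<And>x y. x \<in> A \<Longrightarrow> y \<in> A \<Longrightarrow> \<bar>x - y\<bar> \<le> e"
      and sep: "\<And>x y. x \<in> A \<Longrightarrow> y \<in> A \<Longrightarrow> x < y \<Longrightarrow> {x..y} \<inter> Z \<noteq> {}" for A
  proof (cases "A = {}")
    case True then show ?thesis using sep_bound_ge1[of d] by simp
  next
    case False
    define k0 where "k0 = Min (fl ` A)"
    define Ak where "Ak k = {x\<in>A. fl x = k}" for k
    have "k0 \<in> fl ` A" unfolding k0_def using A(1) False by (intro Min_in) auto
    then obtain x0 where x0: "x0 \<in> A" "fl x0 = k0" by auto
    have two: "fl x = k0 \<or> fl x = k0 + 1" if "x \<in> A" for x
    proof -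
      have "k0 \<le> fl x" unfolding k0_def using A(1) that by (intro Min_le) auto
      moreover have "fl x \<le> k0 + 1"
        unfolding x0(2)[symmetric] fl_def using floor_le_one_apart[OF close[OF that x0(1)] e] by simp
      ultimately show ?thesis by linarith
    qed
    have part: "sum ?q (Ak k) \<le> sep_bound d" for k
    proof (rule Zk(5)[of _ k])
      show "finite (Ak k)" unfolding Ak_def using A by auto
      show "Ak k \<subseteq> J k" unfolding Ak_def using A inJ by auto
      show "Ak k \<inter> Zk k = {}" unfolding Ak_def using A(3) unfolding Z_def by blast
      show "\<forall>x\<in>Ak k. \<forall>y\<in>Ak k. x < y \<longrightarrow> {x..y} \<inter> Zk k \<noteq> {}"
      proof (intro ballI impI)
        fix x y assume xy: "x \<in> Ak k" "y \<in> Ak k" "x < y"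
        then have xy': "x \<in> A" "y \<in> A" "fl x = k" "fl y = k" "x \<notin> D" "y \<notin> D"
          using A(3) unfolding Ak_def Z_def by blast+
        obtain z where z: "z \<in> {x..y}" "z \<in> Z" using sep[OF xy'(1,2) xy(3)] by blast
        have zk: "real_of_int k * e < z" "z < real_of_int (k + 1) * e"
          using strict[OF xy'(5)] strict[OF xy'(6)] xy' z(1) by auto
        have "z \<notin> D"
        proof
          assume "z \<in> D"
          then obtain i where "z = real_of_int i * e" unfolding D_def by auto
          then have "real_of_int k < real_of_int i" "real_of_int i < real_of_int (k + 1)" using zk e by auto
          then show False unfolding of_int_less_iff by linarith
        qed
        then obtain i where i: "z \<in> Zk i" using z(2) unfolding Z_def by auto
        have "z / e < real_of_int k + 1" "real_of_int k \<le> z / e" using zk e by (auto simp: field_simps)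
        then have "fl z = k" unfolding fl_def by linarith
        then have "i = k" using uniq[OF _ \<open>z \<notin> D\<close>, of i] i Zk(1)[of i] by auto
        then show "{x..y} \<inter> Zk k \<noteq> {}" using i z(1) by blast
      qed
    qed
    have "sum ?q A = sum ?q (Ak k0 \<union> Ak (k0 + 1))"
      using two by (intro sum.cong refl) (auto simp: Ak_def)
    also have "\<dots> = sum ?q (Ak k0) + sum ?q (Ak (k0 + 1))"
      using A(1) by (intro sum.union_disjoint) (auto simp: Ak_def)
    also have "\<dots> \<le> 2 * sep_bound d" using part[of k0] part[of "k0 + 1"] by linarith
    finally show ?thesis .
  qed
  show thesis by (rule that[OF 1 2 3 4])
qed

lemma seg_triangle:
  fixes x y z :: real
  shows "closed_segment y z \<subseteq> closed_segment x y \<union> closed_segment x z"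
  by (auto simp: closed_segment_eq_real_ivl split: if_splits)

text \<open>Being joined by a segment that misses \<open>Z\<close> is an equivalence relation on the
  points outside \<open>Z\<close>; the pieces below are built from its classes.\<close>

lemma seg_avoid_iff:
  fixes x y w :: real
  assumes "closed_segment x y \<inter> Z = {}"
  shows "closed_segment x w \<inter> Z = {} \<longleftrightarrow> closed_segment y w \<inter> Z = {}"
proof -
  have "closed_segment y w \<subseteq> closed_segment x y \<union> closed_segment x w"
    "closed_segment x w \<subseteq> closed_segment x y \<union> closed_segment y w"
    using seg_triangle[of y w x] seg_triangle[of x w y] closed_segment_commute[of x y] by blast+
  then show ?thesis using assms by blast
qed

lemma seg_between:
  fixes a w y y' :: real
  assumes "w \<in> closed_segment y y'"
  shows "closed_segment a w \<subseteq> closed_segment a y \<union> closed_segment a y'"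
  using assms by (auto simp: closed_segment_eq_real_ivl split: if_splits)

section \<open>The iterated partition of an interval map\<close>

text \<open>The diameter, for nonempty bounded sets.\<close>

definition len :: "real set \<Rightarrow> real" where "len S = Sup S - Inf S"

lemma len_ge: "bounded S \<Longrightarrow> a \<in> S \<Longrightarrow> b \<in> S \<Longrightarrow> \<bar>a - b\<bar> \<le> len S"
  unfolding len_def using cSup_upper[of a S] cSup_upper[of b S] cInf_lower[of a S] cInf_lower[of b S]
  by (auto simp: bounded_imp_bdd_above bounded_imp_bdd_below abs_le_iff)

lemma len_le:
  assumes "S \<noteq> {}" "\<And>a b. a \<in> S \<Longrightarrow> b \<in> S \<Longrightarrow> \<bar>a - b\<bar> \<le> c"
  shows "len S \<le> c"
proof -
  have "Sup S \<le> Inf S + c"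
  proof (rule cSup_least[OF assms(1)])
    fix a assume a: "a \<in> S"
    have "a - c \<le> Inf S" using assms(2)[OF a] by (intro cInf_greatest[OF assms(1)]) (force simp: abs_le_iff)
    then show "a \<le> Inf S + c" by simp
  qed
  then show ?thesis unfolding len_def by simp
qed

lemma mult_len_le:
  assumes "S \<noteq> {}" "0 \<le> r" "0 \<le> s" "\<And>a b. a \<in> S \<Longrightarrow> b \<in> S \<Longrightarrow> r * \<bar>a - b\<bar> \<le> s"
  shows "r * len S \<le> s"
proof (cases "r = 0")
  case False
  have "len S \<le> s / r"
    by (rule len_le[OF assms(1)]) (use assms(2,4) False in \<open>auto simp: field_simps\<close>)
  then show ?thesis using assms(2) False by (simp add: field_simps)
qed (use assms in auto)

lemma len_mono: "bounded B \<Longrightarrow> A \<subseteq> B \<Longrightarrow> A \<noteq> {} \<Longrightarrow> len A \<le> len B"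
  by (intro len_le len_ge) auto

text \<open>In each class \<open>f\<close> is replaced by its maximum, attained at one member. What
  remains is the sum of \<open>g\<close> over a class, at most \<open>b\<close>, and the sum of
  \<open>f\<close> over a system of representatives, at most \<open>a\<close>. Along a tree this
  multiplies the bounds for parents and for children.\<close>

lemma sum_group_le:
  fixes f g :: "'a \<Rightarrow> real"
  assumes A: "finite A" and nn: "\<And>x. x \<in> A \<Longrightarrow> 0 \<le> f x" "\<And>x. x \<in> A \<Longrightarrow> 0 \<le> g x" and "0 \<le> b"
    and tr: "\<And>A'. A' \<subseteq> A \<Longrightarrow> inj_on c A' \<Longrightarrow> sum f A' \<le> a"
    and gr: "\<And>x0. x0 \<in> A \<Longrightarrow> (\<Sum>x | x \<in> A \<and> c x = c x0. g x) \<le> b"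
  shows "(\<Sum>x\<in>A. f x * g x) \<le> a * b"
proof -
  have "\<exists>x. x \<in> A \<and> c x = k \<and> (\<forall>y\<in>A. c y = k \<longrightarrow> f y \<le> f x)" if "k \<in> c ` A" for k
  proof -
    define S where "S = {x\<in>A. c x = k}"
    have S: "finite S" "S \<noteq> {}" using A that unfolding S_def by auto
    then have "Max (f ` S) \<in> f ` S" by (intro Max_in) auto
    then obtain x where x: "x \<in> S" "Max (f ` S) = f x" by auto
    have "f y \<le> f x" if "y \<in> S" for y unfolding x(2)[symmetric] using S(1) that by (intro Max_ge) auto
    then show ?thesis using x(1) unfolding S_def by auto
  qed
  then obtain m where m: "\<And>k. k \<in> c ` A \<Longrightarrow> m k \<in> A" "\<And>k. k \<in> c ` A \<Longrightarrow> c (m k) = k"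
    "\<And>y. y \<in> A \<Longrightarrow> f y \<le> f (m (c y))"
    by (metis image_eqI)
  have "(\<Sum>x\<in>A. f x * g x) = (\<Sum>k\<in>c ` A. \<Sum>x | x \<in> A \<and> c x = k. f x * g x)"
    using A by (intro sum.group[symmetric]) auto
  also have "\<dots> \<le> (\<Sum>k\<in>c ` A. f (m k) * b)"
  proof (rule sum_mono)
    fix k assume k: "k \<in> c ` A"
    have "(\<Sum>x | x \<in> A \<and> c x = k. f x * g x) \<le> (\<Sum>x | x \<in> A \<and> c x = k. f (m k) * g x)"
      using m(3) nn by (intro sum_mono mult_right_mono) auto
    also have "\<dots> = f (m k) * (\<Sum>x | x \<in> A \<and> c x = c (m k). g x)"
      using m(2)[OF k] by (simp add: sum_distrib_left)
    also have "\<dots> \<le> f (m k) * b" using gr[OF m(1)[OF k]] nn m(1)[OF k] by (intro mult_left_mono) auto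
    finally show "(\<Sum>x | x \<in> A \<and> c x = k. f x * g x) \<le> f (m k) * b" .
  qed
  also have "\<dots> = sum f (m ` c ` A) * b"
  proof -
    have "inj_on m (c ` A)" using m(2) by (metis inj_on_inverseI)
    then show ?thesis by (simp add: sum.reindex sum_distrib_right)
  qed
  also have "\<dots> \<le> a * b"
  proof (intro mult_right_mono tr)
    show "m ` c ` A \<subseteq> A" using m(1) by auto
    show "inj_on c (m ` c ` A)" using m(2) by (auto simp: inj_on_def)
  qed fact
  finally show ?thesis .
qed

text \<open>\<open>Z\<close> is a set of cut points containing the critical points; a segment avoiding it is one on
  which \<open>F'\<close> is nearly constant, and \<open>q\<close> are transition weights for the resulting pieces.\<close>

locale cut_map =
  fixes T T0 R0 Z :: "real set" and F F' q :: "real \<Rightarrow> real" and e M :: real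
  assumes T: "convex T" and T0: "T0 \<subseteq> T" "convex T0" "bounded T0"
    and FT: "x \<in> T \<Longrightarrow> F x \<in> T"
    and DF: "x \<in> T \<Longrightarrow> (F has_real_derivative F' x) (at x within T)"
    and crit: "x \<in> T \<Longrightarrow> F' x = 0 \<Longrightarrow> x \<in> Z"
    and distort: "u \<le> v \<Longrightarrow> {u..v} \<subseteq> T \<Longrightarrow> {u..v} \<inter> Z = {} \<Longrightarrow> x \<in> {u..v} \<Longrightarrow> y \<in> {u..v} \<Longrightarrow>
      \<bar>ln \<bar>F' x\<bar> - ln \<bar>F' y\<bar>\<bar> * (v - u) \<le> \<bar>x - y\<bar> / 4"
    and small: "u \<le> v \<Longrightarrow> {u..v} \<subseteq> T \<Longrightarrow> {u..v} \<inter> Z = {} \<Longrightarrow> v - u \<le> e"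
    and q0: "0 \<le> q x"
    and qsum: "finite A \<Longrightarrow> A \<subseteq> T \<Longrightarrow> A \<inter> Z = {} \<Longrightarrow>
      (\<And>x y. x \<in> A \<Longrightarrow> y \<in> A \<Longrightarrow> \<bar>x - y\<bar> \<le> e) \<Longrightarrow>
      (\<And>x y. x \<in> A \<Longrightarrow> y \<in> A \<Longrightarrow> x < y \<Longrightarrow> {x..y} \<inter> Z \<noteq> {}) \<Longrightarrow> sum q A \<le> 1 / 2"
    and R0: "finite R0"
    and roots: "x \<in> T0 \<Longrightarrow> y \<in> T0 \<Longrightarrow> closed_segment x y \<inter> R0 = {} \<Longrightarrow> \<bar>x - y\<bar> \<le> 1"
    and M: "1 \<le> M" "x \<in> T \<Longrightarrow> \<bar>F' x\<bar> \<le> M" and e: "0 < e" "M * e \<le> 1"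
begin

text \<open>At each step the image of the piece is cut at \<open>Z\<close>, and what remains around
  \<open>x\<close> is halved at its midpoint. Pieces are indexed by a base point: if
  \<open>x\<close> lies in \<open>R0\<close>, or its orbit meets \<open>Z\<close> before time
  \<open>n\<close>, the piece is simply empty, and no quotient has to be formed.\<close>

primrec W :: "nat \<Rightarrow> real \<Rightarrow> real set" where
  "W 0 x = {y\<in>T0. closed_segment x y \<inter> R0 = {}}"
| "W (Suc n) x = (let A = {y\<in>W n x. closed_segment ((F ^^ n) x) ((F ^^ n) y) \<inter> Z = {}};
      c = (Inf A + Sup A) / 2 in {y\<in>A. (y \<le> c) = (x \<le> c)})"

definition A :: "nat \<Rightarrow> real \<Rightarrow> real set" where
  "A n x = {y\<in>W n x. closed_segment ((F ^^ n) x) ((F ^^ n) y) \<inter> Z = {}}"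

definition mid :: "nat \<Rightarrow> real \<Rightarrow> real" where "mid n x = (Inf (A n x) + Sup (A n x)) / 2"

lemma W_Suc: "W (Suc n) x = {y\<in>A n x. (y \<le> mid n x) = (x \<le> mid n x)}"
  by (simp add: A_def mid_def Let_def)

declare W.simps(2) [simp del]

definition D :: "nat \<Rightarrow> real \<Rightarrow> real" where "D n x = (\<Prod>i<n. F' ((F ^^ i) x))"

definition reg :: "nat \<Rightarrow> real set" where "reg n = {x\<in>T0. x \<notin> R0 \<and> (\<forall>i<n. (F ^^ i) x \<notin> Z)}"

lemma W_T0: "W n x \<subseteq> T0"
  by (induction n) (auto simp: W_Suc A_def)

lemma W_T: "y \<in> W n x \<Longrightarrow> y \<in> T" using W_T0 T0(1) by blast

lemma reg_T: "x \<in> reg n \<Longrightarrow> x \<in> T" unfolding reg_def using T0(1) by blast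

lemma reg_antimono: "m \<le> n \<Longrightarrow> reg n \<subseteq> reg m" unfolding reg_def by auto

lemma iter_T: "x \<in> T \<Longrightarrow> (F ^^ n) x \<in> T" by (induction n) (auto intro: FT)

lemma W_antimono: "m \<le> n \<Longrightarrow> W n x \<subseteq> W m x"
  by (induction n rule: dec_induct) (auto simp: W_Suc A_def)

lemma W_self: "x \<in> reg n \<Longrightarrow> x \<in> W n x"
proof (induction n)
  case 0 then show ?case unfolding reg_def by auto
next
  case (Suc n)
  then have "x \<in> W n x" "(F ^^ n) x \<notin> Z" using reg_antimono[of n "Suc n"] unfolding reg_def by auto
  then show ?case by (auto simp: W_Suc A_def)
qed

lemma W_reg: "y \<in> W n x \<Longrightarrow> y \<in> reg n"
proof (induction n)
  case 0 then show ?case unfolding reg_def by auto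
next
  case (Suc n)
  then have "y \<in> reg n" "(F ^^ n) y \<notin> Z" by (auto simp: W_Suc A_def)
  then show ?case unfolding reg_def by (auto simp: less_Suc_eq)
qed

text \<open>The two claims need each other: halving uses the midpoint of \<open>A n x\<close>, so
  pieces of the next depth agree only once \<open>A n y = A n x\<close> is known, and that rests on
  equal pieces of depth \<open>n\<close>.\<close>

lemma W_eq_A_eq: "y \<in> W n x \<Longrightarrow> W n y = W n x \<and> (y \<in> A n x \<longrightarrow> A n y = A n x)"
proof (induction n)
  case 0
  then have "closed_segment x y \<inter> R0 = {}" by simp
  then have "W 0 y = W 0 x" using seg_avoid_iff[of x y R0] by simp
  moreover have "A 0 y = A 0 x" if "y \<in> A 0 x"
  proof -
    have "closed_segment ((F ^^ 0) x) ((F ^^ 0) y) \<inter> Z = {}" using that unfolding A_def by blast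
    from seg_avoid_iff[OF this] show ?thesis unfolding A_def \<open>W 0 y = W 0 x\<close> by simp
  qed
  ultimately show ?case by blast
next
  case (Suc n)
  then have y: "y \<in> A n x" by (auto simp: W_Suc)
  then have eq: "A n y = A n x" using Suc.IH by (auto simp: A_def)
  then have "mid n y = mid n x" unfolding mid_def by simp
  then have W: "W (Suc n) y = W (Suc n) x" using Suc.prems eq by (auto simp: W_Suc)
  moreover have "A (Suc n) y = A (Suc n) x" if "y \<in> A (Suc n) x"
  proof -
    have "closed_segment ((F ^^ Suc n) x) ((F ^^ Suc n) y) \<inter> Z = {}" using that unfolding A_def by blast
    from seg_avoid_iff[OF this] show ?thesis unfolding A_def W by simp
  qed
  ultimately show ?case by blast
qed

lemma W_eq: "y \<in> W n x \<Longrightarrow> W n y = W n x" using W_eq_A_eq by blast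

lemma A_eq: "y \<in> A n x \<Longrightarrow> A n y = A n x" using W_eq_A_eq[of y n x] by (auto simp: A_def)

lemma iter_deriv:
  assumes "x \<in> T" shows "((F ^^ n) has_real_derivative D n x) (at x within T)"
proof (induction n)
  case 0 then show ?case by (simp add: D_def id_def)
next
  case (Suc n)
  have "(F has_real_derivative F' ((F ^^ n) x)) (at ((F ^^ n) x) within (F ^^ n) ` T)"
    by (rule has_field_derivative_subset[OF DF]) (use iter_T assms in auto)
  from DERIV_image_chain[OF this Suc] show ?case by (simp add: D_def mult.commute o_def)
qed

lemma D_add: "D (m + n) x = D n ((F ^^ m) x) * D m x"
proof (induction n)
  case (Suc n)
  have "(F ^^ (m + n)) x = (F ^^ n) ((F ^^ m) x)" by (metis add.commute comp_apply funpow_add)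
  then show ?case using Suc by (simp add: D_def)
qed (simp add: D_def)

lemma D_nz: "y \<in> W n x \<Longrightarrow> D n y \<noteq> 0"
proof -
  assume "y \<in> W n x"
  then have y: "y \<in> reg n" by (rule W_reg)
  then have "F' ((F ^^ i) y) \<noteq> 0" if "i < n" for i
    using crit[OF iter_T[OF reg_T[OF y]], of i] that unfolding reg_def by blast
  then show ?thesis unfolding D_def by (simp add: prod_zero_iff)
qed

lemma D_le: "x \<in> T \<Longrightarrow> \<bar>D n x\<bar> \<le> M ^ n"
proof (induction n)
  case (Suc n)
  have "\<bar>D n x\<bar> * \<bar>F' ((F ^^ n) x)\<bar> \<le> M ^ n * M"
    using Suc M iter_T by (intro mult_mono) auto
  then show ?case by (simp add: D_def abs_mult mult.commute)
qed (simp add: D_def)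

lemma iter_mvt:
  assumes "x \<in> T" "y \<in> T"
  obtains z where "z \<in> closed_segment x y" "(F ^^ n) y - (F ^^ n) x = D n z * (y - x)"
proof -
  have s: "{min x y..max x y} \<subseteq> T"
    using T assms by (metis closed_segment_eq_real_ivl closed_segment_subset max_def min_def)
  have "((F ^^ n) has_real_derivative D n z) (at z within {min x y..max x y})"
    if "z \<in> {min x y..max x y}" for z
    using has_field_derivative_subset[OF iter_deriv s] s that by blast
  then show thesis using mvt_within[of "min x y" "max x y" "F ^^ n" "D n" x y] that by (metis atLeastAtMost_iff max.cobounded1 max.cobounded2 min.cobounded1 min.cobounded2)
qed

lemma iter_lipschitz:
  assumes "x \<in> T" "y \<in> T"
  shows "\<bar>(F ^^ n) x - (F ^^ n) y\<bar> \<le> M ^ n * \<bar>x - y\<bar>"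
proof -
  obtain z where z: "z \<in> closed_segment y x" "(F ^^ n) x - (F ^^ n) y = D n z * (x - y)"
    using iter_mvt assms by metis
  then have "z \<in> T" using T assms closed_segment_subset by blast
  then show ?thesis using z D_le[of z n] by (simp add: abs_mult mult_right_mono)
qed

lemma A_T: "y \<in> A n x \<Longrightarrow> y \<in> T" unfolding A_def using W_T by auto

text \<open>The derivative of the iterate has no zero on the piece, so by the mean value theorem
  distinct points of a convex piece have distinct images.\<close>

lemma iter_inj:
  assumes "convex (W n x)" shows "inj_on (F ^^ n) (W n x)"
proof (rule inj_onI)
  fix y z assume yz: "y \<in> W n x" "z \<in> W n x" "(F ^^ n) y = (F ^^ n) z"
  obtain w where w: "w \<in> closed_segment y z" "(F ^^ n) z - (F ^^ n) y = D n w * (z - y)"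
    using iter_mvt W_T yz by metis
  then have "w \<in> W n x" using closed_segment_subset[OF yz(1,2) assms] by auto
  then show "y = z" using w yz D_nz by auto
qed

lemma iter_between:
  assumes "convex (W n x)" "y \<in> W n x" "z \<in> W n x" "w \<in> closed_segment y z"
  shows "(F ^^ n) w \<in> closed_segment ((F ^^ n) y) ((F ^^ n) z)"
proof -
  have *: "(F ^^ n) w \<in> closed_segment ((F ^^ n) y) ((F ^^ n) z)"
    if "y \<in> W n x" "z \<in> W n x" "y < w" "w < z" for y z
  proof -
    have s: "{y..z} \<subseteq> W n x" using closed_segment_subset[OF that(1,2) assms(1)] that(3,4)
      by (simp add: closed_segment_eq_real_ivl)
    have "continuous_on {y..z} (F ^^ n)"
      using s W_T iter_deriv by (meson DERIV_continuous continuous_on_eq_continuous_within continuous_within_subset subset_iff)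
    moreover have "inj_on (F ^^ n) {y..z}" using iter_inj[OF assms(1)] s inj_on_subset by blast
    ultimately have "(F ^^ n) y < (F ^^ n) w \<and> (F ^^ n) w < (F ^^ n) z \<or>
        (F ^^ n) z < (F ^^ n) w \<and> (F ^^ n) w < (F ^^ n) y"
      by (rule continuous_inj_imp_mono[OF that(3,4)])
    then show ?thesis by (elim disjE) (auto simp: closed_segment_eq_real_ivl)
  qed
  consider "w = y" | "w = z" | "y < w \<and> w < z" | "z < w \<and> w < y"
    using assms(4) unfolding closed_segment_eq_real_ivl by (fastforce split: if_splits)
  then show ?thesis
  proof cases
    case 4 then show ?thesis using *[OF assms(3,2)] by (simp add: closed_segment_commute)
  qed (use *[OF assms(2,3)] in auto)
qed

lemma convex_real_iff: "convex (S :: real set) \<longleftrightarrow> (\<forall>y\<in>S. \<forall>z\<in>S. closed_segment y z \<subseteq> S)"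
  by (metis closed_segment_subset convex_contains_segment)

text \<open>The iterate is monotone on a convex piece, so cutting its image at \<open>Z\<close>
  leaves an interval upstairs as well. Convexity at depth \<open>n\<close> is thus what carries the
  induction.\<close>

lemma convex_W_A: "convex (W n x) \<and> convex (A n x)"
proof (induction n)
  case 0
  have c: "convex (W 0 x)"
    unfolding convex_real_iff
  proof (intro ballI subsetI)
    fix y z w assume yz: "y \<in> W 0 x" "z \<in> W 0 x" "w \<in> closed_segment y z"
    have "w \<in> T0" using yz T0(2) closed_segment_subset[of y T0 z] by auto
    moreover have "closed_segment x w \<inter> R0 = {}" using seg_between[OF yz(3), of x] yz(1,2) by auto
    ultimately show "w \<in> W 0 x" by simp
  qed
  moreover have "convex (A 0 x)"
    unfolding convex_real_iff
  proof (intro ballI subsetI)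
    fix y z w assume yz: "y \<in> A 0 x" "z \<in> A 0 x" "w \<in> closed_segment y z"
    have "w \<in> W 0 x" using c yz unfolding convex_real_iff A_def by auto
    moreover have "closed_segment x w \<inter> Z = {}" using seg_between[OF yz(3), of x] yz(1,2) unfolding A_def by simp blast
    ultimately show "w \<in> A 0 x" unfolding A_def by auto
  qed
  ultimately show ?case by blast
next
  case (Suc n)
  have c: "convex (W (Suc n) x)"
    unfolding convex_real_iff
  proof (intro ballI subsetI)
    fix y z w assume yz: "y \<in> W (Suc n) x" "z \<in> W (Suc n) x" "w \<in> closed_segment y z"
    have "y \<in> A n x" "z \<in> A n x" using yz unfolding W_Suc by auto
    then have "w \<in> A n x" using closed_segment_subset[of y "A n x" z] Suc yz(3) by blast
    moreover have "(w \<le> mid n x) = (x \<le> mid n x)" using yz unfolding W_Suc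
      by (auto simp: closed_segment_eq_real_ivl split: if_splits)
    ultimately show "w \<in> W (Suc n) x" unfolding W_Suc by auto
  qed
  moreover have "convex (A (Suc n) x)"
    unfolding convex_real_iff
  proof (intro ballI subsetI)
    fix y z w assume yz: "y \<in> A (Suc n) x" "z \<in> A (Suc n) x" "w \<in> closed_segment y z"
    have "w \<in> W (Suc n) x" using c yz unfolding convex_real_iff A_def by auto
    moreover have "closed_segment ((F ^^ Suc n) x) ((F ^^ Suc n) w) \<inter> Z = {}"
      using seg_between[OF iter_between[OF c _ _ yz(3)], of "(F ^^ Suc n) x"] yz unfolding A_def by blast
    ultimately show "w \<in> A (Suc n) x" unfolding A_def by auto
  qed
  ultimately show ?case by blast
qed

lemma convex_W: "convex (W n x)" and convex_A: "convex (A n x)" using convex_W_A by auto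

lemma bounded_W: "bounded (W n x)" using W_T0 T0(3) bounded_subset by blast

lemma bounded_A: "bounded (A n x)" by (rule bounded_subset[OF bounded_W[of n x]]) (auto simp: A_def)

lemma W_Suc_sub: "W (Suc n) x \<subseteq> A n x" "A n x \<subseteq> W n x" by (auto simp: W_Suc A_def)

lemma len_W_Suc:
  assumes "y \<in> W (Suc n) x" shows "len (W (Suc n) x) \<le> len (A n x) / 2"
proof (rule len_le)
  show "W (Suc n) x \<noteq> {}" using assms by auto
  have bd: "bdd_above (A n x)" "bdd_below (A n x)"
    using bounded_A bounded_imp_bdd_above bounded_imp_bdd_below by auto
  fix a b assume ab: "a \<in> W (Suc n) x" "b \<in> W (Suc n) x"
  then have a: "a \<in> A n x" "b \<in> A n x" "(a \<le> mid n x) = (b \<le> mid n x)" by (auto simp: W_Suc)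
  note l = cSup_upper[OF a(1) bd(1)] cSup_upper[OF a(2) bd(1)] cInf_lower[OF a(1) bd(2)] cInf_lower[OF a(2) bd(2)]
  have m: "2 * mid n x = Inf (A n x) + Sup (A n x)" unfolding mid_def by simp
  show "\<bar>a - b\<bar> \<le> len (A n x) / 2"
  proof (cases "a \<le> mid n x")
    case True
    then have "b \<le> mid n x" using a(3) by simp
    then show ?thesis using True l m unfolding len_def abs_le_iff by (auto simp: field_simps)
  next
    case False
    then have "\<not> b \<le> mid n x" using a(3) by simp
    then show ?thesis using False l m unfolding len_def abs_le_iff by (auto simp: field_simps)
  qed
qed

lemma seg_image_T: "y \<in> W n x \<Longrightarrow> z \<in> W n x \<Longrightarrow> closed_segment ((F ^^ n) y) ((F ^^ n) z) \<subseteq> T"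
  using T iter_T W_T closed_segment_subset by metis

text \<open>After cutting, the image is at most \<open>e\<close> long, and one more step stretches
  it by at most \<open>M\<close>, with \<open>M * e \<le> 1\<close>. The length 1 is the scale on
  which orbits in a common Bowen ball are compared later.\<close>

lemma image_bound: "y \<in> W n x \<Longrightarrow> z \<in> W n x \<Longrightarrow> \<bar>(F ^^ n) y - (F ^^ n) z\<bar> \<le> 1"
proof (cases n)
  case 0
  assume "y \<in> W n x" "z \<in> W n x"
  then have "y \<in> T0" "z \<in> T0" "closed_segment y z \<inter> R0 = {}"
    using 0 seg_avoid_iff[of x y R0 z] by auto
  then show ?thesis using roots 0 by simp
next
  case (Suc k)
  assume "y \<in> W n x" "z \<in> W n x"
  then have A: "y \<in> A k x" "z \<in> A k x" using Suc W_Suc_sub(1) by blast+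
  then have yz: "y \<in> W k x" "z \<in> W k x" using W_Suc_sub(2) by blast+
  have av: "closed_segment ((F ^^ k) y) ((F ^^ k) z) \<inter> Z = {}"
    using A seg_avoid_iff[of "(F ^^ k) x" "(F ^^ k) y" Z "(F ^^ k) z"] unfolding A_def by auto
  have "\<bar>(F ^^ k) y - (F ^^ k) z\<bar> \<le> e"
    using small[of "min ((F ^^ k) y) ((F ^^ k) z)" "max ((F ^^ k) y) ((F ^^ k) z)"] av seg_image_T[OF yz]
    by (auto simp: closed_segment_eq_real_ivl split: if_splits)
  moreover have "\<bar>F ((F ^^ k) y) - F ((F ^^ k) z)\<bar> \<le> M * \<bar>(F ^^ k) y - (F ^^ k) z\<bar>"
    using iter_lipschitz[of "(F ^^ k) y" "(F ^^ k) z" 1] iter_T yz W_T by simp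
  ultimately have "\<bar>F ((F ^^ k) y) - F ((F ^^ k) z)\<bar> \<le> M * e"
    using M(1) by (meson mult_left_mono order_trans zero_le_one)
  then show ?thesis using Suc e(2) by simp
qed

lemma hull4:
  fixes a b c d p :: real
  assumes "\<And>w. w \<in> {a, b, c, d} \<Longrightarrow> closed_segment p w \<inter> Z = {}" "\<And>w. w \<in> {a, b, c, d} \<Longrightarrow> closed_segment p w \<subseteq> T"
  obtains u v where "u \<le> v" "{u..v} \<inter> Z = {}" "{u..v} \<subseteq> T" "{a, b, c, d} \<subseteq> {u..v}"
proof -
  define u where "u = Min {a, b, c, d}"
  define v where "v = Max {a, b, c, d}"
  have uv: "u \<in> {a, b, c, d}" "v \<in> {a, b, c, d}" unfolding u_def v_def
    by (intro Min_in Max_in; simp)+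
  have sub: "{a, b, c, d} \<subseteq> {u..v}" unfolding u_def v_def by auto
  have "{u..v} \<subseteq> closed_segment p u \<union> closed_segment p v"
    by (auto simp: closed_segment_eq_real_ivl)
  then have "{u..v} \<inter> Z = {}" "{u..v} \<subseteq> T"
    using assms(1)[OF uv(1)] assms(1)[OF uv(2)] assms(2)[OF uv(1)] assms(2)[OF uv(2)] by blast+
  moreover have "u \<le> v" using sub by auto
  ultimately show thesis using sub that by blast
qed

text \<open>Distortion relative to the length of the piece has constant 1 at every depth. One step
  adds the distortion of \<open>F\<close>, which after pulling back to the piece is again at most
  \<open>\<bar>y - z\<bar> / len (A n x)\<close>; the doubled constant is absorbed by halving the
  piece.\<close>

lemma distortion:
  assumes "y \<in> W n x" "z \<in> W n x"
  shows "\<bar>ln \<bar>D n y\<bar> - ln \<bar>D n z\<bar>\<bar> * len (W n x) \<le> \<bar>y - z\<bar>"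
  using assms
proof (induction n arbitrary: y z)
  case 0 then show ?case by (simp add: D_def)
next
  case (Suc n)
  have sub: "A n x \<subseteq> W n x" by (rule W_Suc_sub)
  have yz: "y \<in> A n x" "z \<in> A n x" using Suc.prems W_Suc_sub(1) by blast+
  have ne: "A n x \<noteq> {}" using yz by auto
  have ratio: "\<bar>D n s\<bar> \<le> exp 1 * \<bar>D n t\<bar>" if st: "s \<in> W n x" "t \<in> W n x" for s t
  proof (cases "s = t")
    case True
    have "1 * \<bar>D n t\<bar> \<le> exp 1 * \<bar>D n t\<bar>" by (intro mult_right_mono) auto
    then show ?thesis using True by simp
  next
    case False
    have l: "0 < \<bar>s - t\<bar>" "\<bar>s - t\<bar> \<le> len (W n x)" using False len_ge[OF bounded_W st] by auto
    have "\<bar>ln \<bar>D n s\<bar> - ln \<bar>D n t\<bar>\<bar> * \<bar>s - t\<bar> \<le> \<bar>ln \<bar>D n s\<bar> - ln \<bar>D n t\<bar>\<bar> * len (W n x)"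
      using l by (intro mult_left_mono) auto
    also have "\<dots> \<le> 1 * \<bar>s - t\<bar>" using Suc.IH[OF st] by simp
    finally have "ln \<bar>D n s\<bar> \<le> 1 + ln \<bar>D n t\<bar>" using l by (simp add: abs_le_iff)
    then have "exp (ln \<bar>D n s\<bar>) \<le> exp (1 + ln \<bar>D n t\<bar>)" by simp
    then show ?thesis using D_nz[OF st(1)] D_nz[OF st(2)] by (simp add: exp_add)
  qed
  define G where "G w = ln \<bar>F' ((F ^^ n) w)\<bar>" for w
  have G: "\<bar>G y - G z\<bar> * \<bar>a - b\<bar> \<le> \<bar>y - z\<bar>" if ab: "a \<in> A n x" "b \<in> A n x" for a b
  proof -
    have cs: "closed_segment ((F ^^ n) y) w \<inter> Z = {}" "closed_segment ((F ^^ n) y) w \<subseteq> T"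
      if "w \<in> {(F ^^ n) y, (F ^^ n) z, (F ^^ n) a, (F ^^ n) b}" for w
    proof -
      have "\<exists>w'\<in>A n x. w = (F ^^ n) w'" using that yz ab by auto
      then obtain w' where w': "w' \<in> A n y" "w = (F ^^ n) w'" using A_eq[OF yz(1)] by auto
      then show "closed_segment ((F ^^ n) y) w \<subseteq> T"
        using A_eq[OF yz(1)] yz(1) sub seg_image_T[of y n x w'] by auto
      show "closed_segment ((F ^^ n) y) w \<inter> Z = {}" using w' unfolding A_def by auto
    qed
    obtain u v where uv: "u \<le> v" "{u..v} \<inter> Z = {}" "{u..v} \<subseteq> T"
      "{(F ^^ n) y, (F ^^ n) z, (F ^^ n) a, (F ^^ n) b} \<subseteq> {u..v}"
      by (rule hull4[OF cs]) auto
    obtain s where s: "s \<in> closed_segment y z" "(F ^^ n) z - (F ^^ n) y = D n s * (z - y)"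
      using iter_mvt[OF A_T A_T, OF yz] by metis
    obtain t where t: "t \<in> closed_segment a b" "(F ^^ n) b - (F ^^ n) a = D n t * (b - a)"
      using iter_mvt[OF A_T A_T, OF ab] by metis
    have sW: "s \<in> W n x" "t \<in> W n x"
      using s(1) t(1) yz ab sub convex_W[of n x] closed_segment_subset by blast+
    have "\<bar>G y - G z\<bar> * \<bar>(F ^^ n) b - (F ^^ n) a\<bar> \<le> \<bar>G y - G z\<bar> * (v - u)"
      using uv(4) by (intro mult_left_mono) (auto simp: abs_le_iff)
    also have "\<dots> \<le> \<bar>(F ^^ n) y - (F ^^ n) z\<bar> / 4"
      unfolding G_def using distort[OF uv(1,3,2)] uv(4) by auto
    also have "\<dots> = \<bar>(F ^^ n) z - (F ^^ n) y\<bar> / 4" by (simp add: abs_minus_commute)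
    also have "\<dots> = \<bar>D n s\<bar> * \<bar>y - z\<bar> / 4" unfolding s(2) by (simp add: abs_mult abs_minus_commute)
    also have "\<dots> \<le> exp 1 * \<bar>D n t\<bar> * \<bar>y - z\<bar> / 4"
      using ratio[OF sW] by (intro divide_right_mono mult_right_mono) auto
    \<comment> \<open>The pull-back loses a factor \<open>exp 1 \<le> 3\<close>, which the quarter
      in \<open>distort\<close> absorbs.\<close>
    also have "\<dots> \<le> 4 * \<bar>D n t\<bar> * \<bar>y - z\<bar> / 4"
      using exp_le by (intro divide_right_mono mult_right_mono) auto
    finally have "\<bar>D n t\<bar> * (\<bar>G y - G z\<bar> * \<bar>a - b\<bar>) \<le> \<bar>D n t\<bar> * \<bar>y - z\<bar>"
      unfolding t(2) by (simp add: abs_mult abs_minus_commute mult.commute mult.left_commute)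
    then show ?thesis using D_nz[OF sW(2)] by simp
  qed
  have 1: "\<bar>G y - G z\<bar> * len (A n x) \<le> \<bar>y - z\<bar>"
    by (rule mult_len_le[OF ne _ _ G]) auto
  have "\<bar>ln \<bar>D n y\<bar> - ln \<bar>D n z\<bar>\<bar> * len (A n x) \<le> \<bar>ln \<bar>D n y\<bar> - ln \<bar>D n z\<bar>\<bar> * len (W n x)"
    using len_mono[OF bounded_W sub ne] by (intro mult_left_mono) auto
  also have "\<dots> \<le> \<bar>y - z\<bar>" using Suc.IH yz sub by auto
  finally have 2: "\<bar>ln \<bar>D n y\<bar> - ln \<bar>D n z\<bar>\<bar> * len (A n x) \<le> \<bar>y - z\<bar>" .
  have split: "ln \<bar>D (Suc n) w\<bar> = G w + ln \<bar>D n w\<bar>" if "w \<in> W (Suc n) x" for w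
  proof -
    have "D (Suc n) w \<noteq> 0" by (rule D_nz[OF that])
    moreover have DS: "D (Suc n) w = D n w * F' ((F ^^ n) w)" by (simp add: D_def)
    ultimately have "D n w \<noteq> 0" "F' ((F ^^ n) w) \<noteq> 0" by auto
    then show ?thesis unfolding DS G_def by (simp add: abs_mult ln_mult)
  qed
  define \<Delta> where "\<Delta> = \<bar>ln \<bar>D (Suc n) y\<bar> - ln \<bar>D (Suc n) z\<bar>\<bar>"
  have "\<Delta> \<le> \<bar>G y - G z\<bar> + \<bar>ln \<bar>D n y\<bar> - ln \<bar>D n z\<bar>\<bar>"
    unfolding \<Delta>_def split[OF Suc.prems(1)] split[OF Suc.prems(2)] by linarith
  moreover have l0: "0 \<le> len (A n x)" using len_ge[OF bounded_A yz(1) yz(1)] by simp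
  ultimately have "\<Delta> * len (A n x) \<le> (\<bar>G y - G z\<bar> + \<bar>ln \<bar>D n y\<bar> - ln \<bar>D n z\<bar>\<bar>) * len (A n x)"
    by (intro mult_right_mono)
  also have "\<dots> \<le> 2 * \<bar>y - z\<bar>" using 1 2 by (simp add: distrib_right)
  finally have "\<Delta> * (len (A n x) / 2) \<le> \<bar>y - z\<bar>" by simp
  moreover have "\<Delta> * len (W (Suc n) x) \<le> \<Delta> * (len (A n x) / 2)"
    unfolding \<Delta>_def using len_W_Suc[OF Suc.prems(1)] by (intro mult_left_mono) auto
  ultimately show ?case unfolding \<Delta>_def by linarith
qed

lemma D_ratio:
  assumes st: "s \<in> W n x" "t \<in> W n x" shows "\<bar>D n s\<bar> \<le> exp 1 * \<bar>D n t\<bar>"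
proof (cases "s = t")
  case True
  have "1 * \<bar>D n t\<bar> \<le> exp 1 * \<bar>D n t\<bar>" by (intro mult_right_mono) auto
  then show ?thesis using True by simp
next
  case False
  have l: "0 < \<bar>s - t\<bar>" "\<bar>s - t\<bar> \<le> len (W n x)" using False len_ge[OF bounded_W st] by auto
  have "\<bar>ln \<bar>D n s\<bar> - ln \<bar>D n t\<bar>\<bar> * \<bar>s - t\<bar> \<le> \<bar>ln \<bar>D n s\<bar> - ln \<bar>D n t\<bar>\<bar> * len (W n x)"
    using l by (intro mult_left_mono) auto
  also have "\<dots> \<le> 1 * \<bar>s - t\<bar>" using distortion[OF st] by simp
  finally have "ln \<bar>D n s\<bar> \<le> 1 + ln \<bar>D n t\<bar>" using l by (simp add: abs_le_iff)
  then have "exp (ln \<bar>D n s\<bar>) \<le> exp (1 + ln \<bar>D n t\<bar>)" by simp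
  then show ?thesis using D_nz[OF st(1)] D_nz[OF st(2)] by (simp add: exp_add)
qed

lemma len_W_halving:
  assumes "x \<in> reg (i + j)" shows "len (W (i + j) x) * 2 ^ j \<le> len (W i x)"
  using assms
proof (induction j)
  case (Suc j)
  have x: "x \<in> reg (i + j)" using Suc.prems reg_antimono[of "i + j" "i + Suc j"] by auto
  have "len (W (Suc (i + j)) x) \<le> len (A (i + j) x) / 2"
    using len_W_Suc[OF W_self] Suc.prems by simp
  also have "\<dots> \<le> len (W (i + j) x) / 2"
  proof -
    have "A (i + j) x \<noteq> {}" using W_self[OF Suc.prems] W_Suc_sub(1)[of "i + j" x] by auto
    then show ?thesis using W_Suc_sub(2) by (intro divide_right_mono len_mono bounded_W) auto
  qed
  finally have "len (W (i + Suc j) x) * 2 ^ Suc j \<le> len (W (i + j) x) * 2 ^ j" by simp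
  then show ?case using Suc.IH[OF x] by linarith
qed simp

lemma D_len_le:
  assumes x: "x \<in> reg n" shows "\<bar>D n x\<bar> * len (W n x) \<le> exp 1"
proof (rule mult_len_le)
  show "W n x \<noteq> {}" using W_self[OF x] by auto
  fix a b assume ab: "a \<in> W n x" "b \<in> W n x"
  obtain t where t: "t \<in> closed_segment a b" "(F ^^ n) b - (F ^^ n) a = D n t * (b - a)"
    using iter_mvt[OF W_T W_T, OF ab] by metis
  have tW: "t \<in> W n x" using t(1) ab convex_W[of n x] closed_segment_subset by blast
  have "\<bar>D n x\<bar> * \<bar>a - b\<bar> \<le> exp 1 * \<bar>D n t\<bar> * \<bar>a - b\<bar>"
    using D_ratio[OF W_self[OF x] tW] by (intro mult_right_mono) auto
  also have "\<dots> = exp 1 * \<bar>(F ^^ n) b - (F ^^ n) a\<bar>" unfolding t(2) by (simp add: abs_mult abs_minus_commute)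
  also have "\<dots> \<le> exp 1 * 1" using image_bound[OF ab(2,1)] by (intro mult_left_mono) auto
  finally show "\<bar>D n x\<bar> * \<bar>a - b\<bar> \<le> exp 1" by simp
qed auto

definition good :: "real \<Rightarrow> nat \<Rightarrow> real \<Rightarrow> bool" where
  "good r n x \<longleftrightarrow> x \<in> reg n \<and> (\<exists>y\<in>W n x. \<exists>z\<in>W n x. r \<le> \<bar>(F ^^ n) y - (F ^^ n) z\<bar>)"

lemma good_D_ge:
  assumes g: "good r n x" shows "r \<le> exp 1 * \<bar>D n x\<bar> * len (W n x)"
proof -
  obtain a b where ab: "a \<in> W n x" "b \<in> W n x" "r \<le> \<bar>(F ^^ n) b - (F ^^ n) a\<bar>" and x: "x \<in> reg n"
    using g unfolding good_def by (metis abs_minus_commute)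
  obtain t where t: "t \<in> closed_segment a b" "(F ^^ n) b - (F ^^ n) a = D n t * (b - a)"
    using iter_mvt[OF W_T W_T, OF ab(1,2)] by metis
  have tW: "t \<in> W n x" using t(1) ab convex_W[of n x] closed_segment_subset by blast
  have "r \<le> \<bar>D n t\<bar> * \<bar>b - a\<bar>" using ab(3) unfolding t(2) by (simp add: abs_mult)
  also have "\<dots> \<le> exp 1 * \<bar>D n x\<bar> * len (W n x)"
    using D_ratio[OF tW W_self[OF x]] len_ge[OF bounded_W ab(2,1)] by (intro mult_mono) auto
  finally show ?thesis .
qed

text \<open>Halving makes the pieces shrink by \<open>2\<close> in each step, while a good piece and its
  predecessors have images of size between \<open>r\<close> and \<open>1\<close>: backward contraction.\<close>

lemma good_expansion:
  assumes g: "good r (i + j) x" and r: "0 < r"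
  shows "exp (- 2) * r * 2 ^ j \<le> \<bar>D j ((F ^^ i) x)\<bar>"
proof -
  have x: "x \<in> reg (i + j)" "x \<in> reg i" using g reg_antimono[of i "i + j"] unfolding good_def by auto
  define l L where "l = len (W (i + j) x)" and "L = len (W i x)"
  have 1: "r \<le> exp 1 * \<bar>D (i + j) x\<bar> * l" using good_D_ge[OF g] unfolding l_def .
  have 2: "l * 2 ^ j \<le> L" unfolding l_def L_def by (rule len_W_halving[OF x(1)])
  have 3: "\<bar>D i x\<bar> * L \<le> exp 1" unfolding L_def by (rule D_len_le[OF x(2)])
  have l0: "0 \<le> l" unfolding l_def using len_ge[OF bounded_W W_self[OF x(1)] W_self[OF x(1)]] by simp
  have "r * 2 ^ j \<le> exp 1 * \<bar>D (i + j) x\<bar> * l * 2 ^ j" using 1 by (intro mult_right_mono) auto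
  also have "\<dots> = exp 1 * \<bar>D j ((F ^^ i) x)\<bar> * (\<bar>D i x\<bar> * (l * 2 ^ j))"
    unfolding D_add by (simp add: abs_mult)
  also have "\<dots> \<le> exp 1 * \<bar>D j ((F ^^ i) x)\<bar> * exp 1"
  proof (intro mult_left_mono)
    have "\<bar>D i x\<bar> * (l * 2 ^ j) \<le> \<bar>D i x\<bar> * L" using 2 by (intro mult_left_mono) auto
    then show "\<bar>D i x\<bar> * (l * 2 ^ j) \<le> exp 1" using 3 by linarith
  qed auto
  also have "\<dots> = exp 2 * \<bar>D j ((F ^^ i) x)\<bar>" by (simp add: exp_add[symmetric])
  finally have "exp (-2) * (r * 2 ^ j) \<le> exp (-2) * (exp 2 * \<bar>D j ((F ^^ i) x)\<bar>)"
    by (intro mult_left_mono) auto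
  also have "\<dots> = (exp (-2) * exp 2) * \<bar>D j ((F ^^ i) x)\<bar>" by simp
  also have "\<dots> = \<bar>D j ((F ^^ i) x)\<bar>" by (subst exp_add[symmetric]) simp
  finally show ?thesis by (simp add: mult.assoc)
qed

section \<open>Weights along orbits\<close>

definition Q :: "nat \<Rightarrow> nat \<Rightarrow> real \<Rightarrow> real" where "Q n j x = (\<Prod>i<j. q ((F ^^ (n + i)) x))"

lemma Q_nonneg: "0 \<le> Q n j x" unfolding Q_def by (intro prod_nonneg) (use q0 in auto)

definition distinct_at :: "nat \<Rightarrow> real set \<Rightarrow> bool" where
  "distinct_at n S \<longleftrightarrow> (\<forall>x\<in>S. \<forall>y\<in>S. x \<noteq> y \<longrightarrow> y \<notin> W n x)"

lemma distinct_at_subset: "distinct_at n S \<Longrightarrow> S' \<subseteq> S \<Longrightarrow> distinct_at n S'"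
  unfolding distinct_at_def by blast

lemma distinct_at_inj:
  assumes "S \<subseteq> reg n" "inj_on (W n) S" shows "distinct_at n S"
  using assms W_eq unfolding distinct_at_def inj_on_def by metis

text \<open>The points are split by the side of the midpoint on which they lie. On one side, points
  of different pieces can only have been separated by \<open>Z\<close>, so \<open>qsum\<close>
  applies to their images; its bound 1/2 pays for the two sides.\<close>

lemma step_sum:
  assumes S: "finite S" "S \<subseteq> reg (Suc n)" "distinct_at (Suc n) S"
    and same: "\<And>x y. x \<in> S \<Longrightarrow> y \<in> S \<Longrightarrow> y \<in> W n x"
    and close: "\<And>x y. x \<in> S \<Longrightarrow> y \<in> S \<Longrightarrow> \<bar>(F ^^ n) x - (F ^^ n) y\<bar> \<le> e"
  shows "(\<Sum>x\<in>S. q ((F ^^ n) x)) \<le> 1"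
proof -
  define B where "B b = {x\<in>S. (x \<le> mid n x) = b}" for b
  have half: "(\<Sum>x\<in>B b. q ((F ^^ n) x)) \<le> 1 / 2" for b
  proof -
    have av: "closed_segment ((F ^^ n) x) ((F ^^ n) y) \<inter> Z \<noteq> {}" if "x \<in> B b" "y \<in> B b" "x \<noteq> y" for x y
    proof
      assume em: "closed_segment ((F ^^ n) x) ((F ^^ n) y) \<inter> Z = {}"
      have xy: "x \<in> S" "y \<in> S" using that unfolding B_def by auto
      have y: "y \<in> A n x" unfolding A_def using same[OF xy] em by auto
      then have "mid n y = mid n x" unfolding mid_def by (simp add: A_eq)
      then have "y \<in> W (Suc n) x" using y that unfolding W_Suc B_def by auto
      then show False using S(3) xy that(3) unfolding distinct_at_def by blast
    qed
    have nZ: "(F ^^ n) x \<notin> Z" if "x \<in> S" for x using S(2) that unfolding reg_def by auto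
    have inj: "inj_on (F ^^ n) (B b)"
    proof (rule inj_onI)
      fix x y assume xy: "x \<in> B b" "y \<in> B b" "(F ^^ n) x = (F ^^ n) y"
      have "x \<in> S" using xy unfolding B_def by auto
      from av[OF xy(1,2)] nZ[OF this] show "x = y" unfolding xy(3) by auto
    qed
    have "(\<Sum>x\<in>B b. q ((F ^^ n) x)) = sum q ((F ^^ n) ` B b)" using inj by (simp add: sum.reindex)
    also have "\<dots> \<le> 1 / 2"
    proof (rule qsum)
      show "finite ((F ^^ n) ` B b)" using S(1) unfolding B_def by auto
      show "(F ^^ n) ` B b \<subseteq> T" using S(2) reg_T iter_T unfolding B_def by blast
      show "(F ^^ n) ` B b \<inter> Z = {}" using nZ unfolding B_def by auto
      show "\<bar>u - v\<bar> \<le> e" if "u \<in> (F ^^ n) ` B b" "v \<in> (F ^^ n) ` B b" for u v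
        using that close unfolding B_def by auto
      show "{u..v} \<inter> Z \<noteq> {}" if "u \<in> (F ^^ n) ` B b" "v \<in> (F ^^ n) ` B b" "u < v" for u v
      proof -
        from that(1,2) obtain x y where xy: "x \<in> B b" "y \<in> B b" "u = (F ^^ n) x" "v = (F ^^ n) y" by blast
        then have "x \<noteq> y" using that(3) by auto
        from av[OF xy(1,2) this] show ?thesis using that(3) xy(3,4) by (simp add: closed_segment_eq_real_ivl)
      qed
    qed
    finally show ?thesis .
  qed
  have "(\<Sum>x\<in>S. q ((F ^^ n) x)) = (\<Sum>x\<in>B True \<union> B False. q ((F ^^ n) x))"
    by (rule sum.cong) (auto simp: B_def)
  also have "\<dots> = (\<Sum>x\<in>B True. q ((F ^^ n) x)) + (\<Sum>x\<in>B False. q ((F ^^ n) x))"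
    using S(1) by (intro sum.union_disjoint) (auto simp: B_def)
  finally show ?thesis using half[of True] half[of False] by linarith
qed

text \<open>Induction along the tree of pieces: \<open>step_sum\<close> bounds the sum over the
  children of one piece, the induction hypothesis the sum over the parents.\<close>

lemma multi_step_sum:
  assumes "finite S" "S \<subseteq> reg (n + j)" "distinct_at (n + j) S"
    and "\<And>x y. x \<in> S \<Longrightarrow> y \<in> S \<Longrightarrow> y \<in> W n x"
    and "\<And>x y i. x \<in> S \<Longrightarrow> y \<in> S \<Longrightarrow> i < j \<Longrightarrow> \<bar>(F ^^ (n + i)) x - (F ^^ (n + i)) y\<bar> \<le> e"
  shows "(\<Sum>x\<in>S. Q n j x) \<le> 1"
  using assms
proof (induction j arbitrary: S)
  case 0
  then have "\<And>x y. x \<in> S \<Longrightarrow> y \<in> S \<Longrightarrow> x = y" unfolding distinct_at_def by auto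
  then have "card S \<le> 1" using 0(1) by (simp add: card_le_Suc0_iff_eq)
  then show ?case by (simp add: Q_def)
next
  case (Suc j)
  have r: "S \<subseteq> reg (n + j)" using Suc.prems(2) reg_antimono[of "n + j" "n + Suc j"] by auto
  have "(\<Sum>x\<in>S. Q n j x * q ((F ^^ (n + j)) x)) \<le> 1 * 1"
  proof (rule sum_group_le[where c = "W (n + j)"])
    fix S' assume S': "S' \<subseteq> S" "inj_on (W (n + j)) S'"
    show "sum (Q n j) S' \<le> 1"
    proof (rule Suc.IH)
      show "distinct_at (n + j) S'" by (rule distinct_at_inj) (use S' r in auto)
      show "finite S'" using S' Suc.prems(1) finite_subset by blast
      show "S' \<subseteq> reg (n + j)" using S' r by blast
      show "y \<in> W n x" if "x \<in> S'" "y \<in> S'" for x y using Suc.prems(4) that S'(1) by blast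
      show "\<bar>(F ^^ (n + i)) x - (F ^^ (n + i)) y\<bar> \<le> e" if "x \<in> S'" "y \<in> S'" "i < j" for x y i
        using Suc.prems(5)[of x y i] that S'(1) by auto
    qed
  next
    fix x0 assume x0: "x0 \<in> S"
    show "(\<Sum>x | x \<in> S \<and> W (n + j) x = W (n + j) x0. q ((F ^^ (n + j)) x)) \<le> 1"
    proof (rule step_sum)
      show "distinct_at (Suc (n + j)) {x \<in> S. W (n + j) x = W (n + j) x0}"
        by (rule distinct_at_subset[of _ S]) (use Suc.prems(3) in auto)
      show "y \<in> W (n + j) x"
        if "x \<in> {x \<in> S. W (n + j) x = W (n + j) x0}" "y \<in> {x \<in> S. W (n + j) x = W (n + j) x0}" for x y
        using that W_self[of y "n + j"] r by auto
    qed (use Suc.prems in auto)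
  qed (simp_all add: Suc.prems(1) q0 Q_nonneg)
  then show ?case by (simp add: Q_def)
qed

end

text \<open>\<open>cen\<close> assigns to a point the centre of a Bowen ball of \<open>m\<close> steps containing it.\<close>

locale block_map = cut_map +
  fixes m R :: nat and r :: real and cen :: "real \<Rightarrow> 'c"
  assumes r: "0 < r" "M ^ m * r \<le> e" and R: "finite (cen ` T)" "card (cen ` T) \<le> R"
    and cen: "s \<in> T \<Longrightarrow> t \<in> T \<Longrightarrow> \<bar>s - t\<bar> \<le> 1 \<Longrightarrow> cen s = cen t \<Longrightarrow> i < m \<Longrightarrow> \<bar>(F ^^ i) s - (F ^^ i) t\<bar> \<le> e"
begin

lemma iter_add: "(F ^^ (n + i)) x = (F ^^ i) ((F ^^ n) x)"
  by (metis add.commute comp_apply funpow_add)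

text \<open>\<open>multi_step_sum\<close> asks for \<open>e\<close>-close images during the whole
  block. If \<open>x0\<close> is bad this follows from \<open>M ^ m * r \<le> e\<close>; if it is
  good, it holds within each class of points with a common centre.\<close>

lemma block_sum:
  assumes S: "finite S" "S \<subseteq> reg (n + m)" "distinct_at (n + m) S"
    and same: "\<And>x. x \<in> S \<Longrightarrow> W n x = W n x0" and x0: "x0 \<in> S"
  shows "(\<Sum>x\<in>S. Q n m x) \<le> (if good r n x0 then real R else 1)"
proof -
  have S0: "S \<subseteq> reg n" using S(2) reg_antimono[of n "n + m"] by auto
  have same': "y \<in> W n x" if "x \<in> S" "y \<in> S" for x y
    using same[OF that(1)] same[OF that(2)] W_self[of y n] S0 that by auto
  show ?thesis
  proof (cases "good r n x0")
    case False
    have "(\<Sum>x\<in>S. Q n m x) \<le> 1"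
    proof (rule multi_step_sum[OF S same'])
      fix x y i assume xy: "x \<in> S" "y \<in> S" and i: "i < m"
      have "x \<in> W n x0" "y \<in> W n x0" using same' xy x0 by auto
      moreover have "x0 \<in> reg n" using S0 x0 by auto
      ultimately have "\<bar>(F ^^ n) x - (F ^^ n) y\<bar> < r" using False unfolding good_def by (meson linear not_le)
      moreover have "\<bar>(F ^^ (n + i)) x - (F ^^ (n + i)) y\<bar> \<le> M ^ i * \<bar>(F ^^ n) x - (F ^^ n) y\<bar>"
        unfolding iter_add using S0 xy reg_T iter_T by (intro iter_lipschitz) blast+
      moreover have "M ^ i * \<bar>(F ^^ n) x - (F ^^ n) y\<bar> \<le> M ^ m * r"
        using calculation(1) M(1) i by (intro mult_mono power_increasing) auto
      ultimately show "\<bar>(F ^^ (n + i)) x - (F ^^ (n + i)) y\<bar> \<le> e" using r by linarith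
    qed auto
    then show ?thesis using False by simp
  next
    case True
    define c where "c x = cen ((F ^^ n) x)" for x
    have cT: "c ` S \<subseteq> cen ` T" unfolding c_def using S0 reg_T iter_T by blast
    have "(\<Sum>x\<in>S. Q n m x) = (\<Sum>k\<in>c ` S. \<Sum>x | x \<in> S \<and> c x = k. Q n m x)"
      using S(1) by (intro sum.group[symmetric]) auto
    also have "\<dots> \<le> (\<Sum>k\<in>c ` S. 1)"
    proof (rule sum_mono)
      fix k
      show "(\<Sum>x | x \<in> S \<and> c x = k. Q n m x) \<le> 1"
      proof (rule multi_step_sum)
        show "distinct_at (n + m) {x \<in> S. c x = k}" using S(3) by (rule distinct_at_subset) auto
        fix x y i assume xy: "x \<in> {x \<in> S. c x = k}" "y \<in> {x \<in> S. c x = k}" and i: "i < m"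
        have "\<bar>(F ^^ n) x - (F ^^ n) y\<bar> \<le> 1" using image_bound[of x n x y] same' xy by auto
        then show "\<bar>(F ^^ (n + i)) x - (F ^^ (n + i)) y\<bar> \<le> e"
          unfolding iter_add using xy i S0 reg_T iter_T by (intro cen) (auto simp: c_def)
      qed (use S same' in auto)
    qed
    also have "\<dots> \<le> real R"
      using card_mono[OF R(1) cT] R(2) by simp
    finally show ?thesis using True by simp
  qed
qed

text \<open>Dividing by \<open>R\<close> after good times makes the total weight bounded independently of \<open>n\<close>.\<close>

definition weight :: "nat \<Rightarrow> real \<Rightarrow> real" where
  "weight n x = (\<Prod>l<n. Q (l * m) m x * (if good r (l * m) x then 1 / real R else 1))"

lemma weight_nonneg: "0 \<le> weight n x"
  unfolding weight_def by (intro prod_nonneg mult_nonneg_nonneg) (auto simp: Q_nonneg)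

text \<open>At depth 0 the pieces are the gaps between the points of \<open>R0\<close>, at most
  \<open>card R0 + 1\<close> of them; every further block multiplies the bound by 1.\<close>

lemma weight_sum:
  assumes "finite S" "S \<subseteq> reg (n * m)" "distinct_at (n * m) S"
  shows "(\<Sum>x\<in>S. weight n x) \<le> real (card R0) + 1"
  using assms
proof (induction n arbitrary: S)
  case 0
  have "card S \<le> card R0 + 1"
  proof (rule conjunct2[OF card_separated_le[OF R0]])
    show "S \<inter> R0 = {}" using 0 unfolding reg_def by auto
    fix x y assume xy: "x \<in> S" "y \<in> S" "x < y"
    then have "y \<notin> W 0 x" "y \<in> T0" using 0 unfolding distinct_at_def reg_def by auto
    then show "{x..y} \<inter> R0 \<noteq> {}" using xy by (simp add: closed_segment_eq_real_ivl)
  qed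
  then show ?case by (simp add: weight_def)
next
  case (Suc n)
  have rg: "S \<subseteq> reg (n * m)" using Suc.prems(2) reg_antimono[of "n * m" "Suc n * m"] by auto
  have eq: "Suc n * m = n * m + m" by simp
  note pr = Suc.prems[unfolded eq]
  have "(\<Sum>x\<in>S. weight n x * (Q (n * m) m x * (if good r (n * m) x then 1 / real R else 1))) \<le> (real (card R0) + 1) * 1"
  proof (rule sum_group_le[where c = "W (n * m)"])
    fix S' assume S': "S' \<subseteq> S" "inj_on (W (n * m)) S'"
    show "sum (weight n) S' \<le> real (card R0) + 1"
    proof (rule Suc.IH)
      show "distinct_at (n * m) S'" by (rule distinct_at_inj) (use S' rg in auto)
      show "finite S'" using S' Suc.prems(1) finite_subset by blast
      show "S' \<subseteq> reg (n * m)" using S' rg by blast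
    qed
  next
    fix x0 assume x0: "x0 \<in> S"
    define S' where "S' = {x \<in> S. W (n * m) x = W (n * m) x0}"
    have gd: "good r (n * m) x = good r (n * m) x0" if "x \<in> S'" for x
    proof -
      have "W (n * m) x = W (n * m) x0" "x \<in> reg (n * m)" "x0 \<in> reg (n * m)" using that rg x0 unfolding S'_def by auto
      then show ?thesis unfolding good_def by simp
    qed
    have b: "(\<Sum>x\<in>S'. Q (n * m) m x) \<le> (if good r (n * m) x0 then real R else 1)"
    proof (rule block_sum)
      show "distinct_at (n * m + m) S'"
        using pr(3) by (rule distinct_at_subset) (auto simp: S'_def)
    qed (use pr x0 in \<open>auto simp: S'_def\<close>)
    have "(\<Sum>x\<in>S'. Q (n * m) m x * (if good r (n * m) x then 1 / real R else 1))
        = (\<Sum>x\<in>S'. Q (n * m) m x) * (if good r (n * m) x0 then 1 / real R else 1)"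
      unfolding sum_distrib_right using gd by (intro sum.cong) auto
    also have "\<dots> \<le> 1"
      using b by (auto simp: divide_simps split: if_splits)
    finally show "(\<Sum>x | x \<in> S \<and> W (n * m) x = W (n * m) x0.
        Q (n * m) m x * (if good r (n * m) x then 1 / real R else 1)) \<le> 1" unfolding S'_def .
  qed (simp_all add: Suc.prems(1) Q_nonneg weight_nonneg)
  then show ?case by (simp add: weight_def)
qed

end

text \<open>The limit is also a lower bound for all quotients; thus the entropy of a partition can
  be bounded from above at a single time.\<close>

lemma fekete:
  fixes a :: "nat \<Rightarrow> real"
  assumes sub: "\<And>m n. a (m + n) \<le> a m + a n" and nn: "\<And>n. 0 \<le> a n"
  obtains L where "(\<lambda>n. a n / real n) \<longlonglongrightarrow> L" "\<And>n. 0 < n \<Longrightarrow> L \<le> a n / real n"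
proof -
  define L where "L = Inf ((\<lambda>n. a n / real n) ` {1..})"
  have bdd: "bdd_below ((\<lambda>n. a n / real n) ` {1..})"
    by (rule bdd_belowI[of _ 0]) (use nn in auto)
  have le: "L \<le> a n / real n" if "0 < n" for n
    unfolding L_def by (rule cInf_lower[OF _ bdd]) (use that in auto)
  have mult: "a (k * n + r) \<le> real k * a n + a r" for k n r
  proof (induction k)
    case (Suc k) then show ?case using sub[of n "k * n + r"] by (simp add: algebra_simps)
  qed simp
  have "(\<lambda>n. a n / real n) \<longlonglongrightarrow> L"
  proof (rule LIMSEQ_I)
    fix d :: real assume d: "0 < d"
    have "\<exists>x\<in>(\<lambda>n. a n / real n) ` {1..}. x < L + d / 2"
      by (rule cInf_lessD[of _ "L + d / 2", folded L_def]) (use d in \<open>auto simp: L_def\<close>)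
    then obtain n0 where n0: "1 \<le> n0" "a n0 / real n0 < L + d / 2" by auto
    define B where "B = Max (a ` {..<n0})"
    have B: "a r \<le> B" if "r < n0" for r unfolding B_def using that by (intro Max_ge) auto
    have B0: "0 \<le> B" using B[of 0] nn[of 0] n0 by simp
    obtain N where N: "2 * B / d < real N" using reals_Archimedean2 by auto
    have "norm (a n / real n - L) < d" if n: "Suc N \<le> n" for n
    proof -
      have np: "0 < real n" "2 * B / d < real n" using n N by auto
      define k r where "k = n div n0" and "r = n mod n0"
      have nkr: "n = k * n0 + r" "r < n0" unfolding k_def r_def using n0 by auto
      have "a n \<le> real k * a n0 + B" using mult[of k n0 r] B[OF nkr(2)] nkr(1) by simp
      also have "real k * a n0 = (real k * real n0) * (a n0 / real n0)" using n0 by simp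
      also have "\<dots> \<le> real n * (a n0 / real n0)"
      proof (intro mult_right_mono)
        have "k * n0 \<le> n" using nkr by simp
        then show "real k * real n0 \<le> real n" by (metis of_nat_mono of_nat_mult)
      qed (use nn n0 in auto)
      finally have "a n / real n \<le> (real n * (a n0 / real n0) + B) / real n"
        using np by (intro divide_right_mono) auto
      also have "\<dots> = a n0 / real n0 + B / real n" using np by (simp add: add_divide_distrib)
      also have "B / real n \<le> d / 2" using np d by (simp add: field_simps)
      finally have "a n / real n < L + d" using n0 by linarith
      moreover have "L \<le> a n / real n" using le np by simp
      ultimately show ?thesis by simp
    qed
    then show "\<exists>no. \<forall>n\<ge>no. norm (a n / real n - L) < d" by blast
  qed
  then show thesis using le that by blast
qed

section \<open>Entropy of finite-valued random variables\<close>

definition fiber :: "'a measure \<Rightarrow> ('a \<Rightarrow> 'b) \<Rightarrow> 'b \<Rightarrow> 'a set" where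
  "fiber \<nu> X s = {x\<in>space \<nu>. X x = s}"

text \<open>The Shannon entropy of a finite-valued map. Partitions are handled as level sets of
  maps, so that a join becomes a tuple or a list of values.\<close>

definition ent :: "'a measure \<Rightarrow> ('a \<Rightarrow> 'b) \<Rightarrow> real" where
  "ent \<nu> X = (\<Sum>s\<in>X ` space \<nu>. - measure \<nu> (fiber \<nu> X s) * ln (measure \<nu> (fiber \<nu> X s)))"

definition discrete_rv :: "'a measure \<Rightarrow> ('a \<Rightarrow> 'b) \<Rightarrow> bool" where
  "discrete_rv \<nu> X \<longleftrightarrow> finite (X ` space \<nu>) \<and> (\<forall>s. fiber \<nu> X s \<in> sets \<nu>)"

lemma ent_nonneg: assumes "prob_space \<nu>" shows "0 \<le> ent \<nu> X"
  unfolding ent_def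
proof (rule sum_nonneg)
  fix s
  have "measure \<nu> (fiber \<nu> X s) \<le> 1" using assms by (rule prob_space.prob_le_1)
  then have "ln (measure \<nu> (fiber \<nu> X s)) \<le> 0"
    by (cases "measure \<nu> (fiber \<nu> X s) = 0") (auto simp: ln_le_zero_iff zero_less_measure_iff)
  then show "0 \<le> - measure \<nu> (fiber \<nu> X s) * ln (measure \<nu> (fiber \<nu> X s))"
    by (simp add: mult_nonneg_nonpos)
qed

lemma discrete_rv_fun:
  assumes "discrete_rv \<nu> X" shows "(\<lambda>x. h (X x) :: real) \<in> borel_measurable \<nu>"
proof -
  have "(\<lambda>x. h (X x)) \<in> borel_measurable \<nu> \<longleftrightarrow>
    (\<lambda>x. \<Sum>s\<in>X ` space \<nu>. h s * indicator (fiber \<nu> X s) x) \<in> borel_measurable \<nu>"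
  proof (rule measurable_cong)
    fix x assume x: "x \<in> space \<nu>"
    have "(\<Sum>s\<in>X ` space \<nu>. h s * indicator (fiber \<nu> X s) x) = (\<Sum>s\<in>X ` space \<nu>. if s = X x then h s else 0)"
      using x by (intro sum.cong) (auto simp: fiber_def)
    also have "\<dots> = h (X x)" using assms x by (simp add: discrete_rv_def)
    finally show "h (X x) = (\<Sum>s\<in>X ` space \<nu>. h s * indicator (fiber \<nu> X s) x)" by simp
  qed
  moreover have "(\<lambda>x. \<Sum>s\<in>X ` space \<nu>. h s * indicator (fiber \<nu> X s) x) \<in> borel_measurable \<nu>"
    using assms by (intro borel_measurable_sum borel_measurable_times) (auto simp: discrete_rv_def)
  ultimately show ?thesis by simp
qed

lemma (in finite_measure) discrete_rv_integral:
  assumes X: "discrete_rv M X" and f: "integrable M (f :: 'a \<Rightarrow> real)"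
  shows "(\<Sum>s\<in>X ` space M. \<integral>x. f x * indicator (fiber M X s) x \<partial>M) = (\<integral>x. f x \<partial>M)"
proof -
  have "(\<Sum>s\<in>X ` space M. \<integral>x. f x * indicator (fiber M X s) x \<partial>M) =
      (\<integral>x. (\<Sum>s\<in>X ` space M. f x * indicator (fiber M X s) x) \<partial>M)"
    using X f by (intro Bochner_Integration.integral_sum[symmetric] integrable_real_mult_indicator)
      (auto simp: discrete_rv_def)
  also have "\<dots> = (\<integral>x. f x \<partial>M)"
  proof (rule Bochner_Integration.integral_cong[OF refl])
    fix x assume x: "x \<in> space M"
    have "(\<Sum>s\<in>X ` space M. f x * indicator (fiber M X s) x) = (\<Sum>s\<in>X ` space M. if s = X x then f x else 0)"
      using x by (intro sum.cong) (auto simp: fiber_def)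
    also have "\<dots> = f x" using X x by (simp add: discrete_rv_def)
    finally show "(\<Sum>s\<in>X ` space M. f x * indicator (fiber M X s) x) = f x" .
  qed
  finally show ?thesis .
qed

lemma (in finite_measure) discrete_rv_integrable:
  assumes X: "discrete_rv M X" shows "integrable M (\<lambda>x. h (X x) :: real)"
proof (rule integrable_const_bound[where B = "Max ((\<lambda>s. \<bar>h s\<bar>) ` X ` space M)"])
  show "AE x in M. norm (h (X x)) \<le> Max ((\<lambda>s. \<bar>h s\<bar>) ` X ` space M)"
    using X by (intro AE_I2) (auto simp: discrete_rv_def intro!: Max_ge)
qed (rule discrete_rv_fun[OF X])

lemma (in finite_measure) discrete_rv_integral_fun:
  assumes X: "discrete_rv M X"
  shows "(\<integral>x. h (X x) \<partial>M) = (\<Sum>s\<in>X ` space M. h s * measure M (fiber M X s))"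
proof -
  have "(\<integral>x. h (X x) \<partial>M) = (\<Sum>s\<in>X ` space M. \<integral>x. h (X x) * indicator (fiber M X s) x \<partial>M)"
    using discrete_rv_integral[OF X discrete_rv_integrable[OF X, of h]] by simp
  also have "\<dots> = (\<Sum>s\<in>X ` space M. \<integral>x. h s * indicator (fiber M X s) x \<partial>M)"
    by (intro sum.cong refl Bochner_Integration.integral_cong) (auto simp: fiber_def indicator_def)
  also have "\<dots> = (\<Sum>s\<in>X ` space M. h s * measure M (fiber M X s))"
    using X by (intro sum.cong refl) (auto simp: discrete_rv_def)
  finally show ?thesis .
qed

text \<open>It supplies sample points: in a fiber one where the integrand does not exceed its mean,
  taken inside a set of full measure.\<close>

lemma (in prob_space) exists_below_average:
  assumes F: "F \<in> sets M" "0 < measure M F" and f: "integrable M (f :: 'a \<Rightarrow> real)" and \<Omega>: "AE x in M. x \<in> \<Omega>"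
  obtains x where "x \<in> F" "x \<in> \<Omega>" "measure M F * f x \<le> (\<integral>x. f x * indicator F x \<partial>M)"
proof (rule ccontr)
  assume "\<not> thesis"
  then have c: "\<And>x. x \<in> F \<Longrightarrow> x \<in> \<Omega> \<Longrightarrow> (\<integral>x. f x * indicator F x \<partial>M) < measure M F * f x"
    using that by force
  define a where "a = (\<integral>x. f x * indicator F x \<partial>M) / measure M F"
  have gt: "a < f x" if "x \<in> F" "x \<in> \<Omega>" for x
    using c[OF that] F(2) unfolding a_def by (simp add: pos_divide_less_eq mult.commute)
  define h where "h x = f x * indicator F x - a * indicator F x" for x
  have ii: "integrable M (indicator F :: 'a \<Rightarrow> real)" using F(1) by (simp add: emeasure_eq_measure)
  have ih: "integrable M h" unfolding h_def
    using F(1) f by (intro Bochner_Integration.integrable_diff integrable_real_mult_indicator) auto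
  have "(\<integral>x. h x \<partial>M) = (\<integral>x. f x * indicator F x \<partial>M) - a * measure M F"
    unfolding h_def using F(1) f ii
    by (subst Bochner_Integration.integral_diff) (auto intro: integrable_real_mult_indicator)
  also have "\<dots> = 0" unfolding a_def using F(2) by simp
  finally have h0: "(\<integral>x. h x \<partial>M) = 0" .
  have "AE x in M. 0 \<le> h x" using \<Omega>
    by eventually_elim (auto simp: h_def indicator_def intro: less_imp_le gt)
  then have "AE x in M. h x = 0" using integral_nonneg_eq_0_iff_AE[OF ih] h0 by simp
  then have "AE x in M. x \<notin> F" using \<Omega>
    by eventually_elim (use gt in \<open>auto simp: h_def indicator_def\<close>)
  then have "measure M F = 0" using F(1) by (simp add: prob_eq_0)
  then show False using F(2) by simp
qed

text \<open>The weights live on points instead of on values. From each fiber of positive measure a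
  point is sampled where \<open>l\<close> is at most its average, and only the weights of the
  sampled points have to be summed. The integral is that of the majorant \<open>l\<close> of
  \<open>- ln u\<close>.\<close>

lemma (in prob_space) gibbs:
  assumes X: "discrete_rv M X" and \<Omega>: "AE x in M. x \<in> \<Omega>" and u: "\<And>x. x \<in> \<Omega> \<Longrightarrow> 0 < u x"
    and int: "integrable M l" and l: "\<And>x. x \<in> \<Omega> \<Longrightarrow> - ln (u x) \<le> l x" and K: "0 < K"
    and sum: "\<And>S. finite S \<Longrightarrow> S \<subseteq> \<Omega> \<inter> space M \<Longrightarrow> inj_on X S \<Longrightarrow> (\<Sum>x\<in>S. u x) \<le> K"
  shows "ent M X \<le> (\<integral>x. l x \<partial>M) + ln K"
proof -
  define p where "p s = measure M (fiber M X s)" for s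
  define I where "I s = (\<integral>x. l x * indicator (fiber M X s) x \<partial>M)" for s
  define S where "S = {s\<in>X ` space M. 0 < p s}"
  have fX: "finite (X ` space M)" using X by (simp add: discrete_rv_def)
  have meas: "fiber M X s \<in> sets M" for s using X by (simp add: discrete_rv_def)
  have "\<exists>x. x \<in> fiber M X s \<and> x \<in> \<Omega> \<and> p s * l x \<le> I s" if s: "s \<in> S" for s
    using exists_below_average[OF meas _ int \<Omega>, of s] s unfolding S_def p_def I_def by blast
  then obtain c where c: "\<And>s. s \<in> S \<Longrightarrow> c s \<in> fiber M X s" "\<And>s. s \<in> S \<Longrightarrow> c s \<in> \<Omega>"
    "\<And>s. s \<in> S \<Longrightarrow> p s * l (c s) \<le> I s" by metis
  have fS: "finite S" unfolding S_def using fX by simp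
  have cX: "X (c s) = s" "c s \<in> space M" if "s \<in> S" for s using c(1)[OF that] unfolding fiber_def by auto
  have inj: "inj_on c S" using cX by (metis inj_onI)
  have usum: "(\<Sum>s\<in>S. u (c s)) \<le> K"
  proof -
    have "(\<Sum>s\<in>S. u (c s)) = (\<Sum>x\<in>c ` S. u x)" using inj by (simp add: sum.reindex)
    also have "\<dots> \<le> K"
      by (rule sum) (use fS c(2) cX in \<open>auto simp: inj_on_def\<close>)
    finally show ?thesis .
  qed
  have p0: "p s = 0" if "s \<in> X ` space M - S" for s
    using that unfolding S_def p_def by (auto simp: zero_less_measure_iff)
  have I0: "I s = 0" if "s \<in> X ` space M - S" for s
  proof -
    have "emeasure M (fiber M X s) = 0" using p0[OF that] unfolding p_def by (simp add: emeasure_eq_measure)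
    then have "AE x in M. x \<notin> fiber M X s" using meas by (intro AE_not_in) auto
    then have "AE x in M. l x * indicator (fiber M X s) x = 0" by eventually_elim auto
    then show ?thesis unfolding I_def by (rule integral_eq_zero_AE)
  qed
  have psum: "(\<Sum>s\<in>S. p s) = 1"
  proof -
    have "(\<Sum>s\<in>S. p s) = (\<Sum>s\<in>X ` space M. p s)"
      using p0 fX by (intro sum.mono_neutral_left) (auto simp: S_def)
    also have "\<dots> = (\<integral>x. 1 \<partial>M)" using discrete_rv_integral_fun[OF X, of "\<lambda>_. 1"] p_def by simp
    finally show ?thesis by (simp add: prob_space)
  qed
  have "ent M X = (\<Sum>s\<in>S. - p s * ln (p s))"
    unfolding ent_def p_def[symmetric] using p0 fX by (intro sum.mono_neutral_right) (auto simp: S_def)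
  also have "\<dots> \<le> (\<Sum>s\<in>S. I s + p s * ln K + (u (c s) / K - p s))"
  proof (rule sum_mono)
    fix s assume s: "s \<in> S"
    have ps: "0 < p s" using s unfolding S_def by auto
    have us: "0 < u (c s)" using u c(2)[OF s] by auto
    \<comment> \<open>The inequality \<open>ln t \<le> t - 1\<close> for the ratio of the normalised
      weight \<open>u / K\<close> to the probability of the fiber.\<close>
    have "ln (u (c s) / (K * p s)) \<le> u (c s) / (K * p s) - 1"
      using us K ps by (intro ln_le_minus_one) auto
    then have "p s * ln (u (c s) / (K * p s)) \<le> p s * (u (c s) / (K * p s) - 1)"
      using ps by (intro mult_left_mono) auto
    also have "\<dots> = u (c s) / K - p s" using ps K by (simp add: field_simps)
    also have "ln (u (c s) / (K * p s)) = ln (u (c s)) - ln K - ln (p s)"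
      using us K ps by (simp add: ln_div ln_mult)
    finally have "p s * (ln (u (c s)) - ln K - ln (p s)) \<le> u (c s) / K - p s" .
    moreover have "p s * (- ln (u (c s))) \<le> I s"
      using c(3)[OF s] mult_left_mono[OF l[OF c(2)[OF s]], of "p s"] ps by linarith
    ultimately show "- p s * ln (p s) \<le> I s + p s * ln K + (u (c s) / K - p s)"
      by (simp add: algebra_simps)
  qed
  also have "\<dots> = (\<Sum>s\<in>S. I s) + ln K * (\<Sum>s\<in>S. p s) + ((\<Sum>s\<in>S. u (c s)) / K - (\<Sum>s\<in>S. p s))"
    by (simp add: sum.distrib sum_subtractf sum_distrib_left sum_divide_distrib mult.commute)
  also have "\<dots> \<le> (\<Sum>s\<in>S. I s) + ln K"
    using usum psum K by (simp add: field_simps)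
  also have "(\<Sum>s\<in>S. I s) = (\<Sum>s\<in>X ` space M. I s)"
    using I0 fX by (intro sum.mono_neutral_left) (auto simp: S_def)
  also have "\<dots> = (\<integral>x. l x \<partial>M)" unfolding I_def by (rule discrete_rv_integral[OF X int])
  finally show ?thesis .
qed

section \<open>Itineraries and the entropy of partitions\<close>

definition name :: "('a \<Rightarrow> 'a) \<Rightarrow> ('a \<Rightarrow> 'b) \<Rightarrow> nat \<Rightarrow> 'a \<Rightarrow> 'b list" where
  "name g c n x = map (\<lambda>i. c ((g ^^ i) x)) [0..<n]"

lemma name_eq_iff: "name g c n x = name g c n y \<longleftrightarrow> (\<forall>i<n. c ((g ^^ i) x) = c ((g ^^ i) y))"
  unfolding name_def by (auto simp: list_eq_iff_nth_eq)

lemma name_add: "name g c (m + n) x = name g c m x @ name g c n ((g ^^ m) x)"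
proof (rule nth_equalityI)
  fix i assume "i < length (name g c (m + n) x)"
  then have i: "i < m + n" by (simp add: name_def)
  show "name g c (m + n) x ! i = (name g c m x @ name g c n ((g ^^ m) x)) ! i"
  proof (cases "i < m")
    case True then show ?thesis using i by (simp add: name_def nth_append)
  next
    case False
    then have "(g ^^ i) x = (g ^^ (i - m)) ((g ^^ m) x)"
      by (metis add_diff_inverse_nat add.commute comp_apply funpow_add)
    then show ?thesis using False i by (simp add: name_def nth_append)
  qed
qed (simp add: name_def)

locale pmp = prob_space M for M :: "'a measure" +
  fixes g :: "'a \<Rightarrow> 'a"
  assumes g_meas [measurable]: "g \<in> measurable M M" and g_inv: "distr M M g = M"
begin

lemma iter_meas [measurable]: "(g ^^ n) \<in> measurable M M"
  by (induction n) (auto intro: measurable_comp)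

lemma iter_distr: "distr M M (g ^^ n) = M"
proof (induction n)
  case 0 then show ?case by (simp add: distr_id id_def)
next
  case (Suc n)
  have "distr M M (g \<circ> (g ^^ n)) = distr (distr M M (g ^^ n)) M g" by (rule distr_distr[symmetric]) simp_all
  then show ?case using Suc g_inv by (simp add: comp_def)
qed

lemma iter_space: "x \<in> space M \<Longrightarrow> (g ^^ n) x \<in> space M"
  using measurable_space[OF iter_meas] by blast

lemma iter_AE: "AE x in M. P x \<Longrightarrow> AE x in M. P ((g ^^ n) x)"
proof -
  assume "AE x in M. P x"
  then have "AE x in distr M M (g ^^ n). P x" unfolding iter_distr .
  then show ?thesis by (rule AE_distrD[OF iter_meas])
qed

lemma iter_integral:
  assumes "h \<in> borel_measurable M" shows "(\<integral>x. (h ((g ^^ n) x) :: real) \<partial>M) = (\<integral>x. h x \<partial>M)"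
  using integral_distr[OF iter_meas assms, of n] by (simp add: iter_distr)

lemma iter_integrable:
  assumes "integrable M h" shows "integrable M (\<lambda>x. (h ((g ^^ n) x) :: real))"
  using integrable_distr[OF iter_meas, of n h] assms by (simp add: iter_distr)

lemma iter_measure:
  assumes "B \<in> sets M" shows "measure M {x\<in>space M. (g ^^ n) x \<in> B} = measure M B"
proof -
  have "measure (distr M M (g ^^ n)) B = measure M ((g ^^ n) -` B \<inter> space M)"
    by (rule measure_distr[OF iter_meas assms])
  moreover have "(g ^^ n) -` B \<inter> space M = {x\<in>space M. (g ^^ n) x \<in> B}" by auto
  ultimately show ?thesis by (simp add: iter_distr)
qed

lemma name_discrete:
  assumes c: "discrete_rv M c" shows "discrete_rv M (name g c n)"
  unfolding discrete_rv_def
proof (intro conjI allI)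
  have "name g c n ` space M \<subseteq> {xs. set xs \<subseteq> c ` space M \<and> length xs = n}"
    unfolding name_def using iter_space by auto
  then show "finite (name g c n ` space M)"
    using c finite_lists_length_eq[of "c ` space M" n] by (auto simp: discrete_rv_def intro: finite_subset)
  fix s
  show "fiber M (name g c n) s \<in> sets M"
  proof (cases "length s = n")
    case True
    have "fiber M (name g c n) s = {x\<in>space M. \<forall>i<n. (g ^^ i) x \<in> fiber M c (s ! i)}"
      using True iter_space by (auto simp: fiber_def name_def list_eq_iff_nth_eq)
    moreover have "fiber M c (s ! i) \<in> sets M" for i using c by (simp add: discrete_rv_def)
    ultimately show ?thesis by simp
  next
    case False
    then have "fiber M (name g c n) s = {}" by (auto simp: fiber_def name_def)
    then show ?thesis by simp
  qed
qed

lemma fiber_pos_AE: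
  assumes X: "discrete_rv M X" shows "AE x in M. 0 < measure M (fiber M X (X x))"
proof -
  have "AE x in M. \<forall>s\<in>X ` space M. measure M (fiber M X s) = 0 \<longrightarrow> x \<notin> fiber M X s"
  proof (rule AE_finite_allI)
    show "finite (X ` space M)" using X by (simp add: discrete_rv_def)
    fix s
    show "AE x in M. measure M (fiber M X s) = 0 \<longrightarrow> x \<notin> fiber M X s"
      using X prob_eq_0[of "fiber M X s"] by (cases "measure M (fiber M X s) = 0") (auto simp: discrete_rv_def)
  qed
  then show ?thesis
  proof (rule AE_mp, intro AE_I2 impI)
    fix x assume x: "x \<in> space M" and "\<forall>s\<in>X ` space M. measure M (fiber M X s) = 0 \<longrightarrow> x \<notin> fiber M X s"
    then have "measure M (fiber M X (X x)) \<noteq> 0" using x by (auto simp: fiber_def)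
    then show "0 < measure M (fiber M X (X x))" by (simp add: zero_less_measure_iff)
  qed
qed

lemma ent_eq_integral:
  assumes X: "discrete_rv M X"
  shows "ent M X = (\<integral>x. - ln (measure M (fiber M X (X x))) \<partial>M)"
  unfolding discrete_rv_integral_fun[OF X, of "\<lambda>s. - ln (measure M (fiber M X s))"] ent_def
  by (intro sum.cong) auto

lemma fiber_sum:
  assumes X: "discrete_rv M X" shows "(\<Sum>s\<in>X ` space M. measure M (fiber M X s)) = 1"
  using discrete_rv_integral_fun[OF X, of "\<lambda>_. 1"] by (simp add: prob_space)

text \<open>Gibbs' inequality with the product of the two marginal distributions as weights: a long
  name is determined by its two parts, so the weights of points with different names sum to at most
  1.\<close>

lemma ent_name_add:
  assumes c: "discrete_rv M c"
  shows "ent M (name g c (m + n)) \<le> ent M (name g c m) + ent M (name g c n)"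
proof -
  define X Y where "X = name g c m" and "Y = name g c n"
  have X: "discrete_rv M X" and Y: "discrete_rv M Y" unfolding X_def Y_def by (rule name_discrete[OF c])+
  define p1 p2 where "p1 s = measure M (fiber M X s)" and "p2 s = measure M (fiber M Y s)" for s
  define \<Omega> where "\<Omega> = {x. 0 < p1 (X x) \<and> 0 < p2 (Y ((g ^^ m) x))}"
  have "AE x in M. 0 < p1 (X x)" unfolding p1_def by (rule fiber_pos_AE[OF X])
  moreover have "AE x in M. 0 < p2 (Y ((g ^^ m) x))" unfolding p2_def by (rule iter_AE[OF fiber_pos_AE[OF Y]])
  ultimately have \<Omega>: "AE x in M. x \<in> \<Omega>" unfolding \<Omega>_def by eventually_elim auto
  have i1: "integrable M (\<lambda>x. - ln (p1 (X x)))" by (rule discrete_rv_integrable[OF X])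
  have i2: "integrable M (\<lambda>x. - ln (p2 (Y x)))" by (rule discrete_rv_integrable[OF Y])
  have "ent M (name g c (m + n)) \<le> (\<integral>x. - ln (p1 (X x)) + - ln (p2 (Y ((g ^^ m) x))) \<partial>M) + ln 1"
  proof (rule gibbs[OF name_discrete[OF c] \<Omega>, where u = "\<lambda>x. p1 (X x) * p2 (Y ((g ^^ m) x))"])
    fix S assume S: "finite S" "S \<subseteq> \<Omega> \<inter> space M" "inj_on (name g c (m + n)) S"
    define f where "f x = (X x, Y ((g ^^ m) x))" for x
    have inj: "inj_on f S"
    proof (rule inj_onI)
      fix x y assume "x \<in> S" "y \<in> S" "f x = f y"
      then show "x = y" using S(3) unfolding f_def X_def Y_def by (auto simp: inj_on_def name_add)
    qed
    have "(\<Sum>x\<in>S. p1 (X x) * p2 (Y ((g ^^ m) x))) = (\<Sum>(s, t)\<in>f ` S. p1 s * p2 t)"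
      unfolding sum.reindex[OF inj] by (simp add: f_def)
    also have "\<dots> \<le> (\<Sum>(s, t)\<in>(X ` space M) \<times> (Y ` space M). p1 s * p2 t)"
      using X Y S(2) iter_space by (intro sum_mono2) (auto simp: discrete_rv_def p1_def p2_def f_def)
    also have "\<dots> = (\<Sum>s\<in>X ` space M. p1 s) * (\<Sum>t\<in>Y ` space M. p2 t)"
      by (simp add: sum_product sum.cartesian_product)
    also have "\<dots> = 1" unfolding p1_def p2_def fiber_sum[OF X] fiber_sum[OF Y] by simp
    finally show "(\<Sum>x\<in>S. p1 (X x) * p2 (Y ((g ^^ m) x))) \<le> 1" .
  next
    show "integrable M (\<lambda>x. - ln (p1 (X x)) + - ln (p2 (Y ((g ^^ m) x))))"
      by (intro Bochner_Integration.integrable_add i1 iter_integrable[OF i2])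
  qed (auto simp: \<Omega>_def ln_mult)
  also have "\<dots> = (\<integral>x. - ln (p1 (X x)) \<partial>M) + (\<integral>x. - ln (p2 (Y ((g ^^ m) x))) \<partial>M)"
    using i1 iter_integrable[OF i2] by (subst Bochner_Integration.integral_add) auto
  also have "(\<integral>x. - ln (p2 (Y ((g ^^ m) x))) \<partial>M) = (\<integral>x. - ln (p2 (Y x)) \<partial>M)"
    by (rule iter_integral) (rule discrete_rv_fun[OF Y])
  finally show ?thesis using ent_eq_integral[OF X] ent_eq_integral[OF Y]
    unfolding X_def Y_def p1_def p2_def by simp
qed

definition cell :: "'a set set \<Rightarrow> 'a \<Rightarrow> 'a set" where "cell P x = (THE A. A \<in> P \<and> x \<in> A)"

lemma cell:
  assumes P: "partition_on (space M) P" and x: "x \<in> space M"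
  shows "cell P x \<in> P" "x \<in> cell P x" "\<And>A. A \<in> P \<Longrightarrow> x \<in> A \<Longrightarrow> A = cell P x"
proof -
  have "\<exists>!A. A \<in> P \<and> x \<in> A"
  proof -
    have dis: "disjoint P" and un: "\<Union> P = space M" using P unfolding partition_on_def by auto
    obtain A where A: "A \<in> P" "x \<in> A" using un x by auto
    moreover have "B = A" if "B \<in> P" "x \<in> B" for B using disjointD[OF dis that(1) A(1)] that(2) A(2) by auto
    ultimately show ?thesis by blast
  qed
  then have "cell P x \<in> P \<and> x \<in> cell P x" unfolding cell_def by (rule theI')
  moreover show "\<And>A. A \<in> P \<Longrightarrow> x \<in> A \<Longrightarrow> A = cell P x"
    using \<open>\<exists>!A. A \<in> P \<and> x \<in> A\<close> calculation by blast
  ultimately show "cell P x \<in> P" "x \<in> cell P x" by auto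
qed

lemma cell_discrete:
  assumes P: "partition_on (space M) P" "finite P" "P \<subseteq> sets M"
  shows "discrete_rv M (cell P)"
  unfolding discrete_rv_def
proof (intro conjI allI)
  show "finite (cell P ` space M)" using cell(1)[OF P(1)] P(2) by (meson finite_subset image_subsetI)
  fix A
  show "fiber M (cell P) A \<in> sets M"
  proof (cases "A \<in> P")
    case True
    then have "A \<subseteq> space M" using P(1) by (auto simp: partition_on_def)
    then have "fiber M (cell P) A = A" using cell[OF P(1)] True unfolding fiber_def by blast
    then show ?thesis using True P by auto
  next
    case False
    then have "fiber M (cell P) A = {}" using cell(1)[OF P(1)] unfolding fiber_def by auto
    then show ?thesis by simp
  qed
qed

text \<open>This links the partitions in the definition of metric entropy to names. The refinement
  of the empty family need not partition the space, hence \<open>0 < n\<close>.\<close>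

lemma iterated_partition_fibers:
  assumes P: "partition_on (space M) P" and n: "0 < n"
  shows "iterated_partition M g P n = fiber M (name g (cell P) n) ` name g (cell P) n ` space M"
proof -
  define X where "X = name g (cell P) n"
  define Pi where "Pi i = (\<lambda>A. (g ^^ i) -` A \<inter> space M) ` P - {{}}" for i
  define C where "C = common_refinement (Pi ` {..<n})"
  have part: "partition_on (space M) (Pi i)" for i
  proof (rule partition_onI)
    show "\<Union> (Pi i) = space M"
    proof
      show "space M \<subseteq> \<Union> (Pi i)"
      proof
        fix x assume x: "x \<in> space M"
        have "x \<in> (g ^^ i) -` cell P ((g ^^ i) x) \<inter> space M" using x cell(2)[OF P iter_space[OF x]] by auto
        then show "x \<in> \<Union> (Pi i)" unfolding Pi_def using cell(1)[OF P iter_space[OF x, of i]] by blast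
      qed
    qed (auto simp: Pi_def)
    show "disjnt p q" if "p \<in> Pi i" "q \<in> Pi i" "p \<noteq> q" for p q
    proof -
      from that(1,2) obtain A B where AB: "A \<in> P" "B \<in> P"
        "p = (g ^^ i) -` A \<inter> space M" "q = (g ^^ i) -` B \<inter> space M"
        unfolding Pi_def by blast
      then have "A \<inter> B = {}" using that(3) P unfolding partition_on_def disjoint_def by metis
      then show ?thesis using AB unfolding disjnt_def by auto
    qed
  qed (auto simp: Pi_def)
  have pC: "partition_on (space M) C" unfolding C_def
    by (rule partition_on_common_refinement) (use part n in auto)
  have key: "B = fiber M X (X x)" if B: "B \<in> C" "x \<in> B" for B x
  proof -
    \<comment> \<open>A member of the refinement is given by one choice from each distinct preimage
      partition, so times with equal preimage partitions share their choice; a point of the cell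
      forces every choice.\<close>
    obtain f where f: "f \<in> (\<Pi>\<^sub>E Q\<in>Pi ` {..<n}. Q)" "B = \<Inter> (f ` (Pi ` {..<n}))"
      using B(1) unfolding C_def common_refinement_def by blast
    have x: "x \<in> space M" using B pC unfolding partition_on_def by blast
    have fi: "f (Pi i) = (g ^^ i) -` cell P ((g ^^ i) x) \<inter> space M" if i: "i < n" for i
    proof -
      have "f (Pi i) \<in> Pi i" using f(1) i by (auto simp: PiE_iff)
      then obtain A where A: "A \<in> P" "f (Pi i) = (g ^^ i) -` A \<inter> space M" unfolding Pi_def by blast
      have "x \<in> f (Pi i)" using B(2) f(2) i by auto
      then have "(g ^^ i) x \<in> A" using A by auto
      then have "A = cell P ((g ^^ i) x)" using cell(3)[OF P iter_space[OF x] A(1)] by blast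
      then show ?thesis using A by simp
    qed
    have "y \<in> B \<longleftrightarrow> y \<in> fiber M X (X x)" for y
    proof -
      have "y \<in> B \<longleftrightarrow> (\<forall>i<n. y \<in> f (Pi i))" unfolding f(2) by auto
      also have "\<dots> \<longleftrightarrow> (\<forall>i<n. (g ^^ i) y \<in> cell P ((g ^^ i) x) \<and> y \<in> space M)" using fi by auto
      also have "\<dots> \<longleftrightarrow> y \<in> space M \<and> (\<forall>i<n. (g ^^ i) y \<in> cell P ((g ^^ i) x))" using n by auto
      also have "\<dots> \<longleftrightarrow> y \<in> space M \<and> (\<forall>i<n. cell P ((g ^^ i) y) = cell P ((g ^^ i) x))"
        using cell[OF P iter_space] iter_space x by metis
      also have "\<dots> \<longleftrightarrow> y \<in> fiber M X (X x)" unfolding fiber_def X_def name_eq_iff by simp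
      finally show ?thesis .
    qed
    then show ?thesis by blast
  qed
  have "C = fiber M X ` X ` space M"
  proof
    show "C \<subseteq> fiber M X ` X ` space M"
    proof
      fix B assume B: "B \<in> C"
      then obtain x where x: "x \<in> B" using pC by (metis all_not_in_conv partition_on_def)
      then have "x \<in> space M" using B pC unfolding partition_on_def by blast
      then show "B \<in> fiber M X ` X ` space M" using key[OF B x] by blast
    qed
    show "fiber M X ` X ` space M \<subseteq> C"
    proof
      fix B assume "B \<in> fiber M X ` X ` space M"
      then obtain x where x: "x \<in> space M" "B = fiber M X (X x)" by auto
      then obtain B' where "B' \<in> C" "x \<in> B'" using pC unfolding partition_on_def by blast
      then show "B \<in> C" using key x by metis
    qed
  qed
  then show ?thesis unfolding C_def Pi_def X_def iterated_partition_def by simp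
qed

lemma partition_entropy_iterated:
  assumes P: "partition_on (space M) P" and n: "0 < n"
  shows "partition_entropy M (iterated_partition M g P n) = ent M (name g (cell P) n)"
proof -
  define X where "X = name g (cell P) n"
  have "inj_on (fiber M X) (X ` space M)" by (rule inj_onI) (auto simp: fiber_def)
  then show ?thesis unfolding partition_entropy_def iterated_partition_fibers[OF P n] ent_def X_def[symmetric]
    by (subst sum.reindex) auto
qed

text \<open>By subadditivity the limit is at most every quotient, so one suitable \<open>n\<close>
  for each partition and each \<open>d\<close> suffices.\<close>

lemma metric_entropy_le:
  assumes "\<And>P d. finite P \<Longrightarrow> P \<subseteq> sets M \<Longrightarrow> partition_on (space M) P \<Longrightarrow> 0 < d \<Longrightarrow>
    \<exists>n>0. ent M (name g (cell P) n) \<le> real n * (c + d)"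
  shows "metric_entropy g M \<le> ereal c"
  unfolding metric_entropy_def
proof (rule SUP_least)
  fix P assume "P \<in> {P. finite P \<and> P \<subseteq> sets M \<and> partition_on (space M) P}"
  then have P: "finite P" "P \<subseteq> sets M" "partition_on (space M) P" by auto
  have disc: "discrete_rv M (cell P)" by (rule cell_discrete[OF P(3,1,2)])
  define a where "a n = ent M (name g (cell P) n)" for n
  obtain L where L: "(\<lambda>n. a n / real n) \<longlonglongrightarrow> L" "\<And>n. 0 < n \<Longrightarrow> L \<le> a n / real n"
    by (rule fekete[of a]) (auto simp: a_def ent_name_add[OF disc] ent_nonneg prob_space_axioms)
  have "(\<lambda>n. ereal (partition_entropy M (iterated_partition M g P n) / real n)) \<longlonglongrightarrow> ereal L"
  proof (rule Lim_transform_eventually)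
    show "(\<lambda>n. ereal (a n / real n)) \<longlonglongrightarrow> ereal L" using L(1) by simp
    show "\<forall>\<^sub>F n in sequentially. ereal (a n / real n) = ereal (partition_entropy M (iterated_partition M g P n) / real n)"
      using eventually_gt_at_top[of 0] by eventually_elim (simp add: a_def partition_entropy_iterated[OF P(3)])
  qed
  then have "lim (\<lambda>n. ereal (partition_entropy M (iterated_partition M g P n) / real n)) = ereal L"
    by (rule limI)
  moreover have "L \<le> c"
  proof (rule field_le_epsilon)
    fix d :: real assume d: "0 < d"
    obtain n where n: "0 < n" "a n \<le> real n * (c + d)" using assms[OF P d] unfolding a_def by auto
    have "L \<le> a n / real n" using L(2) n by auto
    also have "\<dots> \<le> c + d" using n by (simp add: field_simps)
    finally show "L \<le> c + d" .
  qed
  ultimately show "lim (\<lambda>n. ereal (partition_entropy M (iterated_partition M g P n) / real n)) \<le> ereal c" by simp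
qed

text \<open>Garsia's argument: \<open>mx N\<close> is the largest of 0 and the first
  \<open>N\<close> Birkhoff sums. Where it is positive, \<open>h\<close> is at least
  \<open>mx N - mx N \<circ> g\<close>, whose integral vanishes by invariance; by \<open>pos\<close>
  almost every point belongs to \<open>E N\<close> for all large \<open>N\<close>.\<close>

lemma maximal_ergodic:
  assumes h: "h \<in> borel_measurable M" and B: "\<And>x. x \<in> space M \<Longrightarrow> \<bar>h x\<bar> \<le> B"
    and pos: "AE x in M. \<exists>n. 0 < (\<Sum>i<n. h ((g ^^ i) x))"
  shows "0 \<le> (\<integral>x. (h x :: real) \<partial>M)"
proof -
  note [measurable] = h
  have gs: "g x \<in> space M" if "x \<in> space M" for x using measurable_space[OF g_meas that] .
  define mx :: "nat \<Rightarrow> 'a \<Rightarrow> real" where "mx N = rec_nat (\<lambda>_. 0) (\<lambda>_ f x. max 0 (h x + f (g x))) N" for N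
  have mx0: "mx 0 = (\<lambda>_. 0)" and mxS: "mx (Suc N) = (\<lambda>x. max 0 (h x + mx N (g x)))" for N
    unfolding mx_def by simp_all
  have mono: "mx N x \<le> mx (Suc N) x" for N x
  proof (induction N arbitrary: x)
    case 0 then show ?case by (simp add: mx0 mxS)
  next
    case (Suc N)
    have "max 0 (h x + mx N (g x)) \<le> max 0 (h x + mx (Suc N) (g x))"
      using Suc[of "g x"] by (intro max.mono add_left_mono) auto
    then show ?case by (simp only: mxS[of "Suc N"] mxS[of N])
  qed
  have nn: "0 \<le> mx N x" for N x by (cases N) (auto simp: mx0 mxS)
  have [measurable]: "mx N \<in> borel_measurable M" for N
    by (induction N) (simp_all add: mx0 mxS)
  have bd: "mx N x \<le> real N * \<bar>B\<bar>" if "x \<in> space M" for N x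
    using that
  proof (induction N arbitrary: x)
    case (Suc N)
    then show ?case using B[of x] Suc.IH[OF gs[OF Suc.prems]] by (auto simp: mxS algebra_simps abs_le_iff)
  qed (simp add: mx0)
  have im: "integrable M (mx N)" for N
    by (rule integrable_const_bound[where B = "real N * \<bar>B\<bar>"]) (use nn bd in auto)
  have part: "(\<Sum>i<n. h ((g ^^ i) x)) \<le> mx N x" if "n \<le> N" for n N x
    using that
  proof (induction N arbitrary: x n)
    case (Suc N)
    show ?case
    proof (cases n)
      case (Suc k)
      have "(\<Sum>i<n. h ((g ^^ i) x)) = h x + (\<Sum>i<k. h ((g ^^ i) (g x)))"
        unfolding Suc sum.lessThan_Suc_shift by (simp add: funpow_swap1)
      also have "\<dots> \<le> h x + mx N (g x)" using Suc.IH[of k "g x"] Suc Suc.prems by simp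
      finally show ?thesis by (simp add: mxS)
    qed (use nn in auto)
  qed (simp add: mx0)
  define E where "E N = {x. 0 < mx N x}" for N
  have [measurable]: "{x\<in>space M. x \<in> E N} \<in> sets M" for N unfolding E_def by simp
  have bound: "mx N x - mx N (g x) \<le> h x * indicator (E N) x" for N x
  proof (cases "x \<in> E N")
    case True
    then obtain k where k: "N = Suc k" by (cases N) (auto simp: E_def mx0)
    then have "mx N x = h x + mx k (g x)" using True unfolding E_def k mxS by auto
    then show ?thesis using True mono[of k "g x"] k by simp
  next
    case False
    then have "mx N x = 0" using nn[of N x] by (auto simp: E_def)
    then show ?thesis using False nn by simp
  qed
  have ih: "integrable M h"
    by (rule integrable_const_bound[where B = B]) (use B in auto)
  have ihE: "integrable M (\<lambda>x. h x * indicator (E N) x)" for N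
    by (rule Bochner_Integration.integrable_bound[OF ih]) (auto simp: indicator_def)
  have ge: "0 \<le> (\<integral>x. h x * indicator (E N) x \<partial>M)" for N
  proof -
    have img: "integrable M (\<lambda>x. mx N (g x))" using iter_integrable[OF im[of N], of 1] by simp
    have "(\<integral>x. mx N (g x) \<partial>M) = (\<integral>x. mx N x \<partial>M)" using iter_integral[of "mx N" 1] by simp
    then have "0 = (\<integral>x. mx N x - mx N (g x) \<partial>M)" using im img by simp
    also have "\<dots> \<le> (\<integral>x. h x * indicator (E N) x \<partial>M)"
      by (intro integral_mono Bochner_Integration.integrable_diff im img ihE bound)
    finally show ?thesis .
  qed
  have "(\<lambda>N. \<integral>x. h x * indicator (E N) x \<partial>M) \<longlonglongrightarrow> (\<integral>x. h x \<partial>M)"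
  proof (rule integral_dominated_convergence[where w = "\<lambda>x. \<bar>h x\<bar>"])
    show "AE x in M. (\<lambda>N. h x * indicator (E N) x) \<longlonglongrightarrow> h x"
      using pos
    proof eventually_elim
      fix x assume "\<exists>n. 0 < (\<Sum>i<n. h ((g ^^ i) x))"
      then obtain n where n: "0 < (\<Sum>i<n. h ((g ^^ i) x))" by auto
      have "\<forall>\<^sub>F N in sequentially. h x * indicator (E N) x = h x"
        using eventually_ge_at_top[of n]
      proof eventually_elim
        fix N assume "n \<le> N"
        then show "h x * indicator (E N) x = h x" using part[of n N x] n by (simp add: E_def)
      qed
      then show "(\<lambda>N. h x * indicator (E N) x) \<longlonglongrightarrow> h x" by (rule tendsto_eventually)
    qed
  qed (use ih in \<open>auto simp: indicator_def\<close>)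
  then show ?thesis using ge by (intro LIMSEQ_le_const) auto
qed

end

section \<open>Phase spaces and lifted maps\<close>

text \<open>\<open>times I\<close> is the parameter space, for the circle its universal cover, and
  \<open>T0\<close> a fundamental domain. The constants 2 in \<open>arc_inv\<close> and
  \<open>near\<close> compare chord and arc on the circle, the length 1 is a scale on which the
  parametrisation is injective, and the 2 in \<open>leb_local\<close> counts the translates of
  \<open>T0\<close> that a window of length 1 can meet.\<close>

locale phase_model =
  fixes I :: "'a::euclidean_space phase_space" and T0 :: "real set"
  assumes T_closed: "closed (times I)" and T_convex: "convex (times I)" and T0_T: "T0 \<subseteq> times I"
    and T0_convex: "convex T0" and T0_bounded: "bounded T0" and T0_0: "0 \<in> T0"
    and X_compact: "compact (points I)" and arc_bij: "bij_betw (arc I) T0 (points I)"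
    and arc_T: "t \<in> times I \<Longrightarrow> arc I t \<in> points I"
    and arc_lip: "s \<in> times I \<Longrightarrow> t \<in> times I \<Longrightarrow> dist (arc I s) (arc I t) \<le> \<bar>s - t\<bar>"
    and arc_inv: "s \<in> times I \<Longrightarrow> t \<in> times I \<Longrightarrow> \<bar>s - t\<bar> \<le> 1 \<Longrightarrow> \<bar>s - t\<bar> \<le> 2 * dist (arc I s) (arc I t)"
    and near: "x \<in> points I \<Longrightarrow> y \<in> points I \<Longrightarrow>
      \<exists>s\<in>times I. \<exists>t\<in>times I. arc I s = x \<and> arc I t = y \<and> \<bar>s - t\<bar> \<le> 2 * dist x y"
    and theta_meas: "inv_into T0 (arc I) \<in> borel_measurable (restrict_space borel (points I))"
    and theta_shift: "s \<le> t \<Longrightarrow> {s..t} \<subseteq> times I \<Longrightarrow> \<forall>w\<in>{s..t}. arc I w \<noteq> arc I 0 \<Longrightarrow>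
      \<exists>c. \<forall>w\<in>{s..t}. inv_into T0 (arc I) (arc I w) = w + c"
    and leb_sets: "sets (leb I) = sets (restrict_space borel (points I))"
    and leb_eq: "B \<in> sets (restrict_space borel (points I)) \<Longrightarrow>
      emeasure (leb I) B = emeasure lborel {t\<in>T0. arc I t \<in> B}"
    and leb_local: "B \<in> sets (restrict_space borel (points I)) \<Longrightarrow> {a..a + 1} \<inter> times I \<noteq> {} \<Longrightarrow>
      emeasure lborel ({a..a + 1} \<inter> {t\<in>times I. arc I t \<in> B}) \<le> 2 * emeasure (leb I) B"
begin

abbreviation "X \<equiv> points I"
abbreviation "T \<equiv> times I"

definition \<theta> :: "'a \<Rightarrow> real" where "\<theta> = inv_into T0 (arc I)"

lemma \<theta>: "x \<in> X \<Longrightarrow> \<theta> x \<in> T0" "x \<in> X \<Longrightarrow> arc I (\<theta> x) = x" "t \<in> T0 \<Longrightarrow> \<theta> (arc I t) = t"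
  using arc_bij unfolding \<theta>_def bij_betw_def
  by (auto simp: inv_into_into f_inv_into_f inv_into_f_f)

lemma \<theta>_T: "x \<in> X \<Longrightarrow> \<theta> x \<in> T" using \<theta>(1) T0_T by blast

lemma X_borel: "X \<in> sets borel" using X_compact by (simp add: borel_compact)

lemma T_borel: "T \<in> sets borel" using T_closed by simp

lemma T0_borel: "T0 \<in> sets borel"
  using T0_convex by (simp add: is_interval_convex_1 real_interval_borel_measurable)

lemma arc_cont: "continuous_on T (arc I)"
  unfolding continuous_on_iff
proof (intro ballI allI impI)
  fix x e assume "x \<in> T" "(0::real) < e"
  then show "\<exists>d>0. \<forall>x'\<in>T. dist x' x < d \<longrightarrow> dist (arc I x') (arc I x) < e"
    using arc_lip[of _ x] by (intro exI[of _ e]) (force simp: dist_real_def)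
qed

lemma arc_eq_apart: "s \<in> T \<Longrightarrow> t \<in> T \<Longrightarrow> arc I s = arc I t \<Longrightarrow> s \<noteq> t \<Longrightarrow> 1 < \<bar>s - t\<bar>"
  using arc_inv[of s t] by (cases "\<bar>s - t\<bar> \<le> 1") auto

text \<open>Two parameters of the same point are more than 1 apart, so the integer part of
  \<open>t - a\<close> tells them apart.\<close>

lemma arc_preimage_finite:
  assumes "{a..b} \<subseteq> T" "a \<le> b"
  shows "finite {t\<in>{a..b}. arc I t = x} \<and> real (card {t\<in>{a..b}. arc I t = x}) \<le> b - a + 2"
proof -
  define S where "S = {t\<in>{a..b}. arc I t = x}"
  define f where "f t = \<lfloor>t - a\<rfloor>" for t
  have inj: "inj_on f S"
  proof (rule inj_onI)
    fix s t assume st: "s \<in> S" "t \<in> S" "f s = f t"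
    then have "\<bar>s - t\<bar> \<le> 1" unfolding f_def by linarith
    then show "s = t" using arc_eq_apart[of s t] st assms unfolding S_def by fastforce
  qed
  have im: "f ` S \<subseteq> {0..\<lfloor>b - a\<rfloor>}" unfolding f_def S_def by (auto intro!: floor_mono)
  have "finite S" using inj im by (meson finite_atLeastAtMost_int inj_on_finite)
  moreover have "card S \<le> card {0..\<lfloor>b - a\<rfloor>}" using inj im by (intro card_inj_on_le) auto
  then have "real (card S) \<le> b - a + 2" using assms(2) by (simp; linarith)
  ultimately show ?thesis unfolding S_def by blast
qed

lemma theta_borel [measurable]: "\<theta> \<in> borel_measurable (restrict_space borel X)"
  unfolding \<theta>_def by (rule theta_meas)

lemma X_sets: "sets (restrict_space borel X) = {B. B \<in> sets borel \<and> B \<subseteq> X}"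
  using X_borel by (auto simp: sets_restrict_space_iff[of X borel] sets_restrict_space)

end

text \<open>Between a compact set inside \<open>B\<close> and an open set around it lies a finite
  union of balls. Membership in this union can change only at the end points of the balls, which
  form \<open>E\<close>.\<close>

lemma borel_real_approx:
  fixes m :: "real measure"
  assumes m: "finite_measure m" "sets m = sets borel" and B: "B \<in> sets borel" and e: "0 < e"
  obtains U E where "finite E" "U \<in> sets borel" "measure m ((B - U) \<union> (U - B)) \<le> e"
    "\<And>s t. closed_segment s t \<inter> E = {} \<Longrightarrow> (s \<in> U \<longleftrightarrow> t \<in> U)"
proof -
  interpret finite_measure m by fact
  have fin: "emeasure m (space m) \<noteq> \<infinity>" by simp
  have B': "B \<in> sets borel" by fact
  have inner: "emeasure m B = (SUP K\<in>{K. K \<subseteq> B \<and> compact K}. emeasure m K)"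
    by (rule inner_regular[OF m(2) fin B])
  have outer: "emeasure m B = (INF U\<in>{U. B \<subseteq> U \<and> open U}. emeasure m U)"
    by (rule outer_regular[OF m(2) fin B])
  have "\<exists>K\<in>{K. K \<subseteq> B \<and> compact K}. emeasure m B < emeasure m K + ennreal (e / 2)"
    by (rule SUP_approx_ennreal[OF _ _ inner]) (use e in \<open>auto intro: exI[of _ "{}"]\<close>)
  then obtain K where K: "K \<subseteq> B" "compact K" "emeasure m B < emeasure m K + ennreal (e / 2)" by auto
  have "\<exists>V\<in>{U. B \<subseteq> U \<and> open U}. emeasure m V < emeasure m B + ennreal (e / 2)"
    by (rule INF_approx_ennreal[OF _ outer]) (use e in auto)
  then obtain V where V: "B \<subseteq> V" "open V" "emeasure m V < emeasure m B + ennreal (e / 2)" by auto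
  have KV: "K \<in> sets m" "V \<in> sets m" "B \<in> sets m" using K V B m(2) by (auto simp: borel_compact)
  have "measure m B < measure m K + e / 2" "measure m V < measure m B + e / 2"
    using K(3) V(3) e by (simp_all add: emeasure_eq_measure ennreal_plus[symmetric] ennreal_less_iff del: ennreal_plus)
  moreover have "measure m (V - K) = measure m V - measure m K"
    using KV K V by (intro finite_measure_Diff) auto
  ultimately have VK: "measure m (V - K) \<le> e" by linarith
  have "\<exists>d>0. ball x d \<subseteq> V" if "x \<in> K" for x
    using that K V openE by (metis subsetD)
  then obtain d where d: "\<And>x. x \<in> K \<Longrightarrow> 0 < d x" "\<And>x. x \<in> K \<Longrightarrow> ball x (d x) \<subseteq> V" by metis
  obtain C where C: "C \<subseteq> K" "finite C" "K \<subseteq> (\<Union>x\<in>C. ball x (d x))"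
    by (rule compactE_image[OF K(2), of K "\<lambda>x. ball x (d x)"]) (use d in \<open>auto intro: centre_in_ball[THEN iffD2]\<close>)
  define U where "U = (\<Union>x\<in>C. ball x (d x))"
  define E where "E = (\<lambda>x. x - d x) ` C \<union> (\<lambda>x. x + d x) ` C"
  have U: "K \<subseteq> U" "U \<subseteq> V" "open U" unfolding U_def using C d by blast+
  have "measure m ((B - U) \<union> (U - B)) \<le> measure m (V - K)"
    using U K V KV m(2) by (intro finite_measure_mono) auto
  then have mU: "measure m ((B - U) \<union> (U - B)) \<le> e" using VK by linarith
  have half: "s \<in> U \<Longrightarrow> t \<in> U" if "closed_segment s t \<inter> E = {}" for s t
  proof -
    assume "s \<in> U"
    then obtain x where x: "x \<in> C" "s \<in> ball x (d x)" unfolding U_def by auto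
    have E: "x - d x \<notin> closed_segment s t" "x + d x \<notin> closed_segment s t" using that x unfolding E_def by auto
    have s: "x - d x < s" "s < x + d x" using x(2) by (auto simp: dist_real_def)
    have "x - d x < t \<and> t < x + d x"
    proof (rule ccontr)
      assume "\<not> ?thesis"
      then have "t \<le> x - d x \<or> x + d x \<le> t" by linarith
      then show False using E s by (auto simp: closed_segment_eq_real_ivl)
    qed
    then have "t \<in> ball x (d x)" by (auto simp: dist_real_def)
    then show "t \<in> U" unfolding U_def using x by auto
  qed
  have "s \<in> U \<longleftrightarrow> t \<in> U" if "closed_segment s t \<inter> E = {}" for s t
    using half[OF that] half[OF that[unfolded closed_segment_commute[of s t]]] by (rule iffI)
  moreover have "finite E" unfolding E_def using C by simp
  moreover have "U \<in> sets borel" using U(3) by (rule borel_open)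
  ultimately show thesis using mU by (intro that)
qed

section \<open>Lifted maps and integrability of the logarithm of the derivative\<close>

locale lifted = phase_model I T0 + pmp \<mu> f
  for I :: "'a::euclidean_space phase_space" and T0 and \<mu> :: "'a measure" and f +
  fixes \<phi> \<phi>' :: "real \<Rightarrow> real" and M0 :: real
  assumes mu_sets: "sets \<mu> = sets (restrict_space borel (points I))"
    and phi_T: "t \<in> times I \<Longrightarrow> \<phi> t \<in> times I" and phi_arc: "t \<in> times I \<Longrightarrow> arc I (\<phi> t) = f (arc I t)"
    and phi_deriv: "t \<in> times I \<Longrightarrow> (\<phi> has_real_derivative \<phi>' t) (at t within times I)"
    and phi_ad: "t \<in> times I \<Longrightarrow> \<bar>\<phi>' t\<bar> = abs_deriv I f (arc I t)"
    and M0: "1 \<le> M0" "t \<in> times I \<Longrightarrow> \<bar>\<phi>' t\<bar> \<le> M0"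
    and ad_meas: "abs_deriv I f \<in> borel_measurable (restrict_space borel (points I))"
    and ac: "absolutely_continuous (leb I) \<mu>"
    and lyap: "AE x in \<mu>. 0 < lyapunov I f x"
begin

lemma mu_space: "space \<mu> = X"
  using sets_eq_imp_space_eq[OF mu_sets] by (simp add: space_restrict_space)

abbreviation "ad \<equiv> abs_deriv I f"

lemma ad_bounds: "x \<in> X \<Longrightarrow> 0 \<le> ad x" "x \<in> X \<Longrightarrow> ad x \<le> M0"
  using phi_ad[OF \<theta>_T, of x] M0(2)[OF \<theta>_T, of x] \<theta>(2)[of x] by auto

lemma leb_null_imp: "B \<in> null_sets (leb I) \<Longrightarrow> AE x in \<mu>. x \<notin> B"
  using ac AE_not_in unfolding absolutely_continuous_def by blast

lemma countable_null: assumes B: "countable B" shows "AE x in \<mu>. x \<notin> B"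
proof -
  define C where "C = B \<inter> X"
  have c: "countable C" unfolding C_def using B by blast
  have "C \<in> sets borel" by (rule sets.countable[OF _ c]) simp
  then have Cs: "C \<in> sets (restrict_space borel X)" unfolding X_sets by (auto simp: C_def)
  have "{t\<in>T0. arc I t \<in> C} \<subseteq> \<theta> ` C"
    using \<theta>(3) by force
  then have "countable {t\<in>T0. arc I t \<in> C}" using c by (meson countable_image countable_subset)
  then have "{t\<in>T0. arc I t \<in> C} \<in> null_sets lborel" by (rule countable_imp_null_set_lborel)
  then have "emeasure (leb I) C = 0" using leb_eq[OF Cs] by auto
  then have "C \<in> null_sets (leb I)" using Cs leb_sets by auto
  from leb_null_imp[OF this] show ?thesis
    by (rule AE_mp) (auto simp: C_def mu_space)
qed

lemma f_iter_X: "x \<in> X \<Longrightarrow> (f ^^ n) x \<in> X"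
  using iter_space mu_space by auto

lemma phi_iter_T: "t \<in> T \<Longrightarrow> (\<phi> ^^ n) t \<in> T" by (induction n) (auto intro: phi_T)

lemma phi_iter_arc: "t \<in> T \<Longrightarrow> arc I ((\<phi> ^^ n) t) = (f ^^ n) (arc I t)"
  by (induction n) (auto simp: phi_arc phi_iter_T)

lemma ad_meas_mu [measurable]: "ad \<in> borel_measurable \<mu>"
  using ad_meas mu_sets measurable_cong_sets by blast

definition neg :: "'a \<Rightarrow> real" where "neg x = max 0 (- ln (ad x))"

text \<open>The truncation at \<open>A\<close> of the negative part of the logarithm, with the true
  value infinity at critical points, where \<open>neg\<close> has the default value 0 because of
  \<open>ln 0 = 0\<close>.\<close>

definition truncated :: "nat \<Rightarrow> 'a \<Rightarrow> real" where
  "truncated A x = (if ad x = 0 then real A else min (real A) (neg x))"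

lemma neg_meas [measurable]: "neg \<in> borel_measurable \<mu>" unfolding neg_def by simp

lemma truncated_meas [measurable]: "truncated A \<in> borel_measurable \<mu>" unfolding truncated_def by simp

lemma truncated_bounds: "0 \<le> truncated A x" "truncated A x \<le> real A"
  unfolding truncated_def neg_def by auto

lemma lyap_sum_pos: "AE x in \<mu>. \<exists>n. 0 < (\<Sum>i<n. ext_ln (ad ((f ^^ i) x)))"
  using lyap
proof eventually_elim
  fix x assume pos: "0 < lyapunov I f x"
  show "\<exists>n. 0 < (\<Sum>i<n. ext_ln (ad ((f ^^ i) x)))"
  proof (rule ccontr)
    assume "\<not> ?thesis"
    then have le: "(\<Sum>i<n. ext_ln (ad ((f ^^ i) x))) \<le> 0" for n by (auto simp: not_less)
    have "lyapunov I f x \<le> 0" unfolding lyapunov_def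
    proof (rule Limsup_bounded, rule always_eventually, rule allI)
      fix n
      have "0 \<le> ereal (1 / real n)" by simp
      then show "ereal (1 / real n) * (\<Sum>i<n. ext_ln (ad ((f ^^ i) x))) \<le> 0"
        using le[of n] ereal_mult_left_mono[OF le[of n], of "ereal (1 / real n)"] by simp
    qed
    then show False using pos by simp
  qed
qed

text \<open>\<open>ln M0 - truncated A\<close> dominates the extended logarithm of the derivative. A
  positive exponent therefore gives it a positive Birkhoff sum almost everywhere, and the maximal
  ergodic inequality applies. The bound is uniform in \<open>A\<close>.\<close>

lemma truncated_integral: "(\<integral>x. truncated A x \<partial>\<mu>) \<le> ln M0"
proof -
  define h where "h x = ln M0 - truncated A x" for x
  have "0 \<le> (\<integral>x. h x \<partial>\<mu>)"
  proof (rule maximal_ergodic)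
    show "h \<in> borel_measurable \<mu>" unfolding h_def by simp
    show "\<bar>h x\<bar> \<le> ln M0 + real A" for x
      using truncated_bounds[where A = A and x = x] M0(1) ln_ge_zero[OF M0(1)] unfolding h_def by linarith
    show "AE x in \<mu>. \<exists>n. 0 < (\<Sum>i<n. h ((f ^^ i) x))"
      using lyap_sum_pos
    proof (rule AE_mp, intro AE_I2 impI)
      fix x assume x: "x \<in> space \<mu>" and "\<exists>n. 0 < (\<Sum>i<n. ext_ln (ad ((f ^^ i) x)))"
      then obtain n where n: "0 < (\<Sum>i<n. ext_ln (ad ((f ^^ i) x)))" by auto
      have "ext_ln (ad y) \<le> ereal (h y)" if y: "y \<in> X" for y
      proof (cases "ad y = 0")
        case True then show ?thesis by (simp add: ext_ln_def)
      next
        case False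
        then have p: "0 < ad y" using ad_bounds(1)[OF y] by simp
        have "ln (ad y) \<le> ln M0" using p ad_bounds(2)[OF y] by simp
        moreover have "0 \<le> ln M0" using M0(1) by simp
        ultimately have "ln (ad y) \<le> ln M0 - min (real A) (max 0 (- ln (ad y)))" by linarith
        then have "ln (ad y) \<le> h y"
          using False unfolding h_def truncated_def neg_def by simp
        then show ?thesis using False by (simp add: ext_ln_def)
      qed
      then have "(\<Sum>i<n. ext_ln (ad ((f ^^ i) x))) \<le> (\<Sum>i<n. ereal (h ((f ^^ i) x)))"
        using x f_iter_X mu_space by (intro sum_mono) auto
      also have "\<dots> = ereal (\<Sum>i<n. h ((f ^^ i) x))" by simp
      finally have "0 < ereal (\<Sum>i<n. h ((f ^^ i) x))" using n by (rule order_less_le_trans[rotated])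
      then show "\<exists>n. 0 < (\<Sum>i<n. h ((f ^^ i) x))" by auto
    qed
  qed
  moreover have "integrable \<mu> (truncated A)"
    by (rule integrable_const_bound[where B = "real A"]) (use truncated_bounds in auto)
  then have "(\<integral>x. h x \<partial>\<mu>) = ln M0 - (\<integral>x. truncated A x \<partial>\<mu>)"
    unfolding h_def by (subst Bochner_Integration.integral_diff) (auto simp: prob_space)
  ultimately show ?thesis by simp
qed

lemma neg_ext: "(\<integral>\<^sup>+x. (SUP A. ennreal (truncated A x)) \<partial>\<mu>) \<le> ennreal (ln M0)"
proof -
  have "incseq (\<lambda>A x. ennreal (truncated A x))"
    unfolding incseq_def le_fun_def truncated_def by (auto intro!: ennreal_leI)
  then have "(\<integral>\<^sup>+x. (SUP A. ennreal (truncated A x)) \<partial>\<mu>) = (SUP A. \<integral>\<^sup>+x. ennreal (truncated A x) \<partial>\<mu>)"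
    by (intro nn_integral_monotone_convergence_SUP) auto
  also have "\<dots> \<le> ennreal (ln M0)"
  proof (rule SUP_least)
    fix A
    have "integrable \<mu> (truncated A)"
      by (rule integrable_const_bound[where B = "real A"]) (use truncated_bounds in auto)
    then have "(\<integral>\<^sup>+x. ennreal (truncated A x) \<partial>\<mu>) = ennreal (\<integral>x. truncated A x \<partial>\<mu>)"
      by (rule nn_integral_eq_integral) (use truncated_bounds in auto)
    then show "(\<integral>\<^sup>+x. ennreal (truncated A x) \<partial>\<mu>) \<le> ennreal (ln M0)"
      using truncated_integral[of A] by (simp add: ennreal_leI)
  qed
  finally show ?thesis .
qed

lemma neg_le_ext: "ennreal (neg x) \<le> (SUP A. ennreal (truncated A x))"
proof (cases "ad x = 0")
  case True then show ?thesis by (simp add: neg_def)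
next
  case False
  obtain A :: nat where "neg x \<le> real A" using real_arch_simple by blast
  then have "ennreal (neg x) = ennreal (truncated A x)" using False by (simp add: truncated_def)
  then show ?thesis by (metis SUP_upper UNIV_I)
qed

text \<open>At a critical point the truncations tend to infinity, whereas their supremum has a
  finite integral.\<close>

lemma ad_nz: "AE x in \<mu>. ad x \<noteq> 0"
proof -
  have "(\<integral>\<^sup>+x. (SUP A. ennreal (truncated A x)) \<partial>\<mu>) \<noteq> \<infinity>"
    using neg_ext by (metis ennreal_neq_top infinity_ennreal_def top.extremum_unique)
  then have "AE x in \<mu>. (SUP A. ennreal (truncated A x)) \<noteq> \<infinity>"
    by (intro nn_integral_PInf_AE) auto
  then show ?thesis
  proof eventually_elim
    fix x assume ne: "(SUP A. ennreal (truncated A x)) \<noteq> \<infinity>"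
    show "ad x \<noteq> 0"
    proof
      assume "ad x = 0"
      then have "(SUP A. ennreal (truncated A x)) = (SUP A::nat. of_nat A)"
        by (simp add: truncated_def ennreal_of_nat_eq_real_of_nat)
      then show False using ne by (simp add: ennreal_SUP_of_nat_eq_top)
    qed
  qed
qed

lemma neg_nn: "(\<integral>\<^sup>+x. ennreal (neg x) \<partial>\<mu>) \<le> ennreal (ln M0)"
  using neg_ext nn_integral_mono[of \<mu> "\<lambda>x. ennreal (neg x)", OF neg_le_ext] by (rule order_trans[rotated])

lemma neg_nonneg: "0 \<le> neg x" unfolding neg_def by simp

lemma neg_integrable: "integrable \<mu> neg"
proof (rule integrableI_nonneg)
  show "(\<integral>\<^sup>+x. ennreal (neg x) \<partial>\<mu>) < \<infinity>"
    using neg_nn by (metis ennreal_less_top infinity_ennreal_def order_le_less_trans)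
qed (simp_all add: neg_nonneg)

lemma neg_integral: "(\<integral>x. neg x \<partial>\<mu>) \<le> ln M0"
proof -
  have "ennreal (\<integral>x. neg x \<partial>\<mu>) \<le> ennreal (ln M0)"
    using neg_nn nn_integral_eq_integral[OF neg_integrable] neg_nonneg by simp
  then show ?thesis using M0(1) by (simp add: ennreal_le_iff)
qed

lemma arc_preimage_borel:
  assumes "B \<in> sets \<mu>" shows "{t\<in>T0. arc I t \<in> B} \<in> sets borel"
proof -
  have B: "B \<in> sets borel" using assms mu_sets X_sets by auto
  have "continuous_on T0 (arc I)" using arc_cont T0_T continuous_on_subset by blast
  then have "arc I \<in> borel_measurable (restrict_space borel T0)" by (rule borel_measurable_continuous_on_restrict)
  then have "arc I -` B \<inter> space (restrict_space borel T0) \<in> sets (restrict_space borel T0)"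
    using B by (rule measurable_sets)
  moreover have "arc I -` B \<inter> space (restrict_space borel T0) = {t\<in>T0. arc I t \<in> B}"
    by (auto simp: space_restrict_space)
  ultimately show ?thesis using T0_borel by (auto simp: sets_restrict_space_iff)
qed

lemma theta_mu [measurable]: "\<theta> \<in> borel_measurable \<mu>"
  using theta_borel mu_sets measurable_cong_sets by blast

text \<open>Names are counted along intervals, so an arbitrary partition is replaced by a classifier
  \<open>q\<close> that changes only at the finitely many points of \<open>E\<close> and errs only
  on a set \<open>N\<close> of small measure.\<close>

lemma interval_partition_approx:
  assumes P: "finite P" "P \<subseteq> sets \<mu>" "partition_on (space \<mu>) P" and d: "0 < d"
  obtains q E N where "\<And>x. q x \<in> P" "N \<in> sets \<mu>" "measure \<mu> N \<le> d"
    "\<And>x. x \<in> X \<Longrightarrow> cell P x \<noteq> q x \<Longrightarrow> x \<in> N"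
    "finite E" "\<And>s t. s \<le> t \<Longrightarrow> {s..t} \<subseteq> T \<Longrightarrow> (\<And>w. w \<in> {s..t} \<Longrightarrow> arc I w \<notin> E) \<Longrightarrow> q (arc I s) = q (arc I t)"
proof -
  have "P \<noteq> {}" using P(3) not_empty unfolding partition_on_def by auto
  then obtain A0 where A0: "A0 \<in> P" by auto
  define k where "k = real (card P)"
  have k: "1 \<le> k" unfolding k_def using P(1) \<open>P \<noteq> {}\<close> by (simp add: card_gt_0_iff Suc_leI)
  define mm where "mm = distr \<mu> borel \<theta>"
  have mm: "finite_measure mm" "sets mm = sets borel"
    unfolding mm_def by (auto intro: finite_measure_distr)
  define G where "G A UE \<longleftrightarrow> finite (snd UE) \<and> fst UE \<in> sets borel \<and>
    measure mm (({t\<in>T0. arc I t \<in> A} - fst UE) \<union> (fst UE - {t\<in>T0. arc I t \<in> A})) \<le> d / k \<and>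
    (\<forall>s t. closed_segment s t \<inter> snd UE = {} \<longrightarrow> (s \<in> fst UE \<longleftrightarrow> t \<in> fst UE))" for A UE
  have "\<exists>UE. G A UE" if "A \<in> P" for A
  proof -
    have B: "{t\<in>T0. arc I t \<in> A} \<in> sets borel" using that P(2) by (intro arc_preimage_borel) auto
    have dk: "0 < d / k" using d k by simp
    obtain U E where "finite E" "U \<in> sets borel"
      "measure mm (({t\<in>T0. arc I t \<in> A} - U) \<union> (U - {t\<in>T0. arc I t \<in> A})) \<le> d / k"
      "\<And>s t. closed_segment s t \<inter> E = {} \<Longrightarrow> (s \<in> U \<longleftrightarrow> t \<in> U)"
      by (rule borel_real_approx[OF mm B dk]) (rule that)
    then have "G A (U, E)" unfolding G_def by simp
    then show ?thesis by blast
  qed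
  then obtain h where h: "\<And>A. A \<in> P \<Longrightarrow> G A (h A)" by metis
  define U E where "U A = fst (h A)" and "E A = snd (h A)" for A
  have UE: "\<And>A. A \<in> P \<Longrightarrow> finite (E A)" "\<And>A. A \<in> P \<Longrightarrow> U A \<in> sets borel"
    "\<And>A. A \<in> P \<Longrightarrow> measure mm (({t\<in>T0. arc I t \<in> A} - U A) \<union> (U A - {t\<in>T0. arc I t \<in> A})) \<le> d / k"
    "\<And>A s t. A \<in> P \<Longrightarrow> closed_segment s t \<inter> E A = {} \<Longrightarrow> (s \<in> U A \<longleftrightarrow> t \<in> U A)"
    using h unfolding G_def U_def E_def by blast+
  define NA where "NA A = {x\<in>space \<mu>. \<theta> x \<in> ({t\<in>T0. arc I t \<in> A} - U A) \<union> (U A - {t\<in>T0. arc I t \<in> A})}" for A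
  define N where "N = (\<Union>A\<in>P. NA A)"
  have symdiff: "({t\<in>T0. arc I t \<in> A} - U A) \<union> (U A - {t\<in>T0. arc I t \<in> A}) \<in> sets borel" if "A \<in> P" for A
    using that P(2) UE(2) by (intro sets.Un sets.Diff arc_preimage_borel) auto
  have NA: "NA A \<in> sets \<mu>" if "A \<in> P" for A
    using measurable_sets[OF theta_mu symdiff[OF that]] unfolding NA_def by (simp add: vimage_def Int_def conj_commute)
  have mNA: "measure \<mu> (NA A) \<le> d / k" if "A \<in> P" for A
  proof -
    have "measure mm (({t\<in>T0. arc I t \<in> A} - U A) \<union> (U A - {t\<in>T0. arc I t \<in> A})) = measure \<mu> (NA A)"
      unfolding mm_def using symdiff[OF that]
      by (subst measure_distr) (auto simp: NA_def intro!: arg_cong[where f = "measure \<mu>"])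
    then show ?thesis using UE(3)[OF that] by simp
  qed
  have N: "N \<in> sets \<mu>" unfolding N_def using NA P(1) by blast
  have "measure \<mu> N \<le> (\<Sum>A\<in>P. measure \<mu> (NA A))"
    unfolding N_def using NA P(1) by (intro finite_measure_subadditive_finite) auto
  also have "\<dots> \<le> (\<Sum>A\<in>P. d / k)" using mNA by (intro sum_mono) auto
  also have "\<dots> = d" using k by (simp add: k_def)
  finally have mN: "measure \<mu> N \<le> d" .
  \<comment> \<open>The class is read off only if exactly one \<open>U A\<close> contains the
    parameter; otherwise the default \<open>A0\<close> is used. Outside \<open>N\<close> all
    memberships are correct, so the first case applies.\<close>
  define \<psi> where "\<psi> S = (if \<exists>A. S = {A} \<and> A \<in> P then (THE A. S = {A}) else A0)" for S
  define q where "q x = \<psi> {A\<in>P. \<theta> x \<in> U A}" for x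
  have qP: "q x \<in> P" for x unfolding q_def \<psi>_def using A0 by auto
  have mis: "x \<in> N" if x: "x \<in> X" "cell P x \<noteq> q x" for x
  proof (rule ccontr)
    assume "x \<notin> N"
    have all: "x \<in> A \<longleftrightarrow> \<theta> x \<in> U A" if "A \<in> P" for A
    proof -
      have "x \<notin> NA A" using \<open>x \<notin> N\<close> that unfolding N_def by blast
      then show ?thesis using x(1) \<theta>(1,2)[OF x(1)] unfolding NA_def mu_space by auto
    qed
    have "x \<in> space \<mu>" using x(1) mu_space by simp
    note c = cell[OF P(3) this]
    have "{A\<in>P. \<theta> x \<in> U A} = {cell P x}" using all c by blast
    then have "q x = cell P x" unfolding q_def \<psi>_def using c(1) by auto
    then show False using x(2) by simp
  qed
  \<comment> \<open>\<open>arc I 0\<close> is added because the inverse parametrisation may jump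
    there; on arcs avoiding it, \<open>\<theta>\<close> is a translation of the parameter.\<close>
  define E' where "E' = insert (arc I 0) (arc I ` ((\<Union>A\<in>P. E A) \<inter> T0))"
  have E': "finite E'" unfolding E'_def using UE(1) P(1) by auto
  have const: "q (arc I s) = q (arc I t)"
    if st: "s \<le> t" "{s..t} \<subseteq> T" and av: "\<And>w. w \<in> {s..t} \<Longrightarrow> arc I w \<notin> E'" for s t
  proof -
    have "\<forall>w\<in>{s..t}. arc I w \<noteq> arc I 0" using av unfolding E'_def by auto
    then obtain c where c: "\<And>w. w \<in> {s..t} \<Longrightarrow> \<theta> (arc I w) = w + c"
      using theta_shift[OF st] unfolding \<theta>_def by auto
    have "closed_segment (s + c) (t + c) \<inter> E A = {}" if A: "A \<in> P" for A
    proof (rule ccontr)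
      assume "\<not> ?thesis"
      then obtain v where v: "v \<in> E A" "s + c \<le> v" "v \<le> t + c"
        using st(1) by (auto simp: closed_segment_eq_real_ivl)
      define w where "w = v - c"
      have w: "w \<in> {s..t}" "\<theta> (arc I w) = v" using v c[of w] unfolding w_def by auto
      have X: "arc I w \<in> X" using w st arc_T by blast
      have "v \<in> T0" "arc I v = arc I w" using \<theta>(1,2)[OF X] w by auto
      then have "arc I w \<in> E'" unfolding E'_def using v A by (auto intro!: image_eqI[of _ _ v])
      then show False using av[OF w(1)] by simp
    qed
    then have "s + c \<in> U A \<longleftrightarrow> t + c \<in> U A" if "A \<in> P" for A using UE(4)[OF that] that by blast
    then have "{A\<in>P. \<theta> (arc I s) \<in> U A} = {A\<in>P. \<theta> (arc I t) \<in> U A}" using c[of s] c[of t] st(1) by auto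
    then show ?thesis unfolding q_def by simp
  qed
  show thesis by (rule that[of q N E', OF qP N mN mis E' const])
qed

lemma phi_lipschitz:
  assumes "s \<in> T" "t \<in> T" shows "\<bar>(\<phi> ^^ n) s - (\<phi> ^^ n) t\<bar> \<le> M0 ^ n * \<bar>s - t\<bar>"
proof (induction n)
  case (Suc n)
  define u v where "u = (\<phi> ^^ n) s" and "v = (\<phi> ^^ n) t"
  have uv: "u \<in> T" "v \<in> T" unfolding u_def v_def using phi_iter_T assms by auto
  have sub: "{min u v..max u v} \<subseteq> T"
    using T_convex uv by (metis closed_segment_eq_real_ivl closed_segment_subset max_def min_def)
  have "(\<phi> has_real_derivative \<phi>' z) (at z within {min u v..max u v})" if "z \<in> {min u v..max u v}" for z
    using has_field_derivative_subset[OF phi_deriv sub] sub that by blast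
  then obtain z where z: "z \<in> {min u v..max u v}" "\<phi> v - \<phi> u = \<phi>' z * (v - u)"
    using mvt_within[of "min u v" "max u v" \<phi> \<phi>' u v]
    by (metis atLeastAtMost_iff max.cobounded1 max.cobounded2 min.cobounded1 min.cobounded2)
  have "\<bar>\<phi> u - \<phi> v\<bar> = \<bar>\<phi>' z\<bar> * \<bar>u - v\<bar>"
    unfolding abs_minus_commute[of "\<phi> u"] abs_minus_commute[of u] z(2) by (rule abs_mult)
  also have "\<dots> \<le> M0 * (M0 ^ n * \<bar>s - t\<bar>)"
    using M0 z(1) sub Suc by (intro mult_mono) (auto simp: u_def v_def)
  finally show ?case by (simp add: u_def v_def mult.assoc)
qed simp

lemma phi_iter_cont: "continuous_on T (\<phi> ^^ n)"
  unfolding continuous_on_iff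
proof (intro ballI allI impI)
  fix x e assume x: "x \<in> T" and e: "(0::real) < e"
  have M: "0 < M0 ^ n" using M0 by simp
  show "\<exists>d>0. \<forall>x'\<in>T. dist x' x < d \<longrightarrow> dist ((\<phi> ^^ n) x') ((\<phi> ^^ n) x) < e"
  proof (intro exI[of _ "e / M0 ^ n"] conjI ballI impI)
    show "0 < e / M0 ^ n" using M e by simp
    fix x' assume "x' \<in> T" "dist x' x < e / M0 ^ n"
    then have "M0 ^ n * \<bar>x' - x\<bar> < e" using M by (simp add: dist_real_def field_simps)
    then show "dist ((\<phi> ^^ n) x') ((\<phi> ^^ n) x) < e"
      using phi_lipschitz[OF \<open>x' \<in> T\<close> x, of n] by (simp add: dist_real_def)
  qed
qed

end

lemma ln_affine_sublinear:
  fixes a b c :: real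
  assumes "0 < a" "0 \<le> b" "0 < c"
  obtains n0 :: nat where "\<And>n. n0 \<le> n \<Longrightarrow> ln (a * (b * real n + 1)) \<le> c * real n"
proof -
  define B where "B = b + 1"
  define k where "k = c / (2 * B)"
  have B: "0 < B" "0 < k" unfolding B_def k_def using assms by auto
  obtain n0 :: nat where n0: "(ln a + k - 1 - ln k) / (c / 2) \<le> real n0" using real_arch_simple by blast
  have "ln (a * (b * real n + 1)) \<le> c * real n" if n: "n0 \<le> n" for n
  proof -
    define y where "y = b * real n + 1"
    have y: "0 < y" unfolding y_def using assms by (simp add: add_nonneg_pos)
    have "ln (k * y) \<le> k * y - 1" using B y by (intro ln_le_minus_one) simp
    then have "ln y \<le> k * y - 1 - ln k" using B y by (simp add: ln_mult)
    also have "k * y \<le> k * (B * real n + 1)"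
      unfolding y_def B_def using B assms by (intro mult_left_mono add_right_mono mult_right_mono) auto
    also have "\<dots> = c / 2 * real n + k" unfolding k_def using B by (simp add: field_simps)
    finally have "ln (a * y) \<le> c / 2 * real n + (ln a + k - 1 - ln k)" using assms y by (simp add: ln_mult)
    moreover have "(ln a + k - 1 - ln k) / (c / 2) \<le> real n" using n0 n by (meson of_nat_mono order_trans)
    then have "ln a + k - 1 - ln k \<le> c / 2 * real n" using assms by (simp add: field_simps)
    ultimately have "ln (a * y) \<le> c * real n" by (simp add: field_simps)
    then show ?thesis unfolding y_def .
  qed
  then show thesis using that by blast
qed

lemma sum_group_card_le:
  fixes f :: "'a \<Rightarrow> real"
  assumes "finite S" "\<And>x. x \<in> S \<Longrightarrow> 0 \<le> f x" "0 \<le> b"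
    and "\<And>S'. S' \<subseteq> S \<Longrightarrow> inj_on c S' \<Longrightarrow> sum f S' \<le> a"
    and "\<And>x0. x0 \<in> S \<Longrightarrow> real (card {x\<in>S. c x = c x0}) \<le> b"
  shows "sum f S \<le> a * b"
  using sum_group_le[OF assms(1,2), where g = "\<lambda>_. 1" and c = c and a = a and b = b] assms by simp

section \<open>The entropy bound\<close>

locale entropy_block = lifted I T0 \<mu> f \<phi> \<phi>' M0 + block_map "times I" T0 R0 Z "\<phi> ^^ p" F' q e M m R r cen
  for I :: "'a::euclidean_space phase_space" and T0 and \<mu> :: "'a measure" and f \<phi> \<phi>' M0
    and R0 Z F' q e M and m R :: nat and r and cen :: "real \<Rightarrow> 'c" and p :: nat +
  fixes K \<beta> :: real
  assumes p: "0 < p" and m: "0 < m" and Fd: "F' t = (\<Prod>i<p. \<phi>' ((\<phi> ^^ i) t))"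
    and qd: "q t = min 1 (\<bar>F' t\<bar> powr \<beta>) / (4 * K)" and K: "1 \<le> K" and \<beta>: "0 \<le> \<beta>"
    and Z_countable: "countable (Z \<inter> {t. F' t \<noteq> 0})" and R_pos: "0 < R"
begin

definition Good :: "nat \<Rightarrow> 'a set" where "Good n = {x\<in>X. good r n (\<theta> x)}"

lemma F_iter: "((\<phi> ^^ p) ^^ n) t = (\<phi> ^^ (p * n)) t"
  by (simp add: funpow_mult)

lemma good_interior:
  assumes t: "good r n t" shows "interior (W n t) \<noteq> {}"
proof -
  obtain y z where yz: "y \<in> W n t" "z \<in> W n t" "r \<le> \<bar>((\<phi> ^^ p) ^^ n) y - ((\<phi> ^^ p) ^^ n) z\<bar>"
    using t unfolding good_def by auto
  have "y \<noteq> z" using yz(3) r(1) by auto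
  have "{min y z..max y z} \<subseteq> W n t" using closed_segment_subset[OF yz(1,2) convex_W] \<open>y \<noteq> z\<close>
    by (auto simp: closed_segment_eq_real_ivl min_def max_def split: if_splits)
  then have "interior {min y z..max y z} \<subseteq> interior (W n t)" by (rule interior_mono)
  moreover have "(y + z) / 2 \<in> interior {min y z..max y z}"
    using \<open>y \<noteq> z\<close> by (auto simp: interior_atLeastAtMost_real min_def max_def)
  ultimately show ?thesis by auto
qed

text \<open>A good piece contains a nondegenerate interval and distinct pieces are disjoint, so
  there are only countably many good pieces and their union is Borel.\<close>

lemma Good_meas: "Good n \<in> sets \<mu>"
proof -
  define \<F> where "\<F> = W n ` {t. good r n t}"
  have nd: "interior S \<noteq> {} \<and> S \<in> sets borel" if "S \<in> \<F>" for S
    using that good_interior convex_W unfolding \<F>_def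
    by (auto simp: is_interval_convex_1 intro!: real_interval_borel_measurable)
  have "pairwise disjnt \<F>"
  proof (rule pairwiseI)
    fix S S' assume S: "S \<in> \<F>" "S' \<in> \<F>" "S \<noteq> S'"
    then obtain t t' where t: "S = W n t" "S' = W n t'" unfolding \<F>_def by auto
    show "disjnt S S'" unfolding disjnt_def using S(3) W_eq unfolding t by blast
  qed
  then have "countable \<F>" by (rule countable_disjoint_nonempty_interior_subsets) (use nd in auto)
  then have "\<Union>\<F> \<in> sets borel" using nd by (intro sets.countable_Union) auto
  moreover have "\<Union>\<F> = {t. good r n t}"
  proof
    show "{t. good r n t} \<subseteq> \<Union>\<F>" unfolding \<F>_def using W_self good_def by blast
    show "\<Union>\<F> \<subseteq> {t. good r n t}"
    proof
      fix s assume "s \<in> \<Union>\<F>"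
      then obtain t where t: "good r n t" "s \<in> W n t" unfolding \<F>_def by auto
      then have "W n s = W n t" "s \<in> reg n" using W_eq W_reg by auto
      then show "s \<in> {t. good r n t}" using t(1) unfolding good_def by simp
    qed
  qed
  ultimately have "{t. good r n t} \<in> sets borel" by simp
  from measurable_sets[OF theta_mu this] show ?thesis
    unfolding Good_def by (simp add: vimage_def Int_def mu_space conj_commute)
qed

text \<open>There are three kinds of exceptional points: those of the finite set \<open>R0\<close>,
  those mapped to the countably many cut points off the critical set, and those with an orbit
  through a critical point, which are null by \<open>ad_nz\<close>.\<close>

lemma reg_AE: "AE x in \<mu>. \<theta> x \<in> reg n"
proof -
  have r0: "AE x in \<mu>. x \<notin> arc I ` R0" by (rule countable_null) (use R0 in \<open>auto intro: countable_finite\<close>)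
  have z1: "AE x in \<mu>. \<forall>i<n. (f ^^ (p * i)) x \<notin> arc I ` (Z \<inter> {t. F' t \<noteq> 0})"
    unfolding AE_all_countable by (intro allI AE_impI iter_AE countable_null) (use Z_countable in auto)
  have z2: "AE x in \<mu>. \<forall>j. ad ((f ^^ j) x) \<noteq> 0"
    unfolding AE_all_countable by (intro allI iter_AE ad_nz)
  show ?thesis
    using r0 z1 z2 AE_space
  proof eventually_elim
    fix x assume a: "x \<notin> arc I ` R0" "\<forall>i<n. (f ^^ (p * i)) x \<notin> arc I ` (Z \<inter> {t. F' t \<noteq> 0})"
      "\<forall>j. ad ((f ^^ j) x) \<noteq> 0" "x \<in> space \<mu>"
    have x: "x \<in> X" using a(4) mu_space by simp
    have 1: "\<theta> x \<notin> R0" using a(1) \<theta>(2)[OF x] by force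
    have 2: "((\<phi> ^^ p) ^^ i) (\<theta> x) \<notin> Z" if i: "i < n" for i
    proof
      assume Z: "((\<phi> ^^ p) ^^ i) (\<theta> x) \<in> Z"
      define t where "t = (\<phi> ^^ (p * i)) (\<theta> x)"
      have tT: "t \<in> T" unfolding t_def using phi_iter_T \<theta>_T x by blast
      have at: "arc I t = (f ^^ (p * i)) x" unfolding t_def using phi_iter_arc[OF \<theta>_T[OF x]] \<theta>(2)[OF x] by simp
      have "F' t \<noteq> 0"
      proof -
        have "\<phi>' ((\<phi> ^^ j) t) \<noteq> 0" for j
        proof -
          have "(\<phi> ^^ j) t \<in> T" using phi_iter_T tT by blast
          then have "\<bar>\<phi>' ((\<phi> ^^ j) t)\<bar> = ad ((f ^^ j) ((f ^^ (p * i)) x))"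
            using phi_ad phi_iter_arc[OF tT] at by simp
          also have "\<dots> = ad ((f ^^ (j + p * i)) x)" by (simp add: funpow_add)
          finally show ?thesis using a(3) by auto
        qed
        then show ?thesis unfolding Fd by (simp add: prod_zero_iff)
      qed
      then have "(f ^^ (p * i)) x \<in> arc I ` (Z \<inter> {t. F' t \<noteq> 0})"
        using Z at unfolding F_iter t_def[symmetric] by force
      then show False using a(2) i by blast
    qed
    show "\<theta> x \<in> reg n" unfolding reg_def using 1 2 \<theta>(1)[OF x] by auto
  qed
qed

text \<open>The chain rule splits \<open>ln \<bar>F'\<bar>\<close> over \<open>p\<close> steps of
  \<open>f\<close>, each bounded below by \<open>- neg\<close>. The constant \<open>4 * K\<close> is
  paid once per step of \<open>F\<close>, that is once in \<open>p\<close> steps of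
  \<open>f\<close>.\<close>

lemma neg_ln_q:
  assumes t: "t \<in> T" and nz: "F' t \<noteq> 0"
  shows "0 < q t" "- ln (q t) \<le> ln (4 * K) + \<beta> * (\<Sum>j<p. neg ((f ^^ j) (arc I t)))"
proof -
  have pos: "0 < min 1 (\<bar>F' t\<bar> powr \<beta>)" using nz by simp
  then show "0 < q t" unfolding qd using K by simp
  define s where "s = (\<Sum>j<p. neg ((f ^^ j) (arc I t)))"
  have s0: "0 \<le> s" unfolding s_def by (intro sum_nonneg) (simp add: neg_def)
  have f0: "\<phi>' ((\<phi> ^^ j) t) \<noteq> 0" if "j < p" for j
    using nz that unfolding Fd by (auto simp: prod_zero_iff)
  have "ln \<bar>F' t\<bar> = ln (\<Prod>j<p. \<bar>\<phi>' ((\<phi> ^^ j) t)\<bar>)" unfolding Fd by (simp add: abs_prod)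
  also have "\<dots> = (\<Sum>j<p. ln \<bar>\<phi>' ((\<phi> ^^ j) t)\<bar>)" using f0 by (subst ln_prod) auto
  also have "\<dots> = (\<Sum>j<p. ln (ad ((f ^^ j) (arc I t))))"
    using phi_ad phi_iter_T[OF t] phi_iter_arc[OF t] by simp
  also have "- \<dots> \<le> s" unfolding s_def sum_negf[symmetric] by (intro sum_mono) (simp add: neg_def)
  finally have le: "- ln \<bar>F' t\<bar> \<le> s" by simp
  have "- ln (min 1 (\<bar>F' t\<bar> powr \<beta>)) \<le> \<beta> * s"
  proof (cases "1 \<le> \<bar>F' t\<bar> powr \<beta>")
    case True then show ?thesis using \<beta> s0 by simp
  next
    case False
    then have "- ln (min 1 (\<bar>F' t\<bar> powr \<beta>)) = \<beta> * (- ln \<bar>F' t\<bar>)" using nz by (simp add: ln_powr)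
    also have "\<dots> \<le> \<beta> * s" using le \<beta> by (intro mult_left_mono) auto
    finally show ?thesis .
  qed
  then show "- ln (q t) \<le> ln (4 * K) + \<beta> * (\<Sum>j<p. neg ((f ^^ j) (arc I t)))"
    unfolding qd s_def[symmetric] using pos K by (subst ln_div) auto
qed

text \<open>An integrable majorant of \<open>- ln (weight n (\<theta> x))\<close>, written with
  iterates of \<open>f\<close>: \<open>l\<close> is the block, \<open>i\<close> the step of
  \<open>F\<close> in the block, and \<open>j\<close> the step of \<open>f\<close> in that
  step.\<close>

definition lw :: "nat \<Rightarrow> 'a \<Rightarrow> real" where
  "lw n x = (\<Sum>l<n. (\<Sum>i<m. ln (4 * K) + \<beta> * (\<Sum>j<p. neg ((f ^^ (j + p * (l * m + i))) x)))
     + ln (real R) * indicator (Good (l * m)) x)"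

lemma neg_ln_weight:
  assumes x: "x \<in> X" and rg: "\<theta> x \<in> reg (n * m)"
  shows "0 < weight n (\<theta> x)" "- ln (weight n (\<theta> x)) \<le> lw n x"
proof -
  define t where "t k = ((\<phi> ^^ p) ^^ k) (\<theta> x)" for k
  have tT: "t k \<in> T" for k unfolding t_def F_iter using phi_iter_T \<theta>_T x by blast
  have at: "arc I (t k) = (f ^^ (p * k)) x" for k
    unfolding t_def F_iter using phi_iter_arc[OF \<theta>_T[OF x]] \<theta>(2)[OF x] by simp
  have nz: "F' (t k) \<noteq> 0" if "k < n * m" for k
    using crit[OF tT] rg that unfolding reg_def t_def by blast
  have idx: "l * m + i < n * m" if "l < n" "i < m" for l i
  proof -
    have "l * m + i < Suc l * m" using that by simp
    also have "\<dots> \<le> n * m" using that by (intro mult_le_mono1) simp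
    finally show ?thesis .
  qed
  have qpos: "0 < q (t (l * m + i))" if "l < n" "i < m" for l i
    using neg_ln_q(1)[OF tT nz[OF idx[OF that]]] .
  have Qpos: "0 < Q (l * m) m (\<theta> x)" if "l < n" for l
    unfolding Q_def t_def[symmetric] using qpos[OF that] by (intro prod_pos) auto
  have lnQ: "- ln (Q (l * m) m (\<theta> x)) \<le> (\<Sum>i<m. ln (4 * K) + \<beta> * (\<Sum>j<p. neg ((f ^^ (j + p * (l * m + i))) x)))"
    if l: "l < n" for l
  proof -
    have "q (t (l * m + i)) \<noteq> 0" if "i < m" for i using qpos[OF l that] by simp
    then have "- ln (Q (l * m) m (\<theta> x)) = (\<Sum>i<m. - ln (q (t (l * m + i))))"
      unfolding Q_def t_def[symmetric] by (subst ln_prod) (auto simp: sum_negf)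
    also have "\<dots> \<le> (\<Sum>i<m. ln (4 * K) + \<beta> * (\<Sum>j<p. neg ((f ^^ (j + p * (l * m + i))) x)))"
    proof (rule sum_mono)
      fix i assume "i \<in> {..<m}"
      then have "F' (t (l * m + i)) \<noteq> 0" using nz[OF idx[OF l, of i]] by simp
      from neg_ln_q(2)[OF tT this]
      show "- ln (q (t (l * m + i))) \<le> ln (4 * K) + \<beta> * (\<Sum>j<p. neg ((f ^^ (j + p * (l * m + i))) x))"
        unfolding at by (simp add: funpow_add)
    qed
    finally show ?thesis .
  qed
  have Rpos: "0 < (if good r (l * m) (\<theta> x) then 1 / real R else 1)" for l using R_pos by simp
  show "0 < weight n (\<theta> x)" unfolding weight_def using Qpos Rpos by (intro prod_pos mult_pos_pos) auto
  have "- ln (weight n (\<theta> x)) =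
      (\<Sum>l<n. - ln (Q (l * m) m (\<theta> x)) - ln (if good r (l * m) (\<theta> x) then 1 / real R else 1))"
  proof -
    have "ln (weight n (\<theta> x)) = (\<Sum>l<n. ln (Q (l * m) m (\<theta> x) * (if good r (l * m) (\<theta> x) then 1 / real R else 1)))"
      unfolding weight_def
    proof (rule ln_prod)
      fix l assume "l \<in> {..<n}"
      then have "0 < Q (l * m) m (\<theta> x)" using Qpos by simp
      from mult_pos_pos[OF this Rpos[of l]]
      show "Q (l * m) m (\<theta> x) * (if good r (l * m) (\<theta> x) then 1 / real R else 1) \<noteq> 0" by linarith
    qed simp
    also have "\<dots> = (\<Sum>l<n. ln (Q (l * m) m (\<theta> x)) + ln (if good r (l * m) (\<theta> x) then 1 / real R else 1))"
      using Qpos Rpos by (intro sum.cong refl ln_mult_pos) auto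
    finally show ?thesis by (simp add: sum_negf sum.distrib sum_subtractf)
  qed
  also have "\<dots> \<le> lw n x" unfolding lw_def
  proof (rule sum_mono)
    fix l assume l: "l \<in> {..<n}"
    have "- ln (if good r (l * m) (\<theta> x) then 1 / real R else 1) = ln (real R) * indicator (Good (l * m)) x"
      using x R_pos by (auto simp: Good_def ln_div)
    then show "- ln (Q (l * m) m (\<theta> x)) - ln (if good r (l * m) (\<theta> x) then 1 / real R else 1)
      \<le> (\<Sum>i<m. ln (4 * K) + \<beta> * (\<Sum>j<p. neg ((f ^^ (j + p * (l * m + i))) x)))
         + ln (real R) * indicator (Good (l * m)) x" using lnQ l by force
  qed
  finally show "- ln (weight n (\<theta> x)) \<le> lw n x" .
qed

lemma neg_iter_integrable: "integrable \<mu> (\<lambda>x. neg ((f ^^ n) x))"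
  by (rule iter_integrable[OF neg_integrable])

lemma neg_iter_integral: "(\<integral>x. neg ((f ^^ n) x) \<partial>\<mu>) \<le> ln M0"
  using iter_integral[OF neg_meas] neg_integral by simp

lemma Good_integrable: "integrable \<mu> (indicator (Good n) :: 'a \<Rightarrow> real)"
  using Good_meas by (simp add: emeasure_eq_measure)

lemma lw_integrable: "integrable \<mu> (lw n)"
  unfolding lw_def using neg_iter_integrable Good_integrable
  by (intro Bochner_Integration.integrable_sum Bochner_Integration.integrable_add integrable_mult_right) auto

lemma lw_integral:
  "(\<integral>x. lw n x \<partial>\<mu>) \<le> real n * real m * (ln (4 * K) + \<beta> * (real p * ln M0))
     + ln (real R) * (\<Sum>l<n. measure \<mu> (Good (l * m)))"
proof -
  define g where "g l i x = ln (4 * K) + \<beta> * (\<Sum>j<p. neg ((f ^^ (j + p * (l * m + i))) x))" for l i x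
  have ig: "integrable \<mu> (g l i)" for l i
    unfolding g_def using neg_iter_integrable
    by (intro Bochner_Integration.integrable_sum Bochner_Integration.integrable_add integrable_mult_right) auto
  have gi: "(\<integral>x. g l i x \<partial>\<mu>) \<le> ln (4 * K) + \<beta> * (real p * ln M0)" for l i
  proof -
    have isum: "integrable \<mu> (\<lambda>x. \<Sum>j<p. neg ((f ^^ (j + p * (l * m + i))) x))"
      using neg_iter_integrable by (intro Bochner_Integration.integrable_sum) auto
    have "(\<integral>x. g l i x \<partial>\<mu>) = ln (4 * K) + \<beta> * (\<integral>x. (\<Sum>j<p. neg ((f ^^ (j + p * (l * m + i))) x)) \<partial>\<mu>)"
      unfolding g_def using isum by (subst Bochner_Integration.integral_add) (auto simp: prob_space)
    also have "(\<integral>x. (\<Sum>j<p. neg ((f ^^ (j + p * (l * m + i))) x)) \<partial>\<mu>)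
        = (\<Sum>j<p. \<integral>x. neg ((f ^^ (j + p * (l * m + i))) x) \<partial>\<mu>)"
      using neg_iter_integrable by (intro Bochner_Integration.integral_sum) auto
    also have "ln (4 * K) + \<beta> * \<dots> \<le> ln (4 * K) + \<beta> * (\<Sum>j<p. ln M0)"
      using neg_iter_integral \<beta> by (intro add_left_mono mult_left_mono sum_mono) auto
    finally show ?thesis by simp
  qed
  have "(\<integral>x. lw n x \<partial>\<mu>) = (\<Sum>l<n. \<integral>x. ((\<Sum>i<m. g l i x) + ln (real R) * indicator (Good (l * m)) x) \<partial>\<mu>)"
    unfolding lw_def g_def[symmetric] using ig Good_integrable by (intro Bochner_Integration.integral_sum
      Bochner_Integration.integrable_sum Bochner_Integration.integrable_add integrable_mult_right) auto
  also have "\<dots> = (\<Sum>l<n. (\<Sum>i<m. \<integral>x. g l i x \<partial>\<mu>) + ln (real R) * measure \<mu> (Good (l * m)))"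
  proof (rule sum.cong[OF refl])
    fix l
    have "integrable \<mu> (\<lambda>x. \<Sum>i<m. g l i x)" using ig by (intro Bochner_Integration.integrable_sum) auto
    then have "(\<integral>x. ((\<Sum>i<m. g l i x) + ln (real R) * indicator (Good (l * m)) x) \<partial>\<mu>) =
        (\<integral>x. (\<Sum>i<m. g l i x) \<partial>\<mu>) + ln (real R) * (\<integral>x. indicator (Good (l * m)) x \<partial>\<mu>)"
      using Good_integrable by (subst Bochner_Integration.integral_add) auto
    also have "(\<integral>x. (\<Sum>i<m. g l i x) \<partial>\<mu>) = (\<Sum>i<m. \<integral>x. g l i x \<partial>\<mu>)"
      using ig by (intro Bochner_Integration.integral_sum) auto
    finally show "(\<integral>x. ((\<Sum>i<m. g l i x) + ln (real R) * indicator (Good (l * m)) x) \<partial>\<mu>) =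
        (\<Sum>i<m. \<integral>x. g l i x \<partial>\<mu>) + ln (real R) * measure \<mu> (Good (l * m))"
      using Good_meas by simp
  qed
  also have "\<dots> \<le> (\<Sum>l<n. (\<Sum>i<m. ln (4 * K) + \<beta> * (real p * ln M0)) + ln (real R) * measure \<mu> (Good (l * m)))"
    using gi by (intro sum_mono add_right_mono) auto
  also have "\<dots> = real n * real m * (ln (4 * K) + \<beta> * (real p * ln M0))
     + ln (real R) * (\<Sum>l<n. measure \<mu> (Good (l * m)))"
    by (simp add: sum.distrib sum_distrib_left)
  finally show ?thesis .
qed

text \<open>The iterate \<open>\<phi> ^^ j\<close> is the inner factor of
  \<open>\<phi> ^^ (p * n)\<close>, which is injective on the piece.\<close>

lemma phi_inj:
  assumes "j \<le> p * n" shows "inj_on (\<phi> ^^ j) (W n t)"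
proof -
  have "inj_on ((\<phi> ^^ p) ^^ n) (W n t)" by (rule iter_inj[OF convex_W])
  moreover have "(\<phi> ^^ p) ^^ n = (\<phi> ^^ (p * n - j)) \<circ> (\<phi> ^^ j)"
    unfolding funpow_mult funpow_add[symmetric] using assms by simp
  ultimately show ?thesis by (metis inj_on_imageI2)
qed

text \<open>At multiples of \<open>p\<close> the images have length at most 1; in between, fewer
  than \<open>p\<close> further steps stretch them by at most \<open>M0 ^ p\<close>.\<close>

lemma phi_spread:
  assumes xy: "x \<in> W n t" "y \<in> W n t" and j: "j < p * n"
  shows "\<bar>(\<phi> ^^ j) x - (\<phi> ^^ j) y\<bar> \<le> M0 ^ p"
proof -
  define i k where "i = j div p" and "k = j mod p"
  have jk: "j = k + p * i" "k < p" unfolding i_def k_def using p by auto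
  have "i < n" using j unfolding i_def by (simp add: less_mult_imp_div_less mult.commute)
  then have "x \<in> W i t" "y \<in> W i t" using W_antimono[of i n t] xy by auto
  then have 1: "\<bar>(\<phi> ^^ (p * i)) x - (\<phi> ^^ (p * i)) y\<bar> \<le> 1" using image_bound unfolding F_iter by blast
  have "x \<in> T" "y \<in> T" using W_T xy by auto
  then have "(\<phi> ^^ (p * i)) x \<in> T" "(\<phi> ^^ (p * i)) y \<in> T" using phi_iter_T by auto
  then have "\<bar>(\<phi> ^^ k) ((\<phi> ^^ (p * i)) x) - (\<phi> ^^ k) ((\<phi> ^^ (p * i)) y)\<bar> \<le> M0 ^ k * \<bar>(\<phi> ^^ (p * i)) x - (\<phi> ^^ (p * i)) y\<bar>"
    by (rule phi_lipschitz)
  also have "\<dots> \<le> M0 ^ k * 1" using 1 M0 by (intro mult_left_mono) auto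
  also have "\<dots> \<le> M0 ^ p" using M0 jk by (simp add: power_increasing)
  finally show ?thesis unfolding jk(1) by (simp add: funpow_add)
qed

lemma seg_T: "x \<in> T \<Longrightarrow> y \<in> T \<Longrightarrow> {x..y} \<subseteq> T"
  using T_convex closed_segment_subset[of x T y] by (cases "x \<le> y") (auto simp: closed_segment_eq_real_ivl)

text \<open>On the piece the iterate is injective and its image has length at most
  \<open>M0 ^ p\<close>; an arc of this length passes each point of \<open>E\<close> at most
  \<open>M0 ^ p + 2\<close> times. Finite subsets are counted because finiteness is part of the
  claim.\<close>

lemma cut_preimage_card:
  assumes E: "finite E" and j: "j < p * n"
  shows "finite {z\<in>W n t. arc I ((\<phi> ^^ j) z) \<in> E} \<and>
    card {z\<in>W n t. arc I ((\<phi> ^^ j) z) \<in> E} \<le> nat \<lfloor>real (card E) * (M0 ^ p + 2)\<rfloor>"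
proof (rule finite_if_finite_subsets_card_bdd)
  fix G assume G: "G \<subseteq> {z\<in>W n t. arc I ((\<phi> ^^ j) z) \<in> E}" "finite G"
  show "card G \<le> nat \<lfloor>real (card E) * (M0 ^ p + 2)\<rfloor>"
  proof (cases "G = {}")
    case False
    define H where "H = (\<phi> ^^ j) ` G"
    define a b where "a = Min H" and "b = Max H"
    have H: "finite H" "H \<noteq> {}" unfolding H_def using G False by auto
    have ab: "a \<in> H" "b \<in> H" "H \<subseteq> {a..b}" unfolding a_def b_def using H by auto
    have HT: "H \<subseteq> T" unfolding H_def using G(1) W_T phi_iter_T by blast
    have abT: "{a..b} \<subseteq> T" by (rule seg_T) (use ab HT in auto)
    have "a \<le> b" using ab by auto
    have "b - a \<le> M0 ^ p"
    proof -
      obtain x y where "x \<in> G" "y \<in> G" "a = (\<phi> ^^ j) x" "b = (\<phi> ^^ j) y" using ab unfolding H_def by auto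
      then show ?thesis using phi_spread[OF _ _ j, of y t x] G(1) by force
    qed
    have "card G = card H" unfolding H_def
      using phi_inj[of j n t] j G(1) by (intro card_image[symmetric]) (auto intro: inj_on_subset)
    also have "arc I s \<in> E" if "s \<in> H" for s using that G(1) unfolding H_def by blast
    then have "H \<subseteq> (\<Union>x\<in>E. {s\<in>{a..b}. arc I s = x})" using ab(3) by blast
    then have "card H \<le> card (\<Union>x\<in>E. {s\<in>{a..b}. arc I s = x})"
      using E arc_preimage_finite[OF abT \<open>a \<le> b\<close>] by (intro card_mono) auto
    also have "\<dots> \<le> (\<Sum>x\<in>E. card {s\<in>{a..b}. arc I s = x})" using E by (rule card_UN_le)
    finally have "real (card G) \<le> (\<Sum>x\<in>E. real (card {s\<in>{a..b}. arc I s = x}))"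
      by (metis of_nat_mono of_nat_sum)
    also have "\<dots> \<le> (\<Sum>x\<in>E. M0 ^ p + 2)"
    proof (rule sum_mono)
      fix x
      have "real (card {s\<in>{a..b}. arc I s = x}) \<le> b - a + 2"
        using arc_preimage_finite[OF abT \<open>a \<le> b\<close>] by blast
      then show "real (card {s\<in>{a..b}. arc I s = x}) \<le> M0 ^ p + 2" using \<open>b - a \<le> M0 ^ p\<close> by linarith
    qed
    also have "\<dots> = real (card E) * (M0 ^ p + 2)" by simp
    finally show ?thesis by (simp add: le_nat_floor)
  qed simp
qed

text \<open>Inside one piece the name changes only at the preimages of \<open>E\<close>, of which
  there are at most linearly many in \<open>n\<close>. Refining the pieces by names therefore adds
  no exponential growth.\<close>

lemma node_names:
  assumes E: "finite E"
    and const: "\<And>s t. s \<le> t \<Longrightarrow> {s..t} \<subseteq> T \<Longrightarrow> (\<And>w. w \<in> {s..t} \<Longrightarrow> arc I w \<notin> E) \<Longrightarrow> h (arc I s) = h (arc I t)"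
    and S: "S \<subseteq> X" "\<And>x. x \<in> S \<Longrightarrow> \<theta> x \<in> W n t0" "\<And>x j. x \<in> S \<Longrightarrow> (f ^^ j) x \<notin> E"
    and inj: "inj_on (name f h (p * n)) S"
  shows "card S \<le> p * n * nat \<lfloor>real (card E) * (M0 ^ p + 2)\<rfloor> + 1"
proof -
  define Ej where "Ej j = {z\<in>W n t0. arc I ((\<phi> ^^ j) z) \<in> E}" for j
  define G where "G = (\<Union>j<p * n. Ej j)"
  have fEj: "finite (Ej j)" "card (Ej j) \<le> nat \<lfloor>real (card E) * (M0 ^ p + 2)\<rfloor>" if "j < p * n" for j
    using cut_preimage_card[OF E that, of t0] unfolding Ej_def by auto
  have fG: "finite G" unfolding G_def using fEj by auto
  have "card G \<le> (\<Sum>j<p * n. card (Ej j))" unfolding G_def by (rule card_UN_le) simp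
  also have "\<dots> \<le> (\<Sum>j<p * n. nat \<lfloor>real (card E) * (M0 ^ p + 2)\<rfloor>)" using fEj by (intro sum_mono) auto
  finally have cG: "card G \<le> p * n * nat \<lfloor>real (card E) * (M0 ^ p + 2)\<rfloor>" by simp
  have orb: "arc I ((\<phi> ^^ j) (\<theta> x)) = (f ^^ j) x" if "x \<in> X" for x j
    using phi_iter_arc[OF \<theta>_T[OF that]] \<theta>(2)[OF that] by simp
  have inj\<theta>: "inj_on \<theta> S"
  proof (rule inj_onI)
    fix x y assume xy: "x \<in> S" "y \<in> S" "\<theta> x = \<theta> y"
    have "arc I (\<theta> x) = x" "arc I (\<theta> y) = y" using xy(1,2) S(1) by (blast intro: \<theta>(2))+
    then show "x = y" unfolding xy(3) by (rule trans[OF sym])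
  qed
  have "card (\<theta> ` S) \<le> card G + 1"
  proof (rule conjunct2[OF card_separated_le[OF fG]])
    show "\<theta> ` S \<inter> G = {}"
    proof (rule equals0I)
      fix u assume "u \<in> \<theta> ` S \<inter> G"
      then obtain x j where "x \<in> S" "arc I ((\<phi> ^^ j) (\<theta> x)) \<in> E" unfolding G_def Ej_def by blast
      then show False using S(3)[of x j] orb[of x j] S(1) by auto
    qed
    fix u v assume uv: "u \<in> \<theta> ` S" "v \<in> \<theta> ` S" "u < v"
    then obtain x y where xy: "x \<in> S" "y \<in> S" "u = \<theta> x" "v = \<theta> y" by auto
    show "{u..v} \<inter> G \<noteq> {}"
    proof
      assume em: "{u..v} \<inter> G = {}"
      have uvW: "{u..v} \<subseteq> W n t0"
        using closed_segment_subset[OF S(2)[OF xy(1)] S(2)[OF xy(2)] convex_W] uv(3) xy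
        by (simp add: closed_segment_eq_real_ivl)
      have uvT: "{u..v} \<subseteq> T" using uvW W_T by auto
      have "h ((f ^^ j) x) = h ((f ^^ j) y)" if j: "j < p * n" for j
      proof -
        define a b where "a = min ((\<phi> ^^ j) u) ((\<phi> ^^ j) v)" and "b = max ((\<phi> ^^ j) u) ((\<phi> ^^ j) v)"
        have "connected ((\<phi> ^^ j) ` {u..v})"
          using phi_iter_cont uvT by (intro connected_continuous_image) (auto intro: continuous_on_subset)
        moreover have "a \<in> (\<phi> ^^ j) ` {u..v}" "b \<in> (\<phi> ^^ j) ` {u..v}"
          unfolding a_def b_def min_def max_def using uv(3) by auto
        ultimately have sub: "{a..b} \<subseteq> (\<phi> ^^ j) ` {u..v}" by (rule connected_contains_Icc)
        have "h (arc I a) = h (arc I b)"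
        proof (rule const)
          show "a \<le> b" unfolding a_def b_def by simp
          show "{a..b} \<subseteq> T" using sub phi_iter_T uvT by blast
          fix w assume "w \<in> {a..b}"
          then obtain z where z: "z \<in> {u..v}" "w = (\<phi> ^^ j) z" using sub by blast
          show "arc I w \<notin> E"
          proof
            assume "arc I w \<in> E"
            then have "z \<in> G" using z uvW j unfolding G_def Ej_def by auto
            then show False using em z(1) by blast
          qed
        qed
        then have "h (arc I ((\<phi> ^^ j) u)) = h (arc I ((\<phi> ^^ j) v))"
          unfolding a_def b_def min_def max_def by (auto split: if_splits)
        moreover have "x \<in> X" "y \<in> X" using xy(1,2) S(1) by auto
        ultimately show ?thesis using orb xy(3,4) by simp
      qed
      then have "name f h (p * n) x = name f h (p * n) y" unfolding name_eq_iff by blast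
      then have "x = y" using inj xy(1,2) by (auto simp: inj_on_def)
      then show False using uv(3) xy by simp
    qed
  qed
  then show ?thesis using cG card_image[OF inj\<theta>] by linarith
qed

end

text \<open>The sum over all words of the products is the product of the sums over the letters, each
  at most 1; \<open>inj\<close> lets points stand for their words.\<close>

lemma sum_prod_kernel:
  fixes \<kappa> :: "'b \<Rightarrow> 'c \<Rightarrow> real" and n :: nat
  assumes P: "finite P" and nn: "\<And>A B. 0 \<le> \<kappa> A B" and one: "\<And>B. B \<in> P' \<Longrightarrow> (\<Sum>A\<in>P. \<kappa> A B) \<le> 1"
    and S: "finite S" and c: "\<And>x i. x \<in> S \<Longrightarrow> i < n \<Longrightarrow> c i x \<in> P" and s: "\<And>i. i < n \<Longrightarrow> s i \<in> P'"
    and inj: "\<And>x y. x \<in> S \<Longrightarrow> y \<in> S \<Longrightarrow> (\<And>i. i < n \<Longrightarrow> c i x = c i y) \<Longrightarrow> x = y"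
  shows "(\<Sum>x\<in>S. \<Prod>i<n. \<kappa> (c i x) (s i)) \<le> 1"
proof -
  define h where "h x = (\<lambda>i\<in>{..<n}. c i x)" for x
  have inj_h: "inj_on h S"
  proof (rule inj_onI)
    fix x y assume xy: "x \<in> S" "y \<in> S" "h x = h y"
    have "c i x = c i y" if "i < n" for i using fun_cong[OF xy(3), of i] that unfolding h_def by simp
    then show "x = y" using inj xy by blast
  qed
  have "(\<Sum>x\<in>S. \<Prod>i<n. \<kappa> (c i x) (s i)) = (\<Sum>w\<in>h ` S. \<Prod>i<n. \<kappa> (w i) (s i))"
    unfolding sum.reindex[OF inj_h] by (simp add: h_def)
  also have "\<dots> \<le> (\<Sum>w\<in>PiE {..<n} (\<lambda>_. P). \<Prod>i<n. \<kappa> (w i) (s i))"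
  proof (rule sum_mono2)
    show "finite (PiE {..<n} (\<lambda>_. P))" using P by (intro finite_PiE) auto
    show "h ` S \<subseteq> PiE {..<n} (\<lambda>_. P)" using c unfolding h_def by (intro image_subsetI restrict_PiE[THEN iffD2]) auto
  qed (auto intro!: prod_nonneg nn)
  also have "\<dots> = (\<Prod>i<n. \<Sum>A\<in>P. \<kappa> A (s i))" by (rule prod_sum_PiE[symmetric]) (use P in auto)
  also have "\<dots> \<le> (\<Prod>i<n. 1)"
  proof (rule prod_mono)
    fix i assume "i \<in> {..<n}"
    then show "0 \<le> (\<Sum>A\<in>P. \<kappa> A (s i)) \<and> (\<Sum>A\<in>P. \<kappa> A (s i)) \<le> 1" using one s nn by (auto intro!: sum_nonneg)
  qed
  finally show ?thesis by simp
qed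

context entropy_block
begin

text \<open>The weights of Gibbs' inequality combine those of the pieces with a Markov kernel
  \<open>\<kappa>\<close> that corrects a name with respect to an interval partition into one with respect to
  \<open>P\<close>.\<close>

lemma entropy_bound:
  assumes freq: "\<And>n0. \<exists>n\<ge>n0. (\<Sum>l<n. measure \<mu> (Good (l * m))) \<le> \<gamma> * real n"
  shows "metric_entropy f \<mu> \<le> ereal (ln (4 * K) / real p + \<beta> * ln M0 + ln (real R) / (real m * real p) * \<gamma>)"
    (is "_ \<le> ereal ?c")
proof (rule metric_entropy_le)
  fix P and d :: real
  assume P: "finite P" "P \<subseteq> sets \<mu>" "partition_on (space \<mu>) P" and d: "0 < d"
  define k where "k = real (card P)"
  have "P \<noteq> {}" using P(3) not_empty unfolding partition_on_def by auto
  then have k: "1 \<le> k" unfolding k_def using P(1) by (simp add: card_gt_0_iff Suc_leI)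
  \<comment> \<open>Keeping a symbol costs \<open>- ln (1 - \<eta>) = d / 4\<close>, correcting one
    costs \<open>L\<close>, and errors occur with probability at most \<open>d / (4 * L)\<close>.
    Correction thus adds at most \<open>d / 2\<close> per step on average; the other
    \<open>d / 2\<close> is left for counting names.\<close>
  define \<eta> where "\<eta> = 1 - exp (- d / 4)"
  have \<eta>: "0 < \<eta>" "\<eta> < 1" unfolding \<eta>_def using d by auto
  define L where "L = ln (k / \<eta>)"
  have kL: "1 < k / \<eta>" using k \<eta> by (simp add: field_simps)
  then have L: "0 < L" unfolding L_def using k \<eta> by (subst ln_gt_zero_iff) auto
  define \<kappa> where "\<kappa> A B = (if A = B then 1 - \<eta> else \<eta> / k)" for A B :: "'a set"
  have \<kappa>0: "0 < \<kappa> A B" for A B unfolding \<kappa>_def using \<eta> k by simp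
  have \<kappa>1: "(\<Sum>A\<in>P. \<kappa> A B) \<le> 1" if "B \<in> P" for B
  proof -
    have "(\<Sum>A\<in>P. \<kappa> A B) \<le> (\<Sum>A\<in>P. (if A = B then 1 - \<eta> else 0) + \<eta> / k)"
      unfolding \<kappa>_def using \<eta> k by (intro sum_mono) auto
    also have "\<dots> = (1 - \<eta>) + k * (\<eta> / k)" using P(1) that by (simp add: sum.distrib k_def)
    finally show ?thesis using k by simp
  qed
  obtain h E N where h: "\<And>x. h x \<in> P" and N: "N \<in> sets \<mu>" "measure \<mu> N \<le> d / (4 * L)"
    and mis: "\<And>x. x \<in> X \<Longrightarrow> cell P x \<noteq> h x \<Longrightarrow> x \<in> N" and E: "finite E"
    and const: "\<And>s t. s \<le> t \<Longrightarrow> {s..t} \<subseteq> T \<Longrightarrow> (\<And>w. w \<in> {s..t} \<Longrightarrow> arc I w \<notin> E) \<Longrightarrow> h (arc I s) = h (arc I t)"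
    by (rule interval_partition_approx[OF P, of "d / (4 * L)"]) (use d L in auto)
  define b where "b = nat \<lfloor>real (card E) * (M0 ^ p + 2)\<rfloor>"
  obtain n1 where n1: "\<And>n. n1 \<le> n \<Longrightarrow> ln ((real (card R0) + 1) * (real b * real n + 1)) \<le> d / 2 * real n"
    by (rule ln_affine_sublinear[of "real (card R0) + 1" "real b" "d / 2"]) (use d in auto)
  \<comment> \<open>\<open>n\<close> is so large that the logarithm of the linear count of names is
    negligible, and it is a time up to which good block times are rare on average.\<close>
  obtain n where n: "max 1 n1 \<le> n" "(\<Sum>l<n. measure \<mu> (Good (l * m))) \<le> \<gamma> * real n" using freq by blast
  define Nn where "Nn = p * (n * m)"
  have nN: "n \<le> Nn" "0 < Nn"
    unfolding Nn_def using p m n(1) by auto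
  have K1: "0 < (real (card R0) + 1) * (real b * real Nn + 1)" by (intro mult_pos_pos add_nonneg_pos) auto
  define xh where "xh = (\<lambda>x. d / 4 + L * indicator N x)"
  define l where "l x = lw n x + (\<Sum>j<Nn. xh ((f ^^ j) x))" for x
  define u where "u x = weight n (\<theta> x) * (\<Prod>j<Nn. \<kappa> (cell P ((f ^^ j) x)) (h ((f ^^ j) x)))" for x
  define \<Omega> where "\<Omega> = {x\<in>X. \<theta> x \<in> reg (n * m) \<and> (\<forall>j. (f ^^ j) x \<notin> E)}"
  have "AE x in \<mu>. \<forall>j. (f ^^ j) x \<notin> E"
    unfolding AE_all_countable using E by (intro allI iter_AE countable_null countable_finite) auto
  with reg_AE[of "n * m"] AE_space have \<Omega>: "AE x in \<mu>. x \<in> \<Omega>"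
    by eventually_elim (auto simp: \<Omega>_def mu_space)
  have disc: "discrete_rv \<mu> (cell P)" by (rule cell_discrete[OF P(3,1,2)])
  have xh_int: "integrable \<mu> xh" unfolding xh_def using N(1)
    by (intro Bochner_Integration.integrable_add integrable_mult_right) (auto simp: emeasure_eq_measure)
  have "ent \<mu> (name f (cell P) Nn) \<le> (\<integral>x. l x \<partial>\<mu>) + ln ((real (card R0) + 1) * (real b * real Nn + 1))"
  proof (rule gibbs[OF name_discrete[OF disc] \<Omega>, where u = u])
    fix x assume x: "x \<in> \<Omega>"
    then have xX: "x \<in> X" and rg: "\<theta> x \<in> reg (n * m)" unfolding \<Omega>_def by auto
    have wp: "0 < weight n (\<theta> x)" by (rule neg_ln_weight(1)[OF xX rg])
    have pp: "0 < (\<Prod>j<Nn. \<kappa> (cell P ((f ^^ j) x)) (h ((f ^^ j) x)))" using \<kappa>0 by (intro prod_pos) auto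
    show "0 < u x" unfolding u_def using wp pp by simp
    have "ln (\<Prod>j<Nn. \<kappa> (cell P ((f ^^ j) x)) (h ((f ^^ j) x))) = (\<Sum>j<Nn. ln (\<kappa> (cell P ((f ^^ j) x)) (h ((f ^^ j) x))))"
      using \<kappa>0 by (intro ln_prod) (auto simp: less_imp_neq[symmetric])
    moreover have "- ln (\<kappa> (cell P y) (h y)) \<le> xh y" if y: "y \<in> X" for y
    proof (cases "cell P y = h y")
      case True
      then show ?thesis unfolding \<kappa>_def \<eta>_def xh_def using L by (simp add: indicator_def)
    next
      case False
      then have "y \<in> N" using mis[OF y] by blast
      moreover have "- ln (\<eta> / k) = L" unfolding L_def using \<eta> k by (simp add: ln_div)
      ultimately show ?thesis unfolding \<kappa>_def xh_def using False d by simp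
    qed
    then have "(\<Sum>j<Nn. - ln (\<kappa> (cell P ((f ^^ j) x)) (h ((f ^^ j) x)))) \<le> (\<Sum>j<Nn. xh ((f ^^ j) x))"
      using f_iter_X[OF xX] by (intro sum_mono) auto
    ultimately have "- ln (\<Prod>j<Nn. \<kappa> (cell P ((f ^^ j) x)) (h ((f ^^ j) x))) \<le> (\<Sum>j<Nn. xh ((f ^^ j) x))"
      by (simp add: sum_negf)
    then show "- ln (u x) \<le> l x"
      unfolding u_def l_def using neg_ln_weight(2)[OF xX rg] wp pp by (simp add: ln_mult_pos)
  next
    show "integrable \<mu> l" unfolding l_def using lw_integrable iter_integrable[OF xh_int]
      by (intro Bochner_Integration.integrable_add Bochner_Integration.integrable_sum) auto
    show "0 < (real (card R0) + 1) * (real b * real Nn + 1)" by (rule K1)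
    fix S assume S: "finite S" "S \<subseteq> \<Omega> \<inter> space \<mu>" "inj_on (name f (cell P) Nn) S"
    have SX: "S \<subseteq> X" "\<And>x. x \<in> S \<Longrightarrow> \<theta> x \<in> reg (n * m)" "\<And>x j. x \<in> S \<Longrightarrow> (f ^^ j) x \<notin> E"
      using S(2) unfolding \<Omega>_def by auto
    \<comment> \<open>Two nested groupings: points with a common \<open>h\<close>-name are summed by
      the kernel; representatives of different names are grouped by pieces, each of which contains
      only linearly many of them.\<close>
    have "(\<Sum>x\<in>S. weight n (\<theta> x) * (\<Prod>j<Nn. \<kappa> (cell P ((f ^^ j) x)) (h ((f ^^ j) x))))
        \<le> ((real (card R0) + 1) * (real b * real Nn + 1)) * 1"
    proof (rule sum_group_le[where c = "name f h Nn"])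
      fix S1 assume S1: "S1 \<subseteq> S" "inj_on (name f h Nn) S1"
      have fS1: "finite S1" using S1 S(1) finite_subset by blast
      show "(\<Sum>x\<in>S1. weight n (\<theta> x)) \<le> (real (card R0) + 1) * (real b * real Nn + 1)"
      proof (rule sum_group_card_le[where c = "\<lambda>x. W (n * m) (\<theta> x)", OF fS1])
        fix S2 assume S2: "S2 \<subseteq> S1" "inj_on (\<lambda>x. W (n * m) (\<theta> x)) S2"
        have S2S: "S2 \<subseteq> S" using S1 S2 by blast
        have inj: "inj_on \<theta> S2" using S2(2) by (auto simp: inj_on_def)
        have "(\<Sum>x\<in>S2. weight n (\<theta> x)) = (\<Sum>t\<in>\<theta> ` S2. weight n t)" using inj by (simp add: sum.reindex)
        also have "\<dots> \<le> real (card R0) + 1"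
        proof (rule weight_sum)
          show "finite (\<theta> ` S2)" using fS1 S2(1) finite_subset by blast
          show rg: "\<theta> ` S2 \<subseteq> reg (n * m)" using S2S SX(2) by blast
          show "distinct_at (n * m) (\<theta> ` S2)"
            by (rule distinct_at_inj[OF rg]) (use S2(2) in \<open>auto simp: inj_on_def\<close>)
        qed
        finally show "(\<Sum>x\<in>S2. weight n (\<theta> x)) \<le> real (card R0) + 1" .
      next
        fix x0 assume x0: "x0 \<in> S1"
        have "card {x\<in>S1. W (n * m) (\<theta> x) = W (n * m) (\<theta> x0)} \<le> p * (n * m) * nat \<lfloor>real (card E) * (M0 ^ p + 2)\<rfloor> + 1"
        proof (rule node_names[OF E, of h _ "n * m" "\<theta> x0", OF const])
          show "{x\<in>S1. W (n * m) (\<theta> x) = W (n * m) (\<theta> x0)} \<subseteq> X" using S1(1) SX(1) by blast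
          show "inj_on (name f h (p * (n * m))) {x\<in>S1. W (n * m) (\<theta> x) = W (n * m) (\<theta> x0)}"
            using S1(2) unfolding Nn_def by (rule inj_on_subset) auto
          fix x assume x: "x \<in> {x\<in>S1. W (n * m) (\<theta> x) = W (n * m) (\<theta> x0)}"
          then show "\<theta> x \<in> W (n * m) (\<theta> x0)" using W_self[OF SX(2)] S1(1) by auto
          show "(f ^^ j) x \<notin> E" for j using x SX(3) S1(1) by blast
        qed
        then have "card {x\<in>S1. W (n * m) (\<theta> x) = W (n * m) (\<theta> x0)} \<le> Nn * b + 1" unfolding Nn_def b_def .
        then have "real (card {x\<in>S1. W (n * m) (\<theta> x) = W (n * m) (\<theta> x0)}) \<le> real (Nn * b + 1)" by (rule of_nat_mono)
        then show "real (card {x\<in>S1. W (n * m) (\<theta> x) = W (n * m) (\<theta> x0)}) \<le> real b * real Nn + 1"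
          by (simp add: mult.commute)
      qed (auto simp: weight_nonneg)
    next
      fix x0 assume x0: "x0 \<in> S"
      define S1 where "S1 = {x\<in>S. name f h Nn x = name f h Nn x0}"
      have "(\<Sum>x\<in>S1. \<Prod>j<Nn. \<kappa> (cell P ((f ^^ j) x)) (h ((f ^^ j) x))) =
          (\<Sum>x\<in>S1. \<Prod>j<Nn. \<kappa> (cell P ((f ^^ j) x)) (h ((f ^^ j) x0)))"
        by (intro sum.cong prod.cong refl) (auto simp: S1_def name_eq_iff)
      also have "\<dots> \<le> 1"
      proof (rule sum_prod_kernel[where P' = P and P = P])
        show "finite S1" unfolding S1_def using S(1) by simp
        show "cell P ((f ^^ j) x) \<in> P" if "x \<in> S1" for x j
          using cell(1)[OF P(3), of "(f ^^ j) x"] f_iter_X[of x j] that SX(1) unfolding S1_def mu_space by blast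
        fix x y assume xy: "x \<in> S1" "y \<in> S1" "\<And>i. i < Nn \<Longrightarrow> cell P ((f ^^ i) x) = cell P ((f ^^ i) y)"
        then have "name f (cell P) Nn x = name f (cell P) Nn y" unfolding name_eq_iff by blast
        then show "x = y" using S(3) xy(1,2) unfolding S1_def inj_on_def by blast
      qed (use \<kappa>0 \<kappa>1 P h in \<open>auto intro: less_imp_le\<close>)
      finally show "(\<Sum>x | x \<in> S \<and> name f h Nn x = name f h Nn x0. \<Prod>j<Nn. \<kappa> (cell P ((f ^^ j) x)) (h ((f ^^ j) x))) \<le> 1"
        unfolding S1_def .
    qed (auto simp: S weight_nonneg intro!: prod_nonneg less_imp_le[OF \<kappa>0])
    then show "(\<Sum>x\<in>S. u x) \<le> (real (card R0) + 1) * (real b * real Nn + 1)" unfolding u_def by simp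
  qed
  also have "(\<integral>x. l x \<partial>\<mu>) = (\<integral>x. lw n x \<partial>\<mu>) + (\<Sum>j<Nn. \<integral>x. xh ((f ^^ j) x) \<partial>\<mu>)"
    unfolding l_def using lw_integrable iter_integrable[OF xh_int]
    by (subst Bochner_Integration.integral_add) (auto simp: Bochner_Integration.integral_sum)
  also have "(\<Sum>j<Nn. \<integral>x. xh ((f ^^ j) x) \<partial>\<mu>) \<le> (\<Sum>j<Nn. d / 2)"
  proof (rule sum_mono)
    fix j
    have "(\<integral>x. xh ((f ^^ j) x) \<partial>\<mu>) = (\<integral>x. xh x \<partial>\<mu>)"
      by (rule iter_integral) (use xh_int in auto)
    also have "\<dots> = d / 4 + L * measure \<mu> N"
      unfolding xh_def using N(1) by (subst Bochner_Integration.integral_add) (auto simp: emeasure_eq_measure prob_space)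
    also have "\<dots> \<le> d / 4 + L * (d / (4 * L))" using N(2) L by (intro add_left_mono mult_left_mono) auto
    also have "\<dots> = d / 2" using L by simp
    finally show "(\<integral>x. xh ((f ^^ j) x) \<partial>\<mu>) \<le> d / 2" .
  qed
  also have "(\<Sum>j<Nn. d / 2) = d / 2 * real Nn" by simp
  also have "ln ((real (card R0) + 1) * (real b * real Nn + 1)) \<le> d / 2 * real Nn" using n1 n(1) nN(1) by simp
  also have "(\<integral>x. lw n x \<partial>\<mu>) \<le> real n * real m * (ln (4 * K) + \<beta> * (real p * ln M0)) + ln (real R) * (\<gamma> * real n)"
    by (rule order_trans[OF lw_integral add_left_mono[OF mult_left_mono[OF n(2)]]]) (use R_pos in simp)
  finally have "ent \<mu> (name f (cell P) Nn) \<le> real n * real m * (ln (4 * K) + \<beta> * (real p * ln M0))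
      + ln (real R) * (\<gamma> * real n) + d * real Nn" by simp
  also have "\<dots> = real Nn * (?c + d)"
    unfolding Nn_def using p m by (simp add: field_simps)
  finally show "\<exists>n>0. ent \<mu> (name f (cell P) n) \<le> real n * (?c + d)" using nN(2) by blast
qed

end

section \<open>Densities on good pieces\<close>

lemma step_approx:
  fixes m :: "real measure" and h :: "real \<Rightarrow> real"
  assumes m: "finite_measure m" "sets m = sets borel" and h: "integrable m h" and d: "0 < d"
  shows "\<exists>E \<rho>. finite E \<and> integrable m \<rho> \<and>
    (\<forall>s t. closed_segment s t \<inter> E = {} \<longrightarrow> \<rho> s = (\<rho> t :: real)) \<and> (\<integral>t. \<bar>h t - \<rho> t\<bar> \<partial>m) \<le> d"
  using h d
proof (induction arbitrary: d rule: integrable_induct)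
  case (base A c)
  interpret finite_measure m by (rule m(1))
  have A: "A \<in> sets borel" using base m by simp
  define d' where "d' = d / (\<bar>c\<bar> + 1)"
  have d': "0 < d'" unfolding d'_def using base by simp
  obtain U E where UE: "finite E" "U \<in> sets borel" "measure m ((A - U) \<union> (U - A)) \<le> d'"
    "\<And>s t. closed_segment s t \<inter> E = {} \<Longrightarrow> (s \<in> U \<longleftrightarrow> t \<in> U)"
    by (rule borel_real_approx[OF m A d']) (rule that)
  have S: "(A - U) \<union> (U - A) \<in> sets m" using A UE(2) m(2) by auto
  have "(\<integral>t. \<bar>indicator A t *\<^sub>R c - indicator U t *\<^sub>R c\<bar> \<partial>m) = (\<integral>t. \<bar>c\<bar> * indicator ((A - U) \<union> (U - A)) t \<partial>m)"
    by (intro Bochner_Integration.integral_cong) (auto simp: indicator_def)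
  also have "\<dots> = \<bar>c\<bar> * measure m ((A - U) \<union> (U - A))" using S by simp
  also have "\<dots> \<le> \<bar>c\<bar> * d'" using UE(3) by (intro mult_left_mono) auto
  also have "\<dots> \<le> d" unfolding d'_def using base by (simp add: field_simps)
  finally have "(\<integral>t. \<bar>indicator A t *\<^sub>R c - indicator U t *\<^sub>R c\<bar> \<partial>m) \<le> d" .
  moreover have "integrable m (\<lambda>t. indicator U t *\<^sub>R c)"
    using UE(2) m(2) by (intro integrable_scaleR_left) (auto simp: emeasure_eq_measure)
  ultimately show ?case using UE(1,4)
    by (intro exI[of _ E] exI[of _ "\<lambda>t. indicator U t *\<^sub>R c"]) (auto simp: indicator_def)
next
  case (add f g)
  obtain E1 \<rho>1 where 1: "finite E1" "integrable m \<rho>1" "\<And>s t. closed_segment s t \<inter> E1 = {} \<Longrightarrow> \<rho>1 s = \<rho>1 t"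
    "(\<integral>t. \<bar>f t - \<rho>1 t\<bar> \<partial>m) \<le> d / 2"
    using add.IH(1)[of "d / 2"] add.prems by auto
  obtain E2 \<rho>2 where 2: "finite E2" "integrable m \<rho>2" "\<And>s t. closed_segment s t \<inter> E2 = {} \<Longrightarrow> \<rho>2 s = \<rho>2 t"
    "(\<integral>t. \<bar>g t - \<rho>2 t\<bar> \<partial>m) \<le> d / 2"
    using add.IH(2)[of "d / 2"] add.prems by auto
  have "(\<integral>t. \<bar>f t + g t - (\<rho>1 t + \<rho>2 t)\<bar> \<partial>m) \<le> (\<integral>t. \<bar>f t - \<rho>1 t\<bar> + \<bar>g t - \<rho>2 t\<bar> \<partial>m)"
    using add.hyps 1(2) 2(2) by (intro integral_mono) auto
  also have "\<dots> = (\<integral>t. \<bar>f t - \<rho>1 t\<bar> \<partial>m) + (\<integral>t. \<bar>g t - \<rho>2 t\<bar> \<partial>m)"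
    using add.hyps 1(2) 2(2) by (intro Bochner_Integration.integral_add) auto
  finally have le: "(\<integral>t. \<bar>f t + g t - (\<rho>1 t + \<rho>2 t)\<bar> \<partial>m) \<le> d" using 1(4) 2(4) by linarith
  have "\<rho>1 s + \<rho>2 s = \<rho>1 t + \<rho>2 t" if "closed_segment s t \<inter> (E1 \<union> E2) = {}" for s t
    using 1(3)[of s t] 2(3)[of s t] that by (simp add: Int_Un_distrib)
  then show ?case using 1(1,2) 2(1,2) le
    by (intro exI[of _ "E1 \<union> E2"] exI[of _ "\<lambda>t. \<rho>1 t + \<rho>2 t"]) auto
next
  case (lim f s)
  have "(\<lambda>i. \<integral>t. \<bar>f t - s i t\<bar> \<partial>m) \<longlonglongrightarrow> (\<integral>t. 0 \<partial>m)"
  proof (rule integral_dominated_convergence[where w = "\<lambda>t. 3 * \<bar>f t\<bar>"])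
    show "integrable m (\<lambda>t. 3 * \<bar>f t\<bar>)" using lim.hyps by auto
    show "(\<lambda>t. \<bar>f t - s i t\<bar>) \<in> borel_measurable m" for i using lim.hyps by auto
    show "AE t in m. (\<lambda>i. \<bar>f t - s i t\<bar>) \<longlonglongrightarrow> 0"
    proof (rule AE_I2)
      fix t assume "t \<in> space m"
      then have "(\<lambda>i. s i t) \<longlonglongrightarrow> f t" by (rule lim.hyps)
      then have "(\<lambda>i. \<bar>f t - s i t\<bar>) \<longlonglongrightarrow> \<bar>f t - f t\<bar>" by (intro tendsto_intros)
      then show "(\<lambda>i. \<bar>f t - s i t\<bar>) \<longlonglongrightarrow> 0" by simp
    qed
    show "AE t in m. norm (\<bar>f t - s i t\<bar>) \<le> 3 * \<bar>f t\<bar>" for i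
    proof (rule AE_I2)
      fix t assume "t \<in> space m"
      then have "norm (s i t) \<le> 2 * norm (f t)" by (rule lim.hyps)
      then show "norm (\<bar>f t - s i t\<bar>) \<le> 3 * \<bar>f t\<bar>" by simp
    qed
  qed simp
  then have "\<forall>\<^sub>F i in sequentially. (\<integral>t. \<bar>f t - s i t\<bar> \<partial>m) < d / 2"
    using lim.prems by (intro order_tendstoD(2)) auto
  then obtain i where i: "(\<integral>t. \<bar>f t - s i t\<bar> \<partial>m) < d / 2" by (auto simp: eventually_sequentially)
  obtain E \<rho> where E: "finite E" "integrable m \<rho>" "\<And>s t. closed_segment s t \<inter> E = {} \<Longrightarrow> \<rho> s = \<rho> t"
    "(\<integral>t. \<bar>s i t - \<rho> t\<bar> \<partial>m) \<le> d / 2"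
    using lim.IH[of "d / 2" i] lim.prems by auto
  have "(\<integral>t. \<bar>f t - \<rho> t\<bar> \<partial>m) \<le> (\<integral>t. \<bar>f t - s i t\<bar> + \<bar>s i t - \<rho> t\<bar> \<partial>m)"
    using lim.hyps E(2) by (intro integral_mono) auto
  also have "\<dots> = (\<integral>t. \<bar>f t - s i t\<bar> \<partial>m) + (\<integral>t. \<bar>s i t - \<rho> t\<bar> \<partial>m)"
    using lim.hyps E(2) by (intro Bochner_Integration.integral_add) auto
  finally have "(\<integral>t. \<bar>f t - \<rho> t\<bar> \<partial>m) \<le> d" using i E(4) by linarith
  then show ?case using E(1-3) by blast
qed

lemma connected_real_convex: "connected (S :: real set) \<Longrightarrow> convex S"
  using is_interval_connected_1 is_interval_convex_1 by blast

lemma len_le_measure: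
  fixes S :: "real set"
  assumes "convex S" "bounded S" "S \<noteq> {}"
  shows "len S \<le> measure lebesgue S"
proof -
  have bb: "bdd_below S" "bdd_above S" using assms(2) bounded_imp_bdd_below bounded_imp_bdd_above by auto
  have "{Inf S<..<Sup S} \<subseteq> S"
  proof
    fix x assume x: "x \<in> {Inf S<..<Sup S}"
    obtain y where y: "y \<in> S" "y < x" using x cInf_less_iff[OF assms(3) bb(1)] by auto
    obtain z where z: "z \<in> S" "x < z" using x less_cSup_iff[OF assms(3) bb(2)] by auto
    have "x \<in> closed_segment y z" using y z by (simp add: closed_segment_eq_real_ivl)
    then show "x \<in> S" using closed_segment_subset[OF y(1) z(1) assms(1)] by blast
  qed
  then have "measure lebesgue {Inf S<..<Sup S} \<le> measure lebesgue S"
    using measurable_convex[OF assms(1,2)] by (intro measure_mono_fmeasurable) auto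
  then have le: "measure lebesgue {Inf S<..<Sup S} \<le> measure lebesgue S" .
  show ?thesis
  proof (cases "Inf S \<le> Sup S")
    case True then show ?thesis using le by (simp add: len_def)
  next
    case False
    then have "len S \<le> 0" by (simp add: len_def)
    also have "0 \<le> measure lebesgue S" by simp
    finally show ?thesis .
  qed
qed

text \<open>Change of variables for the indicator of \<open>B\<close>, with the Jacobian bounded
  below by \<open>k\<close>.\<close>

lemma image_measure_ge:
  fixes g g' :: "real \<Rightarrow> real"
  assumes S: "convex S" "bounded S" and d: "\<And>x. x \<in> S \<Longrightarrow> (g has_real_derivative g' x) (at x within S)"
    and inj: "inj_on g S" and k: "\<And>x. x \<in> S \<Longrightarrow> k \<le> \<bar>g' x\<bar>" "0 \<le> k"
    and bd: "bounded (g ` S)" and B: "B \<in> sets borel"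
  shows "k * measure lebesgue (S \<inter> g -` B) \<le> measure lebesgue (g ` S \<inter> B)"
proof -
  have cont: "continuous_on S g" using d DERIV_continuous continuous_on_eq_continuous_within by blast
  have Sm: "S \<in> lmeasurable" using S by (rule measurable_convex)
  have "connected (g ` S)" using cont S(1) by (intro connected_continuous_image convex_connected)
  then have "convex (g ` S)" by (rule connected_real_convex)
  then have gSm: "g ` S \<in> lmeasurable" using bd by (rule measurable_convex)
  have Bl: "B \<in> sets lebesgue" using B by (simp add: sets_completionI_sets)
  have gB: "g ` S \<inter> B \<in> lmeasurable" using gSm Bl by (rule fmeasurable_Int_fmeasurable)
  have Sb: "S \<in> sets borel" using S(1) by (simp add: is_interval_convex_1 real_interval_borel_measurable)
  have "g \<in> borel_measurable (restrict_space borel S)" using cont by (rule borel_measurable_continuous_on_restrict)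
  from measurable_sets[OF this B] have "S \<inter> g -` B \<in> sets borel"
    using Sb by (auto simp: sets_restrict_space_iff space_restrict_space Int_commute)
  then have SB: "S \<inter> g -` B \<in> lmeasurable"
    using Sm by (metis Int_lower1 fmeasurableI2 sets_completionI_sets sets_lborel)
  define F where "F = (indicator B :: real \<Rightarrow> real)"
  have absF: "F absolutely_integrable_on (g ` S)"
    unfolding F_def set_integrable_def using gB
    by (simp add: indicator_inter_arith[symmetric] lmeasurable_iff_integrable)
  have intF: "integral (g ` S) F = measure lebesgue (g ` S \<inter> B)"
    using set_lebesgue_integral_eq_integral(2)[OF absF] gB
    by (simp add: F_def set_lebesgue_integral_def indicator_inter_arith[symmetric] fmeasurable_def)
  have cv: "(\<lambda>x. \<bar>g' x\<bar> * F (g x)) absolutely_integrable_on S \<and>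
      integral S (\<lambda>x. \<bar>g' x\<bar> * F (g x)) = measure lebesgue (g ` S \<inter> B)"
    using has_absolute_integral_change_of_variables_1'[OF _ d inj, of F "measure lebesgue (g ` S \<inter> B)"]
      absF intF Sm by (auto simp: fmeasurableD)
  have absk: "(\<lambda>x. k * F (g x)) absolutely_integrable_on S"
  proof -
    have "(\<lambda>x. indicator S x *\<^sub>R (k * F (g x))) = (\<lambda>x. k * indicator (S \<inter> g -` B) x)"
      by (auto simp: F_def indicator_def)
    then show ?thesis unfolding set_integrable_def using SB by (simp add: lmeasurable_iff_integrable)
  qed
  have "k * measure lebesgue (S \<inter> g -` B) = integral S (\<lambda>x. k * F (g x))"
  proof -
    have "(\<lambda>x. indicator S x *\<^sub>R (k * F (g x))) = (\<lambda>x. k * indicator (S \<inter> g -` B) x)"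
      by (auto simp: F_def indicator_def)
    then show ?thesis unfolding set_lebesgue_integral_eq_integral(2)[OF absk, symmetric] set_lebesgue_integral_def
      using SB by (simp add: fmeasurable_def)
  qed
  also have "\<dots> \<le> integral S (\<lambda>x. \<bar>g' x\<bar> * F (g x))"
    using absk cv k by (intro integral_le set_lebesgue_integral_eq_integral(1)) (auto simp: F_def indicator_def)
  finally show ?thesis using cv by simp
qed

context entropy_block
begin

lemma leb_finite: "emeasure (leb I) B < \<infinity>"
proof -
  have X: "X \<in> sets (restrict_space borel X)" unfolding X_sets using X_borel by simp
  have sp: "space (leb I) = X" using sets_eq_imp_space_eq[OF leb_sets] by (simp add: space_restrict_space)
  have "emeasure (leb I) B \<le> emeasure (leb I) (space (leb I))" by (rule emeasure_space)
  also have "\<dots> = emeasure lborel {t\<in>T0. arc I t \<in> X}" unfolding sp by (rule leb_eq[OF X])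
  also have "{t\<in>T0. arc I t \<in> X} = T0" using arc_T T0_T by auto
  also have "emeasure lborel T0 < \<infinity>" using T0_bounded by (rule emeasure_bounded_finite)
  finally show ?thesis .
qed

text \<open>On a good piece of length \<open>l\<close> the derivative is at least
  \<open>r / (exp 1 * l)\<close>, so the preimage of \<open>B\<close> is at most
  \<open>exp 1 * l / r\<close> times as long as the part of \<open>B\<close> seen in the image. The
  image lies in a window of length 1, where the parametrisation contributes the factor 2.\<close>

lemma node_density:
  assumes g: "good r n t" and B: "B \<in> sets \<mu>"
  shows "measure lebesgue (W n t \<inter> ((\<phi> ^^ p) ^^ n) -` {s\<in>T. arc I s \<in> B})
    \<le> 2 * exp 1 / r * measure (leb I) B * measure lebesgue (W n t)"
proof -
  define S where "S = W n t"
  define h where "h = (\<phi> ^^ p) ^^ n"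
  have t: "t \<in> reg n" "t \<in> S" using g W_self unfolding good_def S_def by auto
  have S: "convex S" "bounded S" unfolding S_def by (rule convex_W, rule bounded_W)
  have ST: "S \<subseteq> T" unfolding S_def using W_T by auto
  have B': "B \<in> sets (restrict_space borel X)" using B mu_sets by simp
  define l where "l = len S"
  have l0: "0 < l"
  proof -
    obtain y z where yz: "y \<in> S" "z \<in> S" "r \<le> \<bar>h y - h z\<bar>" using g unfolding good_def S_def h_def by auto
    then have "y \<noteq> z" using r(1) by auto
    then show ?thesis using len_ge[OF S(2) yz(1,2)] unfolding l_def by auto
  qed
  define k where "k = r / (exp 1 * l)"
  have k: "0 < k" unfolding k_def using r(1) l0 by simp
  have Dk: "k \<le> \<bar>D n x\<bar>" if x: "x \<in> S" for x
  proof -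
    have "W n x = S" "x \<in> reg n" using W_eq W_reg x unfolding S_def by auto
    then have "good r n x" using g unfolding good_def S_def by simp
    from good_D_ge[OF this] have "r \<le> exp 1 * \<bar>D n x\<bar> * l" unfolding l_def using \<open>W n x = S\<close> by simp
    then show ?thesis unfolding k_def using l0 by (simp add: pos_divide_le_eq mult.commute mult.left_commute)
  qed
  define a where "a = Inf (h ` S)"
  have hb: "\<bar>h y - h z\<bar> \<le> 1" if "y \<in> S" "z \<in> S" for y z
    using image_bound that unfolding S_def h_def by blast
  have bd: "bounded (h ` S)"
  proof -
    have "h ` S \<subseteq> cball (h t) 1" using hb t(2) by (auto simp: dist_real_def)
    then show ?thesis using bounded_cball bounded_subset by blast
  qed
  have "h ` S \<subseteq> {a..a + 1}"
  proof
    fix w assume w: "w \<in> h ` S"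
    have "a \<le> w" unfolding a_def using w bd by (intro cInf_lower bounded_imp_bdd_below)
    moreover have "w - 1 \<le> a" unfolding a_def using w hb by (intro cInf_greatest) (force simp: abs_le_iff)+
    ultimately show "w \<in> {a..a + 1}" by auto
  qed
  have Bt: "{s\<in>T. arc I s \<in> B} \<in> sets borel"
  proof -
    have "arc I \<in> borel_measurable (restrict_space borel T)" using arc_cont by (rule borel_measurable_continuous_on_restrict)
    moreover have "B \<in> sets borel" using B' X_sets by auto
    ultimately have "arc I -` B \<inter> space (restrict_space borel T) \<in> sets (restrict_space borel T)" by (rule measurable_sets)
    then show ?thesis using T_borel by (auto simp: sets_restrict_space_iff space_restrict_space vimage_def Int_def conj_commute)
  qed
  define C where "C = {a..a + 1} \<inter> {s\<in>T. arc I s \<in> B}"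
  have Cb: "C \<in> sets borel" unfolding C_def using Bt by auto
  have hT: "h s \<in> T" if "s \<in> S" for s using iter_T[of s n] that ST unfolding h_def by blast
  have eq: "S \<inter> h -` {s\<in>T. arc I s \<in> B} = S \<inter> h -` C"
    unfolding C_def using \<open>h ` S \<subseteq> {a..a + 1}\<close> by auto
  have le1: "k * measure lebesgue (S \<inter> h -` C) \<le> measure lebesgue (h ` S \<inter> C)"
  proof (rule image_measure_ge[OF S _ _ Dk less_imp_le[OF k] bd Cb])
    show "(h has_real_derivative D n x) (at x within S)" if "x \<in> S" for x
      using has_field_derivative_subset[OF iter_deriv ST] ST that unfolding h_def by blast
    show "inj_on h S" unfolding h_def S_def by (rule iter_inj[OF convex_W])
  qed
  have le2: "measure lebesgue (h ` S \<inter> C) \<le> 2 * measure (leb I) B"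
  proof -
    have Cm: "C \<in> lmeasurable"
    proof -
      have "bounded C" unfolding C_def by (rule bounded_subset[of "{a..a+1}"]) auto
      then show ?thesis using Cb by (simp add: bounded_set_imp_lmeasurable sets_completionI_sets)
    qed
    have "measure lebesgue (h ` S \<inter> C) \<le> measure lebesgue C"
    proof (rule measure_mono_fmeasurable)
      have "connected (h ` S)"
      proof (intro connected_continuous_image convex_connected S(1))
        show "continuous_on S h" unfolding h_def F_iter using phi_iter_cont ST by (rule continuous_on_subset)
      qed
      then have "convex (h ` S)" by (rule connected_real_convex)
      then have "h ` S \<in> lmeasurable" using bd by (rule measurable_convex)
      then show "h ` S \<inter> C \<in> sets lebesgue" using Cm by (auto simp: fmeasurableD)
    qed (use Cm in auto)
    also have "\<dots> = measure lborel C" using Cb by (simp add: measure_completion)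
    also have "\<dots> = enn2real (emeasure lborel C)" by (simp add: measure_def)
    also have "\<dots> \<le> enn2real (2 * emeasure (leb I) B)"
    proof (rule enn2real_mono)
      have "h t \<in> {a..a + 1} \<inter> T" using \<open>h ` S \<subseteq> {a..a + 1}\<close> t(2) hT by auto
      then show "emeasure lborel C \<le> 2 * emeasure (leb I) B" unfolding C_def using leb_local[OF B'] by blast
      show "2 * emeasure (leb I) B < top" using leb_finite[of B] by (simp add: ennreal_mult_less_top)
    qed
    also have "\<dots> = 2 * measure (leb I) B" by (simp add: measure_def enn2real_mult)
    finally show ?thesis .
  qed
  have "k * measure lebesgue (S \<inter> h -` {s\<in>T. arc I s \<in> B}) \<le> 2 * measure (leb I) B"
    unfolding eq using le1 le2 by linarith
  then have "measure lebesgue (S \<inter> h -` {s\<in>T. arc I s \<in> B}) \<le> 2 * measure (leb I) B / k"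
    using k by (simp add: pos_le_divide_eq mult.commute)
  also have "\<dots> = 2 * exp 1 / r * measure (leb I) B * l" unfolding k_def using r(1) l0 by (simp add: field_simps)
  also have "\<dots> \<le> 2 * exp 1 / r * measure (leb I) B * measure lebesgue S"
    unfolding l_def using r(1) t(2) by (intro mult_left_mono len_le_measure S) auto
  finally show ?thesis unfolding S_def h_def .
qed

text \<open>The law of \<open>\<theta>\<close> has only an integrable density, which may oscillate
  inside a piece. It is compared with a step density that is constant on every gap of
  \<open>R0\<close>, so that \<open>node_density\<close> applies piece by piece. The error
  \<open>\<eta>\<close> is the same for all Borel sets and is paid once, however many pieces and
  iterations there are.\<close>

lemma good_density:
  assumes \<rho>: "\<rho> \<in> borel_measurable borel" "\<And>t. 0 \<le> \<rho> t"
    and const: "\<And>s t. closed_segment s t \<inter> R0 = {} \<Longrightarrow> \<rho> s = \<rho> t"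
    and tot: "emeasure (density lborel (\<lambda>t. ennreal (\<rho> t) * indicator T0 t)) UNIV \<le> ennreal (1 + \<eta>)"
    and le: "\<And>C. C \<in> sets borel \<Longrightarrow>
      measure \<mu> {x\<in>X. \<theta> x \<in> C} \<le> measure (density lborel (\<lambda>t. ennreal (\<rho> t) * indicator T0 t)) C + \<eta>"
    and \<eta>: "0 \<le> \<eta>" and B: "B \<in> sets \<mu>"
  shows "measure \<mu> {x\<in>Good n. (f ^^ (p * n)) x \<in> B} \<le> \<eta> + (1 + \<eta>) * (2 * exp 1 / r * measure (leb I) B)"
proof -
  define N where "N = density lborel (\<lambda>t. ennreal (\<rho> t) * indicator T0 t)"
  define h where "h = (\<phi> ^^ p) ^^ n"
  define Bt where "Bt = {s\<in>T. arc I s \<in> B}"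
  define \<F> where "\<F> = W n ` {t. good r n t}"
  define c where "c = 2 * exp 1 / r * measure (leb I) B"
  have c0: "0 \<le> c" unfolding c_def using r(1) by simp
  have Nsets: "sets N = sets borel" unfolding N_def by simp
  have Bb: "B \<in> sets borel" using B mu_sets X_sets by auto
  have Btb: "Bt \<in> sets borel"
  proof -
    have "arc I \<in> borel_measurable (restrict_space borel T)" using arc_cont by (rule borel_measurable_continuous_on_restrict)
    then have "arc I -` B \<inter> space (restrict_space borel T) \<in> sets (restrict_space borel T)" using Bb by (rule measurable_sets)
    then show ?thesis unfolding Bt_def using T_borel by (auto simp: sets_restrict_space_iff space_restrict_space vimage_def Int_def conj_commute)
  qed
  have Wb: "W n t \<in> sets borel" for t
    using convex_W by (simp add: is_interval_convex_1 real_interval_borel_measurable)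
  have WhB: "W n t \<inter> h -` Bt \<in> sets borel" for t
  proof -
    have "continuous_on (W n t) h" unfolding h_def F_iter
      by (rule continuous_on_subset[OF phi_iter_cont]) (use W_T in auto)
    then have "h \<in> borel_measurable (restrict_space borel (W n t))" by (rule borel_measurable_continuous_on_restrict)
    from measurable_sets[OF this Btb] show ?thesis
      using Wb by (auto simp: sets_restrict_space_iff space_restrict_space Int_commute)
  qed
  have cF: "countable \<F>" and disj: "\<And>S S'. S \<in> \<F> \<Longrightarrow> S' \<in> \<F> \<Longrightarrow> S \<noteq> S' \<Longrightarrow> S \<inter> S' = {}"
  proof -
    show dis: "S \<inter> S' = {}" if "S \<in> \<F>" "S' \<in> \<F>" "S \<noteq> S'" for S S'
      using that W_eq unfolding \<F>_def by blast
    show "countable \<F>"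
    proof (rule countable_disjoint_nonempty_interior_subsets)
      show "pairwise disjnt \<F>" using dis by (auto simp: pairwise_def disjnt_def)
      fix S assume "S \<in> \<F>" "interior S = {}"
      then show "S = {}" using good_interior unfolding \<F>_def by blast
    qed
  qed
  have piece: "emeasure N (S \<inter> h -` Bt) \<le> ennreal c * emeasure N S" if S: "S \<in> \<F>" for S
  proof -
    from S obtain t where t: "good r n t" "S = W n t" unfolding \<F>_def by auto
    have tS: "t \<in> S" using t W_self unfolding good_def by auto
    have ST0: "S \<subseteq> T0" unfolding t(2) by (rule W_T0)
    have val: "emeasure N C = ennreal (\<rho> t) * emeasure lborel C" if C: "C \<subseteq> S" "C \<in> sets borel" for C
    proof -
      have "emeasure N C = (\<integral>\<^sup>+s. ennreal (\<rho> s) * indicator T0 s * indicator C s \<partial>lborel)"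
        unfolding N_def using \<rho>(1) T0_borel C(2) by (subst emeasure_density) auto
      also have "\<dots> = (\<integral>\<^sup>+s. ennreal (\<rho> t) * indicator C s \<partial>lborel)"
      proof (rule nn_integral_cong)
        fix s
        show "ennreal (\<rho> s) * indicator T0 s * indicator C s = ennreal (\<rho> t) * indicator C s"
        proof (cases "s \<in> C")
          case True
          then have s: "s \<in> W n t" "s \<in> T0" using C(1) ST0 unfolding t(2) by auto
          \<comment> \<open>A piece lies in a single gap of \<open>R0\<close>, where the step
            density is constant.\<close>
          then have "s \<in> W 0 t" using W_antimono[of 0 n t] by blast
          then have "\<rho> t = \<rho> s" by (intro const) simp
          then show ?thesis using True s by simp
        qed simp
      qed
      also have "\<dots> = ennreal (\<rho> t) * emeasure lborel C" using C(2) by (simp add: nn_integral_cmult_indicator)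
      finally show ?thesis .
    qed
    have fin: "emeasure lborel C < \<infinity>" if "C \<subseteq> S" for C
      by (rule emeasure_bounded_finite) (use that ST0 T0_bounded bounded_subset in blast)
    have "measure lebesgue (S \<inter> h -` Bt) \<le> c * measure lebesgue S"
      unfolding t(2) h_def Bt_def c_def by (rule node_density[OF t(1) B])
    then have "measure lborel (S \<inter> h -` Bt) \<le> c * measure lborel S"
      using Wb WhB unfolding t(2) by (simp add: measure_completion)
    moreover have "emeasure lborel C = ennreal (measure lborel C)" if "C \<subseteq> S" for C
      using fin[OF that] by (simp add: emeasure_eq_ennreal_measure less_top)
    ultimately have "emeasure lborel (S \<inter> h -` Bt) \<le> ennreal c * emeasure lborel S"
      using c0 by (simp add: ennreal_mult[symmetric] ennreal_leI)
    then have "ennreal (\<rho> t) * emeasure lborel (S \<inter> h -` Bt) \<le> ennreal (\<rho> t) * (ennreal c * emeasure lborel S)"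
      by (rule mult_left_mono) simp
    then show ?thesis using val[of S] val[of "S \<inter> h -` Bt"] Wb WhB unfolding t(2)
      by (simp add: mult.left_commute)
  qed
  have Fb: "S \<in> sets N" "S \<inter> h -` Bt \<in> sets N" if "S \<in> \<F>" for S
    using that Wb WhB unfolding \<F>_def Nsets by auto
  define Y where "Y = (\<Union>S\<in>\<F>. S \<inter> h -` Bt)"
  have Yb: "Y \<in> sets borel" unfolding Y_def
    by (rule sets.countable_UN'[OF cF]) (use Fb(2) Nsets in auto)
  have "emeasure N Y = (\<integral>\<^sup>+S. emeasure N (S \<inter> h -` Bt) \<partial>count_space \<F>)"
    unfolding Y_def using Fb(2) cF disj by (intro emeasure_UN_countable) (auto simp: disjoint_family_on_def)
  also have "\<dots> \<le> (\<integral>\<^sup>+S. ennreal c * emeasure N S \<partial>count_space \<F>)"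
    using piece by (intro nn_integral_mono) auto
  also have "\<dots> = ennreal c * (\<integral>\<^sup>+S. emeasure N S \<partial>count_space \<F>)"
    by (rule nn_integral_cmult) simp
  also have "(\<integral>\<^sup>+S. emeasure N S \<partial>count_space \<F>) = emeasure N (\<Union>S\<in>\<F>. S)"
    using Fb(1) cF disj by (intro emeasure_UN_countable[symmetric]) (auto simp: disjoint_family_on_def)
  also have "\<dots> \<le> emeasure N UNIV" using Nsets by (intro emeasure_mono) auto
  also have "\<dots> \<le> ennreal (1 + \<eta>)" unfolding N_def by (rule tot)
  finally have "emeasure N Y \<le> ennreal c * ennreal (1 + \<eta>)" by (simp add: mult_left_mono)
  then have "emeasure N Y \<le> ennreal (c * (1 + \<eta>))" using c0 \<eta> by (simp add: ennreal_mult)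
  then have NY: "measure N Y \<le> (1 + \<eta>) * c"
    using c0 \<eta> by (simp add: measure_def enn2real_leI mult.commute)
  have "{x\<in>Good n. (f ^^ (p * n)) x \<in> B} \<subseteq> {x\<in>X. \<theta> x \<in> Y}"
  proof
    fix x assume x: "x \<in> {x\<in>Good n. (f ^^ (p * n)) x \<in> B}"
    then have xX: "x \<in> X" and g: "good r n (\<theta> x)" unfolding Good_def by auto
    have "\<theta> x \<in> W n (\<theta> x)" using g W_self unfolding good_def by auto
    moreover have "h (\<theta> x) \<in> Bt"
      unfolding h_def F_iter Bt_def using phi_iter_T[OF \<theta>_T[OF xX]] phi_iter_arc[OF \<theta>_T[OF xX]] \<theta>(2)[OF xX] x by simp
    ultimately show "x \<in> {x\<in>X. \<theta> x \<in> Y}" unfolding Y_def \<F>_def using g xX by auto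
  qed
  moreover have "{x\<in>X. \<theta> x \<in> Y} \<in> sets \<mu>"
    using measurable_sets[OF theta_mu Yb] by (simp add: vimage_def Int_def mu_space conj_commute)
  ultimately have "measure \<mu> {x\<in>Good n. (f ^^ (p * n)) x \<in> B} \<le> measure \<mu> {x\<in>X. \<theta> x \<in> Y}"
    by (rule finite_measure_mono)
  also have "\<dots> \<le> measure N Y + \<eta>" unfolding N_def by (rule le[OF Yb])
  finally show ?thesis using NY unfolding c_def by linarith
qed

definition expanding :: "nat \<Rightarrow> 'a set" where
  "expanding j = {x\<in>X. exp (- 2) * r * 2 ^ j \<le> (\<Prod>i<p * j. ad ((f ^^ i) x))}"

lemma abs_D_eq:
  assumes "t \<in> T" shows "\<bar>D j t\<bar> = (\<Prod>i<p * j. ad ((f ^^ i) (arc I t)))"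
proof -
  have "\<bar>D j t\<bar> = (\<Prod>k<j. \<Prod>i<p. ad ((f ^^ (i + k * p)) (arc I t)))"
  proof -
    have "\<bar>D j t\<bar> = (\<Prod>k<j. \<bar>F' (((\<phi> ^^ p) ^^ k) t)\<bar>)" by (simp add: D_def abs_prod)
    also have "\<dots> = (\<Prod>k<j. \<Prod>i<p. ad ((f ^^ (i + k * p)) (arc I t)))"
    proof (rule prod.cong[OF refl])
      fix k
      have "(\<phi> ^^ i) (((\<phi> ^^ p) ^^ k) t) = (\<phi> ^^ (i + k * p)) t" for i
        unfolding F_iter by (simp add: funpow_add mult.commute)
      then have "\<bar>F' (((\<phi> ^^ p) ^^ k) t)\<bar> = (\<Prod>i<p. \<bar>\<phi>' ((\<phi> ^^ (i + k * p)) t)\<bar>)"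
        unfolding Fd abs_prod by simp
      also have "\<dots> = (\<Prod>i<p. ad ((f ^^ (i + k * p)) (arc I t)))"
        using phi_ad[OF phi_iter_T[OF assms]] phi_iter_arc[OF assms] by simp
      finally show "\<bar>F' (((\<phi> ^^ p) ^^ k) t)\<bar> = (\<Prod>i<p. ad ((f ^^ (i + k * p)) (arc I t)))" .
    qed
    finally show ?thesis .
  qed
  also have "\<dots> = (\<Prod>k<j. \<Prod>i\<in>{k * p..<k * p + p}. ad ((f ^^ i) (arc I t)))"
  proof (rule prod.cong[OF refl])
    fix k
    show "(\<Prod>i<p. ad ((f ^^ (i + k * p)) (arc I t))) = (\<Prod>i\<in>{k * p..<k * p + p}. ad ((f ^^ i) (arc I t)))"
      using prod.shift_bounds_nat_ivl[of "\<lambda>i. ad ((f ^^ i) (arc I t))" 0 "k * p" p]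
      by (simp add: lessThan_atLeast0 add.commute)
  qed
  also have "\<dots> = (\<Prod>i<j * p. ad ((f ^^ i) (arc I t)))" by (rule prod.nat_group)
  finally show ?thesis by (simp add: mult.commute)
qed

lemma expanding_meas: "expanding j \<in> sets \<mu>"
proof -
  have "(\<lambda>x. \<Prod>i<p * j. ad ((f ^^ i) x)) \<in> borel_measurable \<mu>"
    by (intro borel_measurable_prod measurable_compose[OF iter_meas ad_meas_mu])
  then have "{x\<in>space \<mu>. exp (- 2) * r * 2 ^ j \<le> (\<Prod>i<p * j. ad ((f ^^ i) x))} \<in> sets \<mu>" by simp
  then show ?thesis unfolding expanding_def mu_space .
qed

text \<open>A point that is good at time \<open>i + j\<close> reaches \<open>expanding j\<close>
  after \<open>i\<close> steps of \<open>F\<close>, and invariance removes \<open>i\<close>.\<close>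

lemma Good_expanding: "measure \<mu> (Good (i + j)) \<le> measure \<mu> (expanding j)"
proof -
  have "Good (i + j) \<subseteq> {x\<in>space \<mu>. (f ^^ (p * i)) x \<in> expanding j}"
  proof
    fix x assume "x \<in> Good (i + j)"
    then have x: "x \<in> X" "good r (i + j) (\<theta> x)" unfolding Good_def by auto
    define t where "t = ((\<phi> ^^ p) ^^ i) (\<theta> x)"
    have t: "t \<in> T" "arc I t = (f ^^ (p * i)) x"
      unfolding t_def F_iter using phi_iter_T[OF \<theta>_T[OF x(1)]] phi_iter_arc[OF \<theta>_T[OF x(1)]] \<theta>(2)[OF x(1)] by auto
    have "exp (- 2) * r * 2 ^ j \<le> \<bar>D j t\<bar>" unfolding t_def by (rule good_expansion[OF x(2) r(1)])
    then have "(f ^^ (p * i)) x \<in> expanding j"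
      unfolding expanding_def abs_D_eq[OF t(1)] t(2) using f_iter_X[OF x(1)] by simp
    then show "x \<in> {x\<in>space \<mu>. (f ^^ (p * i)) x \<in> expanding j}" using x(1) mu_space by simp
  qed
  moreover have "{x\<in>space \<mu>. (f ^^ (p * i)) x \<in> expanding j} \<in> sets \<mu>" using expanding_meas by simp
  ultimately have "measure \<mu> (Good (i + j)) \<le> measure \<mu> {x\<in>space \<mu>. (f ^^ (p * i)) x \<in> expanding j}"
    by (rule finite_measure_mono)
  then show ?thesis using iter_measure[OF expanding_meas] by simp
qed

lemma many_good:
  assumes "ereal (ln (4 * K) / real p + \<beta> * ln M0 + ln (real R) / (real m * real p) * \<gamma>) < metric_entropy f \<mu>"
  obtains n0 where "\<And>n. n0 \<le> n \<Longrightarrow> \<gamma> * real n < (\<Sum>l<n. measure \<mu> (Good (l * m)))"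
proof -
  have "\<not> (\<forall>n0. \<exists>n\<ge>n0. (\<Sum>l<n. measure \<mu> (Good (l * m))) \<le> \<gamma> * real n)"
    using entropy_bound[of \<gamma>] assms by (auto simp: not_le[symmetric])
  then obtain n0 where "\<forall>n\<ge>n0. \<gamma> * real n < (\<Sum>l<n. measure \<mu> (Good (l * m)))"
    by (meson not_le)
  then show thesis using that by blast
qed

text \<open>Good block times have average frequency above \<open>\<gamma>\<close>, and from index
  \<open>j\<close> on each set \<open>Good (l * m)\<close> has at most the measure of
  \<open>expanding j\<close>. The first \<open>j\<close> indices do not affect the average.\<close>

lemma expanding_measure:
  assumes "ereal (ln (4 * K) / real p + \<beta> * ln M0 + ln (real R) / (real m * real p) * \<gamma>) < metric_entropy f \<mu>"
  shows "\<gamma> \<le> measure \<mu> (expanding j)"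
proof (rule ccontr)
  assume c: "\<not> \<gamma> \<le> measure \<mu> (expanding j)"
  define \<zeta> where "\<zeta> = measure \<mu> (expanding j)"
  have lt: "\<zeta> < \<gamma>" using c unfolding \<zeta>_def by simp
  obtain n0 where n0: "\<And>n. n0 \<le> n \<Longrightarrow> \<gamma> * real n < (\<Sum>l<n. measure \<mu> (Good (l * m)))"
    using many_good[OF assms] by blast
  have small: "measure \<mu> (Good (l * m)) \<le> \<zeta>" if "j \<le> l" for l
  proof -
    have "j \<le> l * m" using that m by (metis dual_order.trans le_numeral_extra(4) mult.right_neutral mult_le_mono Suc_leI One_nat_def)
    then have "l * m = (l * m - j) + j" by simp
    then show ?thesis using Good_expanding[of "l * m - j" j] unfolding \<zeta>_def by simp
  qed
  obtain k :: nat where k: "real j / (\<gamma> - \<zeta>) \<le> real k" using real_arch_simple by blast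
  define n where "n = max (max n0 j) k"
  have "\<gamma> * real n < (\<Sum>l<n. measure \<mu> (Good (l * m)))" using n0[of n] unfolding n_def by simp
  also have "\<dots> \<le> (\<Sum>l<n. \<zeta> + (if l < j then 1 else 0))"
  proof (rule sum_mono)
    fix l
    show "measure \<mu> (Good (l * m)) \<le> \<zeta> + (if l < j then 1 else 0)"
    proof (cases "l < j")
      case True
      have "measure \<mu> (Good (l * m)) \<le> 1" "0 \<le> \<zeta>" unfolding \<zeta>_def by auto
      then show ?thesis using True by (simp only: if_True)
    next
      case False then show ?thesis using small[of l] by simp
    qed
  qed
  also have "\<dots> = \<zeta> * real n + real (card {l. l < n \<and> l < j})"
    by (simp add: sum.distrib sum.If_cases lessThan_def Int_def)
  also have "card {l. l < n \<and> l < j} \<le> card {..<j}" by (intro card_mono) auto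
  finally have "\<gamma> * real n < \<zeta> * real n + real j" by simp
  then have "(\<gamma> - \<zeta>) * real n < real j" by (simp add: algebra_simps)
  moreover have "real j \<le> (\<gamma> - \<zeta>) * real n"
  proof -
    have "real j \<le> (\<gamma> - \<zeta>) * real k" using k lt by (simp add: pos_divide_le_eq mult.commute)
    also have "\<dots> \<le> (\<gamma> - \<zeta>) * real n" unfolding n_def using lt by (intro mult_left_mono) auto
    finally show ?thesis .
  qed
  ultimately show False by simp
qed

text \<open>By invariance \<open>B\<close> can be replaced by its preimage at any time: the good
  part of the preimage is bounded by \<open>b\<close>, the rest by the probability of being bad.
  Averaging over the block times replaces that probability by \<open>1 - \<gamma>\<close>.\<close>

lemma measure_density_bound:
  assumes ent: "ereal (ln (4 * K) / real p + \<beta> * ln M0 + ln (real R) / (real m * real p) * \<gamma>) < metric_entropy f \<mu>"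
    and dens: "\<And>n. measure \<mu> {x\<in>Good n. (f ^^ (p * n)) x \<in> B} \<le> b" and B: "B \<in> sets \<mu>"
  shows "measure \<mu> B \<le> 1 - \<gamma> + b"
proof -
  obtain n0 where n0: "\<And>n. n0 \<le> n \<Longrightarrow> \<gamma> * real n < (\<Sum>l<n. measure \<mu> (Good (l * m)))"
    using many_good[OF ent] by blast
  define n where "n = Suc n0"
  have le: "measure \<mu> B \<le> 1 - measure \<mu> (Good k) + b" for k
  proof -
    define C where "C = {x\<in>space \<mu>. (f ^^ (p * k)) x \<in> B}"
    have C: "C \<in> sets \<mu>" unfolding C_def using B by simp
    have GC: "{x\<in>Good k. (f ^^ (p * k)) x \<in> B} = Good k \<inter> C"
      unfolding C_def using sets.sets_into_space[OF Good_meas[of k]] by auto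
    have "measure \<mu> B = measure \<mu> C" unfolding C_def by (rule iter_measure[OF B, symmetric])
    also have "\<dots> \<le> measure \<mu> ((space \<mu> - Good k) \<union> (Good k \<inter> C))"
      using C Good_meas[of k] sets.sets_into_space[OF C] by (intro finite_measure_mono) auto
    also have "\<dots> \<le> measure \<mu> (space \<mu> - Good k) + measure \<mu> (Good k \<inter> C)"
      using C Good_meas[of k] by (intro measure_Un_le) auto
    also have "measure \<mu> (space \<mu> - Good k) = 1 - measure \<mu> (Good k)" using Good_meas by (rule prob_compl)
    also have "measure \<mu> (Good k \<inter> C) \<le> b" using dens[of k] unfolding GC .
    finally show ?thesis by simp
  qed
  have "real n * measure \<mu> B \<le> (\<Sum>l<n. 1 - measure \<mu> (Good (l * m)) + b)"
    using sum_mono[of "{..<n}" "\<lambda>_. measure \<mu> B" "\<lambda>l. 1 - measure \<mu> (Good (l * m)) + b", OF le] by simp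
  also have "\<dots> = real n * (1 + b) - (\<Sum>l<n. measure \<mu> (Good (l * m)))"
    by (simp add: sum.distrib sum_subtractf algebra_simps)
  also have "\<dots> \<le> real n * (1 + b) - \<gamma> * real n" using n0[of n] unfolding n_def by simp
  also have "\<dots> = real n * (1 - \<gamma> + b)" by (simp add: algebra_simps)
  finally show ?thesis unfolding n_def by (simp add: mult_le_cancel_left_pos)
qed

end

section \<open>Both estimates for a single map\<close>

context lifted
begin

text \<open>The Radon-Nikodym density of the law of \<open>\<theta>\<close> is approximated in the
  mean by a step function. The error is then uniform over all Borel sets, as
  \<open>good_density\<close> requires, because the set to which it is applied varies with the
  time.\<close>

lemma density_step:
  assumes \<eta>: "0 < \<eta>"
  obtains E \<rho> where "finite E" "\<rho> \<in> borel_measurable borel" "\<And>t. 0 \<le> \<rho> t"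
    "\<And>s t. closed_segment s t \<inter> E = {} \<Longrightarrow> \<rho> s = (\<rho> t :: real)"
    "emeasure (density lborel (\<lambda>t. ennreal (\<rho> t) * indicator T0 t)) UNIV \<le> ennreal (1 + \<eta>)"
    "\<And>C. C \<in> sets borel \<Longrightarrow>
      measure \<mu> {x\<in>X. \<theta> x \<in> C} \<le> measure (density lborel (\<lambda>t. ennreal (\<rho> t) * indicator T0 t)) C + \<eta>"
proof -
  define m where "m = density lborel (indicator T0 :: real \<Rightarrow> ennreal)"
  define mm where "mm = distr \<mu> borel \<theta>"
  have em: "emeasure m C = emeasure lborel (T0 \<inter> C)" if "C \<in> sets borel" for C
    unfolding m_def using that T0_borel by (simp add: emeasure_density nn_integral_indicator indicator_inter_arith[symmetric])
  have msets: "sets m = sets borel" "space m = UNIV" unfolding m_def by simp_all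
  interpret m: finite_measure m
  proof
    have "emeasure m UNIV = emeasure lborel T0" using em[of UNIV] by simp
    also have "\<dots> < \<infinity>" using T0_bounded by (rule emeasure_bounded_finite)
    finally show "emeasure m (space m) \<noteq> \<infinity>" using msets by simp
  qed
  interpret mm: finite_measure mm unfolding mm_def by (rule finite_measure_distr) simp
  have mm_eq: "emeasure mm C = emeasure \<mu> {x\<in>X. \<theta> x \<in> C}" if "C \<in> sets borel" for C
    unfolding mm_def using that by (subst emeasure_distr) (auto simp: mu_space vimage_def Int_def conj_commute)
  have ac': "absolutely_continuous m mm"
    unfolding absolutely_continuous_def
  proof
    fix C assume C: "C \<in> null_sets m"
    then have "C \<in> sets m" "emeasure m C = 0" by auto
    then have Cb: "C \<in> sets borel" and z: "emeasure lborel (T0 \<inter> C) = 0" using msets em[of C] by auto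
    define B where "B = {x\<in>X. \<theta> x \<in> C}"
    have Bm: "B \<in> sets \<mu>"
      unfolding B_def using measurable_sets[OF theta_mu Cb] by (simp add: vimage_def Int_def mu_space conj_commute)
    then have Bs: "B \<in> sets (restrict_space borel X)" using mu_sets by simp
    have "{t\<in>T0. arc I t \<in> B} = T0 \<inter> C" unfolding B_def using \<theta>(3) arc_T T0_T by auto
    then have "emeasure (leb I) B = 0" using leb_eq[OF Bs] z by simp
    then have "B \<in> null_sets (leb I)" using Bs leb_sets by auto
    then have "B \<in> null_sets \<mu>" using ac unfolding absolutely_continuous_def by blast
    then have "emeasure mm C = 0" unfolding mm_eq[OF Cb] B_def[symmetric] by (rule null_setsD1)
    then show "C \<in> null_sets mm" by (rule null_setsI) (simp add: mm_def Cb)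
  qed
  obtain D where D: "D \<in> borel_measurable m" "AE x in m. RN_deriv m mm x = ennreal (D x)" "\<And>x. 0 \<le> D x"
  proof (rule m.real_RN_deriv[OF mm.finite_measure_axioms ac'])
    show "sets mm = sets m" unfolding mm_def msets by simp
  qed (rule that)
  have dens: "mm = density m (\<lambda>x. ennreal (D x))"
  proof -
    have "density m (RN_deriv m mm) = mm" using ac' msets by (intro m.density_RN_deriv) (auto simp: mm_def)
    moreover have "density m (RN_deriv m mm) = density m (\<lambda>x. ennreal (D x))"
      using D(1,2) by (intro density_cong) auto
    ultimately show ?thesis by simp
  qed
  have mmD: "emeasure mm C = (\<integral>\<^sup>+x. ennreal (D x * indicator C x) \<partial>m)" if "C \<in> sets borel" for C
  proof -
    have "emeasure mm C = (\<integral>\<^sup>+x. ennreal (D x) * indicator C x \<partial>m)"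
      unfolding dens using D(1) that msets by (subst emeasure_density) auto
    also have "\<dots> = (\<integral>\<^sup>+x. ennreal (D x * indicator C x) \<partial>m)"
      by (intro nn_integral_cong) (simp add: indicator_def)
    finally show ?thesis .
  qed
  have one: "emeasure mm UNIV = 1" using mm_eq[of UNIV] emeasure_space_1 mu_space by simp
  have Dint: "integrable m D"
  proof (rule integrableI_nonneg)
    show "(\<integral>\<^sup>+x. ennreal (D x) \<partial>m) < \<infinity>" using mmD[of UNIV] one by simp
  qed (use D in auto)
  have D1: "(\<integral>x. D x \<partial>m) = 1"
    using mmD[of UNIV] one nn_integral_eq_integral[OF Dint] D(3) by simp
  obtain E \<rho>0 where E: "finite E" "integrable m \<rho>0" "\<And>s t. closed_segment s t \<inter> E = {} \<Longrightarrow> \<rho>0 s = \<rho>0 t"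
    "(\<integral>t. \<bar>D t - \<rho>0 t\<bar> \<partial>m) \<le> \<eta>"
    using step_approx[OF m.finite_measure_axioms msets(1) Dint \<eta>] by metis
  \<comment> \<open>Cutting off negative values only improves the approximation of a nonnegative
    density.\<close>
  define \<rho> where "\<rho> t = max 0 (\<rho>0 t)" for t
  have \<rho>0b: "\<rho>0 \<in> borel_measurable borel" using E(2) msets by (metis borel_measurable_integrable measurable_cong_sets)
  have \<rho>b: "\<rho> \<in> borel_measurable borel" unfolding \<rho>_def using \<rho>0b by simp
  have \<rho>i: "integrable m \<rho>" unfolding \<rho>_def using E(2) by simp
  have diff: "(\<integral>t. \<bar>D t - \<rho> t\<bar> \<partial>m) \<le> \<eta>"
  proof -
    have "(\<integral>t. \<bar>D t - \<rho> t\<bar> \<partial>m) \<le> (\<integral>t. \<bar>D t - \<rho>0 t\<bar> \<partial>m)"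
    proof (rule integral_mono)
      show "\<bar>D t - \<rho> t\<bar> \<le> \<bar>D t - \<rho>0 t\<bar>" for t using D(3)[of t] unfolding \<rho>_def by auto
    qed (use Dint \<rho>i E(2) in auto)
    then show ?thesis using E(4) by simp
  qed
  have N: "density lborel (\<lambda>t. ennreal (\<rho> t) * indicator T0 t) = density m (\<lambda>t. ennreal (\<rho> t))"
    unfolding m_def using \<rho>b T0_borel by (subst density_density_eq) (auto simp: mult.commute)
  have emN: "emeasure (density m (\<lambda>t. ennreal (\<rho> t))) C = ennreal (\<integral>t. \<rho> t * indicator C t \<partial>m)"
    if C: "C \<in> sets borel" for C
  proof -
    have "emeasure (density m (\<lambda>t. ennreal (\<rho> t))) C = (\<integral>\<^sup>+t. ennreal (\<rho> t) * indicator C t \<partial>m)"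
      using \<rho>i C msets by (subst emeasure_density) auto
    also have "\<dots> = (\<integral>\<^sup>+t. ennreal (\<rho> t * indicator C t) \<partial>m)"
      by (intro nn_integral_cong) (simp add: indicator_def)
    also have "\<dots> = ennreal (\<integral>t. \<rho> t * indicator C t \<partial>m)"
    proof (rule nn_integral_eq_integral)
      show "integrable m (\<lambda>t. \<rho> t * indicator C t)"
        by (rule integrable_real_mult_indicator) (use \<rho>i C msets in auto)
    qed (simp add: \<rho>_def)
    finally show ?thesis .
  qed
  have ii: "integrable m (\<lambda>t. h t * indicator C t)" if "integrable m h" "C \<in> sets borel" for h :: "real \<Rightarrow> real" and C
    using that msets by (intro integrable_real_mult_indicator) auto
  have cmp: "\<bar>(\<integral>t. D t * indicator C t \<partial>m) - (\<integral>t. \<rho> t * indicator C t \<partial>m)\<bar> \<le> \<eta>" if C: "C \<in> sets borel" for C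
  proof -
    have "\<bar>(\<integral>t. D t * indicator C t \<partial>m) - (\<integral>t. \<rho> t * indicator C t \<partial>m)\<bar> =
        \<bar>\<integral>t. D t * indicator C t - \<rho> t * indicator C t \<partial>m\<bar>"
      by (subst Bochner_Integration.integral_diff[OF ii[OF Dint C] ii[OF \<rho>i C]]) (rule refl)
    also have "\<dots> \<le> (\<integral>t. \<bar>D t * indicator C t - \<rho> t * indicator C t\<bar> \<partial>m)" by (rule integral_abs_bound)
    also have "\<dots> \<le> (\<integral>t. \<bar>D t - \<rho> t\<bar> \<partial>m)"
      using ii[OF Dint C] ii[OF \<rho>i C] Dint \<rho>i by (intro integral_mono) (auto simp: indicator_def)
    finally show ?thesis using diff by simp
  qed
  show thesis
  proof (rule that[OF E(1) \<rho>b])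
    show "0 \<le> \<rho> t" for t unfolding \<rho>_def by simp
    show "closed_segment s t \<inter> E = {} \<Longrightarrow> \<rho> s = \<rho> t" for s t unfolding \<rho>_def using E(3) by metis
    show "emeasure (density lborel (\<lambda>t. ennreal (\<rho> t) * indicator T0 t)) UNIV \<le> ennreal (1 + \<eta>)"
    proof -
      have "(\<integral>t. \<rho> t \<partial>m) \<le> 1 + \<eta>" using cmp[of UNIV] D1 by simp
      moreover have "emeasure (density m (\<lambda>t. ennreal (\<rho> t))) UNIV = ennreal (\<integral>t. \<rho> t \<partial>m)" using emN[of UNIV] by simp
      ultimately show ?thesis unfolding N by (simp only: ennreal_leI)
    qed
    fix C :: "real set" assume C: "C \<in> sets borel"
    have nn: "0 \<le> (\<integral>t. D t * indicator C t \<partial>m)" "0 \<le> (\<integral>t. \<rho> t * indicator C t \<partial>m)"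
      using D(3) by (auto intro!: integral_nonneg simp: \<rho>_def)
    have "emeasure \<mu> {x\<in>X. \<theta> x \<in> C} = ennreal (\<integral>t. D t * indicator C t \<partial>m)"
      using mm_eq[OF C] mmD[OF C] nn_integral_eq_integral[OF ii[OF Dint C]] D(3) by simp
    then have "measure \<mu> {x\<in>X. \<theta> x \<in> C} = (\<integral>t. D t * indicator C t \<partial>m)" using nn by (simp add: measure_def)
    moreover have "measure (density lborel (\<lambda>t. ennreal (\<rho> t) * indicator T0 t)) C = (\<integral>t. \<rho> t * indicator C t \<partial>m)"
      unfolding N measure_def emN[OF C] using nn by simp
    ultimately show "measure \<mu> {x\<in>X. \<theta> x \<in> C} \<le>
        measure (density lborel (\<lambda>t. ennreal (\<rho> t) * indicator T0 t)) C + \<eta>" using cmp[OF C] by linarith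
  qed
qed

lemma ln_abs_variation:
  assumes nz: "\<And>x. x \<in> {u..v} \<Longrightarrow> G x \<noteq> 0" and e: "0 < e"
    and d: "\<And>x. x \<in> {u..v} \<Longrightarrow> (G has_real_derivative G' x / e) (at x within {u..v})"
    and nc: "nearly_const e G G' u v" and x: "x \<in> {u..v}" and y: "y \<in> {u..v}"
  shows "\<bar>ln \<bar>G x\<bar> - ln \<bar>G y\<bar>\<bar> * (v - u) \<le> \<bar>x - y\<bar> / 4"
proof -
  \<comment> \<open>This is \<open>ln \<bar>G\<bar>\<close>, in a form that is differentiated
    without a case distinction on the sign of \<open>G\<close>.\<close>
  define h where "h x = ln ((G x)\<^sup>2) / 2" for x
  have hG: "h x = ln \<bar>G x\<bar>" if "x \<in> {u..v}" for x
  proof -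
    have "ln ((G x)\<^sup>2) = ln (\<bar>G x\<bar> ^ 2)" by simp
    also have "\<dots> = real 2 * ln \<bar>G x\<bar>" by (rule ln_realpow)
    finally show ?thesis unfolding h_def by simp
  qed
  have "(h has_real_derivative G' x / (e * G x)) (at x within {u..v})" if "x \<in> {u..v}" for x
  proof -
    have pos: "0 < (G x)\<^sup>2" using nz[OF that] by simp
    have "((\<lambda>x. (G x)\<^sup>2) has_real_derivative 2 * (G' x / e) * G x) (at x within {u..v})"
      using DERIV_power[OF d[OF that], of 2] by (simp add: mult.commute mult.left_commute)
    from DERIV_cdivide[OF DERIV_chain2[OF DERIV_ln[OF pos] this], of 2]
    have "(h has_real_derivative inverse ((G x)\<^sup>2) * (2 * (G' x / e) * G x) / 2) (at x within {u..v})"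
      unfolding h_def .
    moreover have "inverse ((G x)\<^sup>2) * (2 * (G' x / e) * G x) / 2 = G' x / (e * G x)"
      using nz[OF that] e by (simp add: power2_eq_square field_simps)
    ultimately show ?thesis by simp
  qed
  then obtain z where z: "z \<in> {u..v}" "h x - h y = G' z / (e * G z) * (x - y)"
    using mvt_within[of u v h "\<lambda>x. G' x / (e * G x)" y x] x y by metis
  have uv: "0 \<le> v - u" using x by auto
  have Gz: "0 < \<bar>G z\<bar>" using nz[OF z(1)] by simp
  have "(v - u) * \<bar>G' z\<bar> \<le> e / 4 * \<bar>G z\<bar>" using nc z(1) unfolding nearly_const_def by auto
  then have "(v - u) * \<bar>G' z\<bar> / (e * \<bar>G z\<bar>) \<le> 1 / 4" using e Gz by (simp add: pos_divide_le_eq)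
  then have "(v - u) * \<bar>G' z\<bar> / (e * \<bar>G z\<bar>) * \<bar>x - y\<bar> \<le> 1 / 4 * \<bar>x - y\<bar>" by (intro mult_right_mono) auto
  moreover have "\<bar>h x - h y\<bar> * (v - u) = (v - u) * \<bar>G' z\<bar> / (e * \<bar>G z\<bar>) * \<bar>x - y\<bar>"
    unfolding z(2) using e by (simp add: abs_mult)
  ultimately show ?thesis using hG x y by simp
qed

lemma abs_deriv_Prod_le:
  assumes "t \<in> T" shows "\<bar>\<Prod>i<p. \<phi>' ((\<phi> ^^ i) t)\<bar> \<le> M0 ^ p"
proof -
  have "\<bar>\<Prod>i<p. \<phi>' ((\<phi> ^^ i) t)\<bar> = (\<Prod>i<p. \<bar>\<phi>' ((\<phi> ^^ i) t)\<bar>)" by (rule abs_prod)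
  also have "\<dots> \<le> (\<Prod>i<p. M0)" using M0 phi_iter_T[OF assms] by (intro prod_mono) auto
  finally show ?thesis by simp
qed

lemma phi_iter_deriv:
  assumes "t \<in> T"
  shows "((\<phi> ^^ p) has_real_derivative (\<Prod>i<p. \<phi>' ((\<phi> ^^ i) t))) (at t within T)"
proof (induction p)
  case 0 then show ?case by (simp add: id_def)
next
  case (Suc n)
  have "(\<phi> has_real_derivative \<phi>' ((\<phi> ^^ n) t)) (at ((\<phi> ^^ n) t) within (\<phi> ^^ n) ` T)"
    by (rule has_field_derivative_subset[OF phi_deriv]) (use phi_iter_T assms in auto)
  from DERIV_image_chain[OF this Suc] show ?case by (simp add: mult.commute o_def)
qed

text \<open>The cut set of the step density enters only the initial cuts. Neither \<open>r\<close>
  nor the entropy threshold depends on it, so for each error in the density bound the construction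
  is repeated with a new cut set and the same constants.\<close>

lemma block_dichotomy:
  fixes g :: "nat \<Rightarrow> real \<Rightarrow> real" and cen :: "real \<Rightarrow> 'c"
  assumes p: "0 < p" and m: "0 < m" and e: "0 < e" "M0 ^ p * e \<le> 1"
    and g0: "g 0 = (\<lambda>t. \<Prod>i<p. \<phi>' ((\<phi> ^^ i) t))"
    and gd: "\<And>i t. i \<le> d \<Longrightarrow> t \<in> T \<Longrightarrow> (g i has_real_derivative g (Suc i) t / e) (at t within T)"
    and gb: "\<And>i t. i \<le> d \<Longrightarrow> t \<in> T \<Longrightarrow> \<bar>g (Suc i) t\<bar> \<le> 1"
    and R: "finite (cen ` T)" "card (cen ` T) \<le> R" "0 < R"
    and cen: "\<And>s t i. s \<in> T \<Longrightarrow> t \<in> T \<Longrightarrow> \<bar>s - t\<bar> \<le> 1 \<Longrightarrow> cen s = cen t \<Longrightarrow> i < m \<Longrightarrow>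
      \<bar>((\<phi> ^^ p) ^^ i) s - ((\<phi> ^^ p) ^^ i) t\<bar> \<le> e"
    and ent: "ereal (ln (4 * sep_bound d) / real p + 2 / (real d + 1) * ln M0 + ln (real R) / (real m * real p) * \<gamma>)
      < metric_entropy f \<mu>"
    and r: "r = e / (M0 ^ p) ^ m"
  shows "\<And>B. B \<in> sets \<mu> \<Longrightarrow> measure \<mu> B \<le> 1 - \<gamma> + 2 * exp 1 / r * measure (leb I) B"
    and "\<gamma> \<le> measure \<mu> {x\<in>X. exp (- 2) * r * 2 ^ j \<le> (\<Prod>i<p * j. ad ((f ^^ i) x))}"
proof -
  define K where "K = sep_bound d"
  define \<beta> where "\<beta> = 2 / (real d + 1)"
  \<comment> \<open>Over separated points of diameter at most \<open>e\<close> the numerators sum to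
    at most \<open>2 * K\<close>; the divisor \<open>4 * K\<close> makes this the 1/2 of
    \<open>qsum\<close>.\<close>
  define q where "q t = min 1 (\<bar>g 0 t\<bar> powr \<beta>) / (4 * K)" for t
  have K: "1 \<le> K" unfolding K_def by (rule sep_bound_ge1)
  have M1: "1 \<le> M0 ^ p" using M0(1) by (rule one_le_power)
  have Mpm: "0 < (M0 ^ p) ^ m" using M0(1) by simp
  obtain Z where Z: "countable (Z \<inter> {x. g 0 x \<noteq> 0})" "\<And>x. x \<in> T \<Longrightarrow> g 0 x = 0 \<Longrightarrow> x \<in> Z"
    "\<And>u v. u \<le> v \<Longrightarrow> {u..v} \<subseteq> T \<Longrightarrow> {u..v} \<inter> Z = {} \<Longrightarrow> nearly_const e (g 0) (g 1) u v \<and> v - u \<le> e"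
    "\<And>A. finite A \<Longrightarrow> A \<subseteq> T \<Longrightarrow> A \<inter> Z = {} \<Longrightarrow>
      (\<And>x y. x \<in> A \<Longrightarrow> y \<in> A \<Longrightarrow> \<bar>x - y\<bar> \<le> e) \<Longrightarrow>
      (\<And>x y. x \<in> A \<Longrightarrow> y \<in> A \<Longrightarrow> x < y \<Longrightarrow> {x..y} \<inter> Z \<noteq> {}) \<Longrightarrow>
      (\<Sum>x\<in>A. min 1 (\<bar>g 0 x\<bar> powr (2 / (real d + 1)))) \<le> 2 * sep_bound d"
    by (rule static_cuts[of T e d g, OF T_closed T_convex e(1) gd gb]) blast+
  obtain b where b0: "0 < b" "\<forall>x\<in>T0. norm x \<le> b" using T0_bounded unfolding bounded_pos by blast
  have "T0 \<subseteq> {-b..b}"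
  proof
    fix x assume "x \<in> T0"
    then have "\<bar>x\<bar> \<le> b" using b0(2) by simp
    then show "x \<in> {-b..b}" by (simp add: abs_le_iff)
  qed
  note b = b0(1) this
  have pre: "b - (-b) \<le> 2 * b" "(0::real) < 1" "-b \<le> b" using b(1) by auto
  obtain Gr where Gr: "finite Gr"
    "\<And>u v. -b \<le> u \<Longrightarrow> u \<le> v \<Longrightarrow> v \<le> b \<Longrightarrow> {u..v} \<inter> Gr = {} \<Longrightarrow> v - u \<le> 1"
    by (rule grid_exists[OF pre]) (rule that)
  \<comment> \<open>The grid \<open>Gr\<close> makes the initial pieces at most 1 long, and
    \<open>E\<close> is left open until the step density is known.\<close>
  have EB: "entropy_block I T0 \<mu> f \<phi> \<phi>' M0 (E \<union> Gr) Z (g 0) q e (M0 ^ p) m R r cen p K \<beta>"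
    if E: "finite E" for E
  proof unfold_locales
    show "finite (E \<union> Gr)" using E Gr(1) by simp
    show "\<bar>x - y\<bar> \<le> 1" if "x \<in> T0" "y \<in> T0" "closed_segment x y \<inter> (E \<union> Gr) = {}" for x y
    proof -
      have *: "y - x \<le> 1" if "x \<in> T0" "y \<in> T0" "x \<le> y" "closed_segment x y \<inter> (E \<union> Gr) = {}" for x y
      proof (rule Gr(2))
        show "{x..y} \<inter> Gr = {}" using that(3,4) by (auto simp: closed_segment_eq_real_ivl)
      qed (use that b(2) in auto)
      show ?thesis
        using *[OF that(1,2)] *[OF that(2,1)] that(3) by (cases "x \<le> y") (auto simp: closed_segment_commute)
    qed
    show "((\<phi> ^^ p) has_real_derivative g 0 t) (at t within T)" if "t \<in> T" for t
      unfolding g0 by (rule phi_iter_deriv[OF that])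
    show "\<bar>ln \<bar>g 0 x\<bar> - ln \<bar>g 0 y\<bar>\<bar> * (v - u) \<le> \<bar>x - y\<bar> / 4"
      if uv: "u \<le> v" "{u..v} \<subseteq> T" "{u..v} \<inter> Z = {}" "x \<in> {u..v}" "y \<in> {u..v}" for u v x y
    proof (rule ln_abs_variation[OF _ e(1) _ _ uv(4,5)])
      show "g 0 z \<noteq> 0" if "z \<in> {u..v}" for z using Z(2) uv that by blast
      show "(g 0 has_real_derivative g 1 z / e) (at z within {u..v})" if "z \<in> {u..v}" for z
        using has_field_derivative_subset[OF gd[of 0 z] uv(2)] uv(2) that by auto
      show "nearly_const e (g 0) (g 1) u v" using Z(3)[OF uv(1-3)] by blast
    qed
    show "sum q A \<le> 1 / 2"
      if "finite A" "A \<subseteq> T" "A \<inter> Z = {}" "\<And>x y. x \<in> A \<Longrightarrow> y \<in> A \<Longrightarrow> \<bar>x - y\<bar> \<le> e"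
        "\<And>x y. x \<in> A \<Longrightarrow> y \<in> A \<Longrightarrow> x < y \<Longrightarrow> {x..y} \<inter> Z \<noteq> {}" for A
    proof -
      have "sum q A = (\<Sum>x\<in>A. min 1 (\<bar>g 0 x\<bar> powr \<beta>)) / (4 * K)" unfolding q_def by (simp add: sum_divide_distrib)
      also have "\<dots> \<le> (2 * K) / (4 * K)"
        unfolding \<beta>_def using Z(4)[OF that] K by (intro divide_right_mono) (auto simp: K_def)
      also have "\<dots> = 1 / 2" using K by simp
      finally show ?thesis .
    qed
    show "(M0 ^ p) ^ m * r \<le> e" unfolding r using Mpm
      by (metis less_irrefl nonzero_mult_div_cancel_left order_refl times_divide_eq_right)
    show "0 < r" unfolding r using Mpm e(1) by simp
    show "(\<phi> ^^ p) t \<in> T" if "t \<in> T" for t by (rule phi_iter_T[OF that])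
    show "t \<in> Z" if "t \<in> T" "g 0 t = 0" for t by (rule Z(2)[OF that])
    show "v - u \<le> e" if "u \<le> v" "{u..v} \<subseteq> T" "{u..v} \<inter> Z = {}" for u v using Z(3)[OF that] by simp
    show "\<bar>g 0 t\<bar> \<le> M0 ^ p" if "t \<in> T" for t unfolding g0 by (rule abs_deriv_Prod_le[OF that])
    show "0 \<le> q t" for t unfolding q_def using K by simp
    show "q t = min 1 (\<bar>g 0 t\<bar> powr \<beta>) / (4 * K)" for t by (rule q_def)
    show "g 0 t = (\<Prod>i<p. \<phi>' ((\<phi> ^^ i) t))" for t by (simp only: g0)
    show "0 \<le> \<beta>" unfolding \<beta>_def by simp
  qed (fact T_convex T0_T T0_convex T0_bounded M1 e R cen p m K Z(1))+
  show "measure \<mu> B \<le> 1 - \<gamma> + 2 * exp 1 / r * measure (leb I) B" if B: "B \<in> sets \<mu>" for B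
  proof (rule field_le_epsilon)
    fix \<epsilon> :: real assume \<epsilon>: "0 < \<epsilon>"
    define c where "c = 2 * exp 1 / r * measure (leb I) B"
    have r0: "0 < r" unfolding r using Mpm e(1) by simp
    have c: "0 \<le> c" unfolding c_def using r0 by simp
    define \<eta> where "\<eta> = \<epsilon> / (1 + c)"
    have \<eta>: "0 < \<eta>" unfolding \<eta>_def using \<epsilon> c by simp
    obtain E \<rho> where E: "finite E" and \<rho>: "\<rho> \<in> borel_measurable borel" "\<And>t. 0 \<le> \<rho> t"
      "\<And>s t. closed_segment s t \<inter> E = {} \<Longrightarrow> \<rho> s = (\<rho> t :: real)"
      "emeasure (density lborel (\<lambda>t. ennreal (\<rho> t) * indicator T0 t)) UNIV \<le> ennreal (1 + \<eta>)"
      "\<And>C. C \<in> sets borel \<Longrightarrow>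
        measure \<mu> {x\<in>X. \<theta> x \<in> C} \<le> measure (density lborel (\<lambda>t. ennreal (\<rho> t) * indicator T0 t)) C + \<eta>"
      by (rule density_step[OF \<eta>]) (rule that)
    interpret entropy_block I T0 \<mu> f \<phi> \<phi>' M0 "E \<union> Gr" Z "g 0" q e "M0 ^ p" m R r cen p K \<beta> by (rule EB[OF E])
    have "measure \<mu> B \<le> 1 - \<gamma> + (\<eta> + (1 + \<eta>) * c)"
    proof (rule measure_density_bound[OF ent[folded K_def \<beta>_def] _ B])
      fix n
      show "measure \<mu> {x\<in>Good n. (f ^^ (p * n)) x \<in> B} \<le> \<eta> + (1 + \<eta>) * c"
        unfolding c_def
      proof (rule good_density[OF \<rho>(1,2) _ \<rho>(4,5) less_imp_le[OF \<eta>] B])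
        show "\<rho> s = \<rho> t" if "closed_segment s t \<inter> (E \<union> Gr) = {}" for s t
          by (rule \<rho>(3)) (use that in auto)
      qed
    qed
    also have "\<eta> + (1 + \<eta>) * c = \<eta> * (1 + c) + c" by (simp add: algebra_simps)
    also have "\<eta> * (1 + c) = \<epsilon>" unfolding \<eta>_def using c by simp
    also have "1 - \<gamma> + (\<epsilon> + c) = 1 - \<gamma> + c + \<epsilon>" by simp
    finally show "measure \<mu> B \<le> 1 - \<gamma> + 2 * exp 1 / r * measure (leb I) B + \<epsilon>" unfolding c_def .
  qed
  interpret entropy_block I T0 \<mu> f \<phi> \<phi>' M0 "{} \<union> Gr" Z "g 0" q e "M0 ^ p" m R r cen p K \<beta> by (rule EB) simp
  show "\<gamma> \<le> measure \<mu> {x\<in>X. exp (- 2) * r * 2 ^ j \<le> (\<Prod>i<p * j. ad ((f ^^ i) x))}"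
    using expanding_measure[OF ent[folded K_def \<beta>_def], of j] unfolding expanding_def .
qed

end

section \<open>Uniform control along a smoothly convergent sequence\<close>

text \<open>Families bounded in \<open>C\<^sup>n\<close> uniformly in the index. The derivative is
  quantified instead of being given by an operator, so that sums, products and compositions follow
  by plain induction.\<close>

primrec Cb :: "nat \<Rightarrow> real set \<Rightarrow> (nat \<Rightarrow> real \<Rightarrow> real) \<Rightarrow> bool" where
  "Cb 0 T u \<longleftrightarrow> (\<exists>B. \<forall>k. \<forall>t\<in>T. \<bar>u k t\<bar> \<le> B)"
| "Cb (Suc n) T u \<longleftrightarrow> (\<exists>B. \<forall>k. \<forall>t\<in>T. \<bar>u k t\<bar> \<le> B) \<and>
    (\<exists>u'. (\<forall>k. \<forall>t\<in>T. (u k has_real_derivative u' k t) (at t within T)) \<and> Cb n T u')"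

lemma Cb_bounded: "Cb n T u \<Longrightarrow> \<exists>B. \<forall>k. \<forall>t\<in>T. \<bar>u k t\<bar> \<le> B"
  by (cases n) auto

lemma Cb_Suc_D: "Cb (Suc n) T u \<Longrightarrow> Cb n T u"
  by (induction n arbitrary: u) auto

lemma Cb_const: "Cb n T (\<lambda>_ _. c)"
proof (induction n arbitrary: c)
  case (Suc n)
  show ?case unfolding Cb.simps
  proof (intro conjI exI)
    show "\<forall>k. \<forall>t\<in>T. \<bar>c\<bar> \<le> \<bar>c\<bar>" by simp
    show "\<forall>k. \<forall>t\<in>T. ((\<lambda>_. c) has_real_derivative 0) (at t within T)" by simp
  qed (rule Suc)
qed auto

lemma bounded_add:
  assumes "\<exists>B. \<forall>k. \<forall>t\<in>T. \<bar>u k t\<bar> \<le> (B::real)" "\<exists>B. \<forall>k. \<forall>t\<in>T. \<bar>v k t\<bar> \<le> B"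
  shows "\<exists>B. \<forall>k. \<forall>t\<in>T. \<bar>u k t + v k t\<bar> \<le> B"
proof -
  obtain A B where "\<forall>k. \<forall>t\<in>T. \<bar>u k t\<bar> \<le> A" "\<forall>k. \<forall>t\<in>T. \<bar>v k t\<bar> \<le> B" using assms by blast
  then show ?thesis by (intro exI[of _ "A + B"]) (meson abs_triangle_ineq add_mono order_trans)
qed

lemma bounded_mult:
  assumes "\<exists>B. \<forall>k. \<forall>t\<in>T. \<bar>u k t\<bar> \<le> (B::real)" "\<exists>B. \<forall>k. \<forall>t\<in>T. \<bar>v k t\<bar> \<le> B"
  shows "\<exists>B. \<forall>k. \<forall>t\<in>T. \<bar>u k t * v k t\<bar> \<le> B"
proof -
  obtain A B where AB: "\<forall>k. \<forall>t\<in>T. \<bar>u k t\<bar> \<le> A" "\<forall>k. \<forall>t\<in>T. \<bar>v k t\<bar> \<le> B" using assms by blast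
  have "\<bar>u k t * v k t\<bar> \<le> A * B" if "t \<in> T" for k t
    unfolding abs_mult using AB that by (intro mult_mono) (auto intro: order_trans[OF abs_ge_zero])
  then show ?thesis by blast
qed

lemma Cb_add: "Cb n T u \<Longrightarrow> Cb n T v \<Longrightarrow> Cb n T (\<lambda>k t. u k t + v k t)"
proof (induction n arbitrary: u v)
  case 0 then show ?case using bounded_add by simp
next
  case (Suc n)
  obtain u' where u: "\<forall>k. \<forall>t\<in>T. (u k has_real_derivative u' k t) (at t within T)" "Cb n T u'" using Suc.prems(1) by auto
  obtain v' where v: "\<forall>k. \<forall>t\<in>T. (v k has_real_derivative v' k t) (at t within T)" "Cb n T v'" using Suc.prems(2) by auto
  have "\<forall>k. \<forall>t\<in>T. ((\<lambda>t. u k t + v k t) has_real_derivative u' k t + v' k t) (at t within T)"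
    using u v by (auto intro!: derivative_intros)
  then show ?case using bounded_add[OF Cb_bounded[OF Suc.prems(1)] Cb_bounded[OF Suc.prems(2)]] Suc.IH[OF u(2) v(2)]
    unfolding Cb.simps by (intro conjI exI[of _ "\<lambda>k t. u' k t + v' k t"])
qed

lemma Cb_mult: "Cb n T u \<Longrightarrow> Cb n T v \<Longrightarrow> Cb n T (\<lambda>k t. u k t * v k t)"
proof (induction n arbitrary: u v)
  case 0 then show ?case using bounded_mult by simp
next
  case (Suc n)
  obtain u' where u: "\<forall>k. \<forall>t\<in>T. (u k has_real_derivative u' k t) (at t within T)" "Cb n T u'" using Suc.prems(1) by auto
  obtain v' where v: "\<forall>k. \<forall>t\<in>T. (v k has_real_derivative v' k t) (at t within T)" "Cb n T v'" using Suc.prems(2) by auto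
  have "\<forall>k. \<forall>t\<in>T. ((\<lambda>t. u k t * v k t) has_real_derivative u' k t * v k t + u k t * v' k t) (at t within T)"
    using u v by (auto intro!: derivative_eq_intros)
  moreover have "Cb n T (\<lambda>k t. u' k t * v k t + u k t * v' k t)"
    by (rule Cb_add[OF Suc.IH[OF u(2) Cb_Suc_D[OF Suc.prems(2)]] Suc.IH[OF Cb_Suc_D[OF Suc.prems(1)] v(2)]])
  ultimately show ?case using bounded_mult[OF Cb_bounded[OF Suc.prems(1)] Cb_bounded[OF Suc.prems(2)]]
    unfolding Cb.simps by (intro conjI exI[of _ "\<lambda>k t. u' k t * v k t + u k t * v' k t"])
qed

lemma Cb_prod: "(\<And>i. i < (p::nat) \<Longrightarrow> Cb n T (u i)) \<Longrightarrow> Cb n T (\<lambda>k t. \<Prod>i<p. u i k t)"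
proof (induction p)
  case 0 then show ?case by (simp add: Cb_const)
next
  case (Suc p) then show ?case by (simp add: Cb_mult)
qed

lemma Cb_comp:
  assumes "\<And>k t. t \<in> T \<Longrightarrow> \<psi> k t \<in> T"
    and d: "\<And>k t. t \<in> T \<Longrightarrow> (\<psi> k has_real_derivative \<psi>' k t) (at t within T)"
  shows "Cb n T u \<Longrightarrow> Cb n T \<psi>' \<Longrightarrow> Cb n T (\<lambda>k t. u k (\<psi> k t))"
proof (induction n arbitrary: u)
  case 0
  then obtain B where "\<forall>k. \<forall>t\<in>T. \<bar>u k t\<bar> \<le> B" by auto
  then have "\<forall>k. \<forall>t\<in>T. \<bar>u k (\<psi> k t)\<bar> \<le> B" using assms(1) by simp
  then show ?case by auto
next
  case (Suc n)
  obtain B where B: "\<forall>k. \<forall>t\<in>T. \<bar>u k t\<bar> \<le> B" using Cb_bounded[OF Suc.prems(1)] by blast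
  obtain u' where u: "\<forall>k. \<forall>t\<in>T. (u k has_real_derivative u' k t) (at t within T)" "Cb n T u'" using Suc.prems(1) by auto
  have "((\<lambda>t. u k (\<psi> k t)) has_real_derivative u' k (\<psi> k t) * \<psi>' k t) (at t within T)" if t: "t \<in> T" for k t
  proof -
    have "(u k has_real_derivative u' k (\<psi> k t)) (at (\<psi> k t) within \<psi> k ` T)"
      by (rule has_field_derivative_subset[of _ _ _ T]) (use u assms(1) t in auto)
    from DERIV_image_chain[OF this d[OF t]] show ?thesis by (simp add: o_def)
  qed
  moreover have "Cb n T (\<lambda>k t. u' k (\<psi> k t) * \<psi>' k t)"
    using Suc.IH[OF u(2)] Cb_Suc_D[OF Suc.prems(2)] by (intro Cb_mult) auto
  moreover have "\<forall>k. \<forall>t\<in>T. \<bar>u k (\<psi> k t)\<bar> \<le> B" using B assms(1) by blast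
  ultimately show ?case unfolding Cb.simps
    by (intro conjI exI[of _ B] exI[of _ "\<lambda>k t. u' k (\<psi> k t) * \<psi>' k t"]) auto
qed

text \<open>Strong induction: the derivative of the \<open>i\<close>-th iterate is the product of
  the families with smaller exponents, which are already under control, so \<open>Cb_comp\<close>
  applies with that iterate as inner function.\<close>

lemma Cb_iterates:
  assumes T: "\<And>k t. t \<in> T \<Longrightarrow> \<psi> k t \<in> T"
    and d: "\<And>k t. t \<in> T \<Longrightarrow> (\<psi> k has_real_derivative \<psi>' k t) (at t within T)" and C: "Cb n T \<psi>'"
  shows "Cb n T (\<lambda>k t. \<psi>' k ((\<psi> k ^^ i) t))"
proof (induction i rule: less_induct)
  case (less i)
  have iT: "(\<psi> k ^^ j) t \<in> T" if "t \<in> T" for k j t using that by (induction j) (auto intro: T)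
  have "((\<psi> k ^^ j) has_real_derivative (\<Prod>l<j. \<psi>' k ((\<psi> k ^^ l) t))) (at t within T)" if t: "t \<in> T" for k j t
  proof (induction j)
    case 0 then show ?case by (simp add: id_def)
  next
    case (Suc j)
    have "(\<psi> k has_real_derivative \<psi>' k ((\<psi> k ^^ j) t)) (at ((\<psi> k ^^ j) t) within (\<psi> k ^^ j) ` T)"
      by (rule has_field_derivative_subset[OF d]) (use iT t in auto)
    from DERIV_image_chain[OF this Suc] show ?case by (simp add: mult.commute o_def)
  qed
  moreover have "Cb n T (\<lambda>k t. \<Prod>l<i. \<psi>' k ((\<psi> k ^^ l) t))" using less by (intro Cb_prod)
  ultimately show ?case using C iT by (intro Cb_comp[where \<psi> = "\<lambda>k. \<psi> k ^^ i"])
qed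

lemma Cb_derivs:
  "Cb n T u \<Longrightarrow> \<exists>D B. (\<forall>k. D k 0 = u k) \<and>
    (\<forall>k. \<forall>i<n. \<forall>t\<in>T. (D k i has_real_derivative D k (Suc i) t) (at t within T)) \<and>
    (\<forall>k. \<forall>i\<le>n. \<forall>t\<in>T. \<bar>D k i t\<bar> \<le> (B::real))"
proof (induction n arbitrary: u)
  case 0
  then obtain B where "\<forall>k. \<forall>t\<in>T. \<bar>u k t\<bar> \<le> B" by auto
  then show ?case by (intro exI[of _ "\<lambda>k i. u k"] exI[of _ B]) auto
next
  case (Suc n)
  obtain B where B: "\<forall>k. \<forall>t\<in>T. \<bar>u k t\<bar> \<le> B" using Cb_bounded[OF Suc.prems] by blast
  obtain u' where u: "\<forall>k. \<forall>t\<in>T. (u k has_real_derivative u' k t) (at t within T)" "Cb n T u'" using Suc.prems by auto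
  obtain D B' where D: "\<forall>k. D k 0 = u' k"
    "\<forall>k. \<forall>i<n. \<forall>t\<in>T. (D k i has_real_derivative D k (Suc i) t) (at t within T)"
    "\<forall>k. \<forall>i\<le>n. \<forall>t\<in>T. \<bar>D k i t\<bar> \<le> B'" using Suc.IH[OF u(2)] by blast
  define D' where "D' k i = (case i of 0 \<Rightarrow> u k | Suc j \<Rightarrow> D k j)" for k i
  have "(D' k i has_real_derivative D' k (Suc i) t) (at t within T)" if "i < Suc n" "t \<in> T" for k i t
    using that u(1) D(1,2) unfolding D'_def by (cases i) auto
  moreover have "\<bar>D' k i t\<bar> \<le> max B B'" if "i \<le> Suc n" "t \<in> T" for k i t
    using that B D(3) unfolding D'_def by (cases i) (auto simp: le_max_iff_disj)
  ultimately show ?case by (intro exI[of _ D'] exI[of _ "max B B'"]) (auto simp: D'_def)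
qed

text \<open>The \<open>i\<close>-th derivative is scaled by \<open>e ^ i\<close>. From order 1 on
  the factor \<open>e \<le> 1 / (\<bar>B\<bar> + 1)\<close> makes it at most 1, while order 0 stays
  unscaled. Since \<open>B\<close> is uniform in the index of the family, so is
  \<open>e\<close>.\<close>

lemma rescaled_derivs:
  assumes "Cb (Suc d) T u" and "0 < c"
  obtains e and g :: "nat \<Rightarrow> nat \<Rightarrow> real \<Rightarrow> real" where "0 < e" "e \<le> c" "\<And>k. g k 0 = u k"
    "\<And>k i t. i \<le> d \<Longrightarrow> t \<in> T \<Longrightarrow> (g k i has_real_derivative g k (Suc i) t / e) (at t within T)"
    "\<And>k i t. i \<le> d \<Longrightarrow> t \<in> T \<Longrightarrow> \<bar>g k (Suc i) t\<bar> \<le> 1"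
proof -
  obtain D B where D: "\<And>k. D k 0 = u k"
    "\<And>k i t. i < Suc d \<Longrightarrow> t \<in> T \<Longrightarrow> (D k i has_real_derivative D k (Suc i) t) (at t within T)"
    "\<And>k i t. i \<le> Suc d \<Longrightarrow> t \<in> T \<Longrightarrow> \<bar>D k i t\<bar> \<le> B" using Cb_derivs[OF assms(1)] by blast
  define e where "e = min (min 1 c) (1 / (\<bar>B\<bar> + 1))"
  have e: "0 < e" "e \<le> 1" "e \<le> c" "e \<le> 1 / (\<bar>B\<bar> + 1)" unfolding e_def using assms(2) by auto
  define g where "g k i t = e ^ i * D k i t" for k i t
  show thesis
  proof (rule that[of e g])
    show "g k 0 = u k" for k unfolding g_def using D(1) by auto
    show "(g k i has_real_derivative g k (Suc i) t / e) (at t within T)" if "i \<le> d" "t \<in> T" for k i t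
      unfolding g_def using DERIV_cmult[OF D(2)[of i t k], of "e ^ i"] that e(1) by simp
    show "\<bar>g k (Suc i) t\<bar> \<le> 1" if "i \<le> d" "t \<in> T" for k i t
    proof -
      have "\<bar>g k (Suc i) t\<bar> = e ^ i * e * \<bar>D k (Suc i) t\<bar>" unfolding g_def using e(1) by (simp add: abs_mult)
      also have "\<dots> \<le> 1 * (1 / (\<bar>B\<bar> + 1)) * (\<bar>B\<bar> + 1)"
        using e D(3)[of "Suc i" t k] that by (intro mult_mono power_le_one) auto
      also have "\<dots> = 1" by simp
      finally show ?thesis .
    qed
  qed (use e in auto)
qed

section \<open>Separated sets and uniform convergence of iterates\<close>

lemma iter_in: "g \<in> X \<rightarrow> X \<Longrightarrow> x \<in> X \<Longrightarrow> (g ^^ n) x \<in> X"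
  by (induction n) auto

lemma iter_continuous:
  fixes g :: "'a::metric_space \<Rightarrow> 'a"
  assumes "continuous_on X g" "g \<in> X \<rightarrow> X" shows "continuous_on X (g ^^ n)"
proof (induction n)
  case (Suc n)
  have "(g ^^ n) ` X \<subseteq> X" using iter_in[OF assms(2)] by auto
  then have "continuous_on X (g \<circ> (g ^^ n))"
    using Suc assms(1) continuous_on_subset by (intro continuous_on_compose) blast+
  then show ?case by simp
qed (simp add: id_def)

lemma separated_bounded:
  fixes g :: "'a::metric_space \<Rightarrow> 'a"
  assumes X: "compact X" and g: "continuous_on X g" "g \<in> X \<rightarrow> X" and e: "0 < e"
  obtains B where "\<And>E. E \<subseteq> X \<Longrightarrow> finite E \<Longrightarrow> separated g n e E \<Longrightarrow> card E \<le> B"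
proof -
  have "\<exists>d>0. \<forall>i<n. \<forall>x\<in>X. \<forall>y\<in>X. dist x y < d \<longrightarrow> dist ((g ^^ i) x) ((g ^^ i) y) < e"
  proof (induction n)
    case 0 then show ?case by (intro exI[of _ 1]) auto
  next
    case (Suc n)
    then obtain d where d: "0 < d" "\<And>i x y. i < n \<Longrightarrow> x \<in> X \<Longrightarrow> y \<in> X \<Longrightarrow> dist x y < d \<Longrightarrow> dist ((g ^^ i) x) ((g ^^ i) y) < e"
      by blast
    have "uniformly_continuous_on X (g ^^ n)" using iter_continuous[OF g] X by (rule compact_uniformly_continuous)
    then obtain d' where d': "0 < d'" "\<And>x y. x \<in> X \<Longrightarrow> y \<in> X \<Longrightarrow> dist x y < d' \<Longrightarrow> dist ((g ^^ n) x) ((g ^^ n) y) < e"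
      using e unfolding uniformly_continuous_on_def by (metis dist_commute)
    show ?case using d d' by (intro exI[of _ "min d d'"]) (auto simp: less_Suc_eq)
  qed
  then obtain d where d: "0 < d"
    "\<And>i x y. i < n \<Longrightarrow> x \<in> X \<Longrightarrow> y \<in> X \<Longrightarrow> dist x y < d \<Longrightarrow> dist ((g ^^ i) x) ((g ^^ i) y) < e" by blast
  obtain C where C: "finite C" "C \<subseteq> X" "X \<subseteq> (\<Union>x\<in>C. ball x (d / 2))"
    by (rule compactE_image[OF X, of X "\<lambda>x. ball x (d / 2)"]) (use d(1) in auto)
  have "card E \<le> card C" if E: "E \<subseteq> X" "finite E" "separated g n e E" for E
  proof -
    have "\<exists>c. c \<in> C \<and> dist c x < d / 2" if "x \<in> E" for x using that C(3) E(1) by (auto simp: subset_iff)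
    then obtain c where c: "\<And>x. x \<in> E \<Longrightarrow> c x \<in> C" "\<And>x. x \<in> E \<Longrightarrow> dist (c x) x < d / 2" by metis
    have "inj_on c E"
    proof (rule inj_onI, rule ccontr)
      fix x y assume xy: "x \<in> E" "y \<in> E" "c x = c y" "x \<noteq> y"
      have "dist x y \<le> dist (c x) x + dist (c x) y" by (metis dist_commute dist_triangle)
      then have "dist x y < d" using c(2)[OF xy(1)] c(2)[OF xy(2)] xy(3) by simp
      moreover obtain i where "i < n" "e < dist ((g ^^ i) x) ((g ^^ i) y)"
        using E(3) xy unfolding separated_def by blast
      ultimately show False using d(2)[of i x y] E(1) xy by auto
    qed
    then show ?thesis using c(1) C(1) by (intro card_inj_on_le) auto
  qed
  then show thesis by (rule that)
qed

text \<open>\<open>max_separated\<close> is a supremum of natural numbers; boundedness of the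
  cardinalities makes it an attained maximum. A separated set of maximal size spans, for otherwise a
  point could be added.\<close>

lemma spanning_set:
  fixes g :: "'a::metric_space \<Rightarrow> 'a"
  assumes X: "compact X" "X \<noteq> {}" and g: "continuous_on X g" "g \<in> X \<rightarrow> X" and e: "0 < e"
  obtains E where "finite E" "E \<subseteq> X" "card E = max_separated X g n e" "0 < card E"
    "\<And>x. x \<in> X \<Longrightarrow> \<exists>c\<in>E. \<forall>i<n. dist ((g ^^ i) x) ((g ^^ i) c) \<le> e"
proof -
  define \<C> where "\<C> = card ` {E. E \<subseteq> X \<and> finite E \<and> separated g n e E}"
  obtain B where B: "\<And>E. E \<subseteq> X \<Longrightarrow> finite E \<Longrightarrow> separated g n e E \<Longrightarrow> card E \<le> B"
    using separated_bounded[OF X(1) g e] by blast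
  have fC: "finite \<C>" using B unfolding \<C>_def by (auto intro!: finite_subset[of _ "{..B}"])
  obtain x0 where "x0 \<in> X" using X(2) by auto
  then have c1: "1 \<in> \<C>" unfolding \<C>_def by (auto intro!: image_eqI[of _ _ "{x0}"] simp: separated_def)
  then have ne: "\<C> \<noteq> {}" by auto
  have ms: "max_separated X g n e = Max \<C>"
    unfolding max_separated_def \<C>_def[symmetric] using fC ne by (rule cSup_eq_Max)
  have "Max \<C> \<in> \<C>" using fC ne by (rule Max_in)
  then obtain E where E: "E \<subseteq> X" "finite E" "separated g n e E" "card E = Max \<C>" unfolding \<C>_def by auto
  have "1 \<le> Max \<C>" using fC c1 by (rule Max_ge)
  moreover have "\<exists>c\<in>E. \<forall>i<n. dist ((g ^^ i) x) ((g ^^ i) c) \<le> e" if x: "x \<in> X" for x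
  proof (rule ccontr)
    assume "\<not> ?thesis"
    then have far: "\<And>c. c \<in> E \<Longrightarrow> \<exists>i<n. e < dist ((g ^^ i) x) ((g ^^ i) c)" by (meson linear not_le)
    have "x \<notin> E"
    proof
      assume "x \<in> E"
      from far[OF this] show False using e by auto
    qed
    have "separated g n e (insert x E)"
      using E(3) far unfolding separated_def by (metis dist_commute insertE)
    then have "card (insert x E) \<in> \<C>" unfolding \<C>_def using E x by auto
    then have "card (insert x E) \<le> Max \<C>" using fC by (intro Max_ge)
    then show False using E \<open>x \<notin> E\<close> by simp
  qed
  ultimately show thesis using E ms by (intro that[of E]) auto
qed

lemma uniform_limit_compact_comp:
  fixes F :: "nat \<Rightarrow> 'a::metric_space \<Rightarrow> 'a" and h :: "nat \<Rightarrow> 'a \<Rightarrow> 'b::metric_space"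
  assumes X: "compact X" and H: "continuous_on X H" and h: "uniform_limit X h H sequentially"
    and F: "\<And>k. F k \<in> X \<rightarrow> X" and G: "G \<in> X \<rightarrow> X" and lim: "uniform_limit X F G sequentially"
  shows "uniform_limit X (\<lambda>k x. h k (F k x)) (\<lambda>x. H (G x)) sequentially"
proof (rule uniform_limitI)
  fix e :: real assume e: "0 < e"
  have "uniformly_continuous_on X H" using X H by (rule compact_uniformly_continuous[rotated])
  then obtain d where d: "0 < d" "\<And>x y. x \<in> X \<Longrightarrow> y \<in> X \<Longrightarrow> dist y x < d \<Longrightarrow> dist (H y) (H x) < e / 2"
    unfolding uniformly_continuous_on_def using e by (metis half_gt_zero)
  have "\<forall>\<^sub>F k in sequentially. \<forall>x\<in>X. dist (h k x) (H x) < e / 2" using e by (intro uniform_limitD[OF h]) auto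
  moreover have "\<forall>\<^sub>F k in sequentially. \<forall>x\<in>X. dist (F k x) (G x) < d" using d by (intro uniform_limitD[OF lim]) auto
  ultimately show "\<forall>\<^sub>F k in sequentially. \<forall>x\<in>X. dist (h k (F k x)) (H (G x)) < e"
  proof eventually_elim
    fix k assume a: "\<forall>x\<in>X. dist (h k x) (H x) < e / 2" "\<forall>x\<in>X. dist (F k x) (G x) < d"
    show "\<forall>x\<in>X. dist (h k (F k x)) (H (G x)) < e"
    proof
      fix x assume x: "x \<in> X"
      have m: "F k x \<in> X" "G x \<in> X" using F G x by auto
      have "dist (h k (F k x)) (H (F k x)) < e / 2" "dist (H (F k x)) (H (G x)) < e / 2"
        using a m x d(2)[of "G x" "F k x"] by auto
      then show "dist (h k (F k x)) (H (G x)) < e" using dist_triangle[of "h k (F k x)" "H (G x)" "H (F k x)"] by linarith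
    qed
  qed
qed

lemma iterates_uniform:
  fixes f :: "nat \<Rightarrow> 'a::metric_space \<Rightarrow> 'a"
  assumes X: "compact X" and g: "continuous_on X g" "g \<in> X \<rightarrow> X" and f: "\<And>k. f k \<in> X \<rightarrow> X"
    and lim: "uniform_limit X f g sequentially"
  shows "uniform_limit X (\<lambda>k. f k ^^ n) (g ^^ n) sequentially"
proof (induction n)
  case 0 then show ?case by (simp add: uniform_limit_iff)
next
  case (Suc n)
  have it: "(f k ^^ n) \<in> X \<rightarrow> X" "(g ^^ n) \<in> X \<rightarrow> X" for k
    by (auto intro: iter_in[OF f] iter_in[OF g(2)])
  show ?case using uniform_limit_compact_comp[OF X g(1) lim it Suc] by (simp add: comp_def)
qed

section \<open>The limit measure\<close>

locale smooth_limit = phase_model I T0 for I :: "'a::euclidean_space phase_space" and T0 +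
  fixes f :: "nat \<Rightarrow> 'a \<Rightarrow> 'a" and g :: "'a \<Rightarrow> 'a" and \<mu> :: "nat \<Rightarrow> 'a measure" and \<nu> :: "'a measure"
    and \<phi> \<phi>' :: "nat \<Rightarrow> real \<Rightarrow> real" and M0 :: real
  assumes lift: "lifted I T0 (\<mu> k) (f k) (\<phi> k) (\<phi>' k) M0"
    and Cb_phi: "Cb n (times I) \<phi>'"
    and gX: "g \<in> points I \<rightarrow> points I" and g_cont: "continuous_on (points I) g"
    and ad_cont: "continuous_on (points I) (abs_deriv I g)"
    and f_lim: "uniform_limit (points I) f g sequentially"
    and ad_lim: "uniform_limit (points I) (\<lambda>k. abs_deriv I (f k)) (abs_deriv I g) sequentially"
    and nu: "borel_prob I \<nu>" and weak: "weak_star_converges I \<mu> \<nu>"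
    and ent_lim: "(\<lambda>k. metric_entropy (f k) (\<mu> k)) \<longlonglongrightarrow> top_entropy (points I) g"
    and ent_pos: "0 < top_entropy (points I) g"
begin

lemma X_ne: "X \<noteq> {}" using arc_T[of 0] T0_0 T0_T by auto

lemma M0_ge1: "1 \<le> M0" by (rule lifted.M0(1)[OF lift])

lemma fX: "f k \<in> X \<rightarrow> X"
  using lifted.f_iter_X[OF lift, of _ 1 k] by auto

definition expansion :: "('a \<Rightarrow> 'a) \<Rightarrow> nat \<Rightarrow> 'a \<Rightarrow> real" where
  "expansion h n x = (\<Prod>i<n. abs_deriv I h ((h ^^ i) x))"

text \<open>The threshold of the entropy bound for \<open>\<beta> = 2 / (d + 1)\<close>, with the
  number of Bowen balls taken from separated sets of the limit map. The scale \<open>e / 16\<close>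
  leaves room for comparing orbits of \<open>f k\<close> with orbits of \<open>g\<close>.\<close>

definition entropy_defect :: "nat \<Rightarrow> nat \<Rightarrow> nat \<Rightarrow> real \<Rightarrow> real \<Rightarrow> real" where
  "entropy_defect d p m e \<gamma> = ln (4 * sep_bound d) / real p + 2 / (real d + 1) * ln M0
     + ln (real (max_separated X g (m * p) (e / 16))) / (real m * real p) * \<gamma>"

definition dominated :: "nat \<Rightarrow> real \<Rightarrow> real \<Rightarrow> nat \<Rightarrow> bool" where
  "dominated p r \<gamma> k \<longleftrightarrow>
    (\<forall>B\<in>sets (\<mu> k). measure (\<mu> k) B \<le> 1 - \<gamma> + 2 * exp 1 / r * measure (leb I) B) \<and>
    (\<forall>j. \<gamma> \<le> measure (\<mu> k) {x\<in>X. exp (- 2) * r * 2 ^ j \<le> expansion (f k) (p * j) x})"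

text \<open>The order of the quantifiers matters: \<open>e\<close> is fixed before \<open>m\<close>,
  because \<open>m\<close> is later chosen from the growth of separated sets at scale
  \<open>e / 16\<close>. The frequency \<open>\<gamma>\<close> stays quantified inside, so one block
  structure serves every \<open>\<gamma>\<close>.\<close>

lemma eventually_dichotomy:
  assumes p: "0 < p"
  obtains e where "0 < e" "\<And>m. 0 < m \<Longrightarrow> \<exists>r>0. \<forall>\<^sub>F k in sequentially. \<forall>\<gamma>.
    ereal (entropy_defect d p m e \<gamma>) < metric_entropy (f k) (\<mu> k) \<longrightarrow>
      dominated p r \<gamma> k"
proof -
  define u where "u k t = (\<Prod>i<p. \<phi>' k ((\<phi> k ^^ i) t))" for k t
  have "Cb (Suc d) T u" unfolding u_def
    by (intro Cb_prod Cb_iterates lifted.phi_T[OF lift] lifted.phi_deriv[OF lift] Cb_phi)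
  moreover have Mp: "0 < 1 / M0 ^ p" using M0_ge1 by simp
  ultimately obtain e gs where e: "0 < e" "e \<le> 1 / M0 ^ p" and gs: "\<And>k. gs k 0 = u k"
    "\<And>k i t. i \<le> d \<Longrightarrow> t \<in> T \<Longrightarrow> (gs k i has_real_derivative gs k (Suc i) t / e) (at t within T)"
    "\<And>k i t. i \<le> d \<Longrightarrow> t \<in> T \<Longrightarrow> \<bar>gs k (Suc i) t\<bar> \<le> 1" by (rule rescaled_derivs) (rule that)
  have Me: "M0 ^ p * e \<le> 1" using e(2) Mp by (simp add: field_simps)
  have main: "\<exists>r>0. \<forall>\<^sub>F k in sequentially. \<forall>\<gamma>.
    ereal (entropy_defect d p m e \<gamma>) < metric_entropy (f k) (\<mu> k) \<longrightarrow>
      dominated p r \<gamma> k"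
    if m: "0 < m" for m
  proof -
    define r where "r = e / (M0 ^ p) ^ m"
    have r: "0 < r" unfolding r_def using e M0_ge1 by simp
    obtain E where E: "finite E" "E \<subseteq> X" "card E = max_separated X g (m * p) (e / 16)" "0 < card E"
      "\<And>x. x \<in> X \<Longrightarrow> \<exists>c\<in>E. \<forall>i<m * p. dist ((g ^^ i) x) ((g ^^ i) c) \<le> e / 16"
      using spanning_set[OF X_compact X_ne g_cont gX, of "e / 16" "m * p"] e by auto
    define cen where "cen t = (SOME c. c \<in> E \<and> (\<forall>i<m * p. dist ((g ^^ i) (arc I t)) ((g ^^ i) c) \<le> e / 16))" for t
    have cen: "cen t \<in> E \<and> (\<forall>i<m * p. dist ((g ^^ i) (arc I t)) ((g ^^ i) (cen t)) \<le> e / 16)" if "t \<in> T" for t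
      unfolding cen_def by (rule someI_ex) (use E(5)[OF arc_T[OF that]] in blast)
    have cenE: "cen ` T \<subseteq> E" using cen by auto
    have "\<forall>\<^sub>F k in sequentially. \<forall>i<m * p. \<forall>x\<in>X. dist ((f k ^^ i) x) ((g ^^ i) x) < e / 16"
    proof -
      have "\<forall>\<^sub>F k in sequentially. \<forall>i\<in>{..<m * p}. \<forall>x\<in>X. dist ((f k ^^ i) x) ((g ^^ i) x) < e / 16"
        by (intro eventually_ball_finite ballI uniform_limitD iterates_uniform X_compact g_cont gX fX f_lim)
          (use e in auto)
      then show ?thesis by eventually_elim auto
    qed
    then have "\<forall>\<^sub>F k in sequentially. \<forall>\<gamma>.
      ereal (entropy_defect d p m e \<gamma>) < metric_entropy (f k) (\<mu> k) \<longrightarrow>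
        dominated p r \<gamma> k"
    proof eventually_elim
      fix k assume close: "\<forall>i<m * p. \<forall>x\<in>X. dist ((f k ^^ i) x) ((g ^^ i) x) < e / 16"
      interpret L: lifted I T0 "\<mu> k" "f k" "\<phi> k" "\<phi>' k" M0 by (rule lift)
      \<comment> \<open>Two distances to the common centre and two between the orbits of
        \<open>f k\<close> and \<open>g\<close>, each at most \<open>e / 16\<close>.\<close>
      have orbit: "dist ((f k ^^ i) (arc I s)) ((f k ^^ i) (arc I t)) \<le> e / 4"
        if st: "s \<in> T" "t \<in> T" "cen s = cen t" "i < m * p" for s t i
      proof -
        define a b c where "a = (g ^^ i) (arc I s)" and "b = (g ^^ i) (arc I t)" and "c = (g ^^ i) (cen t)"
        have "dist a c \<le> e / 16" "dist b c \<le> e / 16"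
          using cen[OF st(1)] cen[OF st(2)] st(3,4) unfolding a_def b_def c_def by auto
        moreover have "dist ((f k ^^ i) (arc I s)) a < e / 16" "dist ((f k ^^ i) (arc I t)) b < e / 16"
          using close st(4) arc_T st(1,2) unfolding a_def b_def by auto
        ultimately show ?thesis
          using dist_triangle[of "(f k ^^ i) (arc I s)" "(f k ^^ i) (arc I t)" a]
            dist_triangle[of a "(f k ^^ i) (arc I t)" c] dist_triangle[of c "(f k ^^ i) (arc I t)" b]
            dist_commute[of c b] dist_commute[of b "(f k ^^ i) (arc I t)"] by linarith
      qed
      \<comment> \<open>A small chord bounds the lifted distance only if that distance is known to
        be at most 1. This is carried along: a distance \<open>e\<close> at one step is at most
        \<open>M0 ^ p * e \<le> 1\<close> at the next, and then \<open>arc_inv\<close> improves it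
        to \<open>e / 2\<close>.\<close>
      have shadow: "\<bar>((\<phi> k ^^ p) ^^ i) s - ((\<phi> k ^^ p) ^^ i) t\<bar> \<le> e"
        if st: "s \<in> T" "t \<in> T" "\<bar>s - t\<bar> \<le> 1" "cen s = cen t" and i: "i < m" for s t i
        using i
      proof (induction i)
        case 0
        have "\<bar>s - t\<bar> \<le> 2 * dist (arc I s) (arc I t)" by (rule arc_inv[OF st(1-3)])
        also have "dist (arc I s) (arc I t) \<le> e / 4" using orbit[OF st(1,2,4), of 0] m p by simp
        finally show ?case using e by simp
      next
        case (Suc i)
        define a b where "a = ((\<phi> k ^^ p) ^^ i) s" and "b = ((\<phi> k ^^ p) ^^ i) t"
        have ab: "a \<in> T" "b \<in> T" unfolding a_def b_def funpow_mult using L.phi_iter_T st by auto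
        have "\<bar>(\<phi> k ^^ p) a - (\<phi> k ^^ p) b\<bar> \<le> M0 ^ p * \<bar>a - b\<bar>" by (rule L.phi_lipschitz[OF ab])
        also have "\<dots> \<le> M0 ^ p * e" using Suc M0_ge1 unfolding a_def b_def by (intro mult_left_mono) auto
        also have "\<dots> \<le> 1" by (rule Me)
        finally have le1: "\<bar>(\<phi> k ^^ p) a - (\<phi> k ^^ p) b\<bar> \<le> 1" .
        have ab': "(\<phi> k ^^ p) a \<in> T" "(\<phi> k ^^ p) b \<in> T" using L.phi_iter_T ab by auto
        have idx: "p * Suc i < m * p" using Suc.prems p by (metis mult.commute mult_less_cancel1)
        have "(\<phi> k ^^ p) a = (\<phi> k ^^ (p * Suc i)) s" "(\<phi> k ^^ p) b = (\<phi> k ^^ (p * Suc i)) t"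
          unfolding a_def b_def funpow_mult by (simp_all add: funpow_add)
        then have arcs: "arc I ((\<phi> k ^^ p) a) = (f k ^^ (p * Suc i)) (arc I s)"
          "arc I ((\<phi> k ^^ p) b) = (f k ^^ (p * Suc i)) (arc I t)"
          using L.phi_iter_arc[OF st(1)] L.phi_iter_arc[OF st(2)] by simp_all
        have "\<bar>(\<phi> k ^^ p) a - (\<phi> k ^^ p) b\<bar> \<le> 2 * dist (arc I ((\<phi> k ^^ p) a)) (arc I ((\<phi> k ^^ p) b))"
          by (rule arc_inv[OF ab' le1])
        also have "\<dots> \<le> 2 * (e / 4)" unfolding arcs using orbit[OF st(1,2,4) idx] by simp
        finally show ?case using e unfolding a_def b_def by simp
      qed
      show "\<forall>\<gamma>. ereal (entropy_defect d p m e \<gamma>) < metric_entropy (f k) (\<mu> k) \<longrightarrow>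
        dominated p r \<gamma> k"
      proof (intro allI impI)
        fix \<gamma> assume ent: "ereal (entropy_defect d p m e \<gamma>) < metric_entropy (f k) (\<mu> k)"
        have fin: "finite (cen ` T)" using cenE E(1) finite_subset by blast
        have card: "card (cen ` T) \<le> card E" using cenE E(1) by (intro card_mono)
        have g0: "gs k 0 = (\<lambda>t. \<Prod>i<p. \<phi>' k ((\<phi> k ^^ i) t))" unfolding gs(1) u_def ..
        have ent': "ereal (ln (4 * sep_bound d) / real p + 2 / (real d + 1) * ln M0
          + ln (real (card E)) / (real m * real p) * \<gamma>) < metric_entropy (f k) (\<mu> k)"
          using ent unfolding entropy_defect_def E(3) .
        note L.block_dichotomy[OF p m e(1) Me g0 gs(2,3) fin card E(4) shadow ent' r_def]
        then show "dominated p r \<gamma> k"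
          unfolding dominated_def expansion_def by blast
      qed
    qed
    then show ?thesis using r by blast
  qed
  show thesis by (rule that[OF e(1) main])
qed

text \<open>With \<open>\<gamma> = 2\<close> the dichotomy would yield a set of probability at least
  2. Hence the metric entropies eventually stay below the threshold, and so does their
  limit.\<close>

lemma top_entropy_finite: obtains h where "0 < h" "top_entropy X g = ereal h"
proof -
  obtain e where e: "0 < e" "\<And>m. 0 < m \<Longrightarrow> \<exists>r>0. \<forall>\<^sub>F k in sequentially. \<forall>\<gamma>.
    ereal (entropy_defect 0 1 m e \<gamma>) < metric_entropy (f k) (\<mu> k) \<longrightarrow>
      dominated 1 r \<gamma> k"
    using eventually_dichotomy[of 1 0] by auto
  obtain r where "\<forall>\<^sub>F k in sequentially. \<forall>\<gamma>.
    ereal (entropy_defect 0 1 1 e \<gamma>) < metric_entropy (f k) (\<mu> k) \<longrightarrow>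
      dominated 1 r \<gamma> k"
    using e(2)[of 1] by auto
  then have "\<forall>\<^sub>F k in sequentially. metric_entropy (f k) (\<mu> k) \<le> ereal (entropy_defect 0 1 1 e 2)"
  proof eventually_elim
    fix k assume a: "\<forall>\<gamma>. ereal (entropy_defect 0 1 1 e \<gamma>) < metric_entropy (f k) (\<mu> k) \<longrightarrow>
      dominated 1 r \<gamma> k"
    interpret L: lifted I T0 "\<mu> k" "f k" "\<phi> k" "\<phi>' k" M0 by (rule lift)
    show "metric_entropy (f k) (\<mu> k) \<le> ereal (entropy_defect 0 1 1 e 2)"
    proof (rule ccontr)
      assume "\<not> ?thesis"
      then have "ereal (entropy_defect 0 1 1 e 2) < metric_entropy (f k) (\<mu> k)" by simp
      then have "2 \<le> measure (\<mu> k) {x\<in>X. exp (- 2) * r * 2 ^ 0 \<le> expansion (f k) (1 * 0) x}"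
        using a unfolding dominated_def by blast
      moreover have "measure (\<mu> k) {x\<in>X. exp (- 2) * r * 2 ^ 0 \<le> expansion (f k) (1 * 0) x} \<le> 1"
        by (rule L.prob_le_1)
      ultimately show False by linarith
    qed
  qed
  then have "top_entropy X g \<le> ereal (entropy_defect 0 1 1 e 2)"
    using ent_lim by (intro tendsto_upperbound[OF ent_lim]) auto
  then show thesis using ent_pos that by (cases "top_entropy X g") auto
qed

lemma uniform_domination:
  assumes \<gamma>: "0 < \<gamma>" "\<gamma> < 1"
  obtains p r where "0 < p" "0 < r" "\<forall>\<^sub>F k in sequentially.
      dominated p r \<gamma> k"
proof -
  obtain h where h: "0 < h" "top_entropy X g = ereal h" by (rule top_entropy_finite)
  \<comment> \<open>Positive topological entropy makes \<open>\<delta>\<close> positive. Since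
    \<open>h = h * \<gamma> + 4 * \<delta>\<close>, there is room for three errors of size at most
    \<open>\<delta>\<close>: the power of the derivative, the constant paid once per
    \<open>p\<close> steps, and the growth of separated sets.\<close>
  define \<delta> where "\<delta> = h * (1 - \<gamma>) / 4"
  have \<delta>: "0 < \<delta>" unfolding \<delta>_def using h \<gamma> by simp
  have lM: "0 \<le> ln M0" using M0_ge1 by simp
  obtain d :: nat where d: "2 * ln M0 / \<delta> < real d" using reals_Archimedean2 by blast
  have "2 / (real d + 1) * ln M0 \<le> \<delta>"
  proof -
    have "2 * ln M0 < real d * \<delta>" using d \<delta> by (simp add: pos_divide_less_eq)
    also have "\<dots> \<le> \<delta> * (real d + 1)" using \<delta> by (simp add: algebra_simps)
    finally show ?thesis by (simp add: pos_divide_le_eq)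
  qed
  obtain p :: nat where p: "ln (4 * sep_bound d) / \<delta> < real p" "0 < p"
  proof -
    obtain p :: nat where "ln (4 * sep_bound d) / \<delta> < real p" using reals_Archimedean2 by blast
    then show thesis by (intro that[of "Suc p"]) auto
  qed
  have lp: "ln (4 * sep_bound d) / real p \<le> \<delta>"
    using p \<delta> by (simp add: field_simps)
  obtain e where e: "0 < e" "\<And>m. 0 < m \<Longrightarrow> \<exists>r>0. \<forall>\<^sub>F k in sequentially. \<forall>\<gamma>.
    ereal (entropy_defect d p m e \<gamma>) < metric_entropy (f k) (\<mu> k) \<longrightarrow>
      dominated p r \<gamma> k"
    using eventually_dichotomy[OF p(2), of d] by blast
  \<comment> \<open>As a supremum over all scales, the topological entropy bounds the growth at the
    one scale that the pieces prescribe.\<close>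
  have "limsup (\<lambda>n. ereal (ln (real (max_separated X g n (e / 16))) / real n)) \<le> top_entropy X g"
    unfolding top_entropy_def by (rule SUP_upper) (use e in auto)
  also have "\<dots> < ereal (h + \<delta>)" unfolding h(2) using \<delta> by simp
  finally have "\<forall>\<^sub>F n in sequentially. ereal (ln (real (max_separated X g n (e / 16))) / real n) < ereal (h + \<delta>)"
    by (rule Limsup_lessD)
  then obtain n0 where n0: "\<And>n. n0 \<le> n \<Longrightarrow> ln (real (max_separated X g n (e / 16))) / real n < h + \<delta>"
    by (auto simp: eventually_sequentially)
  define m where "m = Suc n0"
  have m: "0 < m" "n0 \<le> m * p" unfolding m_def using p by (auto intro: le_SucI trans_le_add2)
  have S: "ln (real (max_separated X g (m * p) (e / 16))) / (real m * real p) < h + \<delta>"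
    using n0[OF m(2)] by simp
  have def_le: "entropy_defect d p m e \<gamma> \<le> h - 2 * \<delta> + \<delta> * \<gamma>"
  proof -
    have "ln (real (max_separated X g (m * p) (e / 16))) / (real m * real p) * \<gamma> \<le> (h + \<delta>) * \<gamma>"
      using S \<gamma> by (intro mult_right_mono) auto
    then have "entropy_defect d p m e \<gamma> \<le> \<delta> + \<delta> + (h + \<delta>) * \<gamma>"
      unfolding entropy_defect_def using lp \<open>2 / (real d + 1) * ln M0 \<le> \<delta>\<close> by linarith
    also have "\<dots> = h - 2 * \<delta> + \<delta> * \<gamma>" unfolding \<delta>_def by (simp add: field_simps)
    finally show ?thesis .
  qed
  also have "\<dots> < h" using \<delta> \<gamma> mult_strict_left_mono[OF \<gamma>(2) \<delta>] by linarith
  finally have "ereal (entropy_defect d p m e \<gamma>) < top_entropy X g" unfolding h(2) by simp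
  then have ev: "\<forall>\<^sub>F k in sequentially. ereal (entropy_defect d p m e \<gamma>) < metric_entropy (f k) (\<mu> k)"
    by (rule order_tendstoD(1)[OF ent_lim])
  obtain r where r: "0 < r" "\<forall>\<^sub>F k in sequentially. \<forall>\<gamma>.
    ereal (entropy_defect d p m e \<gamma>) < metric_entropy (f k) (\<mu> k) \<longrightarrow>
      dominated p r \<gamma> k"
    using e(2)[OF m(1)] by blast
  have "\<forall>\<^sub>F k in sequentially.
      dominated p r \<gamma> k"
    using r(2) ev by eventually_elim blast
  then show thesis using p(2) r(1) that by blast
qed

end

section \<open>Testing measures on the phase space with continuous functions\<close>

context phase_model begin

lemma continuous_borel_measurable:
  fixes h :: "'a \<Rightarrow> 'b::topological_space"
  assumes "sets M = sets (restrict_space borel X)" "continuous_on X h"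
  shows "h \<in> borel_measurable M"
  using borel_measurable_continuous_on_restrict[OF assms(2)] measurable_cong_sets[OF assms(1) refl] by blast

text \<open>Inner regularity holds for finite Borel measures on the ambient space; it is transferred
  by pushing \<open>M\<close> forward under the inclusion.\<close>

lemma compact_inner:
  assumes fin: "finite_measure M" and s: "sets M = sets (restrict_space borel X)" and B: "B \<in> sets M"
  shows "emeasure M B = (SUP K\<in>{K. K \<subseteq> B \<and> compact K}. emeasure M K)"
proof -
  have sp: "space M = X" using sets_eq_imp_space_eq[OF s] by (simp add: space_restrict_space)
  have B': "B \<in> sets borel" "B \<subseteq> X" using B s X_sets by auto
  define N where "N = distr M borel (\<lambda>x. x)"
  have id: "(\<lambda>x. x) \<in> measurable M borel"
    by (rule continuous_borel_measurable[OF s continuous_on_id])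
  have N: "emeasure N A = emeasure M A" if "A \<in> sets borel" "A \<subseteq> X" for A
    unfolding N_def using that emeasure_distr[OF id that(1)] sp by (simp add: Int_absorb2)
  have "emeasure N (space N) = emeasure M X"
    unfolding N_def using emeasure_distr[OF id, of UNIV] sp by simp
  then have Nf: "emeasure N (space N) \<noteq> \<infinity>" using finite_measure.emeasure_finite[OF fin] by simp
  have "emeasure N B = (SUP K\<in>{K. K \<subseteq> B \<and> compact K}. emeasure N K)"
    by (rule inner_regular[OF _ Nf B'(1)]) (simp add: N_def)
  also have "\<dots> = (SUP K\<in>{K. K \<subseteq> B \<and> compact K}. emeasure M K)"
    by (rule SUP_cong) (use N B' in \<open>auto simp: borel_compact\<close>)
  finally show ?thesis using N[OF B'] by simp
qed

lemma continuous_bound: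
  fixes h :: "'a \<Rightarrow> real"
  assumes "continuous_on X h"
  obtains B where "\<And>x. x \<in> X \<Longrightarrow> \<bar>h x\<bar> \<le> B"
proof -
  have "bounded (h ` X)" using assms X_compact by (intro compact_imp_bounded compact_continuous_image)
  then obtain B where "\<forall>y\<in>h ` X. \<bar>y\<bar> \<le> B" by (auto simp: bounded_iff)
  then show thesis by (intro that) auto
qed

lemma continuous_integrable:
  fixes h :: "'a \<Rightarrow> real"
  assumes fin: "finite_measure M" and s: "sets M = sets (restrict_space borel X)" and h: "continuous_on X h"
  shows "integrable M h"
proof -
  have sp: "space M = X" using sets_eq_imp_space_eq[OF s] by (simp add: space_restrict_space)
  obtain B where B: "\<And>x. x \<in> X \<Longrightarrow> \<bar>h x\<bar> \<le> B" using continuous_bound[OF h] by blast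
  show ?thesis
    by (rule finite_measure.integrable_const_bound[OF fin, where B = B])
      (use B sp continuous_borel_measurable[OF s h] in \<open>auto intro!: AE_I2\<close>)
qed

text \<open>Continuous cut-offs that decrease to the indicator of a nonempty compact
  \<open>K\<close> as \<open>j\<close> grows.\<close>

definition bump :: "'a set \<Rightarrow> nat \<Rightarrow> 'a \<Rightarrow> real" where
  "bump K j x = max 0 (1 - real j * infdist x K)"

lemma bump_continuous: "continuous_on X (bump K j)"
  unfolding bump_def by (intro continuous_intros)

lemma bump_bounds: "0 \<le> bump K j x" "bump K j x \<le> 1"
  unfolding bump_def by (auto simp: infdist_nonneg)

lemma bump_on: "x \<in> K \<Longrightarrow> bump K j x = 1"
  unfolding bump_def by simp

lemma integral_bump_lim:
  assumes fin: "finite_measure M" and s: "sets M = sets (restrict_space borel X)"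
    and K: "compact K" "K \<subseteq> X" "K \<noteq> {}"
  shows "(\<lambda>j. \<integral>x. bump K j x \<partial>M) \<longlonglongrightarrow> measure M K"
proof -
  interpret finite_measure M by fact
  have sp: "space M = X" using sets_eq_imp_space_eq[OF s] by (simp add: space_restrict_space)
  have Ks: "K \<in> sets M" unfolding s X_sets using K by (auto simp: borel_compact)
  have "(\<lambda>j. \<integral>x. bump K j x \<partial>M) \<longlonglongrightarrow> (\<integral>x. indicator K x \<partial>M)"
  proof (rule integral_dominated_convergence[where w = "\<lambda>_. 1"])
    show "AE x in M. (\<lambda>j. bump K j x) \<longlonglongrightarrow> indicator K x"
    proof (rule AE_I2)
      fix x
      show "(\<lambda>j. bump K j x) \<longlonglongrightarrow> indicator K x"
      proof (cases "x \<in> K")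
        case True then show ?thesis by (simp add: bump_on)
      next
        case False
        have pos: "0 < infdist x K" by (rule infdist_pos_not_in_closed) (use K False compact_imp_closed in auto)
        obtain j0 :: nat where j0: "1 / infdist x K < real j0" using reals_Archimedean2 by blast
        have "\<forall>\<^sub>F j in sequentially. bump K j x = 0" using eventually_ge_at_top[of j0]
        proof eventually_elim
          fix j assume "j0 \<le> j"
          then have "1 / infdist x K < real j" using j0 by linarith
          then have "1 < real j * infdist x K" using pos by (simp add: field_simps)
          then show "bump K j x = 0" by (simp add: bump_def)
        qed
        then show ?thesis using False by (simp add: tendsto_eventually)
      qed
    qed
  qed (use Ks bump_bounds continuous_borel_measurable[OF s bump_continuous] in \<open>auto intro!: AE_I2\<close>)
  then show ?thesis using sp K(2) by (simp add: Int_absorb2)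
qed

lemma measure_eq_continuous:
  assumes M: "finite_measure M" "sets M = sets (restrict_space borel X)"
    and N: "finite_measure N" "sets N = sets (restrict_space borel X)"
    and eq: "\<And>h::'a \<Rightarrow> real. continuous_on X h \<Longrightarrow> (\<integral>x. h x \<partial>M) = (\<integral>x. h x \<partial>N)"
  shows "M = N"
proof (rule measure_eqI)
  show "sets M = sets N" using M N by simp
  fix B assume B: "B \<in> sets M"
  then have B': "B \<in> sets N" "B \<subseteq> X" using M N X_sets by auto
  have "emeasure M K = emeasure N K" if K: "K \<subseteq> B" "compact K" for K
  proof (cases "K = {}")
    case False
    have "(\<lambda>j. \<integral>x. bump K j x \<partial>M) \<longlonglongrightarrow> measure M K"
      by (rule integral_bump_lim) (use K B' M False in auto)
    moreover have "(\<lambda>j. \<integral>x. bump K j x \<partial>N) \<longlonglongrightarrow> measure N K"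
      by (rule integral_bump_lim) (use K B' N False in auto)
    ultimately have "measure M K = measure N K"
      using eq[OF bump_continuous] LIMSEQ_unique by fastforce
    then show ?thesis using M N by (simp add: finite_measure.emeasure_eq_measure)
  qed simp
  then show "emeasure M B = emeasure N B"
    unfolding compact_inner[OF M B] compact_inner[OF N B'(1)] by (intro SUP_cong) auto
qed

lemma leb_finite_measure: "finite_measure (leb I)"
proof (rule finite_measureI)
  have X: "X \<in> sets (restrict_space borel X)" unfolding X_sets using X_borel by auto
  have "space (leb I) = X" using sets_eq_imp_space_eq[OF leb_sets] by (simp add: space_restrict_space)
  moreover have "{t\<in>T0. arc I t \<in> X} = T0" using arc_T T0_T by auto
  moreover have "emeasure lborel T0 < \<infinity>" by (rule emeasure_bounded_finite[OF T0_bounded])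
  ultimately show "emeasure (leb I) (space (leb I)) \<noteq> \<infinity>" using leb_eq[OF X] by simp
qed

end

lemma sum_ext_ln:
  assumes "\<And>i::nat. i < n \<Longrightarrow> 0 < a i" shows "(\<Sum>i<n. ext_ln (a i)) = ereal (ln (\<Prod>i<n. a i))"
  using assms
proof (induction n)
  case (Suc n)
  have "0 < (\<Prod>i<n. a i)" by (rule prod_pos) (use Suc.prems in auto)
  moreover have "0 < a n" using Suc.prems by auto
  moreover have "(\<Sum>i<n. ext_ln (a i)) = ereal (ln (\<Prod>i<n. a i))" using Suc by auto
  ultimately show ?case by (simp add: ext_ln_def ln_mult_pos)
qed (simp add: zero_ereal_def)

text \<open>Half of the growth rate \<open>ln 2 / p\<close> is given away to absorb the constant
  \<open>c\<close> for large \<open>j\<close>. The growth is known only along infinitely many times,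
  which is enough for a \<open>limsup\<close>.\<close>

lemma lyapunov_pos:
  assumes c: "0 < c" and p: "0 < p"
    and inf: "\<exists>\<^sub>\<infinity>j. c * 2 ^ j \<le> (\<Prod>i<p * j. abs_deriv I g ((g ^^ i) x))"
  shows "0 < lyapunov I g x"
proof -
  define L where "L = ln 2 / (2 * real p)"
  define S where "S n = ereal (1 / real n) * (\<Sum>i<n. ext_ln (abs_deriv I g ((g ^^ i) x)))" for n
  have L: "0 < L" unfolding L_def using p by simp
  obtain J :: nat where J: "- 2 * ln c / ln 2 < real J" using reals_Archimedean2 by blast
  have good: "ereal L \<le> S (p * j)" if j: "max 1 J \<le> j" and "c * 2 ^ j \<le> (\<Prod>i<p * j. abs_deriv I g ((g ^^ i) x))" for j
  proof -
    have pos: "0 < c * 2 ^ j" using c by simp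
    then have prod: "0 < (\<Prod>i<p * j. abs_deriv I g ((g ^^ i) x))" using that(2) by linarith
    have a: "0 < abs_deriv I g ((g ^^ i) x)" if "i < p * j" for i
      using prod that prod_zero[of "{..<p * j}" "\<lambda>i. abs_deriv I g ((g ^^ i) x)"]
      by (metis abs_deriv_def finite_lessThan lessThan_iff less_irrefl norm_ge_zero order_le_less)
    have "ln (c * 2 ^ j) \<le> ln (\<Prod>i<p * j. abs_deriv I g ((g ^^ i) x))"
      using that(2) pos prod by simp
    moreover have "ln (c * 2 ^ j) = ln c + real j * ln 2" using c by (simp add: ln_mult_pos ln_realpow)
    moreover have "- 2 * ln c < real J * ln 2" using J by (simp add: field_simps)
    moreover have "real J * ln 2 \<le> real j * ln 2" using j by (intro mult_right_mono) auto
    ultimately have "real j * ln 2 / 2 \<le> ln (\<Prod>i<p * j. abs_deriv I g ((g ^^ i) x))" by linarith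
    then have "1 / real (p * j) * (real j * ln 2 / 2) \<le> 1 / real (p * j) * ln (\<Prod>i<p * j. abs_deriv I g ((g ^^ i) x))"
      by (intro mult_left_mono) auto
    moreover have "1 / real (p * j) * (real j * ln 2 / 2) = L" unfolding L_def using p j by (simp add: field_simps)
    ultimately have "L \<le> 1 / real (p * j) * ln (\<Prod>i<p * j. abs_deriv I g ((g ^^ i) x))" by linarith
    moreover have "S (p * j) = ereal (1 / real (p * j) * ln (\<Prod>i<p * j. abs_deriv I g ((g ^^ i) x)))"
      unfolding S_def using sum_ext_ln[of "p * j" "\<lambda>i. abs_deriv I g ((g ^^ i) x)"] a by simp
    ultimately show ?thesis by (simp del: of_nat_mult)
  qed
  have "\<not> limsup S < ereal L"
  proof
    assume "limsup S < ereal L"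
    then have "\<forall>\<^sub>F n in sequentially. S n < ereal L" by (rule Limsup_lessD)
    then obtain N where N: "\<And>n. N \<le> n \<Longrightarrow> S n < ereal L" by (auto simp: eventually_sequentially)
    obtain j where j: "max (max 1 J) N \<le> j" "c * 2 ^ j \<le> (\<Prod>i<p * j. abs_deriv I g ((g ^^ i) x))"
      using inf unfolding INFM_nat_le by blast
    have "N \<le> p * j" using j(1) p by (metis One_nat_def Suc_leI max.bounded_iff mult_le_mono nat_mult_1)
    then have "S (p * j) < ereal L" by (rule N)
    moreover have "ereal L \<le> S (p * j)" by (rule good) (use j in auto)
    ultimately show False by simp
  qed
  then have "ereal L \<le> lyapunov I g x" unfolding lyapunov_def S_def by simp
  moreover have "0 < ereal L" using L by simp
  ultimately show ?thesis by (rule order_less_le_trans[rotated])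
qed

section \<open>Invariance, absolute continuity and exponents of the limit measure\<close>

context smooth_limit begin

lemma nu_prob: "prob_space \<nu>" and nu_sets: "sets \<nu> = sets (restrict_space borel X)"
  using nu unfolding borel_prob_def by auto

lemma nu_space: "space \<nu> = X"
  using sets_eq_imp_space_eq[OF nu_sets] by (simp add: space_restrict_space)

lemma nu_finite: "finite_measure \<nu>" by (rule prob_space.finite_measure[OF nu_prob])

lemma mu_finite: "finite_measure (\<mu> k)"
proof -
  interpret L: lifted I T0 "\<mu> k" "f k" "\<phi> k" "\<phi>' k" M0 by (rule lift)
  show ?thesis by unfold_locales
qed

lemmas mu_sets' = lifted.mu_sets[OF lift]

text \<open>The test functions vary with \<open>k\<close>, because \<open>f k\<close> and its
  derivative occur in the integrands; uniform convergence lets the limit function take their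
  place.\<close>

lemma weak_uniform:
  fixes h :: "nat \<Rightarrow> 'a \<Rightarrow> real"
  assumes lim: "uniform_limit X h H sequentially" and H: "continuous_on X H"
    and h: "\<And>k. h k \<in> borel_measurable (\<mu> k)"
  shows "(\<lambda>k. \<integral>x. h k x \<partial>\<mu> k) \<longlonglongrightarrow> (\<integral>x. H x \<partial>\<nu>)"
proof -
  have w: "(\<lambda>k. \<integral>x. H x \<partial>\<mu> k) \<longlonglongrightarrow> (\<integral>x. H x \<partial>\<nu>)"
    using weak H unfolding weak_star_converges_def by blast
  obtain B where B: "\<And>x. x \<in> X \<Longrightarrow> \<bar>H x\<bar> \<le> B" using continuous_bound[OF H] by blast
  have "(\<lambda>k. (\<integral>x. h k x \<partial>\<mu> k) - (\<integral>x. H x \<partial>\<mu> k)) \<longlonglongrightarrow> 0"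
  proof (rule tendstoI)
    fix e :: real assume e: "0 < e"
    have "\<forall>\<^sub>F k in sequentially. \<forall>x\<in>X. dist (h k x) (H x) < e / 2" using e by (intro uniform_limitD[OF lim]) auto
    then show "\<forall>\<^sub>F k in sequentially. dist ((\<integral>x. h k x \<partial>\<mu> k) - (\<integral>x. H x \<partial>\<mu> k)) 0 < e"
    proof eventually_elim
      fix k assume a: "\<forall>x\<in>X. dist (h k x) (H x) < e / 2"
      interpret L: lifted I T0 "\<mu> k" "f k" "\<phi> k" "\<phi>' k" M0 by (rule lift)
      have ih: "integrable (\<mu> k) (h k)"
      proof (rule L.integrable_const_bound[where B = "B + e / 2"])
        show "AE x in \<mu> k. norm (h k x) \<le> B + e / 2"
        proof (rule AE_I2)
          fix x assume "x \<in> space (\<mu> k)"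
          then have "\<bar>h k x - H x\<bar> < e / 2" "\<bar>H x\<bar> \<le> B" using a B L.mu_space by (auto simp: dist_real_def)
          then show "norm (h k x) \<le> B + e / 2" unfolding real_norm_def by linarith
        qed
      qed (rule h)
      have iH: "integrable (\<mu> k) H" by (rule continuous_integrable[OF mu_finite mu_sets' H])
      have "\<bar>(\<integral>x. h k x \<partial>\<mu> k) - (\<integral>x. H x \<partial>\<mu> k)\<bar> = \<bar>\<integral>x. h k x - H x \<partial>\<mu> k\<bar>" using ih iH by simp
      also have "\<dots> \<le> (\<integral>x. \<bar>h k x - H x\<bar> \<partial>\<mu> k)" by (rule integral_abs_bound)
      also have "\<dots> \<le> (\<integral>x. e / 2 \<partial>\<mu> k)"
        using a L.mu_space by (intro integral_mono integrable_abs Bochner_Integration.integrable_diff ih iH)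
          (auto simp: dist_real_def less_imp_le)
      also have "\<dots> < e" using e by (simp add: L.prob_space)
      finally show "dist ((\<integral>x. h k x \<partial>\<mu> k) - (\<integral>x. H x \<partial>\<mu> k)) 0 < e" by simp
    qed
  qed
  from tendsto_add[OF this w] show ?thesis by simp
qed

lemma nu_invariant: "invariant_measure g \<nu>"
proof -
  have "g \<in> measurable \<nu> borel" by (rule continuous_borel_measurable[OF nu_sets g_cont])
  then have "g \<in> measurable \<nu> (restrict_space borel X)"
    by (rule measurable_restrict_space2[rotated]) (use gX nu_space in auto)
  then have gm: "g \<in> measurable \<nu> \<nu>" using measurable_cong_sets[OF refl nu_sets] by blast
  have "distr \<nu> \<nu> g = \<nu>"
  proof (rule measure_eq_continuous)
    show "finite_measure (distr \<nu> \<nu> g)" by (rule finite_measure.finite_measure_distr[OF nu_finite gm])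
    fix h :: "'a \<Rightarrow> real" assume h: "continuous_on X h"
    have hm: "h \<in> borel_measurable \<nu>" by (rule continuous_borel_measurable[OF nu_sets h])
    have hk: "h \<in> borel_measurable (\<mu> k)" for k by (rule continuous_borel_measurable[OF mu_sets' h])
    have hg: "continuous_on X (\<lambda>x. h (g x))"
      by (rule continuous_on_compose2[OF h g_cont]) (use gX in auto)
    have inv: "(\<integral>x. h (f k x) \<partial>\<mu> k) = (\<integral>x. h x \<partial>\<mu> k)" for k
    proof -
      interpret L: lifted I T0 "\<mu> k" "f k" "\<phi> k" "\<phi>' k" M0 by (rule lift)
      show ?thesis using L.iter_integral[OF hk, of 1] by simp
    qed
    have hfm: "(\<lambda>x. h (f k x)) \<in> borel_measurable (\<mu> k)" for k
      using measurable_comp[OF pmp.g_meas[OF lifted.axioms(2)[OF lift]] hk] by (simp add: comp_def)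
    have "(\<lambda>k. \<integral>x. h (f k x) \<partial>\<mu> k) \<longlonglongrightarrow> (\<integral>x. h (g x) \<partial>\<nu>)"
      by (rule weak_uniform[OF uniform_limit_compact_comp[OF X_compact h uniform_limit_const fX gX f_lim] hg hfm])
    moreover have "(\<lambda>k. \<integral>x. h x \<partial>\<mu> k) \<longlonglongrightarrow> (\<integral>x. h x \<partial>\<nu>)"
      using weak h unfolding weak_star_converges_def by blast
    ultimately have "(\<integral>x. h (g x) \<partial>\<nu>) = (\<integral>x. h x \<partial>\<nu>)" unfolding inv using LIMSEQ_unique by blast
    then show "(\<integral>x. h x \<partial>distr \<nu> \<nu> g) = (\<integral>x. h x \<partial>\<nu>)" by (simp add: integral_distr[OF gm hm])
  qed (use nu_sets nu_finite in auto)
  then show ?thesis using gm unfolding invariant_measure_def by simp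
qed

text \<open>The density bound holds only up to the mass \<open>1 - \<gamma>\<close>, so first the
  neighbourhoods of \<open>K\<close> shrink and then \<open>\<gamma>\<close> tends to 1. A bump
  function between \<open>K\<close> and its neighbourhood makes weak convergence applicable.\<close>

lemma nu_compact_null:
  assumes K: "compact K" "K \<subseteq> X" and null: "emeasure (leb I) K = 0"
  shows "emeasure \<nu> K = 0"
proof (cases "K = {}")
  case False
  interpret N: prob_space \<nu> by (rule nu_prob)
  interpret Lb: finite_measure "leb I" by (rule leb_finite_measure)
  have Ks: "K \<in> sets \<nu>" unfolding nu_sets X_sets using K by (auto simp: borel_compact)
  define U where "U j = {x\<in>X. infdist x K < 1 / real (Suc j)}" for j
  have Ub: "U j \<in> sets (restrict_space borel X)" for j
  proof -
    have "open {x. infdist x K < 1 / real (Suc j)}" by (intro open_Collect_less continuous_intros)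
    then have "{x. infdist x K < 1 / real (Suc j)} \<in> sets borel" by simp
    then show ?thesis unfolding X_sets U_def using X_borel by (auto simp: Collect_conj_eq)
  qed
  have "decseq U" unfolding decseq_def
  proof (intro allI impI subsetI)
    fix m n x assume "m \<le> n" "x \<in> U n"
    moreover have "1 / real (Suc n) \<le> 1 / real (Suc m)" using \<open>m \<le> n\<close> by (intro divide_left_mono) auto
    ultimately show "x \<in> U m" unfolding U_def by auto
  qed
  moreover have "(\<Inter>j. U j) = K"
  proof
    show "K \<subseteq> (\<Inter>j. U j)" unfolding U_def using K by auto
    show "(\<Inter>j. U j) \<subseteq> K"
    proof
      fix x assume x: "x \<in> (\<Inter>j. U j)"
      show "x \<in> K"
      proof (rule ccontr)
        assume "x \<notin> K"
        then have "0 < infdist x K" by (intro infdist_pos_not_in_closed) (use K False compact_imp_closed in auto)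
        then obtain j where "1 / real (Suc j) < infdist x K" using nat_approx_posE by blast
        then show False using x unfolding U_def by (auto dest!: spec[of _ j])
      qed
    qed
  qed
  ultimately have Ulim: "(\<lambda>j. measure (leb I) (U j)) \<longlonglongrightarrow> 0"
    using Lb.finite_Lim_measure_decseq[of U] Ub leb_sets null by (auto simp: measure_def)
  have small: "measure \<nu> K \<le> 1 - \<gamma>" if \<gamma>: "0 < \<gamma>" "\<gamma> < 1" for \<gamma>
  proof -
    obtain p r where pr: "0 < p" "0 < r" "\<forall>\<^sub>F k in sequentially.
      dominated p r \<gamma> k"
      by (rule uniform_domination[OF \<gamma>])
    have "measure \<nu> K \<le> 1 - \<gamma> + 2 * exp 1 / r * measure (leb I) (U j)" for j
    proof -
      have "measure \<nu> K = (\<integral>x. indicator K x \<partial>\<nu>)" using K(2) nu_space by (simp add: Int_absorb2)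
      also have "\<dots> \<le> (\<integral>x. bump K (Suc j) x \<partial>\<nu>)"
      proof (rule integral_mono)
        show "integrable \<nu> (indicator K :: 'a \<Rightarrow> real)"
          using Ks by (intro integrable_real_indicator) (auto simp: less_top[symmetric])
      qed (use bump_bounds bump_on continuous_integrable[OF nu_finite nu_sets bump_continuous]
          in \<open>auto split: split_indicator\<close>)
      also have "\<dots> \<le> 1 - \<gamma> + 2 * exp 1 / r * measure (leb I) (U j)"
      proof (rule tendsto_upperbound)
        show "(\<lambda>k. \<integral>x. bump K (Suc j) x \<partial>\<mu> k) \<longlonglongrightarrow> (\<integral>x. bump K (Suc j) x \<partial>\<nu>)"
          using weak bump_continuous unfolding weak_star_converges_def by blast
        show "\<forall>\<^sub>F k in sequentially. (\<integral>x. bump K (Suc j) x \<partial>\<mu> k) \<le> 1 - \<gamma> + 2 * exp 1 / r * measure (leb I) (U j)"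
          using pr(3)
        proof eventually_elim
          fix k assume a: "dominated p r \<gamma> k"
          interpret L: lifted I T0 "\<mu> k" "f k" "\<phi> k" "\<phi>' k" M0 by (rule lift)
          have Us: "U j \<in> sets (\<mu> k)" using Ub mu_sets' by simp
          have "(\<integral>x. bump K (Suc j) x \<partial>\<mu> k) \<le> (\<integral>x. indicator (U j) x \<partial>\<mu> k)"
          proof (rule integral_mono)
            fix x assume "x \<in> space (\<mu> k)"
            then have x: "x \<in> X" using L.mu_space by simp
            show "bump K (Suc j) x \<le> indicator (U j) x"
            proof (cases "x \<in> U j")
              case False
              then have "1 \<le> real (Suc j) * infdist x K" using x unfolding U_def by (auto simp: field_simps)
              then show ?thesis using False by (simp add: bump_def)
            qed (simp add: bump_bounds)
          next
            show "integrable (\<mu> k) (indicator (U j) :: 'a \<Rightarrow> real)"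
              using Us by (intro integrable_real_indicator) (auto simp: less_top[symmetric])
          qed (rule continuous_integrable[OF mu_finite mu_sets' bump_continuous])
          also have "\<dots> = measure (\<mu> k) (U j)" using sets.sets_into_space[OF Us] by (simp add: Int_absorb2)
          also have "\<dots> \<le> 1 - \<gamma> + 2 * exp 1 / r * measure (leb I) (U j)"
            using a Us unfolding dominated_def by blast
          finally show "(\<integral>x. bump K (Suc j) x \<partial>\<mu> k) \<le> 1 - \<gamma> + 2 * exp 1 / r * measure (leb I) (U j)" .
        qed
      qed simp
      finally show ?thesis .
    qed
    moreover have "(\<lambda>j. 1 - \<gamma> + 2 * exp 1 / r * measure (leb I) (U j)) \<longlonglongrightarrow> 1 - \<gamma> + 2 * exp 1 / r * 0"
      by (intro tendsto_intros Ulim)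
    ultimately show ?thesis by (intro LIMSEQ_le_const[where X = "\<lambda>j. 1 - \<gamma> + 2 * exp 1 / r * measure (leb I) (U j)"]) auto
  qed
  have "measure \<nu> K \<le> 0"
  proof (rule ccontr)
    assume "\<not> ?thesis"
    then have a: "0 < measure \<nu> K" by simp
    then show False using small[of "1 - measure \<nu> K / 2"] N.prob_le_1[of K] by simp
  qed
  then show ?thesis by (simp add: N.emeasure_eq_measure measure_le_0_iff)
qed simp

lemma nu_ac: "absolutely_continuous (leb I) \<nu>"
  unfolding absolutely_continuous_def
proof
  fix B assume B: "B \<in> null_sets (leb I)"
  then have Bs: "B \<in> sets (leb I)" "B \<in> sets \<nu>" "B \<subseteq> X" using leb_sets nu_sets X_sets by auto
  have "emeasure \<nu> K = 0" if K: "K \<subseteq> B" "compact K" for K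
  proof (rule nu_compact_null)
    have "emeasure (leb I) K \<le> emeasure (leb I) B" using K(1) Bs(1) by (rule emeasure_mono)
    then show "emeasure (leb I) K = 0" using B by (auto simp: null_sets_def)
  qed (use K Bs in auto)
  then have "(SUP K\<in>{K. K \<subseteq> B \<and> compact K}. emeasure \<nu> K) \<le> 0" by (intro SUP_least) auto
  then have "emeasure \<nu> B = 0"
    unfolding compact_inner[OF nu_finite nu_sets Bs(2), symmetric] by simp
  then show "B \<in> null_sets \<nu>" using Bs by auto
qed

lemma expansion_Suc: "expansion h (Suc n) x = expansion h n x * abs_deriv I h ((h ^^ n) x)"
  unfolding expansion_def by simp

lemma g_iter: "(g ^^ n) \<in> X \<rightarrow> X" and f_iter: "(f k ^^ n) \<in> X \<rightarrow> X"
  using iter_in[OF gX] iter_in[OF fX] by auto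

lemma expansion_continuous: "continuous_on X (expansion g n)"
proof (induction n)
  case (Suc n)
  have "continuous_on X (\<lambda>x. abs_deriv I g ((g ^^ n) x))"
    by (rule continuous_on_compose2[OF ad_cont iter_continuous[OF g_cont gX]]) (use g_iter in auto)
  then show ?case unfolding expansion_Suc using Suc by (intro continuous_intros)
qed (simp add: expansion_def)

lemma expansion_lim: "uniform_limit X (\<lambda>k. expansion (f k) n) (expansion g n) sequentially"
proof (induction n)
  case 0 then show ?case by (simp add: expansion_def uniform_limit_const)
next
  case (Suc n)
  have c: "continuous_on X (\<lambda>x. abs_deriv I g ((g ^^ n) x))"
    by (rule continuous_on_compose2[OF ad_cont iter_continuous[OF g_cont gX]]) (use g_iter in auto)
  have "uniform_limit X (\<lambda>k x. abs_deriv I (f k) ((f k ^^ n) x)) (\<lambda>x. abs_deriv I g ((g ^^ n) x)) sequentially"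
    by (rule uniform_limit_compact_comp[OF X_compact ad_cont ad_lim f_iter g_iter])
      (rule iterates_uniform[OF X_compact g_cont gX fX f_lim])
  then have "uniform_limit X (\<lambda>k x. expansion (f k) n x * abs_deriv I (f k) ((f k ^^ n) x))
    (\<lambda>x. expansion g n x * abs_deriv I g ((g ^^ n) x)) sequentially"
    by (intro uniform_lim_mult Suc compact_imp_bounded compact_continuous_image X_compact expansion_continuous c)
  then show ?case unfolding expansion_Suc[abs_def] .
qed

text \<open>Indicators of superlevel sets are not continuous. The ramp \<open>\<psi>\<close> rises
  from 0 at \<open>a / 2\<close> to 1 at \<open>a\<close>, which costs a factor 2 in the
  threshold.\<close>

lemma nu_expansion:
  assumes a: "0 < a" and ev: "\<forall>\<^sub>F k in sequentially. \<gamma> \<le> measure (\<mu> k) {x\<in>X. a \<le> expansion (f k) n x}"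
  shows "\<gamma> \<le> measure \<nu> {x\<in>X. a / 2 \<le> expansion g n x}"
proof -
  interpret N: prob_space \<nu> by (rule nu_prob)
  define \<psi> where "\<psi> y = max 0 (min 1 (2 * y / a - 1))" for y :: real
  have cpsi: "continuous_on S \<psi>" for S unfolding \<psi>_def using a by (intro continuous_intros) auto
  have psi: "0 \<le> \<psi> y" "\<psi> y \<le> 1" for y unfolding \<psi>_def by auto
  have psi1: "a \<le> y \<Longrightarrow> \<psi> y = 1" for y unfolding \<psi>_def using a by (auto simp: field_simps)
  have psi0: "y < a / 2 \<Longrightarrow> \<psi> y = 0" for y unfolding \<psi>_def using a by (auto simp: field_simps)
  have em: "expansion (f k) n \<in> borel_measurable (\<mu> k)" for k
  proof -
    interpret L: lifted I T0 "\<mu> k" "f k" "\<phi> k" "\<phi>' k" M0 by (rule lift)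
    show ?thesis unfolding expansion_def[abs_def] by measurable
  qed
  have pm: "\<psi> \<in> borel_measurable borel" using cpsi by (rule borel_measurable_continuous_onI)
  have lip: "\<bar>\<psi> y - \<psi> z\<bar> \<le> 2 / a * \<bar>y - z\<bar>" for y z
  proof -
    have "\<bar>\<psi> y - \<psi> z\<bar> \<le> \<bar>(2 * y / a - 1) - (2 * z / a - 1)\<bar>" unfolding \<psi>_def by linarith
    also have "(2 * y / a - 1) - (2 * z / a - 1) = 2 / a * (y - z)" by (simp add: algebra_simps diff_divide_distrib)
    also have "\<bar>2 / a * (y - z)\<bar> = 2 / a * \<bar>y - z\<bar>" unfolding abs_mult using a by simp
    finally show ?thesis .
  qed
  have lim: "uniform_limit X (\<lambda>k x. \<psi> (expansion (f k) n x)) (\<lambda>x. \<psi> (expansion g n x)) sequentially"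
  proof (rule uniform_limitI)
    fix e :: real assume e: "0 < e"
    have "\<forall>\<^sub>F k in sequentially. \<forall>x\<in>X. dist (expansion (f k) n x) (expansion g n x) < a * e / 2"
      using e a by (intro uniform_limitD[OF expansion_lim]) auto
    then show "\<forall>\<^sub>F k in sequentially. \<forall>x\<in>X. dist (\<psi> (expansion (f k) n x)) (\<psi> (expansion g n x)) < e"
    proof eventually_elim
      fix k assume b: "\<forall>x\<in>X. dist (expansion (f k) n x) (expansion g n x) < a * e / 2"
      show "\<forall>x\<in>X. dist (\<psi> (expansion (f k) n x)) (\<psi> (expansion g n x)) < e"
      proof
        fix x assume "x \<in> X"
        then have "2 / a * \<bar>expansion (f k) n x - expansion g n x\<bar> < 2 / a * (a * e / 2)"
          using b a by (intro mult_strict_left_mono) (auto simp: dist_real_def)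
        then show "dist (\<psi> (expansion (f k) n x)) (\<psi> (expansion g n x)) < e"
          using lip[of "expansion (f k) n x" "expansion g n x"] a by (simp add: dist_real_def)
      qed
    qed
  qed
  have cg: "continuous_on X (\<lambda>x. \<psi> (expansion g n x))"
    by (rule continuous_on_compose2[OF cpsi[of UNIV] expansion_continuous]) auto
  have "(\<lambda>k. \<integral>x. \<psi> (expansion (f k) n x) \<partial>\<mu> k) \<longlonglongrightarrow> (\<integral>x. \<psi> (expansion g n x) \<partial>\<nu>)"
    by (rule weak_uniform[OF lim cg]) (rule measurable_compose[OF em pm])
  moreover have "\<forall>\<^sub>F k in sequentially. \<gamma> \<le> (\<integral>x. \<psi> (expansion (f k) n x) \<partial>\<mu> k)"
    using ev
  proof eventually_elim
    fix k assume le: "\<gamma> \<le> measure (\<mu> k) {x\<in>X. a \<le> expansion (f k) n x}"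
    interpret L: lifted I T0 "\<mu> k" "f k" "\<phi> k" "\<phi>' k" M0 by (rule lift)
    note [measurable] = em[of k] pm
    have A: "{x\<in>X. a \<le> expansion (f k) n x} \<in> sets (\<mu> k)" unfolding L.mu_space[symmetric] by measurable
    have "measure (\<mu> k) {x\<in>X. a \<le> expansion (f k) n x} = (\<integral>x. indicator {x\<in>X. a \<le> expansion (f k) n x} x \<partial>\<mu> k)"
      using A sets.sets_into_space[OF A] by (simp add: Int_absorb2)
    also have "\<dots> \<le> (\<integral>x. \<psi> (expansion (f k) n x) \<partial>\<mu> k)"
    proof (rule integral_mono)
      show "integrable (\<mu> k) (\<lambda>x. \<psi> (expansion (f k) n x))"
        by (rule L.integrable_const_bound[where B = 1]) (use psi in auto)
      show "integrable (\<mu> k) (indicator {x\<in>X. a \<le> expansion (f k) n x} :: 'a \<Rightarrow> real)"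
        using A by (intro integrable_real_indicator) (auto simp: less_top[symmetric])
    qed (use psi psi1 in \<open>auto split: split_indicator\<close>)
    finally show "\<gamma> \<le> (\<integral>x. \<psi> (expansion (f k) n x) \<partial>\<mu> k)" using le by linarith
  qed
  ultimately have "\<gamma> \<le> (\<integral>x. \<psi> (expansion g n x) \<partial>\<nu>)" by (rule tendsto_lowerbound) simp
  also have "\<dots> \<le> (\<integral>x. indicator {x\<in>X. a / 2 \<le> expansion g n x} x \<partial>\<nu>)"
  proof (rule integral_mono)
    show "integrable \<nu> (\<lambda>x. \<psi> (expansion g n x))" by (rule continuous_integrable[OF nu_finite nu_sets cg])
    note [measurable] = continuous_borel_measurable[OF nu_sets expansion_continuous]
    have A: "{x\<in>X. a / 2 \<le> expansion g n x} \<in> sets \<nu>" unfolding nu_space[symmetric] by measurable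
    then show "integrable \<nu> (indicator {x\<in>X. a / 2 \<le> expansion g n x} :: 'a \<Rightarrow> real)"
      by (intro integrable_real_indicator) (auto simp: less_top[symmetric])
    fix x assume "x \<in> space \<nu>"
    then show "\<psi> (expansion g n x) \<le> indicator {x\<in>X. a / 2 \<le> expansion g n x} x"
      using nu_space psi psi0[of "expansion g n x"] by (cases "a / 2 \<le> expansion g n x") auto
  qed
  also have "\<dots> = measure \<nu> {x\<in>X. a / 2 \<le> expansion g n x}" using nu_space by (simp add: Int_absorb2 Collect_conj_eq)
  finally show ?thesis .
qed

text \<open>Each \<open>A j\<close> is treated for fixed \<open>j\<close> by letting
  \<open>k\<close> tend to infinity. The points that lie in infinitely many \<open>A j\<close> still
  have measure at least \<open>\<gamma>\<close>, since they form the decreasing intersection of the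
  sets \<open>U m\<close>.\<close>

lemma nu_positive_exponent:
  assumes \<gamma>: "0 < \<gamma>" "\<gamma> < 1"
  obtains G where "G \<in> sets \<nu>" "\<gamma> \<le> measure \<nu> G" "\<And>x. x \<in> G \<Longrightarrow> 0 < lyapunov I g x"
proof -
  interpret N: prob_space \<nu> by (rule nu_prob)
  obtain p r where pr: "0 < p" "0 < r" "\<forall>\<^sub>F k in sequentially.
    dominated p r \<gamma> k"
    by (rule uniform_domination[OF \<gamma>])
  define c where "c = exp (- 2) * r / 2"
  have c: "0 < c" unfolding c_def using pr by simp
  define A where "A j = {x\<in>X. c * 2 ^ j \<le> expansion g (p * j) x}" for j
  have mA: "\<gamma> \<le> measure \<nu> (A j)" for j
  proof -
    have "\<forall>\<^sub>F k in sequentially. \<gamma> \<le> measure (\<mu> k) {x\<in>X. exp (- 2) * r * 2 ^ j \<le> expansion (f k) (p * j) x}"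
      using pr(3) by eventually_elim (simp add: dominated_def)
    then have "\<gamma> \<le> measure \<nu> {x\<in>X. (exp (- 2) * r * 2 ^ j) / 2 \<le> expansion g (p * j) x}"
      by (rule nu_expansion[rotated]) (use pr in simp)
    then show ?thesis unfolding A_def c_def by (simp add: mult.commute mult.left_commute)
  qed
  have As: "A j \<in> sets \<nu>" for j
  proof -
    note [measurable] = continuous_borel_measurable[OF nu_sets expansion_continuous]
    show ?thesis unfolding A_def nu_space[symmetric] by measurable
  qed
  define U where "U m = (\<Union>j\<in>{m..}. A j)" for m
  have Us: "U m \<in> sets \<nu>" for m unfolding U_def using As by (intro sets.countable_UN') auto
  have "decseq U" unfolding decseq_def U_def by (auto intro: order_trans)
  then have lim: "(\<lambda>m. measure \<nu> (U m)) \<longlonglongrightarrow> measure \<nu> (\<Inter>m. U m)"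
    using Us by (intro N.finite_Lim_measure_decseq) auto
  have "\<gamma> \<le> measure \<nu> (U m)" for m
    using mA[of m] N.finite_measure_mono[of "A m" "U m"] Us[of m] unfolding U_def by fastforce
  then have ge: "\<gamma> \<le> measure \<nu> (\<Inter>m. U m)" using lim by (intro LIMSEQ_le_const) auto
  show thesis
  proof (rule that[OF _ ge])
    show "(\<Inter>m. U m) \<in> sets \<nu>" using Us by auto
    fix x assume "x \<in> (\<Inter>m. U m)"
    then have "\<exists>\<^sub>\<infinity>j. c * 2 ^ j \<le> expansion g (p * j) x"
      unfolding INFM_nat_le U_def A_def by auto
    then show "0 < lyapunov I g x" unfolding expansion_def by (rule lyapunov_pos[OF c pr(1)])
  qed
qed

lemma nu_hyperbolic: "AE x in \<nu>. 0 < lyapunov I g x"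
proof -
  interpret N: prob_space \<nu> by (rule nu_prob)
  have "\<exists>G. G \<in> sets \<nu> \<and> 1 - 1 / (real n + 2) \<le> measure \<nu> G \<and> (\<forall>x\<in>G. 0 < lyapunov I g x)" for n :: nat
  proof -
    have "0 < 1 - 1 / (real n + 2)" "1 - 1 / (real n + 2) < 1" by (simp_all add: field_simps)
    then obtain G where "G \<in> sets \<nu>" "1 - 1 / (real n + 2) \<le> measure \<nu> G" "\<And>x. x \<in> G \<Longrightarrow> 0 < lyapunov I g x"
      by (rule nu_positive_exponent) (rule that)
    then show ?thesis by blast
  qed
  then have "\<exists>G. \<forall>n. G n \<in> sets \<nu> \<and> 1 - 1 / (real n + 2) \<le> measure \<nu> (G n) \<and> (\<forall>x\<in>G n. 0 < lyapunov I g x)"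
    by (intro choice allI)
  then obtain G where G: "\<And>n. G n \<in> sets \<nu>" "\<And>n. 1 - 1 / (real n + 2) \<le> measure \<nu> (G n)"
    "\<And>n x. x \<in> G n \<Longrightarrow> 0 < lyapunov I g x" by blast
  define E where "E = space \<nu> - (\<Union>n. G n)"
  have E: "E \<in> sets \<nu>" unfolding E_def using G by auto
  have "measure \<nu> E \<le> 1 / (real n + 2)" for n
  proof -
    have "measure \<nu> E \<le> measure \<nu> (space \<nu> - G n)" unfolding E_def using G by (intro N.finite_measure_mono) auto
    also have "\<dots> = 1 - measure \<nu> (G n)" using G by (intro N.prob_compl)
    finally show ?thesis using G(2)[of n] by linarith
  qed
  moreover have "(\<lambda>n. 1 / (real n + 2)) \<longlonglongrightarrow> 0" by real_asymp
  ultimately have "measure \<nu> E \<le> 0" by (intro LIMSEQ_le_const) auto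
  then have "E \<in> null_sets \<nu>" using E by (simp add: null_sets_def N.emeasure_eq_measure measure_le_0_iff)
  from AE_not_in[OF this] show ?thesis
  proof (rule AE_mp, intro AE_I2 impI)
    fix x assume "x \<in> space \<nu>" "x \<notin> E"
    then obtain n where "x \<in> G n" unfolding E_def by blast
    then show "0 < lyapunov I g x" by (rule G(3))
  qed
qed

theorem SRB_limit: "SRB_measure I g \<nu>"
  unfolding SRB_measure_def hyperbolic_measure_def
  using nu nu_invariant nu_hyperbolic nu_ac by blast

end

section \<open>From smooth maps to lifts with uniform bounds\<close>

lemma uniform_limit_bounded_family:
  fixes u :: "nat \<Rightarrow> 'b \<Rightarrow> 'a::real_normed_vector"
  assumes lim: "uniform_limit T u w sequentially" and u: "\<And>k. \<exists>B. \<forall>t\<in>T. norm (u k t) \<le> B"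
    and w: "\<exists>B. \<forall>t\<in>T. norm (w t) \<le> B"
  shows "\<exists>B. \<forall>k. \<forall>t\<in>T. norm (u k t) \<le> B"
proof -
  obtain b where b: "\<And>k t. t \<in> T \<Longrightarrow> norm (u k t) \<le> b k" using u by metis
  obtain B where B: "\<And>t. t \<in> T \<Longrightarrow> norm (w t) \<le> B" using w by blast
  have "\<forall>\<^sub>F k in sequentially. \<forall>t\<in>T. dist (u k t) (w t) < 1" by (rule uniform_limitD[OF lim]) simp
  then obtain K where K: "\<And>k t. K \<le> k \<Longrightarrow> t \<in> T \<Longrightarrow> dist (u k t) (w t) < 1"
    by (auto simp: eventually_sequentially)
  have "norm (u k t) \<le> \<bar>B\<bar> + 1 + (\<Sum>i<K. \<bar>b i\<bar>)" if t: "t \<in> T" for k t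
  proof (cases "K \<le> k")
    case True
    have "norm (u k t) \<le> norm (w t) + dist (u k t) (w t)"
      using norm_triangle_sub[of "u k t" "w t"] by (simp add: dist_norm)
    moreover have "0 \<le> (\<Sum>i<K. \<bar>b i\<bar>)" by (simp add: sum_nonneg)
    ultimately show ?thesis using B[OF t] K[OF True t] by linarith
  next
    case False
    then have "\<bar>b k\<bar> \<le> (\<Sum>i<K. \<bar>b i\<bar>)" by (intro member_le_sum) auto
    then show ?thesis using b[OF t, of k] by linarith
  qed
  then show ?thesis by blast
qed

definition lift_of :: "'a::real_normed_vector phase_space \<Rightarrow> ('a \<Rightarrow> 'a) \<Rightarrow> (real \<Rightarrow> real) \<Rightarrow> (real \<Rightarrow> real) \<Rightarrow> bool" where
  "lift_of I h \<phi> \<phi>' \<longleftrightarrow> (\<forall>t\<in>times I. \<phi> t \<in> times I \<and> arc I (\<phi> t) = h (arc I t) \<and>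
    (\<phi> has_real_derivative \<phi>' t) (at t within times I) \<and>
    \<bar>\<phi>' t\<bar> = norm (vector_derivative (h \<circ> arc I) (at t within times I)))"

text \<open>What has to be checked separately for the interval and the circle: bounded derivatives
  of one map, and lifts whose derivatives are bounded uniformly along a sequence.\<close>

locale smooth_model = phase_model I T0 for I :: "'a::euclidean_space phase_space" and T0 +
  assumes derivs_bounded: "smooth_map I h \<Longrightarrow>
      \<exists>B. \<forall>t\<in>times I. norm (nth_vector_derivative (times I) n (h \<circ> arc I) t) \<le> B"
    and lifts: "(\<And>k. smooth_map I (f k)) \<Longrightarrow>
      (\<And>n. \<exists>B. \<forall>k. \<forall>t\<in>times I. norm (nth_vector_derivative (times I) n (f k \<circ> arc I) t) \<le> B) \<Longrightarrow>
      \<exists>\<phi> \<phi>'. (\<forall>k. lift_of I (f k) (\<phi> k) (\<phi>' k)) \<and> (\<forall>n. Cb n (times I) \<phi>')"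
    and abs_deriv_arc: "smooth_map I h \<Longrightarrow> t \<in> times I \<Longrightarrow>
      abs_deriv I h (arc I t) = norm (vector_derivative (h \<circ> arc I) (at t within times I))"
begin

lemma X_arc: "X = arc I ` T"
  using arc_bij arc_T T0_T unfolding bij_betw_def by blast

text \<open>By \<open>near\<close>, close points have close parameters, so a Lipschitz bound along
  the parametrisation gives continuity, also across the point where the circle is cut open.\<close>

lemma continuous_from_arc:
  fixes H :: "'a \<Rightarrow> 'b::metric_space"
  assumes L: "\<And>s t. s \<in> T \<Longrightarrow> t \<in> T \<Longrightarrow> dist (H (arc I s)) (H (arc I t)) \<le> L * \<bar>s - t\<bar>"
  shows "continuous_on X H"
  unfolding continuous_on_iff
proof (intro ballI allI impI)
  fix x e assume x: "x \<in> X" and e: "(0::real) < e"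
  show "\<exists>d>0. \<forall>y\<in>X. dist y x < d \<longrightarrow> dist (H y) (H x) < e"
  proof (intro exI[of _ "e / (2 * (\<bar>L\<bar> + 1))"] conjI ballI impI)
    show "0 < e / (2 * (\<bar>L\<bar> + 1))" using e by simp
    fix y assume y: "y \<in> X" and d: "dist y x < e / (2 * (\<bar>L\<bar> + 1))"
    obtain s t where st: "s \<in> T" "t \<in> T" "arc I s = y" "arc I t = x" "\<bar>s - t\<bar> \<le> 2 * dist y x"
      using near[OF y x] by blast
    have "dist (H y) (H x) \<le> L * \<bar>s - t\<bar>" using L[OF st(1,2)] st(3,4) by simp
    also have "\<dots> \<le> (\<bar>L\<bar> + 1) * \<bar>s - t\<bar>" by (intro mult_right_mono) auto
    also have "\<dots> \<le> (\<bar>L\<bar> + 1) * (2 * dist y x)" using st(5) by (intro mult_left_mono) auto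
    also have "\<dots> < e" using d by (simp add: field_simps)
    finally show "dist (H y) (H x) < e" .
  qed
qed

lemma deriv_lipschitz:
  assumes "\<And>t. t \<in> T \<Longrightarrow> (u has_real_derivative u' t) (at t within T)" "\<And>t. t \<in> T \<Longrightarrow> \<bar>u' t\<bar> \<le> B"
    and "s \<in> T" "t \<in> T"
  shows "\<bar>u s - u t\<bar> \<le> B * \<bar>s - t\<bar>"
  using field_differentiable_bound[OF T_convex, of u u' B s t] assms by auto

lemma smooth_continuous:
  assumes h: "smooth_map I h"
  shows "continuous_on X h" "continuous_on X (abs_deriv I h)"
proof -
  \<comment> \<open>A lift of the single map \<open>h\<close> is taken from the constant
    sequence.\<close>
  have "\<exists>\<phi> \<phi>'. (\<forall>k::nat. lift_of I h (\<phi> k) (\<phi>' k)) \<and> (\<forall>n. Cb n T \<phi>')"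
    by (rule lifts) (use h derivs_bounded[OF h] in auto)
  then obtain \<phi> \<phi>' where L: "\<And>k::nat. lift_of I h (\<phi> k) (\<phi>' k)" and C: "\<And>n. Cb n T \<phi>'" by blast
  obtain B where B: "\<And>t. t \<in> T \<Longrightarrow> \<bar>\<phi>' 0 t\<bar> \<le> B" using Cb_bounded[OF C] by blast
  obtain \<phi>'' where d: "\<And>t. t \<in> T \<Longrightarrow> (\<phi>' 0 has_real_derivative \<phi>'' 0 t) (at t within T)" and C'': "Cb 0 T \<phi>''"
  proof -
    obtain u' where "\<forall>k. \<forall>t\<in>T. (\<phi>' k has_real_derivative u' k t) (at t within T)" "Cb 0 T u'"
      using C[of "Suc 0"] unfolding Cb.simps(2) by blast
    then show thesis by (intro that[of u']) auto
  qed
  obtain B' where B': "\<And>t. t \<in> T \<Longrightarrow> \<bar>\<phi>'' 0 t\<bar> \<le> B'" using Cb_bounded[OF C''] by blast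
  have phi: "\<phi> 0 t \<in> T" "arc I (\<phi> 0 t) = h (arc I t)" "(\<phi> 0 has_real_derivative \<phi>' 0 t) (at t within T)"
    "\<bar>\<phi>' 0 t\<bar> = abs_deriv I h (arc I t)" if "t \<in> T" for t
    using L[of 0] that abs_deriv_arc[OF h that] unfolding lift_of_def by auto
  show "continuous_on X h"
  proof (rule continuous_from_arc)
    fix s t assume st: "s \<in> T" "t \<in> T"
    have "dist (h (arc I s)) (h (arc I t)) \<le> \<bar>\<phi> 0 s - \<phi> 0 t\<bar>"
      using arc_lip[of "\<phi> 0 s" "\<phi> 0 t"] phi st by simp
    also have "\<dots> \<le> B * \<bar>s - t\<bar>" by (rule deriv_lipschitz[OF phi(3) B st])
    finally show "dist (h (arc I s)) (h (arc I t)) \<le> B * \<bar>s - t\<bar>" .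
  qed
  show "continuous_on X (abs_deriv I h)"
  proof (rule continuous_from_arc)
    fix s t assume st: "s \<in> T" "t \<in> T"
    have "dist (abs_deriv I h (arc I s)) (abs_deriv I h (arc I t)) \<le> \<bar>\<phi>' 0 s - \<phi>' 0 t\<bar>"
      unfolding phi(4)[OF st(1), symmetric] phi(4)[OF st(2), symmetric] dist_real_def by (rule abs_triangle_ineq3)
    also have "\<dots> \<le> B' * \<bar>s - t\<bar>" by (rule deriv_lipschitz[OF d B' st])
    finally show "dist (abs_deriv I h (arc I s)) (abs_deriv I h (arc I t)) \<le> B' * \<bar>s - t\<bar>" .
  qed
qed

lemma smooth_converges_uniform:
  assumes "smooth_converges I f g"
  shows "uniform_limit X f g sequentially"
    "uniform_limit X (\<lambda>k. abs_deriv I (f k)) (abs_deriv I g) sequentially"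
proof -
  have lim: "uniform_limit T (\<lambda>k. nth_vector_derivative T n (f k \<circ> arc I)) (nth_vector_derivative T n (g \<circ> arc I)) sequentially" for n
    using assms unfolding smooth_converges_def by blast
  show "uniform_limit X f g sequentially"
  proof (rule uniform_limitI)
    fix e :: real assume "0 < e"
    from uniform_limitD[OF lim[of 0] this] show "\<forall>\<^sub>F k in sequentially. \<forall>x\<in>X. dist (f k x) (g x) < e"
      unfolding X_arc by (simp add: nth_vector_derivative_def)
  qed
  show "uniform_limit X (\<lambda>k. abs_deriv I (f k)) (abs_deriv I g) sequentially"
  proof (rule uniform_limitI)
    fix e :: real assume "0 < e"
    from uniform_limitD[OF lim[of 1] this]
    show "\<forall>\<^sub>F k in sequentially. \<forall>x\<in>X. dist (abs_deriv I (f k) x) (abs_deriv I g x) < e"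
    proof eventually_elim
      fix k assume a: "\<forall>t\<in>T. dist (nth_vector_derivative T 1 (f k \<circ> arc I) t) (nth_vector_derivative T 1 (g \<circ> arc I) t) < e"
      show "\<forall>x\<in>X. dist (abs_deriv I (f k) x) (abs_deriv I g x) < e"
      proof
        fix x assume "x \<in> X"
        then have t: "inv_into T (arc I) x \<in> T" unfolding X_arc by (rule inv_into_into)
        have "dist (abs_deriv I (f k) x) (abs_deriv I g x)
          \<le> dist (vector_derivative (f k \<circ> arc I) (at (inv_into T (arc I) x) within T))
              (vector_derivative (g \<circ> arc I) (at (inv_into T (arc I) x) within T))"
          unfolding abs_deriv_def dist_norm real_norm_def by (rule norm_triangle_ineq3)
        also have "\<dots> < e" using a t by (simp add: nth_vector_derivative_def)
        finally show "dist (abs_deriv I (f k) x) (abs_deriv I g x) < e" .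
      qed
    qed
  qed
qed

theorem SRB_measure_limit:
  assumes f: "\<And>k. smooth_map I (f k)" and g: "smooth_map I g" and conv: "smooth_converges I f g"
    and srb: "\<And>k. SRB_measure I (f k) (\<mu> k)" and pos: "0 < top_entropy X g"
    and nu: "borel_prob I \<nu>" and weak: "weak_star_converges I \<mu> \<nu>"
    and ent: "(\<lambda>k. metric_entropy (f k) (\<mu> k)) \<longlonglongrightarrow> top_entropy X g"
  shows "SRB_measure I g \<nu>"
proof -
  have "\<exists>B. \<forall>k. \<forall>t\<in>T. norm (nth_vector_derivative T n (f k \<circ> arc I) t) \<le> B" for n
    using conv unfolding smooth_converges_def
    by (intro uniform_limit_bounded_family[where w = "nth_vector_derivative T n (g \<circ> arc I)"] derivs_bounded f g) blast
  then have "\<exists>\<phi> \<phi>'. (\<forall>k. lift_of I (f k) (\<phi> k) (\<phi>' k)) \<and> (\<forall>n. Cb n T \<phi>')" by (rule lifts[OF f])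
  then obtain \<phi> \<phi>' where L: "\<And>k. lift_of I (f k) (\<phi> k) (\<phi>' k)" and C: "\<And>n. Cb n T \<phi>'" by blast
  obtain B where B: "\<And>k t. t \<in> T \<Longrightarrow> \<bar>\<phi>' k t\<bar> \<le> B" using Cb_bounded[OF C] by blast
  have hyp: "prob_space (\<mu> k)" "sets (\<mu> k) = sets (restrict_space borel X)" "f k \<in> measurable (\<mu> k) (\<mu> k)"
    "distr (\<mu> k) (\<mu> k) (f k) = \<mu> k" "AE x in \<mu> k. 0 < lyapunov I (f k) x" "absolutely_continuous (leb I) (\<mu> k)" for k
    using srb[of k] unfolding SRB_measure_def hyperbolic_measure_def borel_prob_def invariant_measure_def by auto
  have lift: "lifted I T0 (\<mu> k) (f k) (\<phi> k) (\<phi>' k) (max 1 B)" for k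
  proof (intro lifted.intro pmp.intro pmp_axioms.intro lifted_axioms.intro)
    fix t assume t: "t \<in> T"
    show "\<phi> k t \<in> T" "arc I (\<phi> k t) = f k (arc I t)" "(\<phi> k has_real_derivative \<phi>' k t) (at t within T)"
      "\<bar>\<phi>' k t\<bar> = abs_deriv I (f k) (arc I t)"
      using L[of k] t abs_deriv_arc[OF f t] unfolding lift_of_def by auto
    show "\<bar>\<phi>' k t\<bar> \<le> max 1 B" using B[OF t, of k] by simp
  next
    show "abs_deriv I (f k) \<in> borel_measurable (restrict_space borel X)"
      by (rule borel_measurable_continuous_on_restrict[OF smooth_continuous(2)[OF f]])
  qed (use hyp phase_model_axioms in auto)
  have "smooth_limit I T0 f g \<mu> \<nu> \<phi> \<phi>' (max 1 B)"
  proof (intro smooth_limit.intro smooth_limit_axioms.intro)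
    show "g \<in> X \<rightarrow> X" using g unfolding smooth_map_def by blast
  qed (use lift C smooth_continuous[OF g] smooth_converges_uniform[OF conv] nu weak ent pos phase_model_axioms in auto)
  then show ?thesis by (rule smooth_limit.SRB_limit)
qed

end

text \<open>A real linear functional, the identity on the interval or a coordinate on the circle,
  turns curves into the real functions to which \<open>Cb\<close> applies.\<close>

lemma Cb_vector_derivs:
  fixes u :: "nat \<Rightarrow> real \<Rightarrow> 'a::real_normed_vector"
  assumes L: "bounded_linear (L :: 'a \<Rightarrow> real)" and u: "\<And>k. smooth_curve_on T (u k)"
    and b: "\<And>n. \<exists>B. \<forall>k. \<forall>t\<in>T. norm (nth_vector_derivative T n (u k) t) \<le> B"
  shows "Cb n T (\<lambda>k t. L (nth_vector_derivative T m (u k) t))"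
proof -
  have bd: "\<exists>B. \<forall>k. \<forall>t\<in>T. \<bar>L (nth_vector_derivative T m (u k) t)\<bar> \<le> B" for m
  proof -
    obtain B where B: "\<And>k t. t \<in> T \<Longrightarrow> norm (nth_vector_derivative T m (u k) t) \<le> B" using b[of m] by blast
    obtain K where K: "0 \<le> K" "\<And>x. norm (L x) \<le> norm x * K" using bounded_linear.nonneg_bounded[OF L] by blast
    have "\<bar>L (nth_vector_derivative T m (u k) t)\<bar> \<le> B * K" if "t \<in> T" for k t
      using K(2)[of "nth_vector_derivative T m (u k) t"] mult_right_mono[OF B[OF that, of k] K(1)] by simp
    then show ?thesis by blast
  qed
  have d: "((\<lambda>t. L (nth_vector_derivative T m (u k) t)) has_real_derivative L (nth_vector_derivative T (Suc m) (u k) t))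
    (at t within T)" if "t \<in> T" for m k t
  proof -
    have "nth_vector_derivative T m (u k) differentiable (at t within T)"
      using u[of k] that unfolding smooth_curve_on_def by blast
    then have "(nth_vector_derivative T m (u k) has_vector_derivative nth_vector_derivative T (Suc m) (u k) t) (at t within T)"
      unfolding vector_derivative_works by (simp add: nth_vector_derivative_def)
    then show ?thesis
      unfolding has_real_derivative_iff_has_vector_derivative by (rule bounded_linear.has_vector_derivative[OF L])
  qed
  show ?thesis
  proof (induction n arbitrary: m)
    case 0
    show ?case using bd by simp
  next
    case (Suc n)
    show ?case unfolding Cb.simps
      using bd[of m] d Suc[of "Suc m"]
      by (intro conjI exI[of _ "\<lambda>k t. L (nth_vector_derivative T (Suc m) (u k) t)"]) auto
  qed
qed

section \<open>The interval and the circle\<close>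

lemma smooth_curve_continuous: "smooth_curve_on T h \<Longrightarrow> continuous_on T (nth_vector_derivative T n h)"
  unfolding smooth_curve_on_def continuous_on_eq_continuous_within
  by (blast intro: differentiable_imp_continuous_within)

lemma smooth_curve_has_derivative:
  assumes "smooth_curve_on T h" "t \<in> T"
  shows "(h has_vector_derivative vector_derivative h (at t within T)) (at t within T)"
proof -
  have "nth_vector_derivative T 0 h differentiable (at t within T)" using assms unfolding smooth_curve_on_def by blast
  then show ?thesis by (simp add: nth_vector_derivative_def vector_derivative_works)
qed

lemma unit_interval_phase: "phase_model unit_interval {0..1}"
proof (unfold_locales, unfold unit_interval_def phase_space.simps)
  have inv: "inv_into {0..1} (\<lambda>t. t) x = x" if "x \<in> {0..1}" for x :: real
    using inv_into_f_f[of "\<lambda>t. t" "{0..1}" x] that by (simp add: inj_on_def)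
  show "bij_betw (\<lambda>t. t) {0..1::real} {0..1}" by (simp add: bij_betw_def inj_on_def)
  show "inv_into {0..1} (\<lambda>t. t) \<in> borel_measurable (restrict_space borel {0..1::real})"
    by (rule measurable_cong[THEN iffD2, OF inv]) (simp_all add: space_restrict_space measurable_restrict_space1)
  show "\<exists>c. \<forall>w\<in>{s..t}. inv_into {0..1} (\<lambda>t. t) w = w + c" if "{s..t} \<subseteq> {0..1}" for s t :: real
    using that inv by (intro exI[of _ 0]) auto
  show "sets (restrict_space lborel {0..1}) = sets (restrict_space borel {0..1::real})"
    by (rule sets_restrict_space_cong) simp
  have Bs: "B \<subseteq> {0..1} \<and> B \<in> sets lborel" if "B \<in> sets (restrict_space borel {0..1::real})" for B
    using that by (auto simp: sets_restrict_space_iff sets_restrict_space)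
  have em: "emeasure (restrict_space lborel {0..1}) B = emeasure lborel B" if "B \<in> sets (restrict_space borel {0..1::real})" for B
    using Bs[OF that] by (intro emeasure_restrict_space) auto
  show "emeasure (restrict_space lborel {0..1}) B = emeasure lborel {t \<in> {0..1}. t \<in> B}"
    if "B \<in> sets (restrict_space borel {0..1::real})" for B
  proof -
    have "{t \<in> {0..1}. t \<in> B} = B" using Bs[OF that] by auto
    then show ?thesis using em[OF that] by simp
  qed
  show "emeasure lborel ({a..a + 1} \<inter> {t \<in> {0..1}. t \<in> B}) \<le> 2 * emeasure (restrict_space lborel {0..1}) B"
    if "B \<in> sets (restrict_space borel {0..1::real})" for a :: real and B
  proof -
    have "emeasure lborel ({a..a + 1} \<inter> {t \<in> {0..1}. t \<in> B}) \<le> emeasure lborel B"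
      using Bs[OF that] by (intro emeasure_mono) auto
    also have "\<dots> \<le> 2 * emeasure lborel B" by (metis add_increasing2 mult_2 order_refl zero_le)
    finally show ?thesis using em[OF that] by simp
  qed
  show "\<exists>s\<in>{0..1}. \<exists>t\<in>{0..1}. s = x \<and> t = y \<and> \<bar>s - t\<bar> \<le> 2 * dist x y" if "x \<in> {0..1}" "y \<in> {0..1}" for x y :: real
    using that by (auto simp: dist_real_def)
qed (auto simp: dist_real_def)

lemma unit_interval_model: "smooth_model unit_interval {0..1}"
proof (intro smooth_model.intro smooth_model_axioms.intro unit_interval_phase)
  have pt: "points unit_interval = {0..1}" "times unit_interval = {0..1}" and arc: "h \<circ> arc unit_interval = h" for h :: "real \<Rightarrow> real"
    unfolding unit_interval_def by (simp_all add: comp_def)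
  have arc_t: "arc unit_interval t = t" for t by (simp add: unit_interval_def)
  show "\<exists>B. \<forall>t\<in>times unit_interval. norm (nth_vector_derivative (times unit_interval) n (h \<circ> arc unit_interval) t) \<le> B"
    if "smooth_map unit_interval h" for h n
  proof -
    have "continuous_on {0..1} (nth_vector_derivative {0..1} n h)"
      using that unfolding smooth_map_def pt arc by (intro smooth_curve_continuous) auto
    then have "bounded (nth_vector_derivative {0..1} n h ` {0..1})"
      by (intro compact_imp_bounded compact_continuous_image) auto
    then show ?thesis unfolding pt arc bounded_iff by auto
  qed
  show "\<exists>\<phi> \<phi>'. (\<forall>k. lift_of unit_interval (f k) (\<phi> k) (\<phi>' k)) \<and> (\<forall>n. Cb n (times unit_interval) \<phi>')"
    if f: "\<And>k. smooth_map unit_interval (f k)"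
      and b: "\<And>n. \<exists>B. \<forall>k. \<forall>t\<in>times unit_interval. norm (nth_vector_derivative (times unit_interval) n (f k \<circ> arc unit_interval) t) \<le> B"
    for f :: "nat \<Rightarrow> real \<Rightarrow> real"
  proof (intro exI conjI allI)
    fix k
    have sm: "smooth_curve_on {0..1} (f k)" "f k \<in> {0..1} \<rightarrow> {0..1}" for k
      using f[of k] unfolding smooth_map_def pt arc by auto
    show "lift_of unit_interval (f k) (f k) (\<lambda>t. nth_vector_derivative {0..1} 1 (f k) t)"
      unfolding lift_of_def pt arc arc_t using funcset_mem[OF sm(2)] smooth_curve_has_derivative[OF sm(1)]
      by (simp add: nth_vector_derivative_def has_real_derivative_iff_has_vector_derivative)
    show "Cb n (times unit_interval) (\<lambda>k t. nth_vector_derivative {0..1} 1 (f k) t)" for n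
      unfolding pt using b sm(1) unfolding pt arc by (intro Cb_vector_derivs bounded_linear_ident)
  qed
  show "abs_deriv unit_interval h (arc unit_interval t) =
      norm (vector_derivative (h \<circ> arc unit_interval) (at t within times unit_interval))"
    if "t \<in> times unit_interval" for h t
  proof -
    have "inv_into {0..1} (arc unit_interval) t = t"
      using inv_into_f_f[of "arc unit_interval" "{0..1}" t] that pt by (simp add: inj_on_def arc_t)
    then show ?thesis unfolding abs_deriv_def pt arc_t by simp
  qed
qed

section \<open>The circle as a quotient of the line\<close>

lemma cis_eq_shift: "cis s = cis t \<longleftrightarrow> (\<exists>n::int. s = t + 2 * pi * n)"
  using sin_cos_eq_iff[of s t] by (auto simp: complex_eq_iff)

lemma dist_cis: "dist (cis s) (cis t) = 2 * \<bar>sin ((s - t) / 2)\<bar>"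
proof -
  have "cis s - cis t = cis t * (cis (s - t) - 1)" by (simp add: algebra_simps cis_mult)
  then have "dist (cis s) (cis t) = norm (cis (s - t) - 1)" by (simp add: dist_norm norm_mult)
  also have "\<dots> = 2 * \<bar>sin ((s - t) / 2)\<bar>" using dist_exp_i_1[of "s - t"] by (simp add: cis_conv_exp)
  finally show ?thesis .
qed

text \<open>On \<open>{0..pi / 4}\<close> the cosine is at least \<open>sqrt 2 / 2\<close>, and the
  double angle formula carries the bound to \<open>pi / 2\<close>. Through \<open>dist_cis\<close>
  this becomes the constant 2 between arc and chord.\<close>

lemma sin_half_lower: assumes "0 \<le> u" "u \<le> pi / 2" shows "u / 2 \<le> sin u"
proof -
  define v where "v = u / 2"
  have v: "0 \<le> v" "v \<le> pi / 4" unfolding v_def using assms by auto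
  have cosv: "sqrt 2 / 2 \<le> cos z" if "0 \<le> z" "z \<le> v" for z
    using cos_monotone_0_pi_le[of z "pi / 4"] that v cos_45 pi_gt_zero by auto
  have "v * (sqrt 2 / 2) \<le> sin v"
  proof (cases "v = 0")
    case False
    then have "0 < v" using v by simp
    then obtain z where z: "0 < z" "z < v" "sin v - sin 0 = (v - 0) * cos z"
      using MVT2[of 0 v sin cos] by (auto intro: derivative_eq_intros)
    then show ?thesis using cosv[of z] v by (simp add: mult_left_mono)
  qed simp
  moreover have "sqrt 2 / 2 \<le> cos v" using cosv[of v] v by simp
  moreover have "0 \<le> v * (sqrt 2 / 2)" using v by simp
  ultimately have "v * (sqrt 2 / 2) * (sqrt 2 / 2) \<le> sin v * cos v" by (intro mult_mono) auto
  moreover have "v * (sqrt 2 / 2) * (sqrt 2 / 2) = v / 2" by (simp add: field_simps)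
  moreover have "sin u = 2 * (sin v * cos v)" using sin_double[of v] by (simp add: v_def)
  ultimately have "v \<le> sin u" by linarith
  then show ?thesis unfolding v_def .
qed

lemma dist_cis_lower: assumes "\<bar>s - t\<bar> \<le> pi" shows "\<bar>s - t\<bar> \<le> 2 * dist (cis s) (cis t)"
proof -
  define d where "d = s - t"
  have "\<bar>d\<bar> / 2 / 2 \<le> sin (\<bar>d\<bar> / 2)" by (rule sin_half_lower) (use assms d_def in auto)
  also have "sin (\<bar>d\<bar> / 2) \<le> \<bar>sin (d / 2)\<bar>"
  proof (cases "0 \<le> d")
    case False
    then have "\<bar>d\<bar> / 2 = - (d / 2)" by simp
    then show ?thesis by (simp only: sin_minus abs_ge_minus_self)
  qed simp
  finally show ?thesis unfolding dist_cis d_def by simp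
qed

lemma cis_representative: "\<exists>t\<in>{a..<a + 2 * pi}. cis t = cis s"
proof -
  define n where "n = \<lfloor>(s - a) / (2 * pi)\<rfloor>"
  have "of_int n \<le> (s - a) / (2 * pi)" "(s - a) / (2 * pi) < of_int n + 1" unfolding n_def by linarith+
  then have "of_int n * (2 * pi) \<le> s - a" "s - a < (of_int n + 1) * (2 * pi)"
    by (simp_all add: pos_le_divide_eq pos_divide_less_eq)
  then have "s - 2 * pi * of_int n \<in> {a..<a + 2 * pi}" by (auto simp: algebra_simps)
  moreover have "cis (s - 2 * pi * of_int n) = cis s" unfolding cis_eq_shift by (intro exI[of _ "- n"]) simp
  ultimately show ?thesis by blast
qed

lemma sphere_cis: "x \<in> sphere 0 1 \<Longrightarrow> \<exists>t\<in>{a..<a + 2 * pi}. cis t = x"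
  using cis_representative[of a "Arg2pi x"] Arg2pi_eq[of x] by (simp add: cis_conv_exp)

lemma cis_unique: "s \<in> {a..<a + 2 * pi} \<Longrightarrow> t \<in> {a..<a + 2 * pi} \<Longrightarrow> cis s = cis t \<Longrightarrow> s = t"
proof -
  assume st: "s \<in> {a..<a + 2 * pi}" "t \<in> {a..<a + 2 * pi}" "cis s = cis t"
  then obtain n :: int where n: "s = t + 2 * pi * n" using cis_eq_shift by auto
  have "\<bar>s - t\<bar> < 2 * pi" using st(1,2) by auto
  then have "2 * pi * \<bar>of_int n\<bar> < 2 * pi * 1" unfolding n by (simp add: abs_mult)
  then have "\<bar>real_of_int n\<bar> < 1" by (subst (asm) mult_less_cancel_left_pos) auto
  then have "n = 0" by linarith
  then show "s = t" using n by simp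
qed

lemma bij_cis: "bij_betw cis {0..<2 * pi} (sphere 0 1)"
proof -
  have "inj_on cis {0..<2 * pi}" using cis_unique[of _ 0] by (auto intro!: inj_onI)
  moreover have "cis ` {0..<2 * pi} = sphere 0 1" using sphere_cis[of _ 0] by (auto simp: image_iff) force
  ultimately show ?thesis unfolding bij_betw_def by blast
qed

lemma cis_continuous: "continuous_on S cis"
  unfolding cis_conv_exp[abs_def] by (intro continuous_intros)

text \<open>An arc that avoids the base point 1 stays in the period in which it starts, and within
  one period the inverse is a translation.\<close>

lemma cis_inverse_shift:
  assumes "s \<le> t" and ne: "\<And>w. w \<in> {s..t} \<Longrightarrow> cis w \<noteq> 1"
  shows "\<exists>c. \<forall>w\<in>{s..t}. inv_into {0..<2 * pi} cis (cis w) = w + c"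
proof -
  obtain r where r: "r \<in> {0..<2 * pi}" "cis r = cis s" using cis_representative[of 0 s] by auto
  obtain n :: int where n: "r = s + 2 * pi * n" using r(2) cis_eq_shift by blast
  have r0: "r \<noteq> 0" using r(2) ne[of s] assms(1) by auto
  have "inv_into {0..<2 * pi} cis (cis w) = w + 2 * pi * n" if w: "w \<in> {s..t}" for w
  proof -
    have "w + 2 * pi * n < 2 * pi"
    proof (rule ccontr)
      assume "\<not> ?thesis"
      then have "2 * pi - 2 * pi * n \<in> {s..t}" using n r(1) w by auto
      moreover have "cis (2 * pi - 2 * pi * n) = cis 0" unfolding cis_eq_shift
        by (intro exI[of _ "1 - n"]) (simp add: algebra_simps)
      ultimately show False using ne by fastforce
    qed
    moreover have "0 \<le> w + 2 * pi * n" using n r(1) w by auto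
    moreover have "cis (w + 2 * pi * n) = cis w" unfolding cis_eq_shift by blast
    ultimately show ?thesis using inv_into_f_f[OF bij_betw_imp_inj_on[OF bij_cis], of "w + 2 * pi * n"] by simp
  qed
  then show ?thesis by blast
qed

lemma cis_inverse_measurable:
  "inv_into {0..<2 * pi} cis \<in> borel_measurable (restrict_space borel (sphere 0 1))"
  unfolding borel_measurable_iff_le
proof
  fix c :: real
  have inv: "inv_into {0..<2 * pi} cis x \<in> {0..<2 * pi}" "cis (inv_into {0..<2 * pi} cis x) = x" if "x \<in> sphere 0 1" for x
    using that bij_cis inv_into_into[of x cis "{0..<2 * pi}"] f_inv_into_f[of x cis "{0..<2 * pi}"]
    unfolding bij_betw_def by auto
  show "{w \<in> space (restrict_space borel (sphere 0 1)). inv_into {0..<2 * pi} cis w \<le> c}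
    \<in> sets (restrict_space borel (sphere 0 1))"
  proof (cases "c < 2 * pi")
    case True
    have "{w \<in> sphere 0 1. inv_into {0..<2 * pi} cis w \<le> c} = cis ` {0..c}" (is "?A = ?B")
    proof
      show "?A \<subseteq> ?B" using inv by force
      show "?B \<subseteq> ?A"
      proof
        fix x assume "x \<in> ?B"
        then obtain t where t: "t \<in> {0..c}" "x = cis t" by blast
        then have "inv_into {0..<2 * pi} cis x = t"
          using inv_into_f_f[OF bij_betw_imp_inj_on[OF bij_cis], of t] True by auto
        then show "x \<in> ?A" using t by simp
      qed
    qed
    moreover have "compact (cis ` {0..c})" by (intro compact_continuous_image cis_continuous) auto
    then have "cis ` {0..c} \<in> sets borel" by (rule borel_compact)
    ultimately show ?thesis by (auto simp: space_restrict_space sets_restrict_space_iff)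
  next
    case False
    then have "{w \<in> space (restrict_space borel (sphere 0 1)). inv_into {0..<2 * pi} cis w \<le> c}
      = space (restrict_space borel (sphere 0 1))" using inv by (force simp: space_restrict_space)
    then show ?thesis by (metis sets.top)
  qed
qed

lemma cis_preimage_borel:
  assumes "B \<in> sets (restrict_space borel (sphere 0 1))" shows "{t. cis t \<in> B} \<in> sets borel"
proof -
  have "B \<in> sets borel" using assms by (auto simp: sets_restrict_space_iff sets_restrict_space)
  moreover have "cis \<in> borel_measurable borel" by (rule borel_measurable_continuous_onI[OF cis_continuous])
  ultimately have "cis -` B \<inter> space borel \<in> sets borel" by (rule measurable_sets[rotated])
  then show ?thesis by (simp add: vimage_def)
qed

lemma leb_circle:
  assumes B: "B \<in> sets (restrict_space borel (sphere 0 1))"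
  shows "emeasure (leb unit_circle) B = emeasure lborel {t \<in> {0..<2 * pi}. cis t \<in> B}"
proof -
  have "cis \<in> borel_measurable borel" by (rule borel_measurable_continuous_onI[OF cis_continuous])
  then have "cis \<in> measurable lborel (restrict_space borel (sphere 0 1))"
    by (intro measurable_restrict_space2) auto
  then have m: "cis \<in> measurable (restrict_space lborel {0..<2 * pi}) (restrict_space borel (sphere 0 1))"
    by (rule measurable_restrict_space1)
  have "emeasure (leb unit_circle) B = emeasure (restrict_space lborel {0..<2 * pi}) (cis -` B \<inter> {0..<2 * pi})"
    unfolding unit_circle_def using emeasure_distr[OF m B] by (simp add: space_restrict_space)
  also have "\<dots> = emeasure lborel (cis -` B \<inter> {0..<2 * pi})" by (rule emeasure_restrict_space) auto
  also have "cis -` B \<inter> {0..<2 * pi} = {t \<in> {0..<2 * pi}. cis t \<in> B}" by auto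
  finally show ?thesis .
qed

lemma leb_circle_translate:
  assumes B: "B \<in> sets (restrict_space borel (sphere 0 1))"
  shows "emeasure lborel {t \<in> {2 * pi * of_int n..<2 * pi * of_int n + 2 * pi}. cis t \<in> B} = emeasure (leb unit_circle) B"
proof -
  let ?c = "2 * pi * of_int n"
  have S: "{t \<in> {a..<b}. cis t \<in> B} \<in> sets borel" for a b
    using sets.Int[OF _ cis_preimage_borel[OF B], of "{a..<b}"] by (simp add: Int_def del: atLeastLessThan_iff)
  have c: "cis (?c + t) = cis t" for t unfolding cis_eq_shift by (intro exI[of _ n]) simp
  have "emeasure lborel {t \<in> {?c..<?c + 2 * pi}. cis t \<in> B}
    = emeasure (distr lborel borel ((+) ?c)) {t \<in> {?c..<?c + 2 * pi}. cis t \<in> B}" by (simp only: lborel_distr_plus)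
  also have "\<dots> = emeasure lborel ((+) ?c -` {t \<in> {?c..<?c + 2 * pi}. cis t \<in> B} \<inter> space lborel)"
    by (rule emeasure_distr) (use S in auto)
  also have "(+) ?c -` {t \<in> {?c..<?c + 2 * pi}. cis t \<in> B} \<inter> space lborel = {t \<in> {0..<2 * pi}. cis t \<in> B}"
    using c by auto
  finally show ?thesis using leb_circle[OF B] by simp
qed

text \<open>A window of length 1, being shorter than a period, meets at most two consecutive
  periods, and each carries one copy of the arc length measure.\<close>

lemma leb_circle_local:
  assumes B: "B \<in> sets (restrict_space borel (sphere 0 1))"
  shows "emeasure lborel ({a..a + 1} \<inter> {t. cis t \<in> B}) \<le> 2 * emeasure (leb unit_circle) B"
proof -
  define n where "n = \<lfloor>a / (2 * pi)\<rfloor>"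
  define P where "P i = {t \<in> {2 * pi * of_int i..<2 * pi * of_int i + 2 * pi}. cis t \<in> B}" for i :: int
  have Ps: "P i \<in> sets lborel" for i unfolding P_def
    using sets.Int[OF _ cis_preimage_borel[OF B], of "{2 * pi * of_int i..<2 * pi * of_int i + 2 * pi}"]
    by (simp add: Int_def del: atLeastLessThan_iff)
  have "of_int n \<le> a / (2 * pi)" "a / (2 * pi) < of_int n + 1" unfolding n_def by linarith+
  then have "of_int n * (2 * pi) \<le> a" "a < (of_int n + 1) * (2 * pi)"
    by (simp_all add: pos_le_divide_eq pos_divide_less_eq)
  then have n: "2 * pi * of_int n \<le> a" "a < 2 * pi * of_int n + 2 * pi" by (auto simp: algebra_simps)
  have "{a..a + 1} \<inter> {t. cis t \<in> B} \<subseteq> P n \<union> P (n + 1)"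
    unfolding P_def using n pi_gt3 by (auto simp: algebra_simps)
  then have "emeasure lborel ({a..a + 1} \<inter> {t. cis t \<in> B}) \<le> emeasure lborel (P n \<union> P (n + 1))"
    using Ps by (intro emeasure_mono) auto
  also have "\<dots> \<le> emeasure lborel (P n) + emeasure lborel (P (n + 1))" using Ps by (intro emeasure_subadditive)
  also have "\<dots> = 2 * emeasure (leb unit_circle) B"
    unfolding P_def leb_circle_translate[OF B] by (simp add: mult_2)
  finally show ?thesis .
qed

lemma unit_circle_phase: "phase_model unit_circle {0..<2 * pi}"
proof -
  have c: "points unit_circle = sphere 0 1" "times unit_circle = UNIV" "arc unit_circle = cis"
    unfolding unit_circle_def by simp_all
  show ?thesis
  proof (unfold_locales, unfold c)
    show "dist (cis s) (cis t) \<le> \<bar>s - t\<bar>" for s t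
      unfolding dist_cis using abs_sin_x_le_abs_x[of "(s - t) / 2"] by simp
    show "\<bar>s - t\<bar> \<le> 2 * dist (cis s) (cis t)" if "\<bar>s - t\<bar> \<le> 1" for s t
      using that pi_gt3 by (intro dist_cis_lower) simp
    show "\<exists>s\<in>UNIV. \<exists>t\<in>UNIV. cis s = x \<and> cis t = y \<and> \<bar>s - t\<bar> \<le> 2 * dist x y"
      if xy: "x \<in> sphere 0 1" "y \<in> sphere 0 1" for x y
    proof -
      obtain s where s: "cis s = x" using sphere_cis[OF xy(1)] by blast
      obtain t where t: "t \<in> {s - pi..<s - pi + 2 * pi}" "cis t = y" using sphere_cis[OF xy(2)] by blast
      have "\<bar>s - t\<bar> \<le> 2 * dist (cis s) (cis t)" using t(1) by (intro dist_cis_lower) auto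
      then show ?thesis using s t(2) by blast
    qed
    show "sets (leb unit_circle) = sets (restrict_space borel (sphere 0 1))" by (simp add: unit_circle_def)
    show "emeasure lborel ({a..a + 1} \<inter> {t \<in> UNIV. cis t \<in> B}) \<le> 2 * emeasure (leb unit_circle) B"
      if "B \<in> sets (restrict_space borel (sphere 0 1))" for a B
      using leb_circle_local[OF that] by simp
    show "\<exists>c. \<forall>w\<in>{s..t}. inv_into {0..<2 * pi} cis (cis w) = w + c"
      if "s \<le> t" "\<forall>w\<in>{s..t}. cis w \<noteq> cis 0" for s t
      using that by (intro cis_inverse_shift) auto
  qed (use bij_cis cis_inverse_measurable leb_circle in auto)
qed

text \<open>The two points have the same derivatives as a relation, so the chosen values agree even
  where \<open>u\<close> is not differentiable.\<close>

lemma vector_derivative_periodic: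
  fixes u :: "real \<Rightarrow> 'a::real_normed_vector"
  assumes "\<And>t. u (t + c) = u t"
  shows "vector_derivative u (at (t + c)) = vector_derivative u (at t)"
proof -
  have shift: "(v has_vector_derivative D) (at s)" if d: "(v has_vector_derivative D) (at (s + b))" and v: "\<And>t. v (t + b) = v t"
    for v :: "real \<Rightarrow> 'a" and D s b
  proof -
    have "((\<lambda>x. x + b) has_vector_derivative 1) (at s)" by (auto intro!: derivative_eq_intros)
    from vector_diff_chain_at[OF this d] have "(v \<circ> (\<lambda>x. x + b) has_vector_derivative D) (at s)" by simp
    moreover have "v \<circ> (\<lambda>x. x + b) = v" using v by (simp add: comp_def)
    ultimately show ?thesis by simp
  qed
  have "(u has_vector_derivative D) (at (t + c)) \<longleftrightarrow> (u has_vector_derivative D) (at t)" for D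
  proof
    show "(u has_vector_derivative D) (at (t + c)) \<Longrightarrow> (u has_vector_derivative D) (at t)"
      by (rule shift) (use assms in auto)
    have "u (t - c) = u t" for t using assms[of "t - c"] by simp
    then show "(u has_vector_derivative D) (at t) \<Longrightarrow> (u has_vector_derivative D) (at (t + c))"
      using shift[of u D "t + c" "- c"] by simp
  qed
  then show ?thesis unfolding vector_derivative_def by simp
qed

lemma nth_vector_derivative_periodic:
  assumes "\<And>t. u (t + c) = u t"
  shows "nth_vector_derivative UNIV n u (t + c) = nth_vector_derivative UNIV n u t"
proof (induction n arbitrary: t)
  case 0 then show ?case using assms by (simp add: nth_vector_derivative_def)
next
  case (Suc n)
  then show ?case using vector_derivative_periodic[of "nth_vector_derivative UNIV n u" c t]
    by (simp add: nth_vector_derivative_def)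
qed

text \<open>\<open>\<omega>\<close> is the tangential component of \<open>D\<close>, and the radial
  one vanishes because the norm of \<open>h\<close> is constant. Let \<open>\<phi>\<close> be the
  antiderivative of \<open>\<omega>\<close> that starts at an argument of \<open>h 0\<close>. The
  inner product of \<open>h\<close> and \<open>cis \<circ> \<phi>\<close> has derivative 0 and
  initial value 1, and unit vectors with inner product 1 agree.\<close>

lemma unit_circle_curve_lift:
  fixes h :: "real \<Rightarrow> complex"
  assumes d: "\<And>t. (h has_vector_derivative D t) (at t)" and n: "\<And>t. norm (h t) = 1"
    and \<omega>: "\<And>t. \<omega> t = Re (h t) * Im (D t) - Im (h t) * Re (D t)" and cont: "\<And>t. isCont \<omega> t"
  shows "(\<exists>\<phi>. \<forall>t. (\<phi> has_real_derivative \<omega> t) (at t) \<and> cis (\<phi> t) = h t) \<and> (\<forall>t. \<bar>\<omega> t\<bar> = norm (D t))"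
proof -
  have sq: "(Re (h t))\<^sup>2 + (Im (h t))\<^sup>2 = 1" for t using n[of t] by (simp add: cmod_def)
  have dR: "((\<lambda>t. Re (h t)) has_real_derivative Re (D t)) (at t)" and dI: "((\<lambda>t. Im (h t)) has_real_derivative Im (D t)) (at t)" for t
    unfolding has_real_derivative_iff_has_vector_derivative
    by (rule bounded_linear.has_vector_derivative[OF bounded_linear_Re d] bounded_linear.has_vector_derivative[OF bounded_linear_Im d])+
  have orth: "Re (h t) * Re (D t) + Im (h t) * Im (D t) = 0" for t
  proof -
    have "((\<lambda>t. (Re (h t))\<^sup>2 + (Im (h t))\<^sup>2) has_real_derivative 2 * (Re (h t) * Re (D t) + Im (h t) * Im (D t))) (at t)"
      using DERIV_add[OF DERIV_power[OF dR, of 2] DERIV_power[OF dI, of 2]] by (simp add: algebra_simps)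
    moreover have "((\<lambda>t. (Re (h t))\<^sup>2 + (Im (h t))\<^sup>2) has_real_derivative 0) (at t)" unfolding sq by simp
    ultimately have "2 * (Re (h t) * Re (D t) + Im (h t) * Im (D t)) = 0" by (rule DERIV_unique)
    then show ?thesis by simp
  qed
  have Re: "Re (D t) = - \<omega> t * Im (h t)" and Im: "Im (D t) = \<omega> t * Re (h t)" for t
  proof -
    have "- \<omega> t * Im (h t) = ((Re (h t))\<^sup>2 + (Im (h t))\<^sup>2) * Re (D t)
      - Re (h t) * (Re (h t) * Re (D t) + Im (h t) * Im (D t))" unfolding \<omega> by algebra
    then show "Re (D t) = - \<omega> t * Im (h t)" using sq orth by simp
    have "\<omega> t * Re (h t) = ((Re (h t))\<^sup>2 + (Im (h t))\<^sup>2) * Im (D t)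
      - Im (h t) * (Re (h t) * Re (D t) + Im (h t) * Im (D t))" unfolding \<omega> by algebra
    then show "Im (D t) = \<omega> t * Re (h t)" using sq orth by simp
  qed
  have "\<bar>\<omega> t\<bar> = norm (D t)" for t
  proof -
    have "(norm (D t))\<^sup>2 = (\<omega> t)\<^sup>2 * ((Re (h t))\<^sup>2 + (Im (h t))\<^sup>2)"
      unfolding cmod_power2 Re[of t] Im[of t] by algebra
    then have "\<bar>\<omega> t\<bar>\<^sup>2 = (norm (D t))\<^sup>2" by (simp add: sq)
    then show ?thesis by (rule power2_eq_imp_eq) simp_all
  qed
  moreover have "\<exists>\<phi>. \<forall>t. (\<phi> has_real_derivative \<omega> t) (at t) \<and> cis (\<phi> t) = h t"
  proof -
    obtain F where F: "\<And>t. (F has_real_derivative \<omega> t) (at t)"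
      using einterval_antiderivative[of "-\<infinity>" "\<infinity>" \<omega>] cont by (auto simp: has_real_derivative_iff_has_vector_derivative)
    obtain a where a: "cis a = h 0" using sphere_cis[of "h 0"] n[of 0] by auto
    define \<phi> where "\<phi> t = F t + (a - F 0)" for t
    have \<phi>: "(\<phi> has_real_derivative \<omega> t) (at t)" for t
      unfolding \<phi>_def[abs_def] by (rule derivative_eq_intros F refl | simp)+
    define p where "p t = Re (h t) * cos (\<phi> t) + Im (h t) * sin (\<phi> t)" for t
    have "(p has_real_derivative 0) (at t)" for t
    proof -
      have "(p has_real_derivative (Re (D t) * cos (\<phi> t) + Re (h t) * (- sin (\<phi> t) * \<omega> t)
        + (Im (D t) * sin (\<phi> t) + Im (h t) * (cos (\<phi> t) * \<omega> t)))) (at t)"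
        unfolding p_def[abs_def]
        using DERIV_add[OF DERIV_mult[OF dR DERIV_chain2[OF DERIV_cos \<phi>]] DERIV_mult[OF dI DERIV_chain2[OF DERIV_sin \<phi>]]]
        by (simp add: algebra_simps)
      moreover have "Re (D t) * cos (\<phi> t) + Re (h t) * (- sin (\<phi> t) * \<omega> t)
        + (Im (D t) * sin (\<phi> t) + Im (h t) * (cos (\<phi> t) * \<omega> t)) = 0"
        unfolding Re Im by (simp add: algebra_simps)
      ultimately show ?thesis by simp
    qed
    then have pc: "p t = p 0" for t using DERIV_isconst_all[of p] by blast
    have "\<phi> 0 = a" unfolding \<phi>_def by simp
    moreover have "cos a = Re (h 0)" "sin a = Im (h 0)" using a by (simp_all add: complex_eq_iff)
    ultimately have "p 0 = 1" unfolding p_def using sq[of 0] by (simp add: power2_eq_square)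
    then have p1: "p t = 1" for t using pc[of t] by simp
    have "cis (\<phi> t) = h t" for t
    proof -
      have "(Re (h t) - cos (\<phi> t))\<^sup>2 + (Im (h t) - sin (\<phi> t))\<^sup>2
        = ((Re (h t))\<^sup>2 + (Im (h t))\<^sup>2) + ((sin (\<phi> t))\<^sup>2 + (cos (\<phi> t))\<^sup>2) - 2 * p t"
        unfolding p_def by algebra
      then have "(Re (h t) - cos (\<phi> t))\<^sup>2 + (Im (h t) - sin (\<phi> t))\<^sup>2 = 0" using sq[of t] p1[of t] by simp
      then show ?thesis by (simp add: sum_power2_eq_zero_iff complex_eq_iff)
    qed
    then show ?thesis using \<phi> by blast
  qed
  ultimately show ?thesis by blast
qed

lemma unit_circle_model: "smooth_model unit_circle {0..<2 * pi}"
proof (intro smooth_model.intro smooth_model_axioms.intro unit_circle_phase)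
  have c: "points unit_circle = sphere 0 1" "times unit_circle = UNIV" "arc unit_circle = cis"
    unfolding unit_circle_def by simp_all
  have per: "(h \<circ> cis) (t + 2 * pi * of_int n) = (h \<circ> cis) t" for h :: "complex \<Rightarrow> complex" and t n
    using cis_eq_shift[of "t + 2 * pi * of_int n" t] by auto
  show "\<exists>B. \<forall>t\<in>times unit_circle. norm (nth_vector_derivative (times unit_circle) n (h \<circ> arc unit_circle) t) \<le> B"
    if "smooth_map unit_circle h" for h n
  proof -
    let ?D = "nth_vector_derivative UNIV n (h \<circ> cis)"
    have "continuous_on UNIV ?D"
      using that unfolding smooth_map_def c by (intro smooth_curve_continuous) auto
    \<comment> \<open>The derivatives are periodic, so a bound on one compact period holds on the
      whole line.\<close>
    then have "bounded (?D ` {0..2 * pi})"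
      by (intro compact_imp_bounded compact_continuous_image) (auto intro: continuous_on_subset)
    then obtain B where B: "\<And>t. t \<in> {0..2 * pi} \<Longrightarrow> norm (?D t) \<le> B"
      unfolding bounded_iff by blast
    have "norm (?D t) \<le> B" for t
    proof -
      obtain s where s: "s \<in> {0..<2 * pi}" "cis s = cis t" using cis_representative[of 0 t] by auto
      then obtain m :: int where "s = t + 2 * pi * m" using cis_eq_shift by blast
      then have "?D s = ?D t" using nth_vector_derivative_periodic[of "h \<circ> cis", OF per] by simp
      then show ?thesis using B[of s] s(1) by simp
    qed
    then show ?thesis unfolding c by blast
  qed
  show "abs_deriv unit_circle h (arc unit_circle t) =
      norm (vector_derivative (h \<circ> arc unit_circle) (at t within times unit_circle))" for h t
  proof -
    \<comment> \<open>The inverse in \<open>abs_deriv\<close> selects some parameter on the line; it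
      differs from \<open>t\<close> by a multiple of the period, which does not change the
      derivative.\<close>
    have "cis (inv_into UNIV cis (cis t)) = cis t" by (rule f_inv_into_f) simp
    then obtain m :: int where "inv_into UNIV cis (cis t) = t + 2 * pi * m" using cis_eq_shift by blast
    then show ?thesis unfolding abs_deriv_def c using vector_derivative_periodic[of "h \<circ> cis", OF per] by simp
  qed
  show "\<exists>\<phi> \<phi>'. (\<forall>k. lift_of unit_circle (f k) (\<phi> k) (\<phi>' k)) \<and> (\<forall>n. Cb n (times unit_circle) \<phi>')"
    if f: "\<And>k. smooth_map unit_circle (f k)"
      and b: "\<And>n. \<exists>B. \<forall>k. \<forall>t\<in>times unit_circle. norm (nth_vector_derivative (times unit_circle) n (f k \<circ> arc unit_circle) t) \<le> B"
    for f :: "nat \<Rightarrow> complex \<Rightarrow> complex"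
  proof -
    define h D where "h k = f k \<circ> cis" and "D k = nth_vector_derivative UNIV 1 (h k)" for k
    have sm: "smooth_curve_on UNIV (h k)" and nh: "norm (h k t) = 1" for k t
      using f[of k] unfolding smooth_map_def c h_def by (auto simp: Pi_iff)
    have d: "(h k has_vector_derivative D k t) (at t)" for k t
      using smooth_curve_has_derivative[OF sm] by (simp add: D_def nth_vector_derivative_def)
    \<comment> \<open>A polynomial in the coordinates of \<open>h k\<close> and its derivative, so
      the uniform bounds pass to it. The minus sign is written as a factor to fit
      \<open>Cb_add\<close>, \<open>Cb_mult\<close> and \<open>Cb_const\<close>.\<close>
    define \<omega> where "\<omega> k t = Re (h k t) * Im (D k t) + (- 1) * (Im (h k t) * Re (D k t))" for k t
    have CbL: "Cb n UNIV (\<lambda>k t. L (nth_vector_derivative UNIV m (h k) t))" if "bounded_linear L" for L :: "complex \<Rightarrow> real" and n m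
      using b unfolding c h_def[symmetric] by (intro Cb_vector_derivs that sm)
    have "Cb n UNIV (\<lambda>k t. Re (h k t))" "Cb n UNIV (\<lambda>k t. Im (h k t))"
      "Cb n UNIV (\<lambda>k t. Re (D k t))" "Cb n UNIV (\<lambda>k t. Im (D k t))" for n
      using CbL[OF bounded_linear_Re, of n 0] CbL[OF bounded_linear_Im, of n 0]
        CbL[OF bounded_linear_Re, of n 1] CbL[OF bounded_linear_Im, of n 1]
      unfolding D_def by (simp_all add: nth_vector_derivative_def)
    then have C: "Cb n UNIV \<omega>" for n unfolding \<omega>_def[abs_def] by (intro Cb_add Cb_mult Cb_const)
    have cont: "isCont (\<omega> k) t" for k t
    proof -
      obtain u' where "\<And>k t. (\<omega> k has_real_derivative u' k t) (at t)" using C[of "Suc 0"] unfolding Cb.simps(2) by auto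
      then show ?thesis by (rule DERIV_isCont)
    qed
    have L: "(\<exists>\<phi>. \<forall>t. (\<phi> has_real_derivative \<omega> k t) (at t) \<and> cis (\<phi> t) = h k t) \<and> (\<forall>t. \<bar>\<omega> k t\<bar> = norm (D k t))" for k
      by (rule unit_circle_curve_lift[OF d nh _ cont]) (simp add: \<omega>_def)
    then have "\<exists>\<phi>. \<forall>k. \<forall>t. (\<phi> k has_real_derivative \<omega> k t) (at t) \<and> cis (\<phi> k t) = h k t"
      by (intro choice allI) blast
    then obtain \<phi> where \<phi>: "\<And>k t. (\<phi> k has_real_derivative \<omega> k t) (at t) \<and> cis (\<phi> k t) = h k t" by blast
    have "lift_of unit_circle (f k) (\<phi> k) (\<omega> k)" for k
      unfolding lift_of_def c using \<phi>[of k] L[of k]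
      by (auto simp: h_def D_def nth_vector_derivative_def)
    then show ?thesis using C unfolding c by blast
  qed
qed

theorem corollary1p13:
  shows
    "(\<forall>(f :: nat \<Rightarrow> real \<Rightarrow> real) (g :: real \<Rightarrow> real)
        (\<mu> :: nat \<Rightarrow> real measure) (\<nu> :: real measure).
        (\<forall>k. smooth_map unit_interval (f k)) \<longrightarrow>
        smooth_map unit_interval g \<longrightarrow>
        smooth_converges unit_interval f g \<longrightarrow>
        (\<forall>k. SRB_measure unit_interval (f k) (\<mu> k) \<and> ergodic_measure (f k) (\<mu> k)) \<longrightarrow>
        0 < top_entropy (points unit_interval) g \<longrightarrow>
        borel_prob unit_interval \<nu> \<longrightarrow>
        weak_star_converges unit_interval \<mu> \<nu> \<longrightarrow>
        (\<lambda>k. metric_entropy (f k) (\<mu> k)) \<longlonglongrightarrow> top_entropy (points unit_interval) g \<longrightarrow>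
        SRB_measure unit_interval g \<nu>) \<and>
     (\<forall>(f :: nat \<Rightarrow> complex \<Rightarrow> complex) (g :: complex \<Rightarrow> complex)
        (\<mu> :: nat \<Rightarrow> complex measure) (\<nu> :: complex measure).
        (\<forall>k. smooth_map unit_circle (f k)) \<longrightarrow>
        smooth_map unit_circle g \<longrightarrow>
        smooth_converges unit_circle f g \<longrightarrow>
        (\<forall>k. SRB_measure unit_circle (f k) (\<mu> k) \<and> ergodic_measure (f k) (\<mu> k)) \<longrightarrow>
        0 < top_entropy (points unit_circle) g \<longrightarrow>
        borel_prob unit_circle \<nu> \<longrightarrow>
        weak_star_converges unit_circle \<mu> \<nu> \<longrightarrow>
        (\<lambda>k. metric_entropy (f k) (\<mu> k)) \<longlonglongrightarrow> top_entropy (points unit_circle) g \<longrightarrow>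
        SRB_measure unit_circle g \<nu>)"
proof (intro conjI allI impI)
  fix f :: "nat \<Rightarrow> real \<Rightarrow> real" and g \<mu> \<nu>
  assume a: "\<forall>k. smooth_map unit_interval (f k)" "smooth_map unit_interval g"
    "smooth_converges unit_interval f g"
    "\<forall>k. SRB_measure unit_interval (f k) (\<mu> k) \<and> ergodic_measure (f k) (\<mu> k)"
    "0 < top_entropy (points unit_interval) g" "borel_prob unit_interval \<nu>"
    "weak_star_converges unit_interval \<mu> \<nu>"
    "(\<lambda>k. metric_entropy (f k) (\<mu> k)) \<longlonglongrightarrow> top_entropy (points unit_interval) g"
  show "SRB_measure unit_interval g \<nu>"
    by (rule smooth_model.SRB_measure_limit[OF unit_interval_model _ a(2,3) _ a(5-8)]) (use a(1,4) in auto)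
next
  fix f :: "nat \<Rightarrow> complex \<Rightarrow> complex" and g \<mu> \<nu>
  assume a: "\<forall>k. smooth_map unit_circle (f k)" "smooth_map unit_circle g"
    "smooth_converges unit_circle f g"
    "\<forall>k. SRB_measure unit_circle (f k) (\<mu> k) \<and> ergodic_measure (f k) (\<mu> k)"
    "0 < top_entropy (points unit_circle) g" "borel_prob unit_circle \<nu>"
    "weak_star_converges unit_circle \<mu> \<nu>"
    "(\<lambda>k. metric_entropy (f k) (\<mu> k)) \<longlonglongrightarrow> top_entropy (points unit_circle) g"
  show "SRB_measure unit_circle g \<nu>"
    by (rule smooth_model.SRB_measure_limit[OF unit_circle_model _ a(2,3) _ a(5-8)]) (use a(1,4) in auto)
qed

end
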